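(* Let $p$ be an admissible symbol, let $t\mapsto\Lambda_t$, $t\in\mathrm{neigh}(0,\mathbf{R})$, be an admissible smooth family of IR-manifolds, and let $f_t$ be the corresponding generating functions. Then $$\partial_tI_\epsilon(\Lambda_t,p)\to\text{``}\partial_tI(\Lambda_t,p)\text{''},\qquad\epsilon\to0,$$ where $$\text{``}\partial_tI(\Lambda_t,p)\text{''}:=-\int_{\Lambda_t}\langle[d\arg p]_{\Lambda_t},H_{f_t}\rangle\,\mu(d\rho)=\int_{\Lambda_t}\langle[H_{\arg p}]_{\Lambda_t},df_t\rangle\,\mu(d\rho).$$ Moreover, $t\mapsto I(\Lambda_t,p)$ is a Lipschitz function, and its almost everywhere defined derivative is given by $\text{``}\partial_tI(\Lambda_t,p)\text{''}$.
   Context: Admissible symbols and manifolds. $\sigma=\sum_1^n d\xi_j\wedge dx_j$ on $\mathbf{C}^{2n}$. An IR-manifold is a smooth submanifold of $\mathbf{C}^{2n}$ of real dimension $2n$ on which $\sigma$ is real and non-degenerate; $\mu(d\rho)=|\sigma^n|/n!$ is its symplectic volume density. Let $\Phi_0$ be a strictly plurisubharmonic real quadratic form on $\mathbf{C}^n$; for real $\Psi$ put $\Lambda_\Psi=\{(x,\frac2i\partial_x\Psi(x));x\in\mathbf{C}^n\}$ ($\partial_x$, $\partial_{\overline x}$ denote holomorphic and antiholomorphic derivatives). Let $\widetilde W\subset\subset W$ be bounded open neighborhoods of $0$ in $\Lambda_{\Phi_0}$. An admissible symbol is a function $p$ holomorphic in $\Lambda_{\Phi_0}+iW$ with $p(x,\xi)-1=\mathcal{O}(\langle(x,\xi)\rangle^m)$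 for some $m<-2n$. An admissible IR-manifold is an IR-manifold $\Lambda\subset\Lambda_{\Phi_0}+i\widetilde W$ that is closed, diffeomorphic to $\mathbf{R}^{2n}$, and such that outside a bounded set $\Lambda=\Lambda_\Psi$ with $\Psi-\Phi_0\in C_b^\infty$ (bounded with all derivatives) and $(\partial_{\overline x}\partial_x\Psi)^{-1}=\mathcal{O}(1)$. Near infinity $\Lambda$ is identified with a neighborhood of infinity in $\mathbf{C}^n$ via $x\mapsto(x,\frac2i\partial_x\Psi(x))$; this defines $C_b^\infty(\Lambda)$ and $L^1$ of forms and vector fields. An admissible smooth family $\Lambda_t$, $t\in\mathrm{neigh}(0,\mathbf{R}^k)$ (some neighborhood of $0$), is a family depending smoothly on $t$, with each $\Lambda_t$ admissible uniformly in $t$, and with $\Lambda_t=\Lambda_{\Psi_t}$ outside a bounded set, $\nabla_t^N\Psi_t''\in C_b^\infty$ uniformly in $t$ for all $N\ge0$. Generating functions ($k=1$): there is a smooth family $f_t\in C_b^\infty(\Lambda_t;\mathbf{R})$, unique up to a $t$-dependent constant, such that the flow $\kappa_t:\Lambda_0\to\Lambda_t$, $\partial_t\kappa_t(\rho)=J H_{f_t}(\kappa_t(\rho))$, $\kappa_0=\mathrm{id}$, maps $\Lambda_0$ onto $\Lambda_t$; here $H_{f_t}$ is the Hamilton field of $f_t$ on the real symplectic manifold $(\Lambda_t,\sigma|_{\Lambda_t})$ and $J$ is multiplication by $i$ on tangent vectors of $\mathbf{C}^{2n}$. Convention: $\sigma(H_f,t)=-\langle df,t\rangle$, i.e. $H_f=\sum\partial_{\xi_j}f\,\partial_{x_j}-\partial_{x_j}f\,\partial_{\xi_j}$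 in symplectic coordinates. Functionals: $I(\Lambda,p)=\int_\Lambda\log|p(\rho)|\,\mu(d\rho)$ and, for $0<\epsilon\le1$, $I_\epsilon(\Lambda,p)=\frac12\int_\Lambda\log\frac{|p(\rho)|^2+\epsilon^2}{1+\epsilon^2}\,\mu(d\rho)$. The form $d\arg p=\frac1{2i}\big(\frac{dp}{p}-\frac{d\overline p}{\overline p}\big)$ (with $p$ restricted to $\Lambda$) and the Hamilton field $H_{\arg p}$ on $\Lambda\setminus p^{-1}(0)$ have $L^1$ coefficients; $[d\arg p]_\Lambda$ and $[H_{\arg p}]_\Lambda$ denote their $L^1$ extensions to $\Lambda$. *)

theory Defs
  imports "HOL-Analysis.Analysis"
begin

section \<open>Smooth maps, submanifolds, tangent vectors\<close>

fun iter_deriv :: "'a list \<Rightarrow> ('a::real_normed_vector \<Rightarrow> 'b::real_normed_vector) \<Rightarrow> 'a \<Rightarrow> 'b" where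
  "iter_deriv [] F = F"
| "iter_deriv (v # vs) F = (\<lambda>x. frechet_derivative (iter_deriv vs F) (at x) v)"

definition smooth_open :: "'a::real_normed_vector set \<Rightarrow> ('a \<Rightarrow> 'b::real_normed_vector) \<Rightarrow> bool" where
  "smooth_open U F \<longleftrightarrow> open U \<and> (\<forall>vs. \<forall>x\<in>U. iter_deriv vs F differentiable (at x))"

text \<open>Smoothness on an arbitrary subset: local existence of a smooth extension.\<close>

definition smooth_on :: "'a::real_normed_vector set \<Rightarrow> ('a \<Rightarrow> 'b::real_normed_vector) \<Rightarrow> bool" where
  "smooth_on S f \<longleftrightarrow>
     (\<forall>x\<in>S. \<exists>U F. x \<in> U \<and> smooth_open U F \<and> (\<forall>y\<in>S \<inter> U. F y = f y))"

definition diffeomorphism ::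
  "'a::real_normed_vector set \<Rightarrow> 'b::real_normed_vector set \<Rightarrow> ('a \<Rightarrow> 'b) \<Rightarrow> bool" where
  "diffeomorphism S T f \<longleftrightarrow>
     bij_betw f S T \<and> smooth_on S f \<and> smooth_on T (inv_into S f)"

definition tangent_space :: "'a::real_normed_vector set \<Rightarrow> 'a \<Rightarrow> 'a set" where
  "tangent_space M \<rho> = {v. \<exists>\<gamma> e. e > 0 \<and> smooth_open {-e<..<e} \<gamma> \<and> \<gamma> ` {-e<..<e} \<subseteq> M \<and>
     \<gamma> 0 = \<rho> \<and> (\<gamma> has_vector_derivative v) (at (0::real))}"

text \<open>
  The differential of a function on a submanifold. The derivative within \<open>M\<close> is not unique as a
  linear map on the ambient space, but its values on \<open>tangent_space M \<rho>\<close> are; it is only ever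
  evaluated there.
\<close>

definition mdiff :: "'a::real_normed_vector set \<Rightarrow> ('a \<Rightarrow> 'b::real_normed_vector) \<Rightarrow> 'a \<Rightarrow> 'a \<Rightarrow> 'b" where
  "mdiff M f \<rho> v = frechet_derivative f (at \<rho> within M) v"

text \<open>The functions in \<open>C\<^sub>b\<^sup>\<infinity>(U)\<close> depending on a parameter, with bounds uniform in the parameter.\<close>

definition Cb_inf_unif ::
  "'p set \<Rightarrow> 'a::real_normed_vector set \<Rightarrow> ('p \<Rightarrow> 'a \<Rightarrow> 'b::real_normed_vector) \<Rightarrow> bool" where
  "Cb_inf_unif T U F \<longleftrightarrow> (\<forall>t\<in>T. smooth_open U (F t)) \<and>
     (\<forall>vs. bounded ((\<lambda>(t, x). iter_deriv vs (F t) x) ` (T \<times> U)))"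

definition Cb_inf :: "'a::real_normed_vector set \<Rightarrow> ('a \<Rightarrow> 'b::real_normed_vector) \<Rightarrow> bool" where
  "Cb_inf U F \<longleftrightarrow> smooth_open U F \<and> (\<forall>vs. bounded (iter_deriv vs F ` U))"


section \<open>The complex symplectic space\<close>

text \<open>
  Points of \<open>\<complex>\<^sup>2\<^sup>n\<close> are pairs \<open>(x, \<xi>)\<close> with \<open>x, \<xi>\<close> in \<open>\<complex>\<^sup>n\<close>. The space \<open>complex ^ 'n\<close>, of real
  dimension \<open>2n\<close>, also serves as \<open>\<real>\<^sup>2\<^sup>n\<close>.
\<close>

type_synonym 'n cphase = "(complex ^ 'n) \<times> (complex ^ 'n)"

definition mult_i :: "'n::finite cphase \<Rightarrow> 'n cphase" where
  "mult_i v = (\<i> *s fst v, \<i> *s snd v)"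

text \<open>\<open>\<sigma> = \<Sum> d\<xi>\<^sub>j \<and> dx\<^sub>j\<close>\<close>

definition csympl :: "'n::finite cphase \<Rightarrow> 'n cphase \<Rightarrow> complex" where
  "csympl u v = (\<Sum>j\<in>UNIV. snd u $ j * fst v $ j - fst u $ j * snd v $ j)"

definition submanifold_2n :: "'n::finite cphase set \<Rightarrow> bool" where
  "submanifold_2n M \<longleftrightarrow>
     (\<forall>\<rho>\<in>M. \<exists>U V \<phi>. open U \<and> \<rho> \<in> U \<and> open (V :: (complex ^ 'n) set) \<and>
        diffeomorphism V (M \<inter> U) \<phi>)"

definition IR_manifold :: "'n::finite cphase set \<Rightarrow> bool" where
  "IR_manifold M \<longleftrightarrow> submanifold_2n M \<and>
     (\<forall>\<rho>\<in>M. (\<forall>u\<in>tangent_space M \<rho>. \<forall>v\<in>tangent_space M \<rho>. csympl u v \<in> \<real>) \<and>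
             (\<forall>u\<in>tangent_space M \<rho>. (\<forall>v\<in>tangent_space M \<rho>. csympl u v = 0) \<longrightarrow> u = 0))"

text \<open>
  \<open>|\<sigma>\<^sup>n| / n!\<close> evaluated on the frame that a real-linear \<open>D\<close> makes out of the standard basis of
  \<open>\<complex>\<^sup>n = \<real>\<^sup>2\<^sup>n\<close>, using
  \<open>\<sigma>\<^sup>n(v\<^sub>1, \<dots>, v\<^sub>2\<^sub>n) = 2\<^sup>-\<^sup>n \<Sum>\<^sub>\<pi> sgn \<pi> \<Prod>\<^sub>k \<sigma>(v\<^bsub>\<pi>(2k-1)\<^esub>, v\<^bsub>\<pi>(2k)\<^esub>)\<close>. The basis vectors are paired as
  \<open>(axis j 1, axis j \<i>)\<close>; the absolute value does not depend on their order.
\<close>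

definition sympl_density :: "((complex ^ 'n) \<Rightarrow> 'n::finite cphase) \<Rightarrow> real" where
  "sympl_density D =
     cmod ((\<Sum>\<pi> | \<pi> permutes (Basis :: (complex ^ 'n) set).
              of_int (sign \<pi>) *
              (\<Prod>j\<in>UNIV. csympl (D (\<pi> (axis j 1))) (D (\<pi> (axis j \<i>)))))
           / (2 ^ CARD('n))) / fact CARD('n)"

text \<open>
  The symplectic volume \<open>\<mu>\<close>, as a measure with underlying space \<open>M\<close>, for \<open>M\<close> diffeomorphic to
  \<open>\<real>\<^sup>2\<^sup>n\<close>. It does not depend on the chosen parametrization, by the change of variables formula.
\<close>

definition sympl_vol :: "'n::finite cphase set \<Rightarrow> 'n cphase measure" where
  "sympl_vol M =
     (let \<phi> = (SOME \<phi> :: (complex ^ 'n) \<Rightarrow> 'n cphase. diffeomorphism UNIV M \<phi>)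
      in distr (density lborel (\<lambda>y. ennreal (sympl_density (frechet_derivative \<phi> (at y)))))
               (restrict_space borel M) \<phi>)"

text \<open>
  The Hamilton vector at \<open>\<rho>\<close> of a real covector \<open>\<alpha>\<close> on the tangent space: \<open>\<sigma>(H, v) = -\<alpha>(v)\<close>.
\<close>

definition ham_vec :: "'n::finite cphase set \<Rightarrow> 'n cphase \<Rightarrow> ('n cphase \<Rightarrow> real) \<Rightarrow> 'n cphase" where
  "ham_vec M \<rho> \<alpha> = (THE u. u \<in> tangent_space M \<rho> \<and>
     (\<forall>v\<in>tangent_space M \<rho>. csympl u v = - complex_of_real (\<alpha> v)))"

definition ham_fun :: "'n::finite cphase set \<Rightarrow> ('n cphase \<Rightarrow> real) \<Rightarrow> 'n cphase \<Rightarrow> 'n cphase" where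
  "ham_fun M g \<rho> = ham_vec M \<rho> (mdiff M g \<rho>)"


section \<open>Weights and the manifolds they generate\<close>

definition wirt :: "'n::finite \<Rightarrow> (complex ^ 'n \<Rightarrow> complex) \<Rightarrow> complex ^ 'n \<Rightarrow> complex" where
  "wirt j F x = (frechet_derivative F (at x) (axis j 1)
                 - \<i> * frechet_derivative F (at x) (axis j \<i>)) / 2"

definition wirt_bar :: "'n::finite \<Rightarrow> (complex ^ 'n \<Rightarrow> complex) \<Rightarrow> complex ^ 'n \<Rightarrow> complex" where
  "wirt_bar j F x = (frechet_derivative F (at x) (axis j 1)
                     + \<i> * frechet_derivative F (at x) (axis j \<i>)) / 2"

definition levi :: "(complex ^ 'n \<Rightarrow> real) \<Rightarrow> complex ^ 'n \<Rightarrow> complex ^ 'n ^ 'n::finite" where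
  "levi \<Psi> x = (\<chi> j k. wirt_bar j (wirt k (\<lambda>y. complex_of_real (\<Psi> y))) x)"

definition graph_point :: "(complex ^ 'n \<Rightarrow> real) \<Rightarrow> complex ^ 'n \<Rightarrow> 'n::finite cphase" where
  "graph_point \<Psi> x = (x, \<chi> j. (2 / \<i>) * wirt j (\<lambda>y. complex_of_real (\<Psi> y)) x)"

definition Lam :: "(complex ^ 'n \<Rightarrow> real) \<Rightarrow> 'n::finite cphase set" where
  "Lam \<Psi> = range (graph_point \<Psi>)"

definition real_quadratic_form :: "(complex ^ 'n::finite \<Rightarrow> real) \<Rightarrow> bool" where
  "real_quadratic_form \<Phi> \<longleftrightarrow> (\<exists>B. bilinear B \<and> (\<forall>x. \<Phi> x = B x x))"

definition strictly_psh :: "(complex ^ 'n::finite \<Rightarrow> real) \<Rightarrow> bool" where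
  "strictly_psh \<Phi> \<longleftrightarrow>
     (\<forall>x v. v \<noteq> 0 \<longrightarrow> 0 < Re (\<Sum>j\<in>UNIV. \<Sum>k\<in>UNIV. levi \<Phi> x $ j $ k * cnj (v $ j) * v $ k))"

definition bounded_open_nbhd_0 :: "(complex ^ 'n \<Rightarrow> real) \<Rightarrow> 'n::finite cphase set \<Rightarrow> bool" where
  "bounded_open_nbhd_0 \<Phi> W \<longleftrightarrow> openin (top_of_set (Lam \<Phi>)) W \<and> 0 \<in> W \<and> bounded W"

definition tube :: "(complex ^ 'n \<Rightarrow> real) \<Rightarrow> 'n::finite cphase set \<Rightarrow> 'n cphase set" where
  "tube \<Phi> W = {a + mult_i w | a w. a \<in> Lam \<Phi> \<and> w \<in> W}"


section \<open>Admissible symbols and manifolds\<close>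

definition holomorphic_cphase :: "('n::finite cphase \<Rightarrow> complex) \<Rightarrow> 'n cphase set \<Rightarrow> bool" where
  "holomorphic_cphase p S \<longleftrightarrow>
     (\<forall>z\<in>S. \<exists>D. (p has_derivative D) (at z) \<and> (\<forall>v. D (mult_i v) = \<i> * D v))"

definition admissible_symbol ::
  "(complex ^ 'n \<Rightarrow> real) \<Rightarrow> 'n::finite cphase set \<Rightarrow> ('n cphase \<Rightarrow> complex) \<Rightarrow> bool" where
  "admissible_symbol \<Phi> W p \<longleftrightarrow> holomorphic_cphase p (tube \<Phi> W) \<and>
     (\<exists>m C. m < - 2 * real CARD('n) \<and>
        (\<forall>\<rho>\<in>tube \<Phi> W. cmod (p \<rho> - 1) \<le> C * (sqrt (1 + (norm \<rho>)\<^sup>2)) powr m))"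

abbreviation far :: "real \<Rightarrow> (complex ^ 'n::finite) set" where
  "far R \<equiv> {x. R < norm x}"

text \<open>
  Inside a tube \<open>\<Lambda>\<^sub>\<Phi> + iW\<close> with \<open>W\<close> bounded, \<open>(x, \<xi>)\<close> is bounded iff \<open>x\<close> is. Hence coincidence of
  \<open>M\<close> and \<open>\<Lambda>\<^sub>\<Psi>\<close> outside a bounded set may be expressed by the size of \<open>x\<close>, and only the values of
  \<open>\<Psi>\<close> for large \<open>x\<close> matter.
\<close>

definition graph_outside ::
  "real \<Rightarrow> (complex ^ 'n \<Rightarrow> real) \<Rightarrow> 'n::finite cphase set \<Rightarrow> bool" where
  "graph_outside R \<Psi> M \<longleftrightarrow> {\<rho>\<in>M. fst \<rho> \<in> far R} = graph_point \<Psi> ` far R"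

definition admissible_IR ::
  "(complex ^ 'n \<Rightarrow> real) \<Rightarrow> 'n::finite cphase set \<Rightarrow> 'n cphase set \<Rightarrow> bool" where
  "admissible_IR \<Phi> W' M \<longleftrightarrow> IR_manifold M \<and> M \<subseteq> tube \<Phi> W' \<and> closed M \<and>
     (\<exists>\<phi> :: (complex ^ 'n) \<Rightarrow> _. diffeomorphism UNIV M \<phi>) \<and>
     (\<exists>R \<Psi> C. graph_outside R \<Psi> M \<and> Cb_inf (far R) (\<lambda>x. \<Psi> x - \<Phi> x) \<and>
        (\<forall>x\<in>far R. invertible (levi \<Psi> x) \<and> norm (matrix_inv (levi \<Psi> x)) \<le> C))"

text \<open>
  One-parameter families over a parameter interval \<open>T\<close>. Smooth dependence on \<open>t\<close> means that the
  manifolds are parametrized by \<open>\<real>\<^sup>2\<^sup>n\<close> smoothly in \<open>t\<close> (a smooth trivialization of the total space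
  \<open>{(t, \<rho>). \<rho> \<in> \<Lambda>\<^sub>t}\<close>), and that the weights near infinity are smooth in \<open>(t, x)\<close>.
\<close>

definition admissible_family ::
  "(complex ^ 'n \<Rightarrow> real) \<Rightarrow> 'n::finite cphase set \<Rightarrow> real set \<Rightarrow> (real \<Rightarrow> 'n cphase set) \<Rightarrow> bool" where
  "admissible_family \<Phi> W' T \<Lambda> \<longleftrightarrow>
     (\<forall>t\<in>T. admissible_IR \<Phi> W' (\<Lambda> t)) \<and>
     (\<exists>\<phi> :: real \<Rightarrow> (complex ^ 'n) \<Rightarrow> 'n cphase.
        diffeomorphism (T \<times> UNIV) (SIGMA t:T. \<Lambda> t) (\<lambda>(t, y). (t, \<phi> t y))) \<and>
     (\<exists>R \<Psi> C.
        (\<forall>t\<in>T. graph_outside R (\<Psi> t) (\<Lambda> t)) \<and>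
        smooth_open (T \<times> far R) (\<lambda>(t, x). \<Psi> t x) \<and>
        Cb_inf_unif T (far R) (\<lambda>t x. \<Psi> t x - \<Phi> x) \<and>
        (\<forall>t\<in>T. \<forall>x\<in>far R. invertible (levi (\<Psi> t) x) \<and> norm (matrix_inv (levi (\<Psi> t) x)) \<le> C) \<and>
        (\<forall>N u v. Cb_inf_unif T (far R)
           (\<lambda>t x. (deriv ^^ N) (\<lambda>s. iter_deriv [u, v] (\<Psi> s) x) t)))"


section \<open>Generating functions\<close>

text \<open>
  A smooth family \<open>f\<^sub>t \<in> C\<^sub>b\<^sup>\<infinity>(\<Lambda>\<^sub>t; \<real>)\<close>: jointly smooth on the total space, and near infinity, in the
  coordinate \<open>x\<close>, all \<open>(t, x)\<close>-derivatives are bounded, locally uniformly in \<open>t\<close>. Only the graph of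
  \<open>\<Lambda>\<^sub>t\<close> over \<open>far R\<close> enters, so the choice of \<open>\<Psi>\<close> is immaterial.
\<close>

definition smooth_Cb_family ::
  "real set \<Rightarrow> (real \<Rightarrow> 'n::finite cphase set) \<Rightarrow> (real \<Rightarrow> 'n cphase \<Rightarrow> real) \<Rightarrow> bool" where
  "smooth_Cb_family T \<Lambda> f \<longleftrightarrow>
     smooth_on (SIGMA t:T. \<Lambda> t) (\<lambda>(t, \<rho>). f t \<rho>) \<and>
     (\<exists>R \<Psi>. (\<forall>t\<in>T. graph_outside R (\<Psi> t) (\<Lambda> t)) \<and>
        (\<forall>K vs. compact K \<and> K \<subseteq> T \<longrightarrow>
           bounded (iter_deriv vs (\<lambda>(t, x). f t (graph_point (\<Psi> t) x)) ` (K \<times> far R))))"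

definition generating_functions ::
  "real set \<Rightarrow> (real \<Rightarrow> 'n::finite cphase set) \<Rightarrow> (real \<Rightarrow> 'n cphase \<Rightarrow> real) \<Rightarrow> bool" where
  "generating_functions T \<Lambda> f \<longleftrightarrow> smooth_Cb_family T \<Lambda> f \<and>
     (\<exists>\<kappa>. smooth_on (T \<times> \<Lambda> 0) (\<lambda>(t, \<rho>). \<kappa> t \<rho>) \<and>
        (\<forall>\<rho>\<in>\<Lambda> 0. \<kappa> 0 \<rho> = \<rho>) \<and>
        (\<forall>t\<in>T. diffeomorphism (\<Lambda> 0) (\<Lambda> t) (\<kappa> t)) \<and>
        (\<forall>t\<in>T. \<forall>\<rho>\<in>\<Lambda> 0.
           ((\<lambda>s. \<kappa> s \<rho>) has_vector_derivative
              mult_i (ham_fun (\<Lambda> t) (f t) (\<kappa> t \<rho>))) (at t)))"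


section \<open>The functionals\<close>

definition I_fun :: "'n::finite cphase set \<Rightarrow> ('n cphase \<Rightarrow> complex) \<Rightarrow> real" where
  "I_fun M p = (LINT \<rho>|sympl_vol M. ln (cmod (p \<rho>)))"

definition I_eps :: "real \<Rightarrow> 'n::finite cphase set \<Rightarrow> ('n cphase \<Rightarrow> complex) \<Rightarrow> real" where
  "I_eps \<epsilon> M p =
     1 / 2 * (LINT \<rho>|sympl_vol M. ln (((cmod (p \<rho>))\<^sup>2 + \<epsilon>\<^sup>2) / (1 + \<epsilon>\<^sup>2)))"

text \<open>
  The \<open>L\<^sup>1\<close> extension of \<open>d arg p = (dp/p - d(cnj p)/cnj p)/(2i)\<close> from
  \<open>M - p\<^sup>-\<^sup>1(0)\<close> to \<open>M\<close>, by 0 on the null set \<open>p\<^sup>-\<^sup>1(0)\<close>. The complex value is real.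
\<close>

definition darg :: "'n::finite cphase set \<Rightarrow> ('n cphase \<Rightarrow> complex) \<Rightarrow> 'n cphase \<Rightarrow> 'n cphase \<Rightarrow> real" where
  "darg M p \<rho> v =
     (if p \<rho> = 0 then 0
      else Re (1 / (2 * \<i>) * (mdiff M p \<rho> v / p \<rho> - mdiff M (\<lambda>z. cnj (p z)) \<rho> v / cnj (p \<rho>))))"

definition ham_arg :: "'n::finite cphase set \<Rightarrow> ('n cphase \<Rightarrow> complex) \<Rightarrow> 'n cphase \<Rightarrow> 'n cphase" where
  "ham_arg M p \<rho> = ham_vec M \<rho> (darg M p \<rho>)"

text \<open>The formal derivative \<open>\<partial>\<^sub>t I(\<Lambda>\<^sub>t, p)\<close> at \<open>M = \<Lambda>\<^sub>t\<close>, \<open>g = f\<^sub>t\<close>.\<close>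

definition formal_dI ::
  "'n::finite cphase set \<Rightarrow> ('n cphase \<Rightarrow> complex) \<Rightarrow> ('n cphase \<Rightarrow> real) \<Rightarrow> real" where
  "formal_dI M p g = - (LINT \<rho>|sympl_vol M. darg M p \<rho> (ham_fun M g \<rho>))"

end

theory Submission
  imports Defs "HOL-Complex_Analysis.Complex_Analysis" "HOL-Real_Asymp.Real_Asymp"
begin

text \<open>
  Pull everything back by the flow to a fixed coordinate space \<open>\<real>\<^sup>2\<^sup>n\<close>. Since \<open>\<sigma>\<close> is closed and
  \<open>\<sigma>(\<i>H\<^sub>f, \<cdot>) = -\<i> df\<close> is \<open>\<i>\<close> times an exact form, the flow preserves the restriction of \<open>\<sigma>\<close>, so
  \<open>I(\<Lambda>\<^sub>t, p) = \<integral> ln |F(t, y)| w(y) dy\<close> with \<open>F = p \<circ> \<kappa>\<^sub>t\<close> and a density \<open>w\<close> independent of \<open>t\<close>.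
  By holomorphy \<open>\<partial>\<^sub>tF = \<i> dF(h)\<close> for the real vector \<open>h\<close> representing \<open>H\<^sub>f\<close>, hence
  \<open>\<partial>\<^sub>t ln |F| = - Im (dF(h) / F) = - \<langle>d arg F, h\<rangle>\<close>.

  The analytic point is a bound for \<open>\<integral> (|ln |F|| + |Im (dF/F)|)\<close> over compact sets, uniform in \<open>t\<close>.
  Because \<open>\<Lambda>\<^sub>t\<close> is totally real and \<open>p\<close> does not vanish identically, the leading homogeneous part of \<open>p\<close>
  at a zero does not vanish on the tangent space. So \<open>F\<close> is of finite type along some direction: one of its
  derivatives is nonzero, uniformly for nearby \<open>t\<close> and nearby lines. On such a line \<open>F\<close> is compared
  with a polynomial, each root \<open>a\<close> of which contributes \<open>|Im 1/(s - a)|\<close>, of integral at most \<open>\<pi>\<close>, and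
  \<open>|ln |s - a||\<close>. Near infinity the Levi form bounds \<open>H\<^sub>f\<close>, and \<open>p - 1\<close> decays integrably
  together with its derivatives. Dominated convergence as \<open>\<epsilon> \<rightarrow> 0\<close> then gives
  \<open>I(\<Lambda>\<^sub>t, p) - I(\<Lambda>\<^sub>s, p) = \<integral>\<^sub>s\<^sup>t\<close> of the bounded formal derivative.
\<close>

section \<open>Functions of finite type on an interval\<close>

text \<open>The bound on a line must be uniform while the zeros of F move, merge and approach the
  line. They are never located. A cluster is described by one real point \<open>al\<close> and one
  scale D: \<open>al\<close> minimizes the sum over k < m of |F k|^(1/(m-k)), and D is the minimum.
  Beyond a fixed multiple of D from \<open>al\<close> the function behaves like c (x - al)^m, whose
  logarithmic derivative m / (x - al) is real. This is why the imaginary part of F'/F can be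
  integrated uniformly although 1 / |x - al| cannot; the error is a Cauchy kernel of width D, with
  mass at most \<pi> for every D. Within that distance, rescaling by D leaves a function for which
  at every point some derivative of order below m is bounded from below, and induction on m applies.
  The factor \<i> in the flow is what produces exactly the imaginary part. The last step has its own
  obstacle. Q, the formal derivative as a function of t, is known to be bounded and integrable, and
  the integral formula for I has to be differentiated at almost every t with value Q t: Lebesgue's
  differentiation theorem, obtained from a maximal inequality.\<close>

definition deriv_chain :: "(nat => real => complex) => bool" where
 "deriv_chain F \<longleftrightarrow> (\<forall>k s. (F k has_vector_derivative F (Suc k) s) (at s))"

text \<open>The value is infinite at a zero, where \<open>w / z\<close> and \<open>ln 0\<close>
  would both be 0 by convention. A finite integral of \<open>log_var\<close> therefore also shows
  that the zeros form a null set.\<close>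

definition log_var :: "complex => complex => ennreal" where
 "log_var z w = (if z = 0 then \<infinity> else ennreal (\<bar>Im (w / z)\<bar> + \<bar>ln (cmod z)\<bar>))"

lemma log_var_measurable [measurable]:
 assumes [measurable]: "f : borel_measurable M" "g : borel_measurable M"
 shows "(%x. log_var (f x) (g x)) : borel_measurable M"
 unfolding log_var_def by measurable

lemma deriv_chain_continuous: "deriv_chain F ==> continuous_on S (F k)"
 unfolding deriv_chain_def
 by (meson continuous_at_imp_continuous_on has_vector_derivative_continuous)

lemma deriv_chain_measurable: "deriv_chain F ==> F k : borel_measurable borel"
 using deriv_chain_continuous[of F UNIV] by (intro borel_measurable_continuous_onI) auto

lemma vector_derivative_bound:
 fixes f :: "real => 'a::real_normed_vector"
 assumes "!!y. y : closed_segment a x ==> (f has_vector_derivative f' y) (at y)"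
  and "!!y. y : closed_segment a x ==> norm (f' y) <= B"
 shows "norm (f x - f a) <= B * \<bar>x - a\<bar>"
proof -
 have "norm (f x - f a) <= B * norm (x - a)"
 proof (rule differentiable_bound[of "closed_segment a x" f "%y h. h *\<^sub>R f' y"])
  fix y assume y: "y : closed_segment a x"
  show "(f has_derivative (%h. h *\<^sub>R f' y)) (at y within closed_segment a x)"
   using assms(1)[OF y] unfolding has_vector_derivative_def
   by (rule has_derivative_at_withinI)
  show "onorm (%h. h *\<^sub>R f' y) <= B"
   using assms(2)[OF y] by (intro onorm_le) (metis mult.commute mult_left_mono norm_ge_zero norm_scaleR real_norm_def)
 qed auto
 thus ?thesis by simp
qed

lemma set_nn_integral_has_integral:
 assumes "(f has_integral I) S" "S : sets borel" "f : borel_measurable borel"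
  and "!!x. x : S ==> 0 <= f x"
 shows "(\<integral>\<^sup>+x\<in>S. ennreal (f x) \<partial>lborel) = ennreal I"
proof -
 have "((%x. indicator S x * f x) has_integral I) UNIV"
  using assms(1) by (simp add: indicator_def of_bool_def if_distrib[of "%c. c * _"] has_integral_restrict_UNIV cong: if_cong)
 hence "(\<integral>\<^sup>+x. ennreal (indicator S x * f x) \<partial>lborel) = ennreal I"
  using assms by (intro nn_integral_has_integral_lborel) (auto simp: indicator_def)
 thus ?thesis
  by (simp add: nn_integral_set_ennreal mult.commute)
qed

lemma set_nn_integral_split_le:
 fixes g :: "real => ennreal"
 assumes [measurable]: "g : borel_measurable borel" "A : sets borel" "B : sets borel"
  and "S \<subseteq> A \<union> B"
 shows "(\<integral>\<^sup>+x\<in>S. g x \<partial>lborel) <= (\<integral>\<^sup>+x\<in>A. g x \<partial>lborel) + (\<integral>\<^sup>+x\<in>B. g x \<partial>lborel)"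
proof -
 have "(\<integral>\<^sup>+x\<in>S. g x \<partial>lborel) <= (\<integral>\<^sup>+x. g x * indicator A x + g x * indicator B x \<partial>lborel)"
  using assms(4) by (intro nn_integral_mono) (auto simp: indicator_def)
 also have "... = (\<integral>\<^sup>+x\<in>A. g x \<partial>lborel) + (\<integral>\<^sup>+x\<in>B. g x \<partial>lborel)"
  by (rule nn_integral_add) auto
 finally show ?thesis .
qed

text \<open>The bound counts pieces: an interval of length b - a splits into at most (b - a) /
  \<eta> + 1 pieces of length at most \<eta>.\<close>

lemma set_nn_integral_subdivide:
 fixes g :: "real => ennreal"
 assumes g [measurable]: "g : borel_measurable borel"
  and "\<eta> > 0" "C \<ge> 0" "a <= b"
  and short: "!!c d. a <= c ==> c <= d ==> d <= b ==> d - c <= \<eta> ==> (\<integral>\<^sup>+x\<in>{c..d}. g x \<partial>lborel) <= ennreal C"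
 shows "(\<integral>\<^sup>+x\<in>{a..b}. g x \<partial>lborel) <= ennreal (C * ((b - a) / \<eta> + 1))"
proof -
 have *: "(\<integral>\<^sup>+x\<in>{c..b}. g x \<partial>lborel) <= ennreal (real n * C)"
  if "a <= c" "c <= b" "b - c <= real n * \<eta>" "n > 0" for n c
  using that
 proof (induction n arbitrary: c)
  case (Suc n)
  show ?case
  proof (cases "b - c <= \<eta>")
   case True
   hence "(\<integral>\<^sup>+x\<in>{c..b}. g x \<partial>lborel) <= ennreal C"
    using Suc by (intro short) auto
   also have "... <= ennreal (real (Suc n) * C)"
    using \<open>C \<ge> 0\<close> by (intro ennreal_leI) (simp add: mult_right_mono[of 1 "real (Suc n)" C, simplified])
   finally show ?thesis .
  next
   case False
   have n: "n > 0" using Suc(4) False by (cases n) auto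
   have "(\<integral>\<^sup>+x\<in>{c..b}. g x \<partial>lborel) <= (\<integral>\<^sup>+x\<in>{c..c+\<eta>}. g x \<partial>lborel) + (\<integral>\<^sup>+x\<in>{c+\<eta>..b}. g x \<partial>lborel)"
    by (rule set_nn_integral_split_le) auto
   also have "... <= ennreal C + ennreal (real n * C)"
    using Suc False \<open>\<eta> > 0\<close> n by (intro add_mono short Suc.IH) (auto simp: algebra_simps)
   also have "... = ennreal (real (Suc n) * C)"
    using \<open>C \<ge> 0\<close> by (subst ennreal_plus[symmetric]) (auto simp: algebra_simps)
   finally show ?thesis .
  qed
 qed simp
 define n where "n = nat \<lceil>(b - a) / \<eta>\<rceil>"
 show ?thesis
 proof (cases "a = b")
  case True
  hence "(\<integral>\<^sup>+x\<in>{a..b}. g x \<partial>lborel) <= ennreal C"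
   using \<open>\<eta> > 0\<close> by (intro short) auto
  with True show ?thesis by simp
 next
  case False
  have ab: "(b - a) / \<eta> > 0" using False assms by simp
  have n0: "n > 0" using ab unfolding n_def by linarith
  have n1: "(b - a) / \<eta> <= real n" unfolding n_def by linarith
  have n2: "real n <= (b - a) / \<eta> + 1" using ab unfolding n_def by linarith
  have "b - a <= real n * \<eta>" using n1 \<open>\<eta> > 0\<close> by (simp add: field_simps)
  hence "(\<integral>\<^sup>+x\<in>{a..b}. g x \<partial>lborel) <= ennreal (real n * C)"
   using * n0 assms by auto
  also have "... <= ennreal (C * ((b - a) / \<eta> + 1))"
   using n2 \<open>C \<ge> 0\<close> by (intro ennreal_leI) (simp add: mult.commute mult_left_mono)
  finally show ?thesis .
 qed
qed

text \<open>For 0 < s \<le> 1 the inequality ln x \<le> x - 1 at x = s^(-1/2) gives |ln s| \<le> 2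
  s^(-1/2), whose integral over the unit interval is 4; reflection at 0 doubles it.\<close>

lemma nn_integral_abs_ln:
 "(\<integral>\<^sup>+s\<in>{-1..1}. ennreal \<bar>ln \<bar>s\<bar>\<bar> \<partial>lborel) <= ennreal 8"
proof -
 let ?g = "%s::real. ennreal \<bar>ln \<bar>s\<bar>\<bar>"
 have pos: "(\<integral>\<^sup>+s\<in>{0..1}. ?g s \<partial>lborel) <= ennreal 4"
 proof -
  have hi: "((%x. x powr (-1/2)) has_integral (1 powr (-1/2+1) / (-1/2+1))) {0..1::real}"
   by (rule has_integral_powr_from_0) auto
  have "(\<integral>\<^sup>+s\<in>{0..1}. ?g s \<partial>lborel) <= (\<integral>\<^sup>+s. ennreal (2 * s powr (-1/2)) * indicator {0..1} s \<partial>lborel)"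
  proof (intro nn_integral_mono)
   fix s :: real
   have "\<bar>ln s\<bar> <= 2 * s powr (-1/2)" if "0 < s" "s <= 1"
   proof -
    have "ln (s powr (-1/2)) <= s powr (-1/2) - 1"
     using that by (intro ln_le_minus_one) auto
    moreover have "ln (s powr (-1/2)) = (-1/2) * ln s" using that by (simp add: ln_powr)
    moreover have "ln s <= 0" using that by simp
    ultimately show ?thesis by simp
   qed
   \<comment> \<open>Both sides are 0 here, as \<open>ln 0\<close> and \<open>0 powr _\<close> are
     0.\<close>
   moreover have "\<bar>ln \<bar>s\<bar>\<bar> <= 2 * s powr (-1/2)" if "s = 0" using that by simp
   ultimately show "?g s * indicator {0..1} s <= ennreal (2 * s powr (-1/2)) * indicator {0..1} s"
    by (cases "s = 0") (auto simp: indicator_def intro!: ennreal_leI)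
  qed
  also have "... = ennreal (2 * (1 powr (-1/2+1) / (-1/2+1)))"
   by (rule set_nn_integral_has_integral[OF has_integral_mult_right[OF hi, of 2]]) auto
  finally show ?thesis by simp
 qed
 have "(\<integral>\<^sup>+s\<in>{-1..0}. ?g s \<partial>lborel) = ennreal \<bar>-1\<bar> * (\<integral>\<^sup>+s. ?g (0 + (-1) * s) * indicator {-1..0} (0 + (-1) * s) \<partial>lborel)"
  by (rule nn_integral_real_affine) auto
 also have "... = (\<integral>\<^sup>+s\<in>{0..1}. ?g s \<partial>lborel)"
  by (simp, intro nn_integral_cong) (auto simp: indicator_def)
 finally have neg: "(\<integral>\<^sup>+s\<in>{-1..0}. ?g s \<partial>lborel) <= ennreal 4" using pos by simp
 have "(\<integral>\<^sup>+s\<in>{-1..1}. ?g s \<partial>lborel) <= (\<integral>\<^sup>+s\<in>{-1..0}. ?g s \<partial>lborel) + (\<integral>\<^sup>+s\<in>{0..1}. ?g s \<partial>lborel)"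
  by (rule set_nn_integral_split_le) auto
 also have "... <= ennreal 4 + ennreal 4" using pos neg by (intro add_mono)
 also have "... = ennreal 8" by (subst ennreal_plus[symmetric]) auto
 finally show ?thesis .
qed

text \<open>The integrand is the derivative of \<open>arctan (s / D)\<close>, so its mass stays
  below \<pi> for every width D. This scale invariance keeps the later bounds independent of how
  closely zeros cluster.\<close>

lemma nn_integral_cauchy_kernel:
 assumes "D \<ge> 0"
 shows "(\<integral>\<^sup>+s\<in>{-1..1}. ennreal (D / (s\<^sup>2 + D\<^sup>2)) \<partial>lborel) <= ennreal pi"
proof (cases "D = 0")
 case False
 hence D: "D > 0" using assms by simp
 have "((%s. D / (s\<^sup>2 + D\<^sup>2)) has_integral (arctan (1 / D) - arctan (-1 / D))) {-1..1}"
 proof (intro fundamental_theorem_of_calculus)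
  fix x :: real
  have pos: "x\<^sup>2 + D\<^sup>2 > 0" using D by (intro add_nonneg_pos) auto
  have "((%s. arctan (s / D)) has_real_derivative (1 / D) * inverse (1 + (x / D)\<^sup>2)) (at x within {-1..1})"
   using D by (auto intro!: derivative_eq_intros)
  moreover have "(1 / D) * inverse (1 + (x / D)\<^sup>2) = D / (x\<^sup>2 + D\<^sup>2)"
  proof -
   have "1 + (x / D)\<^sup>2 = (x\<^sup>2 + D\<^sup>2) / D\<^sup>2" using D by (simp add: field_simps power2_eq_square)
   thus ?thesis using D pos by (simp add: field_simps power2_eq_square)
  qed
  ultimately show "((%s. arctan (s / D)) has_vector_derivative D / (x\<^sup>2 + D\<^sup>2)) (at x within {-1..1})"
   by (simp add: has_real_derivative_iff_has_vector_derivative)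
 qed auto
 hence "(\<integral>\<^sup>+s\<in>{-1..1}. ennreal (D / (s\<^sup>2 + D\<^sup>2)) \<partial>lborel) = ennreal (arctan (1 / D) - arctan (-1 / D))"
  using D by (intro set_nn_integral_has_integral) auto
 also have "... <= ennreal pi"
  using arctan_bounded[of "1 / D"] arctan_bounded[of "-1 / D"] by (intro ennreal_leI) linarith
 finally show ?thesis .
qed simp

text \<open>D is a length scale at \<open>al\<close>: with the k-th derivative at most D^(m-k)
  there, the lower Taylor terms of \<open>F (m - i)\<close> at distance s are of size D (s +
  D)^(i-1), small against the top term s^i once s is large compared with D. Induction on i
  integrates the estimate from \<open>al\<close>, and the constant of integration is at most
  D^(i+1).\<close>

lemma taylor_top_remainder:
 assumes "deriv_chain F" and "al : {a..b}" and "D \<ge> 0" "A \<ge> 0"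
  and A: "!!x. x : {a..b} ==> cmod (F (Suc m) x) <= A"
  and D: "!!k. k < m ==> cmod (F k al) <= D ^ (m - k)"
  and "i <= m" "x : {a..b}"
 shows "cmod (F (m - i) x - F m al * of_real ((x - al) ^ i / fact i))
  <= real i * D * (\<bar>x - al\<bar> + D) ^ (i - 1) + A * \<bar>x - al\<bar> ^ Suc i"
 using assms(7,8)
proof (induction i arbitrary: x)
 case 0
 have "closed_segment al x \<subseteq> {a..b}" using 0 assms(2) by (auto simp: closed_segment_eq_real_ivl)
 hence "norm (F m x - F m al) <= A * \<bar>x - al\<bar>"
  using assms(1) A by (intro vector_derivative_bound[of _ _ _ "F (Suc m)"]) (auto simp: deriv_chain_def)
 thus ?case by simp
next
 case (Suc i)
 let ?V = "%i x. F (m - i) x - F m al * of_real ((x - al) ^ i / fact i)"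
 let ?s = "\<bar>x - al\<bar>"
 have seg: "closed_segment al x \<subseteq> {a..b}" using Suc assms(2) by (auto simp: closed_segment_eq_real_ivl)
 have mi: "m - i = Suc (m - Suc i)" using Suc by simp
 have "norm (?V (Suc i) x - ?V (Suc i) al) <= (real i * D * (?s + D) ^ (i - 1) + A * ?s ^ Suc i) * ?s"
 proof (rule vector_derivative_bound[of _ _ _ "?V i"])
  fix y assume y: "y : closed_segment al x"
  have "((%x. of_real ((x - al) ^ Suc i / fact (Suc i)) :: complex) has_vector_derivative of_real ((y - al) ^ i / fact i)) (at y)"
  proof -
   have "((%x. (x - al) ^ Suc i / fact (Suc i)) has_real_derivative (real (Suc i) * (y - al) ^ i) / fact (Suc i)) (at y)"
    by (auto intro!: derivative_eq_intros simp del: power_Suc fact_Suc)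
   also have "(real (Suc i) * (y - al) ^ i) / fact (Suc i) = (y - al) ^ i / fact i"
    by (simp add: divide_simps)
   finally show ?thesis
    unfolding has_real_derivative_iff_has_vector_derivative
     by (rule bounded_linear.has_vector_derivative[OF bounded_linear_of_real])
  qed
  moreover have "(F (m - Suc i) has_vector_derivative F (m - i) y) (at y)"
   using assms(1) unfolding deriv_chain_def mi by blast
  ultimately show "(?V (Suc i) has_vector_derivative ?V i y) (at y)"
   by (intro has_vector_derivative_diff has_vector_derivative_mult_right)
  have le: "\<bar>y - al\<bar> <= ?s" using y by (auto simp: closed_segment_eq_real_ivl split: if_splits)
  have "norm (?V i y) <= real i * D * (\<bar>y - al\<bar> + D) ^ (i - 1) + A * \<bar>y - al\<bar> ^ Suc i"
   using Suc seg y by (intro Suc.IH) auto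
  also have "... <= real i * D * (?s + D) ^ (i - 1) + A * ?s ^ Suc i"
   using le assms(3,4) by (intro add_mono mult_left_mono power_mono) auto
  finally show "norm (?V i y) <= real i * D * (?s + D) ^ (i - 1) + A * ?s ^ Suc i" .
 qed
 moreover have "?V (Suc i) al = F (m - Suc i) al" by simp
 moreover have "cmod (F (m - Suc i) al) <= D ^ Suc i"
  using D[of "m - Suc i"] Suc by simp
 ultimately have "cmod (?V (Suc i) x) <= D ^ Suc i + (real i * D * (?s + D) ^ (i - 1) + A * ?s ^ Suc i) * ?s"
  using norm_triangle_ineq2[of "?V (Suc i) x" "F (m - Suc i) al"] by simp
 \<comment> \<open>The constant of integration and the integrated error are both brought to the form
   D (s + D)^i; one of the first and i of the second make the factor i + 1.\<close>
 also have "D ^ Suc i <= D * (?s + D) ^ i"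
  using assms(3) by (auto intro!: mult_left_mono power_mono)
 also have "real i * D * (?s + D) ^ (i - 1) * ?s <= real i * D * (?s + D) ^ i"
 proof (cases i)
  case (Suc j)
  have "(?s + D) ^ j * ?s <= (?s + D) ^ j * (?s + D)"
   using assms(3) by (intro mult_left_mono) auto
  hence "real i * D * ((?s + D) ^ j * ?s) <= real i * D * ((?s + D) ^ j * (?s + D))"
   using assms(3) by (intro mult_left_mono) auto
  thus ?thesis using Suc by (simp add: mult.assoc mult.commute[of "?s + D"])
 qed simp
 hence "D * (?s + D) ^ i + (real i * D * (?s + D) ^ (i - 1) + A * ?s ^ Suc i) * ?s
  <= D * (?s + D) ^ i + (real i * D * (?s + D) ^ i + A * ?s ^ Suc (Suc i))"
  by (simp add: algebra_simps)
 finally show ?case by (simp add: algebra_simps)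
qed

text \<open>At distances large compared with D, \<open>F 0\<close> is c (x - al)^m / m! up to at
  most half its size. Since m / (x - al) is real, it may be subtracted under \<open>Im\<close>. What
  remains of the numerator is (x - al) V1 - m V0, which has either a factor D or an additional power
  of x - al, and so yields D / (x - al)^2 + A in place of the nonintegrable 1 / |x - al|.\<close>

lemma outer_estimate:
 assumes "deriv_chain F" and "m > 0" and "al : {a..b}" and "D \<ge> 0" and "A \<ge> 1"
  and A: "!!x. x : {a..b} ==> cmod (F (Suc m) x) <= A"
  and D: "!!k. k < m ==> cmod (F k al) <= D ^ (m - k)"
  and low: "1 / A <= cmod (F m al)"
  and x: "x : {a..b}" "x ~= al"
  and far: "4 * A * fact m * (real m * 2 ^ m) * D <= \<bar>x - al\<bar>"
  and near: "\<bar>x - al\<bar> <= 1 / (4 * A\<^sup>2 * fact m)"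
 shows "\<bar>x - al\<bar> ^ m / (2 * A * fact m) <= cmod (F 0 x)"
  and "\<bar>Im (F 1 x / F 0 x)\<bar> <= 2 * A * fact m * (real m + 1) * (real m * 2 ^ m * (D / (x - al)\<^sup>2) + A)"
proof -
 define s where "s = \<bar>x - al\<bar>"
 have s: "s > 0" using x by (simp add: s_def)
 define c where "c = F m al"
 define V0 where "V0 = F 0 x - c * of_real ((x - al) ^ m / fact m)"
 define V1 where "V1 = F 1 x - c * of_real ((x - al) ^ (m - 1) / fact (m - 1))"
 define B where "B = real m * 2 ^ m * D * s ^ (m - 1) + A * s ^ Suc m"
 have "1 * 1 <= 4 * A * fact m * (real m * 2 ^ m)"
 proof (rule mult_mono)
  have "(1::real) * 1 <= A * fact m" using assms by (intro mult_mono) auto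
  thus "1 <= 4 * A * fact m" by simp
  have "(1::real) * 1 <= real m * 2 ^ m" using assms by (intro mult_mono) auto
  thus "1 <= real m * 2 ^ m" by simp
 qed (use assms in auto)
 hence "1 * D <= 4 * A * fact m * (real m * 2 ^ m) * D"
  using assms(4) by (intro mult_right_mono) auto
 hence Ds: "D <= s" using far unfolding s_def by linarith
 have pw: "(s + D) ^ (k - 1) <= 2 ^ m * s ^ (k - 1)" if "k <= m" for k
 proof -
  have "(s + D) ^ (k - 1) <= (2 * s) ^ (k - 1)" using Ds assms(4) s by (intro power_mono) auto
  also have "... = 2 ^ (k - 1) * s ^ (k - 1)" by (simp add: power_mult_distrib)
  also have "... <= 2 ^ m * s ^ (k - 1)"
   using that s by (intro mult_right_mono power_increasing) auto
  finally show ?thesis .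
 qed
 have "cmod V0 <= real m * D * (s + D) ^ (m - 1) + A * s ^ Suc m"
  using taylor_top_remainder[OF assms(1,3,4) _ A D, of m x] assms(5) x
  by (simp add: V0_def s_def c_def)
 also have "... <= B"
  unfolding B_def using mult_left_mono[OF pw[of m], of "real m * D"] assms(4) by (simp add: mult_ac)
 finally have V0: "cmod V0 <= B" .
 have "cmod V1 <= real (m - 1) * D * (s + D) ^ (m - 1 - 1) + A * s ^ Suc (m - 1)"
  using taylor_top_remainder[OF assms(1,3,4) _ A D, of "m - 1" x] assms(2,5) x
  by (simp add: V1_def s_def c_def)
 hence "s * cmod V1 <= s * (real (m - 1) * D * (s + D) ^ (m - 1 - 1) + A * s ^ Suc (m - 1))"
  using s by (intro mult_left_mono) auto
 also have "... <= B"
 proof (cases "m = 1")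
  case True
  thus ?thesis using s assms(4) by (simp add: B_def)
 next
  case False
  then obtain j where j: "m = Suc (Suc j)" using assms(2) by (metis One_nat_def gr0_implies_Suc not0_implies_Suc)
  have "real (m - 1) * D * (s + D) ^ (m - 1 - 1) <= real m * D * (2 ^ m * s ^ (m - 1 - 1))"
   using pw[of "m - 1"] assms(4) s by (intro mult_mono) auto
  hence "s * (real (m - 1) * D * (s + D) ^ (m - 1 - 1)) <= s * (real m * D * (2 ^ m * s ^ (m - 1 - 1)))"
   using s by (intro mult_left_mono) auto
  thus ?thesis unfolding B_def j by (simp add: algebra_simps)
 qed
 finally have V1: "s * cmod V1 <= B" .
 have sm: "s ^ m = s * s ^ (m - 1)" using assms(2) by (simp add: power_eq_if)
 \<comment> \<open>The hypotheses \<open>far\<close> and \<open>near\<close> are made so that each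
   of the two terms of B is at most a quarter of s^m / (A m!), the lower bound for the top
   term.\<close>
 have "real m * 2 ^ m * D * s ^ (m - 1) <= s ^ m / (4 * A * fact m)"
 proof -
  have "(4 * A * fact m * (real m * 2 ^ m) * D) * s ^ (m - 1) <= s * s ^ (m - 1)"
   using far s unfolding s_def[symmetric] by (intro mult_right_mono) auto
  thus ?thesis using assms(5) unfolding sm by (simp add: field_simps)
 qed
 moreover have "A * s ^ Suc m <= s ^ m / (4 * A * fact m)"
 proof -
  have "A * s <= A * (1 / (4 * A\<^sup>2 * fact m))"
   using near assms(5) unfolding s_def by (intro mult_left_mono) auto
  also have "... = 1 / (4 * A * fact m)" using assms(5) by (simp add: field_simps power2_eq_square)
  finally have "s ^ m * (A * s) <= s ^ m * (1 / (4 * A * fact m))" using s by (intro mult_left_mono) auto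
  thus ?thesis by (simp add: mult_ac)
 qed
 ultimately have "B <= s ^ m / (2 * A * fact m)" unfolding B_def by (simp add: field_simps)
 moreover have "s ^ m / (A * fact m) <= cmod (c * of_real ((x - al) ^ m / fact m))"
 proof -
  have "cmod (c * of_real ((x - al) ^ m / fact m)) = cmod c * (s ^ m / fact m)"
   by (simp only: norm_mult norm_of_real) (simp add: s_def power_abs)
  moreover have "1 / A * (s ^ m / fact m) <= cmod c * (s ^ m / fact m)"
   using low s unfolding c_def by (intro mult_right_mono) auto
  ultimately show ?thesis by simp
 qed
 moreover have "s ^ m / (A * fact m) = 2 * (s ^ m / (2 * A * fact m))" by simp
 ultimately have "s ^ m / (2 * A * fact m) <= cmod (c * of_real ((x - al) ^ m / fact m)) - cmod V0"
  using V0 by linarith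
 also have "... <= cmod (F 0 x)"
  using norm_diff_ineq[of "c * of_real ((x - al) ^ m / fact m)" V0] by (simp add: V0_def)
 finally have lower: "s ^ m / (2 * A * fact m) <= cmod (F 0 x)" .
 thus "\<bar>x - al\<bar> ^ m / (2 * A * fact m) <= cmod (F 0 x)" by (simp add: s_def)
 have pos: "0 < s ^ m / (2 * A * fact m)" using s assms(5) by simp
 hence F0: "F 0 x ~= 0" using lower by auto
 have xa: "complex_of_real (x - al) ~= 0" using x by simp
 \<comment> \<open>Multiplied by x - al, the top term of \<open>F 1\<close> is exactly m times that
   of \<open>F 0\<close>, so the two cancel in \<open>num\<close>.\<close>
 have top: "of_real (x - al) * (c * of_real ((x - al) ^ (m - 1) / fact (m - 1))) = of_nat m * (c * complex_of_real ((x - al) ^ m / fact m))"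
 proof -
  have "(x - al) * ((x - al) ^ (m - 1) / fact (m - 1)) = real m * ((x - al) ^ m / fact m)"
   using assms(2) by (cases m) (simp_all add: divide_simps)
  hence "complex_of_real ((x - al) * ((x - al) ^ (m - 1) / fact (m - 1))) = complex_of_real (real m * ((x - al) ^ m / fact m))"
   by (simp only:)
  thus ?thesis by (simp only: of_real_mult of_real_of_nat_eq mult.left_commute[of _ c])
 qed
 have num: "of_real (x - al) * F 1 x - of_nat m * F 0 x = of_real (x - al) * V1 - of_nat m * V0"
  using top by (simp add: V0_def V1_def algebra_simps)
 have "Im (F 1 x / F 0 x) = Im (F 1 x / F 0 x - of_real (real m / (x - al)))" by simp
 also have "F 1 x / F 0 x - of_real (real m / (x - al)) = (of_real (x - al) * V1 - of_nat m * V0) / (of_real (x - al) * F 0 x)"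
  unfolding num[symmetric] using F0 xa by (simp add: field_simps)
 finally have "\<bar>Im (F 1 x / F 0 x)\<bar> <= cmod ((of_real (x - al) * V1 - of_nat m * V0) / (of_real (x - al) * F 0 x))"
  using abs_Im_le_cmod by metis
 also have "... = cmod (of_real (x - al) * V1 - of_nat m * V0) / (s * cmod (F 0 x))"
  by (simp only: norm_divide norm_mult norm_of_real s_def)
 also have "... <= ((real m + 1) * B) / (s * (s ^ m / (2 * A * fact m)))"
 proof (intro frac_le)
  have "cmod (of_real (x - al) * V1 - of_nat m * V0) <= s * cmod V1 + real m * cmod V0"
   by (rule order_trans[OF norm_triangle_ineq4]) (simp only: norm_mult norm_of_real norm_of_nat s_def order_refl)
  also have "... <= B + real m * B" using V0 V1 by (intro add_mono mult_left_mono) auto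
  finally show "cmod (of_real (x - al) * V1 - of_nat m * V0) <= (real m + 1) * B" by (simp add: algebra_simps)
  have "0 <= B" using V0 norm_ge_zero order_trans by blast
  thus "0 <= (real m + 1) * B" by simp
  show "0 < s * (s ^ m / (2 * A * fact m))" using s pos by (intro mult_pos_pos)
  show "s * (s ^ m / (2 * A * fact m)) <= s * cmod (F 0 x)" using lower s by (intro mult_left_mono) auto
 qed
 also have "... = 2 * A * fact m * (real m + 1) * (real m * 2 ^ m * (D / s\<^sup>2) + A)"
  unfolding B_def using s assms(5) by (simp add: sm field_simps power2_eq_square)
 finally show "\<bar>Im (F 1 x / F 0 x)\<bar> <= 2 * A * fact m * (real m + 1) * (real m * 2 ^ m * (D / (x - al)\<^sup>2) + A)"
  by (simp add: s_def)
qed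

lemma nn_integral_translate_interval:
 fixes g :: "real => ennreal"
 assumes [measurable]: "g : borel_measurable borel"
  and "!!x. x : S ==> x - al : {-1..1}"
 shows "(\<integral>\<^sup>+x\<in>S. g (x - al) \<partial>lborel) <= (\<integral>\<^sup>+s\<in>{-1..1}. g s \<partial>lborel)"
proof -
 have "(\<integral>\<^sup>+x\<in>S. g (x - al) \<partial>lborel) <= (\<integral>\<^sup>+x. g (x - al) * indicator {-1..1} (x - al) \<partial>lborel)"
  using assms(2) by (intro nn_integral_mono) (auto simp: indicator_def)
 also have "... = ennreal \<bar>1\<bar> * (\<integral>\<^sup>+x. g ((al + 1 * x) - al) * indicator {-1..1} ((al + 1 * x) - al) \<partial>lborel)"
  by (rule nn_integral_real_affine) auto
 finally show ?thesis by simp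
qed

text \<open>The pointwise bound consists of a Cauchy kernel, a constant over a set of length at most
  2, and m |ln |x - al||. Each has an integral bounded independently of D, which is why D does not
  occur in the conclusion.\<close>

lemma outer_integral:
 assumes "deriv_chain F" and "m > 0" and "al : {a..b}" and "D \<ge> 0" and "A \<ge> 1"
  and A: "!!x k. x : {a..b} ==> k <= Suc m ==> cmod (F k x) <= A"
  and D: "!!k. k < m ==> cmod (F k al) <= D ^ (m - k)"
  and low: "1 / A <= cmod (F m al)"
  and short: "b - a <= 1 / (4 * A\<^sup>2 * fact m)"
  and S: "S \<subseteq> {a..b}" "S : sets borel" "!!x. x : S ==> x ~= al & 4 * A * fact m * (real m * 2 ^ m) * D <= \<bar>x - al\<bar>"
 shows "(\<integral>\<^sup>+x\<in>S. log_var (F 0 x) (F 1 x) \<partial>lborel)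
  <= ennreal (4 * A * fact m * (real m + 1) * (real m * 2 ^ m) * pi
    + 2 * (2 * A * fact m * (real m + 1) * A + ln A + ln (2 * A * fact m)) + real m * 8)"
proof -
 define K where "K = 2 * A * fact m * (real m + 1)"
 define k1 where "k1 = 2 * K * (real m * 2 ^ m)"
 define k2 where "k2 = K * A + ln A + ln (2 * A * fact m)"
 have Af: "1 <= A * fact m"
  using mult_mono[of 1 A 1 "fact m"] assms(5) by simp
 have K0: "K \<ge> 0" unfolding K_def using assms(5) by simp
 have k1: "k1 \<ge> 0" unfolding k1_def using K0 by simp
 have k2: "k2 \<ge> 0" unfolding k2_def using K0 assms(5) Af by simp
 have "1 / (4 * A\<^sup>2 * fact m) <= 1"
 proof -
  have "1 * 1 <= A * (A * fact m)" using Af assms(5) by (intro mult_mono) auto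
  thus ?thesis by (simp add: divide_simps power2_eq_square mult_ac)
 qed
 hence S1: "x - al : {-1..1}" if "x : S" for x
  using that S(1) assms(3) short by auto
 have pt: "log_var (F 0 x) (F 1 x) <= ennreal (k1 * (D / ((x - al)\<^sup>2 + D\<^sup>2))) + (ennreal k2 + ennreal (real m * \<bar>ln \<bar>x - al\<bar>\<bar>))"
  if "x : S" for x
 proof -
  have x: "x : {a..b}" "x ~= al" using that S by auto
  have near: "\<bar>x - al\<bar> <= 1 / (4 * A\<^sup>2 * fact m)" using x assms(3) short by auto
  have far: "4 * A * fact m * (real m * 2 ^ m) * D <= \<bar>x - al\<bar>" using S(3)[OF that] by simp
  note est = outer_estimate[OF assms(1-5) _ _ low x far near]
  have lo: "\<bar>x - al\<bar> ^ m / (2 * A * fact m) <= cmod (F 0 x)"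
   by (rule est) (use A D in auto)
  have im: "\<bar>Im (F 1 x / F 0 x)\<bar> <= K * (real m * 2 ^ m * (D / (x - al)\<^sup>2) + A)"
   unfolding K_def by (rule est) (use A D in auto)
  have "(1::real) * 1 <= real m * 2 ^ m" using assms(2) by (intro mult_mono) auto
  hence "1 * 1 <= (4 * (A * fact m)) * (real m * 2 ^ m)"
   using Af by (intro mult_mono) auto
  from mult_right_mono[OF this assms(4)] have Ds: "D <= \<bar>x - al\<bar>" using far by (simp add: mult.assoc)
  \<comment> \<open>As D \<le> |x - al|, the singular quotient is at most twice the Cauchy kernel,
    whose integral does not degenerate when D tends to 0.\<close>
  have D2: "D / (x - al)\<^sup>2 <= 2 * (D / ((x - al)\<^sup>2 + D\<^sup>2))"
  proof -
   have "D\<^sup>2 <= (x - al)\<^sup>2" using Ds assms(4) by (metis power2_abs power_mono)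
   hence "D * ((x - al)\<^sup>2 + D\<^sup>2) <= D * (2 * (x - al)\<^sup>2)" using assms(4) by (intro mult_left_mono) auto
   moreover have "(x - al)\<^sup>2 > 0" "(x - al)\<^sup>2 + D\<^sup>2 > 0" using x by (auto intro!: add_pos_nonneg)
   ultimately show ?thesis by (simp add: divide_simps mult_ac)
  qed
  have "\<bar>Im (F 1 x / F 0 x)\<bar> <= K * (real m * 2 ^ m * (2 * (D / ((x - al)\<^sup>2 + D\<^sup>2))) + A)"
   using D2 K0 by (intro order_trans[OF im] mult_left_mono add_mono) auto
  hence im': "\<bar>Im (F 1 x / F 0 x)\<bar> <= k1 * (D / ((x - al)\<^sup>2 + D\<^sup>2)) + K * A"
   by (simp add: k1_def algebra_simps)
  have pos: "0 < \<bar>x - al\<bar> ^ m / (2 * A * fact m)" using x assms(5) by simp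
  hence F0: "cmod (F 0 x) > 0" using lo by linarith
  have "ln (cmod (F 0 x)) <= ln A" using A[OF x(1), of 0] F0 by (intro ln_mono) auto
  moreover have "ln (\<bar>x - al\<bar> ^ m / (2 * A * fact m)) <= ln (cmod (F 0 x))" using pos lo by (intro ln_mono) auto
  moreover have "ln (\<bar>x - al\<bar> ^ m / (2 * A * fact m)) = real m * ln \<bar>x - al\<bar> - ln (2 * A * fact m)"
   using x assms(5) by (subst ln_div) (auto simp: ln_realpow)
  moreover have "real m * \<bar>ln \<bar>x - al\<bar>\<bar> \<ge> - (real m * ln \<bar>x - al\<bar>)"
   by (metis abs_ge_minus_self abs_mult abs_of_nat)
  moreover have "real m * \<bar>ln \<bar>x - al\<bar>\<bar> \<ge> 0" by simp
  moreover have "ln A \<ge> 0" "ln (2 * A * fact m) \<ge> 0" using assms(5) Af by auto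
  ultimately have "\<bar>ln (cmod (F 0 x))\<bar> <= ln A + ln (2 * A * fact m) + real m * \<bar>ln \<bar>x - al\<bar>\<bar>" by linarith
  hence "\<bar>Im (F 1 x / F 0 x)\<bar> + \<bar>ln (cmod (F 0 x))\<bar> <= k1 * (D / ((x - al)\<^sup>2 + D\<^sup>2)) + (k2 + real m * \<bar>ln \<bar>x - al\<bar>\<bar>)"
   using im' unfolding k2_def by linarith
  thus ?thesis
   using F0 k1 k2 assms(4) unfolding log_var_def
   by (simp add: ennreal_plus[symmetric] del: ennreal_plus)
 qed
 have "(\<integral>\<^sup>+x\<in>S. log_var (F 0 x) (F 1 x) \<partial>lborel)
  <= (\<integral>\<^sup>+x. ennreal k1 * (ennreal (D / ((x - al)\<^sup>2 + D\<^sup>2)) * indicator S x) + (ennreal k2 * indicator S x + ennreal (real m) * (ennreal \<bar>ln \<bar>x - al\<bar>\<bar> * indicator S x)) \<partial>lborel)"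
 proof (intro nn_integral_mono)
  fix x
  show "log_var (F 0 x) (F 1 x) * indicator S x <= ennreal k1 * (ennreal (D / ((x - al)\<^sup>2 + D\<^sup>2)) * indicator S x) + (ennreal k2 * indicator S x + ennreal (real m) * (ennreal \<bar>ln \<bar>x - al\<bar>\<bar> * indicator S x))"
   using pt[of x] k1 assms(4) by (cases "x : S") (auto simp: ennreal_mult simp del: times_divide_eq_right)
 qed
 also have "... = ennreal k1 * (\<integral>\<^sup>+x\<in>S. ennreal (D / ((x - al)\<^sup>2 + D\<^sup>2)) \<partial>lborel) + (ennreal k2 * emeasure lborel S + ennreal (real m) * (\<integral>\<^sup>+x\<in>S. ennreal \<bar>ln \<bar>x - al\<bar>\<bar> \<partial>lborel))"
  using S(2) by (simp add: nn_integral_add nn_integral_cmult)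
 also have "... <= ennreal k1 * ennreal pi + (ennreal k2 * ennreal 2 + ennreal (real m) * ennreal 8)"
 proof (intro add_mono mult_left_mono)
  show "(\<integral>\<^sup>+x\<in>S. ennreal (D / ((x - al)\<^sup>2 + D\<^sup>2)) \<partial>lborel) <= ennreal pi"
   using nn_integral_translate_interval[OF _ S1, of "%s. ennreal (D / (s\<^sup>2 + D\<^sup>2))"] nn_integral_cauchy_kernel[OF assms(4)]
   by (auto intro: order_trans)
  show "(\<integral>\<^sup>+x\<in>S. ennreal \<bar>ln \<bar>x - al\<bar>\<bar> \<partial>lborel) <= ennreal 8"
   using nn_integral_translate_interval[OF _ S1, of "%s. ennreal \<bar>ln \<bar>s\<bar>\<bar>"] nn_integral_abs_ln
   by (auto intro: order_trans)
  have "S \<subseteq> {al - 1..al + 1}" using S1 by force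
  hence "emeasure lborel S <= emeasure lborel {al - 1..al + 1}"
   by (intro emeasure_mono) auto
  thus "emeasure lborel S <= ennreal 2" by simp
 qed auto
 also have "... = ennreal (k1 * pi + (k2 * 2 + real m * 8))"
  using k1 k2 by (simp add: ennreal_mult ennreal_plus)
 also have "k1 * pi + (k2 * 2 + real m * 8) = 4 * A * fact m * (real m + 1) * (real m * 2 ^ m) * pi
    + 2 * (2 * A * fact m * (real m + 1) * A + ln A + ln (2 * A * fact m)) + real m * 8"
  by (simp add: k1_def k2_def K_def algebra_simps)
 finally show ?thesis .
qed

text \<open>In the variable u = (x - al) / D, with values divided by D^m, the interval of radius M D
  becomes one of radius M, the derivatives up to order m are bounded independently of D, and the
  hypothesis on L bounds at each point some derivative of order below m from below. The expression
  Im (F'/F) dx is invariant under this rescaling; the logarithm changes by m ln D, which the factor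
  D in dx = D du absorbs.\<close>

lemma inner_integral:
 assumes F: "deriv_chain F" and m: "m > 0" and al: "al : {a..b}" and "D > 0" and "A \<ge> 1" and "M > 0"
  and D0: "D <= D0"
  and A: "!!x. x : {a..b} ==> cmod (F m x) <= A"
  and D: "!!k. k < m ==> cmod (F k al) <= D ^ (m - k)"
  and L: "0 < L" "!!x. x : {a..b} ==> \<exists>k<m. L * D ^ (m - k) <= cmod (F k x)"
  and A'_def: "A' = A * (1 + M) ^ m" and A''_def: "A'' = max A' (2 / L)"
  and IH: "!!G k c d. deriv_chain G ==> k < m ==> c <= d ==> d - c <= A'' ==>
    (\<forall>i\<le>Suc k. \<forall>x\<in>{c..d}. cmod (G i x) <= A'') ==> (\<forall>x\<in>{c..d}. 1 / A'' <= cmod (G k x)) ==>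
    (\<integral>\<^sup>+x\<in>{c..d}. log_var (G 0 x) (G 1 x) \<partial>lborel) <= ennreal C"
  and C: "C \<ge> 0"
 shows "(\<integral>\<^sup>+x\<in>{max a (al - M * D)..min b (al + M * D)}. log_var (F 0 x) (F 1 x) \<partial>lborel)
  <= ennreal (max 1 D0 * (C * (2 * M / (L / (2 * A')) + 1)) + real m * (D0\<^sup>2 + 1) * (2 * M))"
proof -
 define G where "G k u = (D ^ k / D ^ m) *\<^sub>R F k (al + D * u)" for k u
 define l where "l = max (- M) ((a - al) / D)"
 define r where "r = min M ((b - al) / D)"
 \<comment> \<open>The derivatives of G up to order m are at most A', so one of order below m that
   is at least L at the left end of an interval of length \<eta> stays at least L / 2 on it.\<close>
 define \<eta> where "\<eta> = L / (2 * A')"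
 have lr: "l <= 0" "0 <= r" using al \<open>M > 0\<close> \<open>D > 0\<close> by (auto simp: l_def r_def min_def max_def field_simps)
 have lrM: "-M <= l" "r <= M" by (auto simp: l_def r_def)
 have in_ab: "al + D * u : {a..b}" if "u : {l..r}" for u
 proof -
  have "(a - al) / D <= u" "u <= (b - al) / D" using that by (auto simp: l_def r_def)
  thus ?thesis using \<open>D > 0\<close> by (auto simp: field_simps)
 qed
 have conv: "al + D * u : {max a (al - M * D)..min b (al + M * D)} \<longleftrightarrow> u : {l..r}" for u
 proof -
  have "a <= al + D * u \<longleftrightarrow> (a - al) / D <= u" "al - M * D <= al + D * u \<longleftrightarrow> - M <= u"
   "al + D * u <= b \<longleftrightarrow> u <= (b - al) / D" "al + D * u <= al + M * D \<longleftrightarrow> u <= M"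
   using \<open>D > 0\<close> mult_le_cancel_left_pos[of D "-M" u] mult_le_cancel_left_pos[of D u M]
   by (auto simp: field_simps)
  thus ?thesis by (auto simp: l_def r_def)
 qed
 have chG: "deriv_chain G"
  unfolding deriv_chain_def
 proof (intro allI)
  fix k s
  have "((%u. al + D * u) has_vector_derivative D) (at s)"
   by (auto intro!: derivative_eq_intros)
  moreover have "(F k has_vector_derivative F (Suc k) (al + D * s)) (at (al + D * s))"
   using F unfolding deriv_chain_def by blast
  ultimately have "((F k \<circ> (%u. al + D * u)) has_vector_derivative D *\<^sub>R F (Suc k) (al + D * s)) (at s)"
   by (intro vector_diff_chain_at)
  from has_vector_derivative_scaleR[OF DERIV_const this, of "D ^ k / D ^ m"]
  have "((%u. (D ^ k / D ^ m) *\<^sub>R F k (al + D * u)) has_vector_derivative (D ^ k / D ^ m) *\<^sub>R (D *\<^sub>R F (Suc k) (al + D * s))) (at s)"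
   by (simp add: o_def)
  thus "(G k has_vector_derivative G (Suc k) s) (at s)"
   by (simp add: G_def[abs_def] o_def mult.commute)
 qed
 have A1: "A' \<ge> 1" unfolding A'_def
  using mult_mono[of 1 A 1 "(1 + M) ^ m"] \<open>A \<ge> 1\<close> \<open>M > 0\<close> by (simp add: one_le_power)
 have Gb: "cmod (G (m - i) u) <= A * (1 + M) ^ i" if "i <= m" "u : {l..r}" for i u
  using that
 proof (induction i arbitrary: u)
  case 0
  thus ?case using A[OF in_ab] \<open>D > 0\<close> by (simp add: G_def)
 next
  case (Suc i)
  have seg: "closed_segment 0 u \<subseteq> {l..r}" using Suc(3) lr by (auto simp: closed_segment_eq_real_ivl)
  have mi: "m - i = Suc (m - Suc i)" using Suc by simp
  have "norm (G (m - Suc i) u - G (m - Suc i) 0) <= (A * (1 + M) ^ i) * \<bar>u - 0\<bar>"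
  proof (rule vector_derivative_bound[of _ _ _ "G (m - i)"])
   fix y assume "y : closed_segment 0 u"
   thus "cmod (G (m - i) y) <= A * (1 + M) ^ i" using Suc seg by auto
   show "(G (m - Suc i) has_vector_derivative G (m - i) y) (at y)"
    using chG unfolding deriv_chain_def mi by blast
  qed
  also have "... <= (A * (1 + M) ^ i) * M"
   using Suc(3) lrM \<open>A \<ge> 1\<close> \<open>M > 0\<close> by (intro mult_left_mono) auto
  finally have 1: "norm (G (m - Suc i) u - G (m - Suc i) 0) <= (A * (1 + M) ^ i) * M" .
  have "cmod (G (m - Suc i) 0) = D ^ (m - Suc i) / D ^ m * cmod (F (m - Suc i) al)"
   using \<open>D > 0\<close> by (simp add: G_def)
  also have "... <= D ^ (m - Suc i) / D ^ m * D ^ Suc i"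
   using D[of "m - Suc i"] Suc(2) \<open>D > 0\<close> by (intro mult_left_mono) auto
  also have "... = 1" using Suc(2) \<open>D > 0\<close> by (simp add: power_add[symmetric] del: power_Suc)
  finally have 2: "cmod (G (m - Suc i) 0) <= 1" .
  have "1 <= A * (1 + M) ^ i"
   using mult_mono[of 1 A 1 "(1 + M) ^ i"] \<open>A \<ge> 1\<close> \<open>M > 0\<close> by (simp add: one_le_power)
  with 1 2 show ?case
   using norm_triangle_ineq2[of "G (m - Suc i) u" "G (m - Suc i) 0"] by (simp add: algebra_simps)
 qed
 have Gb': "cmod (G k u) <= A'" if "k <= m" "u : {l..r}" for k u
 proof -
  have "cmod (G (m - (m - k)) u) <= A * (1 + M) ^ (m - k)" using that by (intro Gb) auto
  also have "... <= A'" unfolding A'_def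
   using \<open>A \<ge> 1\<close> \<open>M > 0\<close> by (intro mult_left_mono power_increasing) auto
  finally show ?thesis using that by simp
 qed
 have Glow: "\<exists>k<m. L <= cmod (G k u)" if u: "u : {l..r}" for u
 proof -
  obtain k where k: "k < m" "L * D ^ (m - k) <= cmod (F k (al + D * u))" using L(2)[OF in_ab[OF u]] by blast
  have "D ^ m = D ^ k * D ^ (m - k)" using k by (simp add: power_add[symmetric])
  hence "cmod (G k u) = cmod (F k (al + D * u)) / D ^ (m - k)"
   using \<open>D > 0\<close> by (simp add: G_def)
  thus ?thesis using k \<open>D > 0\<close> by (intro exI[of _ k]) (simp add: pos_le_divide_eq)
 qed
 have eta: "\<eta> > 0" using L A1 by (simp add: \<eta>_def)
 have short: "(\<integral>\<^sup>+x\<in>{c..d}. log_var (G 0 x) (G 1 x) \<partial>lborel) <= ennreal C"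
  if cd: "l <= c" "c <= d" "d <= r" "d - c <= \<eta>" for c d
 proof -
  obtain k where k: "k < m" "L <= cmod (G k c)" using Glow[of c] cd by auto
  \<comment> \<open>The induction hypothesis has a single constant for upper and lower bounds: A''
    exceeds A', and 1 / A'' \<le> L / 2.\<close>
  have AL: "A'' \<ge> A'" "A'' \<ge> 2 / L" by (auto simp: A''_def)
  show ?thesis
  proof (rule IH[OF chG k(1)])
   show "\<forall>i\<le>Suc k. \<forall>x\<in>{c..d}. cmod (G i x) <= A''"
    using Gb' AL k cd by (meson Suc_leI atLeastAtMost_iff le_trans order_trans)
   have L1: "L <= A'" using k Gb'[of k c] cd by auto
   have "\<eta> <= 1" using L1 A1 by (simp add: \<eta>_def divide_simps)
   thus "d - c <= A''" using cd AL A1 by linarith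
   show "\<forall>x\<in>{c..d}. 1 / A'' <= cmod (G k x)"
   proof
    fix x assume x: "x : {c..d}"
    have "norm (G k x - G k c) <= A' * \<bar>x - c\<bar>"
     using chG x cd k unfolding deriv_chain_def
     by (intro vector_derivative_bound[of _ _ _ "G (Suc k)"] Gb') (auto simp: closed_segment_eq_real_ivl)
    also have "... <= A' * \<eta>" using x cd A1 by (intro mult_left_mono) auto
    also have "... = L / 2" using A1 by (simp add: \<eta>_def)
    finally have "L / 2 <= cmod (G k x)" using k norm_triangle_ineq2[of "G k c" "G k x"]
     by (simp add: norm_minus_commute)
    moreover have "A'' > 0" using AL A1 by linarith
    hence "1 / A'' <= L / 2" using AL L by (simp add: field_simps)
    ultimately show "1 / A'' <= cmod (G k x)" by linarith
   qed
  qed (use cd in auto)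
 qed
 have measF [measurable]: "F k : borel_measurable borel" for k using F by (rule deriv_chain_measurable)
 have measG [measurable]: "G k : borel_measurable borel" for k using chG by (rule deriv_chain_measurable)
 have "(\<integral>\<^sup>+x\<in>{l..r}. log_var (G 0 x) (G 1 x) \<partial>lborel) <= ennreal (C * ((r - l) / \<eta> + 1))"
  using eta C lr short by (intro set_nn_integral_subdivide) auto
 also have "... <= ennreal (C * (2 * M / \<eta> + 1))"
  using eta C lrM by (intro ennreal_leI mult_left_mono add_mono divide_right_mono) auto
 finally have intG: "(\<integral>\<^sup>+x\<in>{l..r}. log_var (G 0 x) (G 1 x) \<partial>lborel) <= ennreal (C * (2 * M / \<eta> + 1))" .
 define k2 where "k2 = real m * (D0\<^sup>2 + 1)"
 have pt: "ennreal D * log_var (F 0 (al + D * u)) (F 1 (al + D * u)) <= ennreal (max 1 D0) * log_var (G 0 u) (G 1 u) + ennreal k2" for u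
 proof (cases "F 0 (al + D * u) = 0")
  case True
  hence "log_var (G 0 u) (G 1 u) = \<infinity>" by (simp add: log_var_def G_def)
  moreover have "ennreal (max 1 D0) ~= 0" by (simp add: ennreal_eq_0_iff max_def)
  ultimately show ?thesis by (simp add: ennreal_mult_top)
 next
  case False
  let ?F = "%k. F k (al + D * u)"
  have G0: "G 0 u ~= 0" using False \<open>D > 0\<close> by (simp add: G_def)
  have q: "G 1 u / G 0 u = of_real D * (?F 1 / ?F 0)"
   using \<open>D > 0\<close> False by (simp add: G_def scaleR_conv_of_real)
  have im: "D * \<bar>Im (?F 1 / ?F 0)\<bar> = \<bar>Im (G 1 u / G 0 u)\<bar>"
   unfolding q using \<open>D > 0\<close> by (simp add: abs_mult del: times_divide_eq_right)
  have "cmod (G 0 u) = cmod (?F 0) / D ^ m" using \<open>D > 0\<close> by (simp add: G_def)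
  hence lnG: "ln (cmod (?F 0)) = ln (cmod (G 0 u)) + real m * ln D"
   using False \<open>D > 0\<close> by (simp add: ln_div ln_realpow)
  \<comment> \<open>Only the boundedness of D |ln D| for D \<le> D0 matters, so a crude bound
    without case distinction on the size of D is enough.\<close>
  have "\<bar>ln D\<bar> <= D + 1 / D"
  proof -
   have "ln (1 / D) <= 1 / D - 1" "ln D <= D - 1" using \<open>D > 0\<close> by (auto intro!: ln_le_minus_one)
   moreover have "ln (1 / D) = - ln D" using \<open>D > 0\<close> by (simp add: ln_div)
   moreover have "1 / D > 0" using \<open>D > 0\<close> by simp
   ultimately show ?thesis using \<open>D > 0\<close> by linarith
  qed
  hence "D * \<bar>ln D\<bar> <= D * (D + 1 / D)" using \<open>D > 0\<close> by (intro mult_left_mono) auto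
  also have "... = D\<^sup>2 + 1" using \<open>D > 0\<close> by (simp add: field_simps power2_eq_square)
  also have "... <= D0\<^sup>2 + 1" using D0 \<open>D > 0\<close> by (simp add: power_mono)
  finally have "real m * (D * \<bar>ln D\<bar>) <= k2" unfolding k2_def by (intro mult_left_mono) auto
  moreover have "\<bar>ln (cmod (?F 0))\<bar> <= \<bar>ln (cmod (G 0 u))\<bar> + real m * \<bar>ln D\<bar>"
   unfolding lnG by (rule order_trans[OF abs_triangle_ineq]) (simp add: abs_mult)
  hence "D * \<bar>ln (cmod (?F 0))\<bar> <= D * (\<bar>ln (cmod (G 0 u))\<bar> + real m * \<bar>ln D\<bar>)"
   using \<open>D > 0\<close> by (intro mult_left_mono) auto
  ultimately have "D * \<bar>ln (cmod (?F 0))\<bar> <= D * \<bar>ln (cmod (G 0 u))\<bar> + k2" by (simp add: algebra_simps)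
  moreover have "D * \<bar>ln (cmod (G 0 u))\<bar> <= max 1 D0 * \<bar>ln (cmod (G 0 u))\<bar>"
   using D0 by (intro mult_right_mono) auto
  moreover have "1 * \<bar>Im (G 1 u / G 0 u)\<bar> <= max 1 D0 * \<bar>Im (G 1 u / G 0 u)\<bar>" by (intro mult_right_mono) auto
  ultimately have "D * (\<bar>Im (?F 1 / ?F 0)\<bar> + \<bar>ln (cmod (?F 0))\<bar>)
   <= max 1 D0 * (\<bar>Im (G 1 u / G 0 u)\<bar> + \<bar>ln (cmod (G 0 u))\<bar>) + k2"
   using im by (simp add: algebra_simps)
  thus ?thesis using False G0 \<open>D > 0\<close>
   by (simp add: log_var_def ennreal_mult'[symmetric] ennreal_plus[symmetric] k2_def del: ennreal_plus)
 qed
 let ?S = "{max a (al - M * D)..min b (al + M * D)}"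
 have "(\<integral>\<^sup>+x\<in>?S. log_var (F 0 x) (F 1 x) \<partial>lborel)
  = ennreal \<bar>D\<bar> * (\<integral>\<^sup>+u. log_var (F 0 (al + D * u)) (F 1 (al + D * u)) * indicator ?S (al + D * u) \<partial>lborel)"
  using \<open>D > 0\<close> by (intro nn_integral_real_affine) auto
 also have "... = (\<integral>\<^sup>+u. ennreal D * (log_var (F 0 (al + D * u)) (F 1 (al + D * u)) * indicator ?S (al + D * u)) \<partial>lborel)"
  using \<open>D > 0\<close> by (subst nn_integral_cmult) auto
 also have "... <= (\<integral>\<^sup>+u. ennreal (max 1 D0) * (log_var (G 0 u) (G 1 u) * indicator {l..r} u) + ennreal k2 * indicator {l..r} u \<partial>lborel)"
 proof (intro nn_integral_mono)
  fix u
  have ind: "indicator ?S (al + D * u) = (indicator {l..r} u :: ennreal)" unfolding indicator_def conv ..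
  show "ennreal D * (log_var (F 0 (al + D * u)) (F 1 (al + D * u)) * indicator ?S (al + D * u))
   <= ennreal (max 1 D0) * (log_var (G 0 u) (G 1 u) * indicator {l..r} u) + ennreal k2 * indicator {l..r} u"
   unfolding ind using pt[of u] by (auto simp: indicator_def)
 qed
 also have "... = ennreal (max 1 D0) * (\<integral>\<^sup>+u\<in>{l..r}. log_var (G 0 u) (G 1 u) \<partial>lborel) + ennreal k2 * emeasure lborel {l..r}"
  by (simp add: nn_integral_add nn_integral_cmult)
 also have "... <= ennreal (max 1 D0) * ennreal (C * (2 * M / \<eta> + 1)) + ennreal k2 * ennreal (2 * M)"
 proof (intro add_mono mult_left_mono intG)
  show "emeasure lborel {l..r} <= ennreal (2 * M)" using lr lrM by (auto intro!: ennreal_leI)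
 qed auto
 also have "... = ennreal (max 1 D0 * (C * (2 * M / \<eta> + 1)) + k2 * (2 * M))"
  using C \<open>M > 0\<close> eta by (simp add: ennreal_mult'[symmetric] ennreal_plus[symmetric] k2_def del: ennreal_plus)
 finally show ?thesis by (simp add: \<eta>_def k2_def)
qed

text \<open>Strong induction on m. One number A has all quantitative roles, so that the induction
  hypothesis can be used with a single changed constant: it bounds the length of the interval and
  the derivatives, and 1 / A bounds the m-th derivative from below. Order m + 1 enters through the
  Taylor remainder.\<close>

theorem finite_type_integral_bound:
 "\<exists>C\<ge>0. \<forall>F a b. deriv_chain F --> a <= b --> b - a <= A -->
   (\<forall>k\<le>Suc m. \<forall>x\<in>{a..b}. cmod (F k x) <= A) --> (\<forall>x\<in>{a..b}. 1 / A <= cmod (F m x)) -->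
   (\<integral>\<^sup>+x\<in>{a..b}. log_var (F 0 x) (F 1 x) \<partial>lborel) <= ennreal C"
proof (induction m arbitrary: A rule: less_induct)
 case (less m)
 show ?case
 proof (cases "A \<ge> 1")
  case False
  \<comment> \<open>For 0 < A < 1 the bounds A and 1 / A contradict each other; for A \<le> 0 the
    length bound leaves a single point.\<close>
  have point: "a = b" if "a <= b" "b - a <= A" "cmod z <= A" "1 / A <= cmod z" for a b and z :: complex
  proof (rule ccontr)
   assume "a ~= b"
   hence A: "A > 0" "A < 1" using that False by auto
   hence "1 < 1 / A" by simp
   thus False using that A by linarith
  qed
  have "(\<integral>\<^sup>+x\<in>{a..b}. log_var (F 0 x) (F 1 x) \<partial>lborel) = 0"
   if H: "a <= b" "b - a <= A" "\<forall>k\<le>Suc m. \<forall>x\<in>{a..b}. cmod (F k x) <= A" "\<forall>x\<in>{a..b}. 1 / A <= cmod (F m x)"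
   for F :: "nat => real => complex" and a b
  proof -
   have "cmod (F m a) <= A" "1 / A <= cmod (F m a)" using H by auto
   hence "b = a" using point[OF H(1,2)] by metis
   thus ?thesis by (subst nn_integral_null_set) auto
  qed
  thus ?thesis by (intro exI[of _ 0]) auto
 next
  case A1: True
  show ?thesis
  proof (cases "m = 0")
   case True
   define c where "c = A * A + ln A"
   have c: "c \<ge> 0" using A1 by (simp add: c_def)
   have "(\<integral>\<^sup>+x\<in>{a..b}. log_var (F 0 x) (F 1 x) \<partial>lborel) <= ennreal (c * A)"
    if H: "deriv_chain F" "a <= b" "b - a <= A" "\<forall>k\<le>Suc m. \<forall>x\<in>{a..b}. cmod (F k x) <= A" "\<forall>x\<in>{a..b}. 1 / A <= cmod (F m x)" for F a b
   proof -
    have "(\<integral>\<^sup>+x\<in>{a..b}. log_var (F 0 x) (F 1 x) \<partial>lborel) <= (\<integral>\<^sup>+x. ennreal c * indicator {a..b} x \<partial>lborel)"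
    proof (intro nn_integral_mono)
     fix x
     have "log_var (F 0 x) (F 1 x) <= ennreal c" if x: "x : {a..b}"
     proof -
      have f: "1 / A <= cmod (F 0 x)" "cmod (F 0 x) <= A" "cmod (F 1 x) <= A" using H(4,5) x True by auto
      have p: "0 < 1 / A" using A1 by simp
      have "\<bar>Im (F 1 x / F 0 x)\<bar> <= cmod (F 1 x) / cmod (F 0 x)"
      by (metis abs_Im_le_cmod norm_divide)
      also have "... <= A / (1 / A)" using f p A1 by (intro frac_le) auto
      finally have 1: "\<bar>Im (F 1 x / F 0 x)\<bar> <= A * A" by simp
      have "ln (cmod (F 0 x)) <= ln A" "ln (1 / A) <= ln (cmod (F 0 x))"
      using f p A1 by (auto intro!: ln_mono simp del: ln_le_cancel_iff)
      hence "\<bar>ln (cmod (F 0 x))\<bar> <= ln A" using A1 by (simp add: ln_div)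
      thus ?thesis using 1 f p unfolding log_var_def c_def by (auto intro!: ennreal_leI simp del: ennreal_plus)
     qed
     thus "log_var (F 0 x) (F 1 x) * indicator {a..b} x <= ennreal c * indicator {a..b} x"
      by (auto simp: indicator_def)
    qed
    also have "... = ennreal c * ennreal (b - a)" using H by (simp add: nn_integral_cmult)
    also have "... <= ennreal c * ennreal A" using H by (intro mult_left_mono ennreal_leI) auto
    finally show ?thesis using c A1 by (simp add: ennreal_mult)
   qed
   thus ?thesis using c A1 by (intro exI[of _ "c * A"]) auto
  next
   case False
   hence m: "m > 0" by simp
   \<comment> \<open>M D is the distance from \<open>al\<close> at which the hypothesis
     \<open>far\<close> of \<open>outer_estimate\<close> starts to hold.\<close>
   define M where "M = 4 * A * fact m * (real m * 2 ^ m)"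
   have M: "M > 0" using A1 m by (simp add: M_def)
   \<comment> \<open>One of the m summands of \<open>dd x\<close>, which is at least D, is at least
     D / m. Raised to the power m - k this gives the factor (1 / m)^(m - k), and (1 / m)^m is below
     all of them.\<close>
   define L where "L = (1 / real m) ^ m"
   have L: "L > 0" using m by (simp add: L_def)
   define A' where "A' = A * (1 + M) ^ m"
   define A'' where "A'' = max A' (2 / L)"
   \<comment> \<open>An a priori bound for D: each of the m roots is at most A because A \<ge>
     1.\<close>
   define D0 where "D0 = real m * A"
   define P where "P k C \<longleftrightarrow> C \<ge> 0 & (\<forall>F a b. deriv_chain F --> a <= b --> b - a <= A'' -->
     (\<forall>i\<le>Suc k. \<forall>x\<in>{a..b}. cmod (F i x) <= A'') --> (\<forall>x\<in>{a..b}. 1 / A'' <= cmod (F k x)) -->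
     (\<integral>\<^sup>+x\<in>{a..b}. log_var (F 0 x) (F 1 x) \<partial>lborel) <= ennreal C)" for k and C :: real
   have "\<forall>k. \<exists>C. k < m --> P k C" using less.IH[of _ A''] unfolding P_def by blast
   then obtain Cf where "\<forall>k. k < m --> P k (Cf k)" using choice[of "%k C. k < m --> P k C"] by blast
   hence Cf: "Cf k \<ge> 0"
    "deriv_chain F ==> a <= b ==> b - a <= A'' ==>
     (\<forall>i\<le>Suc k. \<forall>x\<in>{a..b}. cmod (F i x) <= A'') ==> (\<forall>x\<in>{a..b}. 1 / A'' <= cmod (F k x)) ==>
     (\<integral>\<^sup>+x\<in>{a..b}. log_var (F 0 x) (F 1 x) \<partial>lborel) <= ennreal (Cf k)"
    if "k < m" for k F a b
    using that unfolding P_def by blast+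
   define C where "C = (\<Sum>k<m. Cf k)"
   have C: "C \<ge> 0" unfolding C_def using Cf(1) by (intro sum_nonneg) auto
   have CfC: "Cf k <= C" if "k < m" for k unfolding C_def
    using Cf(1) that by (intro member_le_sum) auto
   define Co where "Co = 4 * A * fact m * (real m + 1) * (real m * 2 ^ m) * pi
    + 2 * (2 * A * fact m * (real m + 1) * A + ln A + ln (2 * A * fact m)) + real m * 8"
   define Ci where "Ci = max 1 D0 * (C * (2 * M / (L / (2 * A')) + 1)) + real m * (D0\<^sup>2 + 1) * (2 * M)"
   \<comment> \<open>On an interval of this length the hypothesis \<open>near\<close> of
     \<open>outer_estimate\<close> holds whatever the base point.\<close>
   define de where "de = 1 / (4 * A\<^sup>2 * fact m)"
   have de: "de > 0" using A1 by (simp add: de_def)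
   have Af: "1 <= A * fact m" using mult_mono[of 1 A 1 "fact m"] A1 by simp
   have Co: "Co \<ge> 0" unfolding Co_def using A1 Af by (intro add_nonneg_nonneg mult_nonneg_nonneg) auto
   have Ci: "Ci \<ge> 0" unfolding Ci_def A'_def using A1 C M L by (intro add_nonneg_nonneg mult_nonneg_nonneg) auto
   have short: "(\<integral>\<^sup>+x\<in>{a..b}. log_var (F 0 x) (F 1 x) \<partial>lborel) <= ennreal (Co + Ci)"
    if H: "deriv_chain F" "a <= b" "b - a <= de" "\<forall>k\<le>Suc m. \<forall>x\<in>{a..b}. cmod (F k x) <= A" "\<forall>x\<in>{a..b}. 1 / A <= cmod (F m x)" for F a b
   proof -
    have measF [measurable]: "F k : borel_measurable borel" for k using H(1) by (rule deriv_chain_measurable)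
    \<comment> \<open>Each summand scales like a length and measures the derivative of order k
      against the m-th. Minimality at \<open>al\<close> gives the upper bounds \<open>Dk\<close>
      there and at the same time the lower bounds \<open>Lk\<close> at every other point with the
      same D; the outer and the inner estimate need both.\<close>
    define dd where "dd x = (\<Sum>k<m. root (m - k) (cmod (F k x)))" for x
    have "continuous_on {a..b} dd" unfolding dd_def
     using deriv_chain_continuous[OF H(1)] by (intro continuous_intros) auto
    then obtain al where al: "al : {a..b}" "!!x. x : {a..b} ==> dd al <= dd x"
     using continuous_attains_inf[of "{a..b}" dd] H(2) by auto
    define D where "D = dd al"
    have D0: "D \<ge> 0" unfolding D_def dd_def by (intro sum_nonneg) auto
    have Dk: "cmod (F k al) <= D ^ (m - k)" if "k < m" for k
    proof -
     have "root (m - k) (cmod (F k al)) <= D" unfolding D_def dd_def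
      using that by (intro member_le_sum) auto
     hence "root (m - k) (cmod (F k al)) ^ (m - k) <= D ^ (m - k)" using that by (intro power_mono) auto
     thus ?thesis using that by simp
    qed
    have DD0: "D <= D0"
    proof -
     have "root (m - k) (cmod (F k al)) <= A" if "k < m" for k
     proof -
      have "A ^ 1 <= A ^ (m - k)" using that A1 by (intro power_increasing) auto
      moreover have "cmod (F k al) <= A" using H(4) al that by auto
      ultimately have "root (m - k) (cmod (F k al)) <= root (m - k) (A ^ (m - k))"
      using that by (subst real_root_le_iff) auto
      thus ?thesis using that A1 by (simp add: real_root_power_cancel)
     qed
     hence "D <= (\<Sum>k<m. A)" unfolding D_def dd_def by (intro sum_mono) auto
     thus ?thesis by (simp add: D0_def)
    qed
    have Lk: "\<exists>k<m. L * D ^ (m - k) <= cmod (F k x)" if x: "x : {a..b}" for x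
    proof -
     have "\<exists>k<m. D / real m <= root (m - k) (cmod (F k x))"
     proof (rule ccontr)
      assume "\<not> ?thesis"
      hence "dd x < (\<Sum>k<m. D / real m)" unfolding dd_def
      using m by (intro sum_strict_mono) auto
      thus False using al(2)[OF x] m by (simp add: D_def)
     qed
     then obtain k where k: "k < m" "D / real m <= root (m - k) (cmod (F k x))" by blast
     hence "(D / real m) ^ (m - k) <= root (m - k) (cmod (F k x)) ^ (m - k)"
      using D0 by (intro power_mono) auto
     hence "(D / real m) ^ (m - k) <= cmod (F k x)" using k by simp
     moreover have "L * D ^ (m - k) <= (1 / real m) ^ (m - k) * D ^ (m - k)"
      unfolding L_def using m D0 by (intro mult_right_mono power_decreasing) auto
     ultimately have "L * D ^ (m - k) <= cmod (F k x)" by (simp add: power_mult_distrib[symmetric])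
     thus ?thesis using k by blast
    qed
    let ?I = "{max a (al - M * D)..min b (al + M * D)}"
    let ?g = "%x. log_var (F 0 x) (F 1 x)"
    have inner: "(\<integral>\<^sup>+x\<in>?I. ?g x \<partial>lborel) <= ennreal Ci"
    proof (cases "D = 0")
     \<comment> \<open>Here \<open>al\<close> is a zero of exact order m, and the inner interval
       shrinks to this one point.\<close>
     case True
     hence "?I = {al}" using al by auto
     hence "(\<integral>\<^sup>+x\<in>?I. ?g x \<partial>lborel) = 0"
      by (subst nn_integral_null_set) auto
     thus ?thesis by simp
    next
     case False
     hence "D > 0" using D0 by simp
     show ?thesis unfolding Ci_def
     proof (rule inner_integral[OF H(1) m al(1) \<open>D > 0\<close> A1 M DD0 _ Dk L Lk A'_def A''_def _ C])
      fix G k c d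
      assume G: "deriv_chain G" "k < m" "c <= d" "d - c <= A''" "\<forall>i\<le>Suc k. \<forall>x\<in>{c..d}. cmod (G i x) <= A''" "\<forall>x\<in>{c..d}. 1 / A'' <= cmod (G k x)"
      hence "(\<integral>\<^sup>+x\<in>{c..d}. log_var (G 0 x) (G 1 x) \<partial>lborel) <= ennreal (Cf k)" by (intro Cf)
      also have "... <= ennreal C" using CfC G by (intro ennreal_leI) auto
      finally show "(\<integral>\<^sup>+x\<in>{c..d}. log_var (G 0 x) (G 1 x) \<partial>lborel) <= ennreal C" .
     qed (use H(4) in auto)
    qed
    let ?S = "{a..b} - ?I"
    have "(\<integral>\<^sup>+x\<in>?S. ?g x \<partial>lborel) <= ennreal Co"
     unfolding Co_def
    proof (rule outer_integral[OF H(1) m al(1) D0 A1 _ Dk])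
     show "b - a <= 1 / (4 * A\<^sup>2 * fact m)" using H(3) by (simp add: de_def)
     fix x assume "x : ?S"
     hence "M * D <= \<bar>x - al\<bar> & x ~= al" using M D0 by auto
     thus "x ~= al & 4 * A * fact m * (real m * 2 ^ m) * D <= \<bar>x - al\<bar>" by (simp add: M_def)
    qed (use H al in auto)
    hence "(\<integral>\<^sup>+x\<in>?S. ?g x \<partial>lborel) + (\<integral>\<^sup>+x\<in>?I. ?g x \<partial>lborel) <= ennreal Co + ennreal Ci"
     using inner by (intro add_mono)
    moreover have "(\<integral>\<^sup>+x\<in>{a..b}. ?g x \<partial>lborel) <= (\<integral>\<^sup>+x\<in>?S. ?g x \<partial>lborel) + (\<integral>\<^sup>+x\<in>?I. ?g x \<partial>lborel)"
     by (rule set_nn_integral_split_le) auto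
    ultimately show ?thesis using Co Ci by (simp add: ennreal_plus)
   qed
   have "(\<integral>\<^sup>+x\<in>{a..b}. log_var (F 0 x) (F 1 x) \<partial>lborel) <= ennreal ((Co + Ci) * (A / de + 1))"
    if H: "deriv_chain F" "a <= b" "b - a <= A" "\<forall>k\<le>Suc m. \<forall>x\<in>{a..b}. cmod (F k x) <= A" "\<forall>x\<in>{a..b}. 1 / A <= cmod (F m x)" for F a b
   proof -
    have [measurable]: "F k : borel_measurable borel" for k using H(1) by (rule deriv_chain_measurable)
    have "(\<integral>\<^sup>+x\<in>{a..b}. log_var (F 0 x) (F 1 x) \<partial>lborel) <= ennreal ((Co + Ci) * ((b - a) / de + 1))"
     using de Co Ci H by (intro set_nn_integral_subdivide short) auto
    also have "... <= ennreal ((Co + Ci) * (A / de + 1))"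
     using de Co Ci H by (intro ennreal_leI mult_left_mono add_mono divide_right_mono) auto
    finally show ?thesis .
   qed
   thus ?thesis using de Co Ci A1 by (intro exI[of _ "(Co + Ci) * (A / de + 1)"]) auto
  qed
 qed
qed

section \<open>Calculus of smooth maps\<close>

lemma iter_deriv_append: "iter_deriv (vs @ [v]) F = iter_deriv vs (%x. frechet_derivative F (at x) v)"
 by (induction vs) auto

lemma differentiable_cong_open:
 assumes "open U" "x : U" "!!y. y : U ==> F y = G y" "F differentiable (at x)"
 shows "G differentiable (at x)" "frechet_derivative F (at x) = frechet_derivative G (at x)"
proof -
 have F: "(F has_derivative frechet_derivative F (at x)) (at x)"
  using assms(4) by (simp add: frechet_derivative_works)
 have "(G has_derivative frechet_derivative F (at x)) (at x)"
  using has_derivative_transform_within_open[OF F assms(1,2,3)] .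
 thus "G differentiable (at x)" "frechet_derivative F (at x) = frechet_derivative G (at x)"
  using frechet_derivative_at differentiable_def by blast+
qed

lemma frechet_derivative_cong_open:
 assumes "open U" "x : U" "!!y. y : U ==> F y = G y"
 shows "frechet_derivative F (at x) = frechet_derivative G (at x)"
proof -
 have "(F has_derivative D) (at x) \<longleftrightarrow> (G has_derivative D) (at x)" for D
  using has_derivative_transform_within_open[of F D x UNIV U G] has_derivative_transform_within_open[of G D x UNIV U F] assms
  by auto
 thus ?thesis unfolding frechet_derivative_def by simp
qed

lemma iter_deriv_cong_open:
 assumes "open U" "!!y. y : U ==> F y = G y" "x : U"
 shows "iter_deriv vs F x = iter_deriv vs G x"
 using assms(3)
proof (induction vs arbitrary: x)
 case (Cons v vs)
 thus ?case using frechet_derivative_cong_open[OF assms(1), of x "iter_deriv vs F" "iter_deriv vs G"] by simp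
qed (use assms(2) in auto)

text \<open>Smoothness concerns all orders at once, but closure properties need induction on a
  finite order: the derivative of a product or of a composite contains the original maps again, with
  one order of differentiability fewer available.\<close>

definition diff_up_to :: "nat => 'a::real_normed_vector set => ('a => 'b::real_normed_vector) => bool" where
 "diff_up_to k U F \<longleftrightarrow> (\<forall>vs. length vs <= k --> (\<forall>x\<in>U. iter_deriv vs F differentiable (at x)))"

lemma smooth_open_iff: "smooth_open U F \<longleftrightarrow> open U & (\<forall>k. diff_up_to k U F)"
 unfolding smooth_open_def diff_up_to_def by auto

lemma diff_up_to_mono: "diff_up_to k U F ==> l <= k ==> diff_up_to l U F"
 unfolding diff_up_to_def by auto

lemma diff_up_to_0: "diff_up_to 0 U F \<longleftrightarrow> (\<forall>x\<in>U. F differentiable (at x))"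
 unfolding diff_up_to_def by auto

lemma diff_up_to_Suc:
 "diff_up_to (Suc k) U F \<longleftrightarrow>
  (\<forall>x\<in>U. F differentiable (at x)) & (\<forall>v. diff_up_to k U (%x. frechet_derivative F (at x) v))"
proof
 assume L: "diff_up_to (Suc k) U F"
 show "(\<forall>x\<in>U. F differentiable (at x)) & (\<forall>v. diff_up_to k U (%x. frechet_derivative F (at x) v))"
 proof
  show "\<forall>x\<in>U. F differentiable (at x)"
   using L unfolding diff_up_to_def by (metis iter_deriv.simps(1) le0 list.size(3))
  show "\<forall>v. diff_up_to k U (%x. frechet_derivative F (at x) v)"
   using L unfolding diff_up_to_def iter_deriv_append[symmetric] by (simp add: Suc_le_eq)
 qed
next
 assume R: "(\<forall>x\<in>U. F differentiable (at x)) & (\<forall>v. diff_up_to k U (%x. frechet_derivative F (at x) v))"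
 show "diff_up_to (Suc k) U F" unfolding diff_up_to_def
 proof (intro allI impI)
  fix vs :: "'a list" assume l: "length vs <= Suc k"
  show "\<forall>x\<in>U. iter_deriv vs F differentiable (at x)"
  proof (cases vs rule: rev_cases)
   case Nil
   thus ?thesis using R by simp
  next
   case (snoc ws v)
   thus ?thesis using R l unfolding snoc iter_deriv_append diff_up_to_def by simp
  qed
 qed
qed

lemma diff_up_to_differentiable: "diff_up_to k U F ==> x : U ==> F differentiable (at x)"
 using diff_up_to_mono[of k U F 0] by (simp add: diff_up_to_0)

lemma diff_up_to_has_derivative:
 "diff_up_to k U F ==> x : U ==> (F has_derivative frechet_derivative F (at x)) (at x)"
 using diff_up_to_differentiable frechet_derivative_works by blast

lemma diff_up_to_cong:
 assumes "open U" "!!x. x : U ==> F x = G x" "diff_up_to k U F"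
 shows "diff_up_to k U G"
 unfolding diff_up_to_def
proof (intro allI impI ballI)
 fix vs :: "'a list" and x assume "length vs <= k" "x : U"
 thus "iter_deriv vs G differentiable (at x)"
  using assms differentiable_cong_open(1)[of U x "iter_deriv vs F" "iter_deriv vs G"] iter_deriv_cong_open[of U F G]
  unfolding diff_up_to_def by blast
qed

lemma diff_up_to_SucI:
 assumes "open U" "!!x. x : U ==> (F has_derivative D x) (at x)" "!!v. diff_up_to k U (%x. D x v)"
 shows "diff_up_to (Suc k) U F"
 unfolding diff_up_to_Suc
proof (intro conjI ballI allI)
 fix x assume "x : U" thus "F differentiable (at x)" using assms(2) by (auto simp: differentiable_def)
next
 fix v show "diff_up_to k U (%x. frechet_derivative F (at x) v)"
  by (rule diff_up_to_cong[OF assms(1) _ assms(3)[of v]]) (simp add: frechet_derivative_at[OF assms(2), symmetric])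
qed

lemma diff_up_to_const: "open U ==> diff_up_to k U (%x. c)"
proof (induction k arbitrary: c)
 case (Suc k)
 thus ?case by (intro diff_up_to_SucI[where D="%x v. 0"]) auto
qed (simp add: diff_up_to_0)

lemma diff_up_to_bounded_linear_compose:
 assumes "bounded_linear L" "open U" "diff_up_to k U F"
 shows "diff_up_to k U (%x. L (F x))"
 using assms(3)
proof (induction k arbitrary: F)
 case 0
 thus ?case using assms(1) by (auto simp: diff_up_to_0 differentiable_def dest: bounded_linear.has_derivative)
next
 case (Suc k)
 show ?case
 proof (rule diff_up_to_SucI[OF assms(2)])
  fix x assume "x : U"
  thus "((%x. L (F x)) has_derivative (%v. L (frechet_derivative F (at x) v))) (at x)"
   using diff_up_to_has_derivative[OF Suc.prems] bounded_linear.has_derivative[OF assms(1)] by blast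
 next
  fix v show "diff_up_to k U (%x. L (frechet_derivative F (at x) v))"
   using Suc by (intro Suc.IH) (simp add: diff_up_to_Suc)
 qed
qed

lemma diff_up_to_bounded_linear:
 assumes "bounded_linear L" "open U"
 shows "diff_up_to k U L"
proof (cases k)
 case 0
 thus ?thesis using bounded_linear_imp_has_derivative[OF assms(1)] by (auto simp: diff_up_to_0 differentiable_def)
next
 case (Suc k)
 thus ?thesis
  using bounded_linear_imp_has_derivative[OF assms(1)] assms(2) diff_up_to_const
  by (auto intro!: diff_up_to_SucI[where D="%x. L"])
qed

lemma diff_up_to_add:
 assumes "open U" "diff_up_to k U F" "diff_up_to k U G"
 shows "diff_up_to k U (%x. F x + G x)"
 using assms(2,3)
proof (induction k arbitrary: F G)
 case 0
 thus ?case by (auto simp: diff_up_to_0)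
next
 case (Suc k)
 show ?case
 proof (rule diff_up_to_SucI[OF assms(1)])
  fix x assume "x : U"
  thus "((%x. F x + G x) has_derivative (%v. frechet_derivative F (at x) v + frechet_derivative G (at x) v)) (at x)"
   by (intro has_derivative_add diff_up_to_has_derivative[OF Suc.prems(1)] diff_up_to_has_derivative[OF Suc.prems(2)])
 next
  fix v show "diff_up_to k U (%x. frechet_derivative F (at x) v + frechet_derivative G (at x) v)"
   using Suc by (intro Suc.IH) (auto simp: diff_up_to_Suc)
 qed
qed

lemma diff_up_to_sum:
 assumes "open U" "!!i. i : I ==> diff_up_to k U (F i)"
 shows "diff_up_to k U (%x. \<Sum>i\<in>I. F i x)"
 using assms(2) by (induction I rule: infinite_finite_induct) (auto intro: diff_up_to_add assms(1) diff_up_to_const)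

lemma diff_up_to_scaleR:
 assumes "open U" "diff_up_to k U f" "diff_up_to k U G"
 shows "diff_up_to k U (%x. f x *\<^sub>R G x)"
 using assms(2,3)
proof (induction k arbitrary: f G)
 case 0
 thus ?case by (auto simp: diff_up_to_0)
next
 case (Suc k)
 show ?case
 proof (rule diff_up_to_SucI[OF assms(1)])
  fix x assume "x : U"
  thus "((%x. f x *\<^sub>R G x) has_derivative (%v. f x *\<^sub>R frechet_derivative G (at x) v + frechet_derivative f (at x) v *\<^sub>R G x)) (at x)"
   by (intro has_derivative_scaleR diff_up_to_has_derivative[OF Suc.prems(1)] diff_up_to_has_derivative[OF Suc.prems(2)])
 next
  fix v
  have "diff_up_to k U f" "diff_up_to k U G" using Suc.prems diff_up_to_mono le_SucI by blast+
  thus "diff_up_to k U (%x. f x *\<^sub>R frechet_derivative G (at x) v + frechet_derivative f (at x) v *\<^sub>R G x)"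
   using Suc by (intro diff_up_to_add[OF assms(1)] Suc.IH) (auto simp: diff_up_to_Suc)
 qed
qed

text \<open>Expanding F' v in the basis writes the derivative of the composite as a sum of scalar
  functions times x \<mapsto> G'(F x) b. Sums and products are already covered, and the composites
  are of order k, so the induction hypothesis applies. The expansion is the reason for the Euclidean
  type in the middle.\<close>

lemma diff_up_to_compose:
 fixes F :: "'a::real_normed_vector => 'b::euclidean_space"
 assumes "open U" "open V" "F ` U \<subseteq> V" "diff_up_to k U F" "diff_up_to k V G"
 shows "diff_up_to k U (%x. G (F x))"
 using assms(4,5)
proof (induction k arbitrary: G)
 case 0
 thus ?case using assms(3) differentiable_chain_at[of F _ G]
  by (auto simp: diff_up_to_0 o_def image_subset_iff)
next
 case (Suc k)
 show ?case
 proof (rule diff_up_to_SucI[OF assms(1)])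
  fix x assume x: "x : U"
  hence "F x : V" using assms(3) by auto
  thus "((%x. G (F x)) has_derivative (%v. frechet_derivative G (at (F x)) (frechet_derivative F (at x) v))) (at x)"
   by (rule has_derivative_compose[OF diff_up_to_has_derivative[OF Suc.prems(1) x] diff_up_to_has_derivative[OF Suc.prems(2)]])
 next
  fix v
  have F: "diff_up_to k U F" using Suc.prems diff_up_to_mono le_SucI by blast
  have "diff_up_to k U (%x. \<Sum>b\<in>Basis. (frechet_derivative F (at x) v \<bullet> b) *\<^sub>R frechet_derivative G (at (F x)) b)"
   using Suc.prems F
   by (intro diff_up_to_sum diff_up_to_scaleR Suc.IH assms(1) diff_up_to_bounded_linear_compose[of "%y. y \<bullet> _"] bounded_linear_inner_left)
    (auto simp: diff_up_to_Suc)
  thus "diff_up_to k U (%x. frechet_derivative G (at (F x)) (frechet_derivative F (at x) v))"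
  proof (rule diff_up_to_cong[OF assms(1), rotated])
   fix x assume "x : U"
   hence "linear (frechet_derivative G (at (F x)))"
    using diff_up_to_differentiable[OF Suc.prems(2)] assms(3) by (intro linear_frechet_derivative) auto
   hence "frechet_derivative G (at (F x)) (\<Sum>b\<in>Basis. (frechet_derivative F (at x) v \<bullet> b) *\<^sub>R b)
    = (\<Sum>b\<in>Basis. (frechet_derivative F (at x) v \<bullet> b) *\<^sub>R frechet_derivative G (at (F x)) b)"
    by (simp add: linear_sum linear_scale)
   thus "(\<Sum>b\<in>Basis. (frechet_derivative F (at x) v \<bullet> b) *\<^sub>R frechet_derivative G (at (F x)) b)
    = frechet_derivative G (at (F x)) (frechet_derivative F (at x) v)"
    by (simp add: euclidean_representation)
  qed
 qed
qed

section \<open>Smooth maps on open sets\<close>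

lemma smooth_open_open: "smooth_open U F ==> open U"
 by (simp add: smooth_open_def)

lemma smooth_open_has_derivative:
 "smooth_open U F ==> x : U ==> (F has_derivative frechet_derivative F (at x)) (at x)"
 by (metis diff_up_to_has_derivative smooth_open_iff)

lemma smooth_open_iter_has_derivative:
 "smooth_open U F ==> x : U ==>
  (iter_deriv vs F has_derivative (%v. iter_deriv (v # vs) F x)) (at x)"
 unfolding smooth_open_def using frechet_derivative_works by force

lemma smooth_open_iter_continuous_on: "smooth_open U F ==> continuous_on U (iter_deriv vs F)"
 unfolding smooth_open_def
 by (meson continuous_at_imp_continuous_on differentiable_imp_continuous_within)

lemma smooth_open_continuous_on: "smooth_open U F ==> continuous_on U F"
 using smooth_open_iter_continuous_on[of U F "[]"] by simp

lemma smooth_open_subset: "smooth_open U F ==> open V ==> V \<subseteq> U ==> smooth_open V F"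
 unfolding smooth_open_def by blast

lemma smooth_open_cong: "smooth_open U F ==> (!!x. x : U ==> F x = G x) ==> smooth_open U G"
 unfolding smooth_open_iff using diff_up_to_cong by blast

lemma smooth_open_compose:
 fixes F :: "'a::real_normed_vector => 'b::euclidean_space"
 assumes "smooth_open U F" "smooth_open V G" "F ` U \<subseteq> V"
 shows "smooth_open U (%x. G (F x))"
 using assms diff_up_to_compose[of U V F _ G] unfolding smooth_open_iff by blast

lemma smooth_open_bounded_linear: "bounded_linear L ==> open U ==> smooth_open U L"
 unfolding smooth_open_iff using diff_up_to_bounded_linear by blast

lemma smooth_open_const: "open U ==> smooth_open U (%x. c)"
 unfolding smooth_open_iff using diff_up_to_const by blast

lemma smooth_open_add: "smooth_open U F ==> smooth_open U G ==> smooth_open U (%x. F x + G x)"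
 unfolding smooth_open_iff using diff_up_to_add by blast

lemma smooth_open_sum: "open U ==> (!!i. i : I ==> smooth_open U (F i)) ==> smooth_open U (%x. \<Sum>i\<in>I. F i x)"
 unfolding smooth_open_iff using diff_up_to_sum[of U I _ F] by blast

lemma smooth_open_bounded_linear_compose:
 "bounded_linear L ==> smooth_open U F ==> smooth_open U (%x. L (F x))"
 unfolding smooth_open_iff using diff_up_to_bounded_linear_compose by blast

lemma bounded_linear_Pair_left: "bounded_linear (%x. (x, 0))"
 by (intro bounded_linear_Pair bounded_linear_ident bounded_linear_zero)

lemma bounded_linear_Pair_right: "bounded_linear (%x. (0, x))"
 by (intro bounded_linear_Pair bounded_linear_ident bounded_linear_zero)

lemma smooth_open_Pair:
 assumes "smooth_open U F" "smooth_open U G"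
 shows "smooth_open U (%x. (F x, G x))"
proof -
 have "smooth_open U (%x. (F x, 0) + (0, G x))"
  using assms by (intro smooth_open_add smooth_open_bounded_linear_compose[OF bounded_linear_Pair_left]
   smooth_open_bounded_linear_compose[OF bounded_linear_Pair_right])
 thus ?thesis by simp
qed

lemma smooth_open_iter:
 assumes "smooth_open U F"
 shows "smooth_open U (iter_deriv vs F)"
proof -
 have "iter_deriv ws (iter_deriv vs F) = iter_deriv (ws @ vs) F" for ws
  by (induction ws) auto
 thus ?thesis using assms unfolding smooth_open_def by simp
qed

section \<open>Smooth maps on arbitrary subsets\<close>

lemma smooth_on_open:
 assumes "open U" "smooth_on U F"
 shows "smooth_open U F"
 unfolding smooth_open_def
proof (intro conjI allI ballI assms(1))
 fix vs x assume x: "x : U"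
 then obtain V G where V: "x : V" "smooth_open V G" "\<forall>y\<in>U \<inter> V. G y = F y"
  using assms(2) unfolding smooth_on_def by blast
 hence "open V" by (simp add: smooth_open_def)
 thus "iter_deriv vs F differentiable (at x)"
  using V x assms(1) differentiable_cong_open(1)[of "U \<inter> V" x "iter_deriv vs G" "iter_deriv vs F"]
   iter_deriv_cong_open[of "U \<inter> V" G F] unfolding smooth_open_def by blast
qed

lemma smooth_open_imp_smooth_on: "smooth_open U F ==> S \<subseteq> U ==> smooth_on S F"
 unfolding smooth_on_def by blast

lemma smooth_on_compose:
 fixes f :: "'a::real_normed_vector => 'b::euclidean_space"
 assumes "smooth_on S f" "smooth_on T g" "f ` S \<subseteq> T"
 shows "smooth_on S (%x. g (f x))"
 unfolding smooth_on_def
proof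
 fix x assume x: "x : S"
 obtain U F where U: "x : U" "smooth_open U F" "\<forall>y\<in>S \<inter> U. F y = f y"
  using assms(1) x unfolding smooth_on_def by blast
 obtain V G where V: "f x : V" "smooth_open V G" "\<forall>y\<in>T \<inter> V. G y = g y"
  using assms(2,3) x unfolding smooth_on_def by blast
 have o: "open (U \<inter> F -` V)"
  using U V by (metis Int_commute continuous_open_preimage smooth_open_continuous_on smooth_open_open)
 have "smooth_open (U \<inter> F -` V) (%x. G (F x))"
  by (rule smooth_open_compose[OF smooth_open_subset[OF U(2) o] V(2)]) auto
 moreover have "\<forall>y\<in>S \<inter> (U \<inter> F -` V). G (F y) = g (f y)"
 proof
  fix y assume y: "y : S \<inter> (U \<inter> F -` V)"
  hence "F y = f y" using U(3) by blast
  moreover have "f y : T \<inter> V" using y calculation assms(3) by auto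
  ultimately show "G (F y) = g (f y)" using V(3) by metis
 qed
 moreover have "F x = f x" using U(1,3) x by blast
 hence "x : U \<inter> F -` V" using U(1) V(1) by simp
 ultimately show "\<exists>U F. x : U & smooth_open U F & (\<forall>y\<in>S \<inter> U. F y = g (f y))"
  by (intro exI[of _ "U \<inter> F -` V"] exI[of _ "%x. G (F x)"]) fast
qed

lemma smooth_on_differentiable:
 assumes "smooth_on S f" "x : S"
 shows "\<exists>D. (f has_derivative D) (at x within S)"
proof -
 obtain U F where U: "x : U" "smooth_open U F" "\<forall>y\<in>S \<inter> U. F y = f y"
  using assms unfolding smooth_on_def by blast
 have "(F has_derivative frechet_derivative F (at x)) (at x within S)"
  using smooth_open_has_derivative[OF U(2,1)] by (rule has_derivative_at_withinI)
 moreover obtain d where "d > 0" "ball x d \<subseteq> U"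
  using open_contains_ball[of U] smooth_open_open[OF U(2)] U(1) by blast
 ultimately have "(f has_derivative frechet_derivative F (at x)) (at x within S)"
  using has_derivative_transform_within[of F _ x S d f] U(3) assms(2)
  by (metis (no_types, lifting) IntI dist_commute mem_ball subsetD)
 thus ?thesis by blast
qed

lemma smooth_on_continuous_on: "smooth_on S f ==> continuous_on S f"
 unfolding continuous_on_eq_continuous_within
proof
 fix x assume "smooth_on S f" "x : S"
 then obtain D where "(f has_derivative D) (at x within S)" using smooth_on_differentiable by fast
 thus "continuous (at x within S) f" by (rule has_derivative_continuous)
qed

lemma smooth_on_cong:
 assumes "smooth_on S f" "!!x. x : S ==> f x = g x"
 shows "smooth_on S g"
 unfolding smooth_on_def
proof
 fix x assume "x : S"
 then obtain U F where U: "x : U" "smooth_open U F" "\<forall>y\<in>S \<inter> U. F y = f y"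
  using assms(1) unfolding smooth_on_def by (meson subsetD)
 have "\<forall>y\<in>S \<inter> U. F y = g y"
 proof
  fix y assume "y : S \<inter> U"
  thus "F y = g y" using U(3) assms(2)[of y] by force
 qed
 thus "\<exists>U F. x : U & smooth_open U F & (\<forall>y\<in>S \<inter> U. F y = g y)"
  using U(1,2) by (intro exI[of _ U] exI[of _ F]) fast
qed

lemma smooth_on_bounded_linear: "bounded_linear L ==> smooth_on S L"
 by (rule smooth_open_imp_smooth_on[OF smooth_open_bounded_linear[OF _ open_UNIV]]) auto

lemma smooth_on_Pair:
 assumes "smooth_on S f" "smooth_on S g"
 shows "smooth_on S (%x. (f x, g x))"
 unfolding smooth_on_def
proof
 fix x assume x: "x : S"
 obtain U F where U: "x : U" "smooth_open U F" "\<forall>y\<in>S \<inter> U. F y = f y"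
  using assms(1) x unfolding smooth_on_def by blast
 obtain V G where V: "x : V" "smooth_open V G" "\<forall>y\<in>S \<inter> V. G y = g y"
  using assms(2) x unfolding smooth_on_def by blast
 have "smooth_open (U \<inter> V) (%x. (F x, G x))"
  using smooth_open_open[OF U(2)] smooth_open_open[OF V(2)]
  by (intro smooth_open_Pair smooth_open_subset[OF U(2)] smooth_open_subset[OF V(2)]) auto
 moreover have "\<forall>y\<in>S \<inter> (U \<inter> V). (F y, G y) = (f y, g y)" using U(3) V(3) by blast
 ultimately show "\<exists>U F. x : U & smooth_open U F & (\<forall>y\<in>S \<inter> U. F y = (f y, g y))"
  using U(1) V(1) by (intro exI[of _ "U \<inter> V"] exI[of _ "%x. (F x, G x)"]) fast
qed

text \<open>The mean value theorem is applied in direction u and then in direction v. The second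
  difference is symmetric in u and v, and letting h tend to 0 in both readings gives the symmetry of
  second derivatives.\<close>

lemma second_difference:
 fixes g :: "'a::real_normed_vector => real"
 assumes "smooth_open U g" "ball x r \<subseteq> U" "h > 0" "h * (norm u + norm v) < r"
 shows "\<exists>z. norm (z - x) <= h * (norm u + norm v) &
  g (x + h *\<^sub>R u + h *\<^sub>R v) - g (x + h *\<^sub>R u) - g (x + h *\<^sub>R v) + g x = h\<^sup>2 * iter_deriv [v, u] g z"
proof -
 have inU: "x + s *\<^sub>R u + t *\<^sub>R v : U" and nrm: "norm (x + s *\<^sub>R u + t *\<^sub>R v - x) <= h * (norm u + norm v)"
  if "0 <= s" "s <= h" "0 <= t" "t <= h" for s t
 proof -
  have "norm (s *\<^sub>R u + t *\<^sub>R v) <= s * norm u + t * norm v"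
   using norm_triangle_ineq[of "s *\<^sub>R u" "t *\<^sub>R v"] that by simp
  also have "... <= h * norm u + h * norm v" using that by (intro add_mono mult_right_mono) auto
  finally have n: "norm (s *\<^sub>R u + t *\<^sub>R v) <= h * (norm u + norm v)" by (simp add: algebra_simps)
  thus "norm (x + s *\<^sub>R u + t *\<^sub>R v - x) <= h * (norm u + norm v)" by (simp add: algebra_simps)
  have "dist x (x + s *\<^sub>R u + t *\<^sub>R v) = norm (s *\<^sub>R u + t *\<^sub>R v)"
   using norm_minus_cancel[of "s *\<^sub>R u + t *\<^sub>R v"] by (simp add: dist_norm add.assoc del: norm_minus_cancel)
  hence "x + s *\<^sub>R u + t *\<^sub>R v : ball x r" using n assms(4) by simp
  thus "x + s *\<^sub>R u + t *\<^sub>R v : U" using assms(2) by (rule subsetD[rotated])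
 qed
 have D1: "((%s. iter_deriv ws g (x + s *\<^sub>R u + t *\<^sub>R v)) has_real_derivative iter_deriv (u # ws) g (x + s *\<^sub>R u + t *\<^sub>R v)) (at s)"
  if "0 <= s" "s <= h" "0 <= t" "t <= h" for s t ws
 proof -
  have "((%s. x + s *\<^sub>R u + t *\<^sub>R v) has_derivative (%k. k *\<^sub>R u)) (at s)"
   by (auto intro!: derivative_eq_intros)
  from has_derivative_compose[OF this smooth_open_iter_has_derivative[OF assms(1) inU[OF that]]]
  have "((%s. iter_deriv ws g (x + s *\<^sub>R u + t *\<^sub>R v)) has_derivative (%k. iter_deriv ((k *\<^sub>R u) # ws) g (x + s *\<^sub>R u + t *\<^sub>R v))) (at s)" .
  moreover have "iter_deriv ((k *\<^sub>R u) # ws) g (x + s *\<^sub>R u + t *\<^sub>R v) = iter_deriv (u # ws) g (x + s *\<^sub>R u + t *\<^sub>R v) * k" for k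
   using linear_scale[OF has_derivative_linear[OF smooth_open_iter_has_derivative[OF assms(1) inU[OF that], of ws]], of k u]
   by (simp add: mult.commute del: iter_deriv.simps)
  ultimately show ?thesis by (simp add: has_field_derivative_def del: iter_deriv.simps)
 qed
 have D2: "((%t. iter_deriv ws g (x + s *\<^sub>R u + t *\<^sub>R v)) has_real_derivative iter_deriv (v # ws) g (x + s *\<^sub>R u + t *\<^sub>R v)) (at t)"
  if "0 <= s" "s <= h" "0 <= t" "t <= h" for s t ws
 proof -
  have "((%t. x + s *\<^sub>R u + t *\<^sub>R v) has_derivative (%k. k *\<^sub>R v)) (at t)"
   by (auto intro!: derivative_eq_intros)
  from has_derivative_compose[OF this smooth_open_iter_has_derivative[OF assms(1) inU[OF that]]]
  have "((%t. iter_deriv ws g (x + s *\<^sub>R u + t *\<^sub>R v)) has_derivative (%k. iter_deriv ((k *\<^sub>R v) # ws) g (x + s *\<^sub>R u + t *\<^sub>R v))) (at t)" .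
  moreover have "iter_deriv ((k *\<^sub>R v) # ws) g (x + s *\<^sub>R u + t *\<^sub>R v) = iter_deriv (v # ws) g (x + s *\<^sub>R u + t *\<^sub>R v) * k" for k
   using linear_scale[OF has_derivative_linear[OF smooth_open_iter_has_derivative[OF assms(1) inU[OF that], of ws]], of k v]
   by (simp add: mult.commute del: iter_deriv.simps)
  ultimately show ?thesis by (simp add: has_field_derivative_def del: iter_deriv.simps)
 qed
 define \<phi> where "\<phi> s = g (x + s *\<^sub>R u + h *\<^sub>R v) - g (x + s *\<^sub>R u + 0 *\<^sub>R v)" for s
 have "\<exists>z>0. z < h & \<phi> h - \<phi> 0 = (h - 0) * (iter_deriv [u] g (x + z *\<^sub>R u + h *\<^sub>R v) - iter_deriv [u] g (x + z *\<^sub>R u + 0 *\<^sub>R v))"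
 proof (rule MVT2[OF assms(3)])
  fix s assume "0 <= s" "s <= h"
  thus "(\<phi> has_real_derivative iter_deriv [u] g (x + s *\<^sub>R u + h *\<^sub>R v) - iter_deriv [u] g (x + s *\<^sub>R u + 0 *\<^sub>R v)) (at s)"
   using D1[of s h "[]"] D1[of s 0 "[]"] assms(3) unfolding \<phi>_def
   by (intro DERIV_diff) (auto simp del: iter_deriv.simps(2))
 qed
 then obtain \<xi> where xi: "0 < \<xi>" "\<xi> < h" "\<phi> h - \<phi> 0 = h * (iter_deriv [u] g (x + \<xi> *\<^sub>R u + h *\<^sub>R v) - iter_deriv [u] g (x + \<xi> *\<^sub>R u + 0 *\<^sub>R v))"
  by auto
 have "\<exists>z>0. z < h & iter_deriv [u] g (x + \<xi> *\<^sub>R u + h *\<^sub>R v) - iter_deriv [u] g (x + \<xi> *\<^sub>R u + 0 *\<^sub>R v) = (h - 0) * iter_deriv [v, u] g (x + \<xi> *\<^sub>R u + z *\<^sub>R v)"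
  using D2[of \<xi> _ "[u]"] xi by (intro MVT2[OF assms(3)]) auto
 then obtain \<eta> where eta: "0 < \<eta>" "\<eta> < h" "iter_deriv [u] g (x + \<xi> *\<^sub>R u + h *\<^sub>R v) - iter_deriv [u] g (x + \<xi> *\<^sub>R u + 0 *\<^sub>R v) = h * iter_deriv [v, u] g (x + \<xi> *\<^sub>R u + \<eta> *\<^sub>R v)"
  by auto
 have "\<phi> h - \<phi> 0 = h\<^sup>2 * iter_deriv [v, u] g (x + \<xi> *\<^sub>R u + \<eta> *\<^sub>R v)"
  unfolding xi(3) eta(3) by (simp add: power2_eq_square)
 thus ?thesis using nrm[of \<xi> \<eta>] xi eta
  by (intro exI[of _ "x + \<xi> *\<^sub>R u + \<eta> *\<^sub>R v"]) (auto simp: \<phi>_def simp del: iter_deriv.simps)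
qed

lemma mixed_partials_real:
 fixes g :: "'a::real_normed_vector => real"
 assumes "smooth_open U g" "x : U"
 shows "iter_deriv [v, u] g x = iter_deriv [u, v] g x"
proof (rule ccontr)
 let ?a = "iter_deriv [v, u] g" and ?b = "iter_deriv [u, v] g"
 assume ne: "?a x ~= ?b x"
 define e where "e = \<bar>?a x - ?b x\<bar> / 2"
 have e: "e > 0" using ne by (simp add: e_def)
 have oU: "open U" using assms(1) by (rule smooth_open_open)
 have cont: "isCont ?a x" "isCont ?b x"
  using smooth_open_iter_continuous_on[OF assms(1)] assms(2) oU continuous_on_eq_continuous_at by blast+
 obtain d1 where d1: "d1 > 0" "!!y. dist y x < d1 ==> dist (?a y) (?a x) < e"
  using cont(1) e unfolding continuous_at_eps_delta by metis
 obtain d2 where d2: "d2 > 0" "!!y. dist y x < d2 ==> dist (?b y) (?b x) < e"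
  using cont(2) e unfolding continuous_at_eps_delta by metis
 obtain r where r: "r > 0" "ball x r \<subseteq> U" using oU assms(2) open_contains_ball by blast
 define m where "m = min r (min d1 d2)"
 have m: "m > 0" using r d1 d2 by (simp add: m_def)
 define h where "h = m / (2 * (norm u + norm v + 1))"
 have h: "h > 0" using m by (simp add: h_def add_nonneg_pos)
 have "h * (norm u + norm v) <= h * (norm u + norm v + 1)" using h by (intro mult_left_mono) auto
 also have "... = m / 2" unfolding h_def using add_nonneg_pos[OF add_nonneg_nonneg[OF norm_ge_zero[of u] norm_ge_zero[of v]] zero_less_one]
  by (simp add: field_simps del: distrib_left_numeral)
 also have "... < m" using m by simp
 finally have hm: "h * (norm u + norm v) < m" .
 have hm': "h * (norm v + norm u) < m" using hm by (simp add: add.commute)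
 obtain z where z: "norm (z - x) <= h * (norm u + norm v)"
  "g (x + h *\<^sub>R u + h *\<^sub>R v) - g (x + h *\<^sub>R u) - g (x + h *\<^sub>R v) + g x = h\<^sup>2 * ?a z"
  using second_difference[OF assms(1) r(2) h, of u v] hm m_def by auto
 obtain w where w: "norm (w - x) <= h * (norm v + norm u)"
  "g (x + h *\<^sub>R v + h *\<^sub>R u) - g (x + h *\<^sub>R v) - g (x + h *\<^sub>R u) + g x = h\<^sup>2 * ?b w"
  using second_difference[OF assms(1) r(2) h, of v u] hm' m_def by auto
 have "h\<^sup>2 * ?a z = h\<^sup>2 * ?b w" unfolding z(2)[symmetric] w(2)[symmetric] by (simp add: algebra_simps)
 hence "?a z = ?b w" using h by simp
 moreover have "dist (?a z) (?a x) < e" using z(1) hm by (intro d1) (auto simp: dist_norm m_def)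
 moreover have "dist (?b w) (?b x) < e" using w(1) hm' by (intro d2) (auto simp: dist_norm m_def)
 ultimately have "\<bar>?a x - ?b x\<bar> < 2 * e" by (simp add: dist_real_def del: iter_deriv.simps)
 thus False by (simp add: e_def)
qed

lemma iter_deriv_bounded_linear:
 assumes "bounded_linear L" "smooth_open U F" "x : U"
 shows "iter_deriv vs (%x. L (F x)) x = L (iter_deriv vs F x)"
 using assms(3)
proof (induction vs arbitrary: x)
 case (Cons v vs)
 have oU: "open U" using assms(2) by (rule smooth_open_open)
 have "((%x. L (iter_deriv vs F x)) has_derivative (%v. L (iter_deriv (v # vs) F x))) (at x)"
  using bounded_linear.has_derivative[OF assms(1) smooth_open_iter_has_derivative[OF assms(2) Cons.prems]] .
 hence "frechet_derivative (%x. L (iter_deriv vs F x)) (at x) = (%v. L (iter_deriv (v # vs) F x))"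
  using frechet_derivative_at by metis
 moreover have "frechet_derivative (iter_deriv vs (%x. L (F x))) (at x) = frechet_derivative (%x. L (iter_deriv vs F x)) (at x)"
  using Cons by (intro frechet_derivative_cong_open[OF oU]) auto
 ultimately show ?case by simp
qed simp

lemma mixed_partials:
 fixes F :: "'a::real_normed_vector => 'b::euclidean_space"
 assumes "smooth_open U F" "x : U"
 shows "iter_deriv [v, u] F x = iter_deriv [u, v] F x"
proof (rule euclidean_eqI)
 fix b :: 'b
 have bl: "bounded_linear (%y. y \<bullet> b)" by (rule bounded_linear_inner_left)
 have sm: "smooth_open U (%x. F x \<bullet> b)" using smooth_open_bounded_linear_compose[OF bl assms(1)] .
 show "iter_deriv [v, u] F x \<bullet> b = iter_deriv [u, v] F x \<bullet> b"
  using mixed_partials_real[OF sm assms(2), of v u] iter_deriv_bounded_linear[OF bl assms, of "[v, u]"]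
   iter_deriv_bounded_linear[OF bl assms, of "[u, v]"] by simp
qed

section \<open>Holomorphic functions on phase space\<close>

text \<open>Complex scalar multiplication; the type of phase space carries only a real vector space
  structure. It parametrizes complex lines, through which one-variable theory is brought in.\<close>

definition cscale :: "complex => 'n::finite cphase => 'n cphase" where
 "cscale c v = (c *s fst v, c *s snd v)"

lemma cscale_eq: "cscale c v = Re c *\<^sub>R v + Im c *\<^sub>R mult_i v"
 by (auto simp: cscale_def mult_i_def prod_eq_iff vec_eq_iff complex_eq_iff)

lemma cscale_of_real [simp]: "cscale (of_real t) v = t *\<^sub>R v"
 by (simp add: cscale_eq)

lemma cscale_0 [simp]: "cscale 0 v = 0" and cscale_1 [simp]: "cscale 1 v = v" and cscale_i: "cscale \<i> v = mult_i v"
 by (simp_all add: cscale_eq)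

lemma cscale_zero_right [simp]: "cscale c 0 = 0"
 by (simp add: cscale_def vec_eq_iff prod_eq_iff)

lemma cscale_cscale: "cscale a (cscale b v) = cscale (a * b) v"
 by (simp add: cscale_def)

lemma cscale_scaleR: "cscale c (t *\<^sub>R v) = cscale (of_real t * c) v"
 using cscale_cscale[of c "of_real t" v] by (simp add: mult.commute)

lemma scaleR_cscale: "t *\<^sub>R cscale c v = cscale (of_real t * c) v"
 by (simp add: cscale_eq algebra_simps)

lemma cscale_add_left: "cscale (a + b) v = cscale a v + cscale b v"
 by (simp add: cscale_eq algebra_simps)

lemma cscale_add_right: "cscale a (v + w) = cscale a v + cscale a w"
 by (simp add: cscale_def prod_eq_iff vec_eq_iff algebra_simps)

lemma cscale_diff_left: "cscale (a - b) v = cscale a v - cscale b v"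
 by (simp add: cscale_eq algebra_simps)

lemma norm_vec_cmult: "norm (c *s (x :: complex ^ 'n::finite)) = cmod c * norm x"
 unfolding norm_vec_def by (simp add: norm_mult L2_set_right_distrib)

lemma norm_cscale: "norm (cscale c v) = cmod c * norm v"
proof -
 have "(norm (cscale c v))\<^sup>2 = (cmod c * norm v)\<^sup>2"
  by (simp add: cscale_def norm_Pair norm_vec_cmult power_mult_distrib norm_prod_def algebra_simps)
 thus ?thesis by (simp add: power2_eq_iff_nonneg)
qed

lemma norm_mult_i: "norm (mult_i v) = norm v"
 using norm_cscale[of \<i> v] by (simp add: cscale_i)

lemma bounded_linear_cscale_left: "bounded_linear (%c. cscale c v)"
 by (intro bounded_linear_intro[where K="norm v"]) (simp_all add: cscale_eq algebra_simps norm_cscale[unfolded cscale_eq])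

lemma bounded_linear_mult_i: "bounded_linear mult_i"
proof (intro bounded_linear_intro[where K=1])
 show "mult_i (x + y) = mult_i x + mult_i y" for x y :: "'n::finite cphase"
  using cscale_add_right[of \<i> x y] by (simp add: cscale_i)
 show "mult_i (r *\<^sub>R x) = r *\<^sub>R mult_i x" for r and x :: "'n::finite cphase"
  by (simp add: mult_i_def prod_eq_iff vec_eq_iff)
qed (simp add: norm_mult_i)

lemma holomorphic_cphase_derivative:
 assumes "holomorphic_cphase p S" "z : S"
 shows "(p has_derivative frechet_derivative p (at z)) (at z)"
  "frechet_derivative p (at z) (cscale c v) = c * frechet_derivative p (at z) v"
proof -
 obtain D where D: "(p has_derivative D) (at z)" "\<forall>v. D (mult_i v) = \<i> * D v"
  using assms unfolding holomorphic_cphase_def by metis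
 have eq: "frechet_derivative p (at z) = D" using frechet_derivative_at[OF D(1)] by simp
 show "(p has_derivative frechet_derivative p (at z)) (at z)" using D eq by simp
 have lin: "linear D" using D(1) by (rule has_derivative_linear)
 have "D (cscale c v) = Re c *\<^sub>R D v + Im c *\<^sub>R (\<i> * D v)"
  unfolding cscale_eq linear_add[OF lin] linear_scale[OF lin] D(2)[rule_format] ..
 also have "... = (complex_of_real (Re c) + \<i> * complex_of_real (Im c)) * D v"
  by (simp add: scaleR_conv_of_real algebra_simps)
 also have "... = c * D v" by (metis complex_eq)
 finally show "frechet_derivative p (at z) (cscale c v) = c * frechet_derivative p (at z) v" using eq by simp
qed

lemma holomorphic_cphase_continuous_on:
 assumes "holomorphic_cphase p S"
 shows "continuous_on S p"
 by (intro continuous_at_imp_continuous_on ballI)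
  (rule has_derivative_continuous[OF holomorphic_cphase_derivative(1)[OF assms]])

lemma holomorphic_cphase_bounded_compact:
 assumes "holomorphic_cphase p S" "compact K" "K \<subseteq> S"
 obtains B where "!!y. y : K ==> cmod (p y) <= B"
proof -
 have "bounded (p ` K)"
  using continuous_on_subset[OF holomorphic_cphase_continuous_on[OF assms(1)] assms(3)] assms(2)
  by (intro compact_imp_bounded compact_continuous_image)
 thus thesis using that by (auto simp: bounded_iff)
qed

lemma holomorphic_cphase_line:
 assumes "holomorphic_cphase p S" "z + cscale \<zeta> v : S"
 shows "((%\<zeta>. p (z + cscale \<zeta> v)) has_field_derivative frechet_derivative p (at (z + cscale \<zeta> v)) v) (at \<zeta>)"
proof -
 have "((%\<zeta>. z + cscale \<zeta> v) has_derivative (%h. cscale h v)) (at \<zeta>)"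
  using bounded_linear_imp_has_derivative[OF bounded_linear_cscale_left[of v]]
  by (auto intro!: derivative_eq_intros)
 from has_derivative_compose[OF this holomorphic_cphase_derivative(1)[OF assms]]
 show ?thesis
  unfolding has_field_derivative_def holomorphic_cphase_derivative(2)[OF assms] by (simp add: mult_commute_abs)
qed

lemma holomorphic_cphase_line_on:
 assumes "holomorphic_cphase p S" "!!\<zeta>. \<zeta> : U ==> z + cscale \<zeta> v : S"
 shows "(%\<zeta>. p (z + cscale \<zeta> v)) holomorphic_on U"
 unfolding holomorphic_on_def field_differentiable_def
 using holomorphic_cphase_line[OF assms(1) assms(2)] has_field_derivative_at_within by blast

lemma holomorphic_cphase_cauchy:
 assumes "holomorphic_cphase p S" "ball z R \<subseteq> S" "!!y. y : ball z R ==> cmod (p y) <= B"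
  and "0 < r" "r * norm v < R"
 shows "cmod ((deriv ^^ n) (%\<zeta>. p (z + cscale \<zeta> v)) 0) <= fact n * B / r ^ n"
proof (rule Cauchy_inequality)
 have in_ball: "z + cscale \<zeta> v : ball z R" if "cmod \<zeta> <= r" for \<zeta>
 proof -
  have "cmod \<zeta> * norm v <= r * norm v" using that by (intro mult_right_mono) auto
  thus ?thesis using assms(5) by (simp add: dist_norm norm_cscale)
 qed
 have hol: "(%\<zeta>. p (z + cscale \<zeta> v)) holomorphic_on cball 0 r"
  using in_ball assms(2) by (intro holomorphic_cphase_line_on[OF assms(1)]) auto
 thus "(%\<zeta>. p (z + cscale \<zeta> v)) holomorphic_on ball 0 r"
  by (rule holomorphic_on_subset) auto
 show "continuous_on (cball 0 r) (%\<zeta>. p (z + cscale \<zeta> v))"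
  using hol by (rule holomorphic_on_imp_continuous_on)
 fix x assume "cmod (0 - x) = r"
 thus "cmod (p (z + cscale x v)) <= B" using in_ball[of x] by (intro assms(3)) auto
qed (use assms in auto)

lemma holomorphic_cphase_derivative_bound:
 assumes "holomorphic_cphase p S" "ball z R \<subseteq> S" "!!y. y : ball z R ==> cmod (p y) <= B" "R > 0"
 shows "cmod (frechet_derivative p (at z) v) <= 2 * B / R * norm v"
proof (cases "v = 0")
 case True
 have "z : S" using assms by auto
 hence "linear (frechet_derivative p (at z))"
  using holomorphic_cphase_derivative(1)[OF assms(1)] has_derivative_linear by blast
 thus ?thesis using True by (simp add: linear_0)
next
 case False
 have "z : S" using assms by auto
 hence "((%\<zeta>. p (z + cscale \<zeta> v)) has_field_derivative frechet_derivative p (at z) v) (at 0)"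
  using holomorphic_cphase_line[OF assms(1), of z 0 v] by simp
 hence "deriv (%\<zeta>. p (z + cscale \<zeta> v)) 0 = frechet_derivative p (at z) v"
  by (rule DERIV_imp_deriv)
 moreover have "cmod ((deriv ^^ 1) (%\<zeta>. p (z + cscale \<zeta> v)) 0) <= fact 1 * B / (R / (2 * norm v)) ^ 1"
  using assms False by (intro holomorphic_cphase_cauchy[OF assms(1-3)]) auto
 ultimately show ?thesis using False by (simp add: field_simps)
qed

text \<open>The homogeneous part of degree k of the Taylor expansion of p at \<open>rh\<close>, read
  off on the complex line spanned by z instead of from multi-index coefficients.\<close>

definition line_coeff :: "('n::finite cphase => complex) => 'n cphase => nat => 'n cphase => complex" where
 "line_coeff p rh k z = (deriv ^^ k) (%\<zeta>. p (rh + cscale \<zeta> z)) 0 / fact k"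

text \<open>On the line \<zeta> \<mapsto> rh + \<zeta> z this is the one-variable Taylor formula at
  \<zeta> = 1. Cauchy's inequality on discs of radius R / (4 |z|) > 1 about points of the unit disc
  bounds the remainder, and the inverse of that radius supplies the powers of |z|.\<close>

lemma holomorphic_cphase_taylor:
 assumes "holomorphic_cphase p S" "ball rh R \<subseteq> S" "!!y. y : ball rh R ==> cmod (p y) <= B" "R > 0"
  and z: "norm z < R / 4"
 shows "cmod (p (rh + z) - (\<Sum>k\<le>n. line_coeff p rh k z)) <= fact (Suc n) * B * (4 / R) ^ Suc n * norm z ^ Suc n"
proof (cases "z = 0")
 case True
 have "(deriv ^^ k) (%\<zeta>. c) (x::complex) = (if k = 0 then c else 0)" for k c x
  by (induction k arbitrary: x c) (auto simp: funpow_Suc_right simp del: funpow.simps(2))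
 hence lc: "line_coeff p rh k 0 = (if k = 0 then p rh else 0)" for k
  unfolding line_coeff_def by simp
 have "(\<Sum>k\<le>n. line_coeff p rh k 0) = p rh" unfolding lc by simp
 thus ?thesis using True by simp
next
 case False
 define f where "f = (%\<zeta>. p (rh + cscale \<zeta> z))"
 define r where "r = R / (4 * norm z)"
 have r: "r > 1" using z False by (simp add: r_def field_simps)
 have inb: "rh + cscale \<zeta> z : ball rh R" if "cmod \<zeta> < 3 * r" for \<zeta>
 proof -
  have "cmod \<zeta> * norm z < 3 * r * norm z" using that False by (intro mult_strict_right_mono) auto
  also have "... <= R" using False assms(4) by (simp add: r_def)
  finally show ?thesis by (simp add: dist_norm norm_cscale)
 qed
 have hol: "f holomorphic_on ball 0 (3 * r)" unfolding f_def
  using inb assms(2) by (intro holomorphic_cphase_line_on[OF assms(1)]) auto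
 have bd: "cmod ((deriv ^^ Suc n) f x) <= fact (Suc n) * B / r ^ Suc n" if x: "x : cball 0 1" for x
 proof (rule Cauchy_inequality)
  have sub: "cball x r \<subseteq> ball 0 (3 * r)"
  proof
   fix y assume "y : cball x r"
   hence "cmod y <= cmod x + r" using norm_triangle_ineq2[of y x] by (simp add: dist_norm norm_minus_commute)
   thus "y : ball 0 (3 * r)" using x r by simp
  qed
  show "f holomorphic_on ball x r"
   by (rule holomorphic_on_subset[OF hol order_trans[OF ball_subset_cball sub]])
  show "continuous_on (cball x r) f"
   by (rule holomorphic_on_imp_continuous_on[OF holomorphic_on_subset[OF hol sub]])
  fix y assume "cmod (x - y) = r"
  hence "y : ball 0 (3 * r)" using sub by (auto simp: dist_norm)
  thus "cmod (f y) <= B" unfolding f_def using inb by (intro assms(3)) auto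
 qed (use r in auto)
 have "cmod ((deriv ^^ 0) f 1 - (\<Sum>k\<le>n. (deriv ^^ k) f 0 * (1 - 0) ^ k / fact k))
  <= fact (Suc n) * B / r ^ Suc n * cmod (1 - 0) ^ Suc n / fact n"
 proof (rule complex_Taylor[of "cball 0 1"])
  fix i x assume x: "x : cball (0::complex) 1" "i <= n"
  have "(deriv ^^ i) f holomorphic_on ball 0 (3 * r)" by (intro holomorphic_higher_deriv hol) auto
  thus "((deriv ^^ i) f has_field_derivative (deriv ^^ Suc i) f x) (at x within cball 0 1)"
   using x r by (auto intro!: has_field_derivative_at_within[OF holomorphic_derivI])
 next
  fix x assume "x : cball (0::complex) 1"
  thus "cmod ((deriv ^^ Suc n) f x) <= fact (Suc n) * B / r ^ Suc n" by (rule bd)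
 qed auto
 also have "... <= fact (Suc n) * B / r ^ Suc n"
 proof -
  have "rh : ball rh R" using assms(4) by simp
  hence "B \<ge> 0" using assms(3) norm_ge_zero order_trans by metis
  hence "0 <= fact (Suc n) * B / r ^ Suc n" using r by simp
  hence "fact (Suc n) * B / r ^ Suc n / fact n <= fact (Suc n) * B / r ^ Suc n / 1"
   by (intro divide_left_mono) auto
  thus ?thesis by (simp del: fact_Suc power_Suc)
 qed
 also have "... = fact (Suc n) * B * (4 / R) ^ Suc n * norm z ^ Suc n"
 proof -
  have "1 / r = 4 / R * norm z" using False by (simp add: r_def)
  hence "1 / r ^ Suc n = (4 / R * norm z) ^ Suc n" by (metis power_one_over)
  hence "fact (Suc n) * B * (1 / r ^ Suc n) = fact (Suc n) * B * ((4 / R) ^ Suc n * norm z ^ Suc n)"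
   by (simp only: power_mult_distrib)
  thus ?thesis by (simp only: times_divide_eq_right mult_1_right mult.assoc)
 qed
 finally show ?thesis by (simp add: f_def line_coeff_def del: fact_Suc power_Suc)
qed

text \<open>\<open>holomorphic_cphase\<close> demands a complex-linear derivative at each point and
  says nothing about its dependence on the point. The difference quotients \<open>q n\<close> are
  holomorphic and converge uniformly by the first-order Taylor estimate; Cauchy's inequality for q n
  - q m makes their derivatives converge uniformly too, and complex linearity survives the
  limit.\<close>

lemma holomorphic_cphase_frechet_derivative:
 assumes p: "holomorphic_cphase p S" and "open S"
 shows "holomorphic_cphase (%z. frechet_derivative p (at z) w) S"
 unfolding holomorphic_cphase_def
proof
 fix z0 assume "z0 : S"
 then obtain R0 where R0: "R0 > 0" "cball z0 R0 \<subseteq> S" using \<open>open S\<close> open_contains_cball by blast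
 define R where "R = R0 / 2"
 have R: "R > 0" "cball z0 (2 * R) \<subseteq> S" using R0 by (auto simp: R_def)
 obtain B where B: "!!y. y : cball z0 (2 * R) ==> cmod (p y) <= B"
  using holomorphic_cphase_bounded_compact[OF p compact_cball R(2)] by metis
 define K where "K = 2 * B * (4 / R)\<^sup>2 * (norm w)\<^sup>2"
 \<comment> \<open>A null sequence of steps with h n |w| < R / 4, as the Taylor estimate
   requires.\<close>
 define h where "h n = R / 4 / ((norm w + 1) * real (Suc n))" for n
 have nw: "norm w + 1 > 0" by (simp add: add_nonneg_pos)
 have h: "h n > 0" for n using R nw by (simp add: h_def)
 have hle: "h n * norm w < R / 4" for n
 proof -
  have "norm w * 1 < (norm w + 1) * real (Suc n)"
   by (intro mult_less_le_imp_less) auto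
  hence "norm w / ((norm w + 1) * real (Suc n)) < 1" using nw by (simp add: divide_less_eq)
  hence "R / 4 * (norm w / ((norm w + 1) * real (Suc n))) < R / 4 * 1" using R by (intro mult_strict_left_mono) auto
  thus ?thesis unfolding h_def by (simp only: times_divide_eq_left times_divide_eq_right mult_1_right mult.commute)
 qed
 define q where "q n z = (p (z + h n *\<^sub>R w) - p z) / of_real (h n)" for n z
 define q' where "q' n z v = (frechet_derivative p (at (z + h n *\<^sub>R w)) v - frechet_derivative p (at z) v) / of_real (h n)" for n z v
 have inS: "z : S" "z + h n *\<^sub>R w : S" if "z : ball z0 R" for z n
 proof -
  show "z : S" using that R by auto
  have "dist z0 (z + h n *\<^sub>R w) <= dist z0 z + norm (h n *\<^sub>R w)"
   using dist_triangle[of z0 "z + h n *\<^sub>R w" z] by (simp add: dist_norm)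
  also have "norm (h n *\<^sub>R w) = h n * norm w" using h[of n] by simp
  finally have "dist z0 (z + h n *\<^sub>R w) <= 2 * R" using hle[of n] that R by simp
  thus "z + h n *\<^sub>R w : S" using R by auto
 qed
 have qhol: "(q n has_derivative q' n z) (at z)" "q' n z (cscale c v) = c * q' n z v" if z: "z : ball z0 R" for n z c v
 proof -
  have "((%z. z + h n *\<^sub>R w) has_derivative (%v. v)) (at z)" by (auto intro!: derivative_eq_intros)
  from has_derivative_compose[OF this holomorphic_cphase_derivative(1)[OF p inS(2)[OF z]]]
  have "((%z. p (z + h n *\<^sub>R w)) has_derivative frechet_derivative p (at (z + h n *\<^sub>R w))) (at z)" .
  from has_derivative_mult_right[OF has_derivative_diff[OF this holomorphic_cphase_derivative(1)[OF p inS(1)[OF z]]], of "inverse (of_real (h n))"]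
  show "(q n has_derivative q' n z) (at z)" by (simp add: q_def[abs_def] q'_def[abs_def] divide_inverse mult.commute)
  show "q' n z (cscale c v) = c * q' n z v"
   using holomorphic_cphase_derivative(2)[OF p inS(2)[OF z]] holomorphic_cphase_derivative(2)[OF p inS(1)[OF z]]
   by (simp add: q'_def algebra_simps)
 qed
 have est: "cmod (q n z - frechet_derivative p (at z) w) <= K * h n" if z: "z : ball z0 R" for n z
 proof -
  have sub: "ball z R \<subseteq> cball z0 (2 * R)"
  proof
   fix y assume "y : ball z R"
   thus "y : cball z0 (2 * R)" using z dist_triangle[of z0 y z] by simp
  qed
  let ?z = "h n *\<^sub>R w"
  have "cmod (p (z + ?z) - (\<Sum>k\<le>1. line_coeff p z k ?z)) <= fact (Suc 1) * B * (4 / R) ^ Suc 1 * norm ?z ^ Suc 1"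
   using sub R B h[of n] hle[of n] by (intro holomorphic_cphase_taylor[OF p]) auto
  moreover have "(\<Sum>k\<le>1. line_coeff p z k ?z) = p z + of_real (h n) * frechet_derivative p (at z) w"
  proof -
   have "deriv (%\<zeta>. p (z + cscale \<zeta> ?z)) 0 = frechet_derivative p (at z) ?z"
    using holomorphic_cphase_line[OF p, of z 0 ?z] inS(1)[OF z] by (intro DERIV_imp_deriv) simp
   also have "... = of_real (h n) * frechet_derivative p (at z) w"
    using holomorphic_cphase_derivative(2)[OF p inS(1)[OF z], of "of_real (h n)" w] by simp
   finally show ?thesis by (simp add: line_coeff_def)
  qed
  ultimately have "cmod (p (z + ?z) - p z - of_real (h n) * frechet_derivative p (at z) w) <= K * h n * h n"
   by (simp add: K_def power2_eq_square algebra_simps)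
  moreover have "q n z - frechet_derivative p (at z) w = (p (z + ?z) - p z - of_real (h n) * frechet_derivative p (at z) w) / of_real (h n)"
   using h[of n] by (simp add: q_def field_simps)
  ultimately show ?thesis using h[of n] by (simp add: norm_divide divide_le_eq del: divide_diff_eq_iff)
 qed
 have h0: "h \<longlonglongrightarrow> 0"
 proof -
  have "(%n. R / 4 / (norm w + 1) * inverse (real (Suc n))) \<longlonglongrightarrow> R / 4 / (norm w + 1) * 0"
   by (intro tendsto_mult tendsto_const LIMSEQ_inverse_real_of_nat)
  thus ?thesis
   by (simp only: h_def[abs_def] divide_inverse inverse_mult_distrib mult.assoc mult_zero_right)
 qed
 have qlim: "(%n. q n x) \<longlonglongrightarrow> frechet_derivative p (at x) w" if x: "x : ball z0 R" for x
 proof -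
  have "(%n. q n x - frechet_derivative p (at x) w) \<longlonglongrightarrow> 0"
   by (rule Lim_null_comparison[OF always_eventually[OF allI[OF est[OF x]]] tendsto_mult_right_zero[OF h0]])
  thus ?thesis by (simp add: LIM_zero_iff)
 qed
 \<comment> \<open>The halved radius leaves room for Cauchy's inequality on balls of radius R /
   2.\<close>
 have cau: "cmod (q' n z v - q' m z v) <= K * (h n + h m) * (4 / R) * norm v" if z: "z : ball z0 (R / 2)" for n m z v
 proof -
  define d where "d z = q n z - q m z" for z
  have zR: "z : ball z0 R" using z R by auto
  have dd: "(d has_derivative (%v. q' n y v - q' m y v)) (at y)" if "y : ball z0 R" for y
   unfolding d_def[abs_def] by (intro has_derivative_diff qhol that)
  have dh: "holomorphic_cphase d (ball z0 R)"
   unfolding holomorphic_cphase_def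
  proof
   fix y assume y: "y : ball z0 R"
   have "\<forall>v. q' n y (mult_i v) - q' m y (mult_i v) = \<i> * (q' n y v - q' m y v)"
    using qhol(2)[OF y, of _ \<i>] by (simp add: cscale_i algebra_simps)
   thus "\<exists>D. (d has_derivative D) (at y) & (\<forall>v. D (mult_i v) = \<i> * D v)" using dd[OF y] by blast
  qed
  have "cmod (frechet_derivative d (at z) v) <= 2 * (K * (h n + h m)) / (R / 2) * norm v"
  proof (rule holomorphic_cphase_derivative_bound[OF dh])
   show "ball z (R / 2) \<subseteq> ball z0 R"
   proof
    fix y assume "y : ball z (R / 2)"
    thus "y : ball z0 R" using z dist_triangle[of z0 y z] by simp
   qed
   hence zs: "ball z (R / 2) \<subseteq> ball z0 R" .
   have "cmod (d y) <= K * h n + K * h m" if y: "y : ball z (R / 2)" for y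
   proof -
    let ?X = "frechet_derivative p (at y) w"
    have yb: "y : ball z0 R" using y zs by blast
    have "cmod (q n y - ?X) <= K * h n" "cmod (q m y - ?X) <= K * h m" by (rule est[OF yb])+
    moreover have "d y = (q n y - ?X) - (q m y - ?X)" by (simp add: d_def)
    ultimately show ?thesis using norm_triangle_ineq4[of "q n y - ?X" "q m y - ?X"] by simp
   qed
   thus "cmod (d y) <= K * (h n + h m)" if "y : ball z (R / 2)" for y using that by (simp add: distrib_left)
  qed (use R in auto)
  moreover have "frechet_derivative d (at z) v = q' n z v - q' m z v"
   using frechet_derivative_at[OF dd[OF zR]] by metis
  ultimately show ?thesis by (simp add: mult_ac)
 qed
 define g' where "g' z v = lim (%n. q' n z v)" for z v
 have lim: "(%n. q' n z v) \<longlonglongrightarrow> g' z v" if z: "z : ball z0 (R / 2)" for z v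
 proof -
  have "Cauchy (%n. q' n z v)"
  proof (rule metric_CauchyI)
   fix e :: real assume "e > 0"
   have "(%n. K * (4 / R) * norm v * (2 * h n)) \<longlonglongrightarrow> K * (4 / R) * norm v * (2 * 0)"
    by (intro tendsto_intros h0)
   hence "\<forall>\<^sub>F n in sequentially. K * (4 / R) * norm v * (2 * h n) < e"
    using \<open>e > 0\<close> by (intro order_tendstoD) auto
   then obtain N where N: "K * (4 / R) * norm v * (2 * h N) < e" by (auto simp: eventually_sequentially)
   have B0: "B \<ge> 0" using order_trans[OF norm_ge_zero B[of z0]] R by simp
   show "\<exists>M. \<forall>m\<ge>M. \<forall>n\<ge>M. dist (q' m z v) (q' n z v) < e"
   proof (intro exI allI impI)
    fix m n assume mn: "N <= m" "N <= n"
    have hm: "h m <= h N" "h n <= h N" using mn R nw unfolding h_def by (auto intro!: divide_left_mono)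
    have "K * (4 / R) * norm v * (h m + h n) <= K * (4 / R) * norm v * (2 * h N)"
     using hm B0 R by (intro mult_left_mono) (auto simp: K_def)
    thus "dist (q' m z v) (q' n z v) < e"
     using cau[OF z, of m v n] N by (simp add: dist_norm mult_ac)
   qed
  qed
  hence "convergent (%n. q' n z v)" by (rule Cauchy_convergent)
  thus ?thesis unfolding g'_def by (simp add: convergent_LIMSEQ_iff)
 qed
 have unif: "cmod (q' n z v - g' z v) <= K * (4 / R) * h n * norm v" if z: "z : ball z0 (R / 2)" for n z v
 proof (rule tendsto_le[OF sequentially_bot])
  show "(%m. K * (h n + h m) * (4 / R) * norm v) \<longlonglongrightarrow> K * (4 / R) * h n * norm v"
   using R by (auto intro!: tendsto_eq_intros h0)
  show "(%m. cmod (q' n z v - q' m z v)) \<longlonglongrightarrow> cmod (q' n z v - g' z v)"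
   by (intro tendsto_intros lim z)
 qed (use cau[OF z] in auto)
 have "\<exists>g. \<forall>x\<in>ball z0 (R / 2). (%n. q n x) \<longlonglongrightarrow> g x & (g has_derivative g' x) (at x within ball z0 (R / 2))"
 proof (rule has_derivative_sequence[where f=q and f'=q' and g'=g' and S="ball z0 (R / 2)" and ?x0.0=z0 and l="frechet_derivative p (at z0) w"])
  show "(q n has_derivative q' n x) (at x within ball z0 (R / 2))" if x: "x : ball z0 (R / 2)" for n x
  proof -
   have "x : ball z0 R" using x R by simp
   thus ?thesis by (rule has_derivative_at_withinI[OF qhol(1)])
  qed
  fix e :: real assume "e > 0"
  have "(%n. K * (4 / R) * h n) \<longlonglongrightarrow> K * (4 / R) * 0" by (intro tendsto_intros h0)
  hence "\<forall>\<^sub>F n in sequentially. K * (4 / R) * h n < e" using \<open>e > 0\<close> by (intro order_tendstoD) auto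
  thus "\<forall>\<^sub>F n in sequentially. \<forall>x\<in>ball z0 (R / 2). \<forall>v. cmod (q' n x v - g' x v) <= e * norm v"
  proof eventually_elim
   case (elim n)
   show ?case
   proof (intro ballI allI)
    fix x v assume "x : ball z0 (R / 2)"
    from unif[OF this, of n v] show "cmod (q' n x v - g' x v) <= e * norm v"
     using elim mult_right_mono[of "K * (4 / R) * h n" e "norm v"] by simp
   qed
  qed
 next
  show "z0 : ball z0 (R / 2)" using R by simp
  show "(%n. q n z0) \<longlonglongrightarrow> frechet_derivative p (at z0) w" using R by (intro qlim) simp
 qed (rule convex_ball)
 then obtain g where g: "!!x. x : ball z0 (R / 2) ==> (%n. q n x) \<longlonglongrightarrow> g x"
  "!!x. x : ball z0 (R / 2) ==> (g has_derivative g' x) (at x within ball z0 (R / 2))" by blast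
 have z0: "z0 : ball z0 (R / 2)" using R by simp
 have gd: "(g has_derivative g' z0) (at z0)"
  using g(2)[OF z0] by (simp only: at_within_open[OF z0 open_ball])
 have geq: "g x = frechet_derivative p (at x) w" if x: "x : ball z0 (R / 2)" for x
  using x R by (intro LIMSEQ_unique[OF g(1)[OF x] qlim]) auto
 have "((%z. frechet_derivative p (at z) w) has_derivative g' z0) (at z0)"
  by (rule has_derivative_transform_within_open[OF gd open_ball z0 geq])
 moreover have "g' z0 (mult_i v) = \<i> * g' z0 v" for v
 proof (rule LIMSEQ_unique[OF lim[OF z0]])
  have z0R: "z0 : ball z0 R" using R by simp
  show "(%n. q' n z0 (mult_i v)) \<longlonglongrightarrow> \<i> * g' z0 v"
   unfolding cscale_i[symmetric] qhol(2)[OF z0R] by (intro tendsto_mult tendsto_const lim[OF z0])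
 qed
 ultimately show "\<exists>D. ((%z. frechet_derivative p (at z) w) has_derivative D) (at z0) & (\<forall>v. D (mult_i v) = \<i> * D v)"
  by blast
qed

lemma holomorphic_cphase_iter_deriv:
 assumes "holomorphic_cphase p S" "open S"
 shows "holomorphic_cphase (iter_deriv vs p) S"
 using assms by (induction vs) (auto intro: holomorphic_cphase_frechet_derivative)

lemma holomorphic_cphase_smooth:
 assumes "holomorphic_cphase p S" "open S"
 shows "smooth_open S p"
 unfolding smooth_open_def
 using holomorphic_cphase_derivative(1)[OF holomorphic_cphase_iter_deriv[OF assms]] assms(2)
 by (auto simp: differentiable_def)

text \<open>P is the first nonvanishing homogeneous part; one exists because p does not vanish
  identically near \<open>rh\<close> on the line spanned by b. Continuity, and holomorphy along
  lines, follow from P being the locally uniform limit of p (rh + t z) / t^m as t tends to 0, so P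
  never has to be exhibited as a polynomial. The disc of radius 2 is just large enough to contain a
  real interval around 0 together with \<i>.\<close>

lemma leading_form:
 fixes p :: "'n::finite cphase => complex"
 assumes p: "holomorphic_cphase p S" and "open S" "rh : S"
  and nz: "!!e. e > 0 ==> \<exists>\<zeta>. cmod \<zeta> < e & p (rh + cscale \<zeta> b) ~= 0"
 obtains m P C r where "r > 0" "!!z. norm z < r ==> cmod (p (rh + z) - P z) <= C * norm z ^ Suc m"
  "!!t z. P (t *\<^sub>R z) = of_real t ^ m * P z" "continuous_on UNIV P"
  "!!v w. (%\<tau>. P (v + cscale \<tau> w)) holomorphic_on ball 0 2" "\<exists>z. P z ~= 0"
proof -
 obtain R0 where R0: "R0 > 0" "cball rh R0 \<subseteq> S" using \<open>open S\<close> \<open>rh : S\<close> open_contains_cball by blast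
 obtain B where B: "!!y. y : cball rh R0 ==> cmod (p y) <= B"
  using holomorphic_cphase_bounded_compact[OF p compact_cball R0(2)] by metis
 have sub: "ball rh R0 \<subseteq> S" using R0(2) by auto
 let ?a = "line_coeff p rh"
 have holz: "(%\<zeta>. p (rh + cscale \<zeta> z)) holomorphic_on ball 0 (R0 / (norm z + 1))" for z
 proof (rule holomorphic_cphase_line_on[OF p])
  fix \<zeta> :: complex assume "\<zeta> : ball 0 (R0 / (norm z + 1))"
  hence "cmod \<zeta> * (norm z + 1) < R0" by (simp add: less_divide_eq add_nonneg_pos)
  moreover have "cmod \<zeta> * norm z <= cmod \<zeta> * (norm z + 1)" by (intro mult_left_mono) auto
  ultimately have "cmod \<zeta> * norm z < R0" by linarith
  thus "rh + cscale \<zeta> z : S" using sub by (auto simp: dist_norm norm_cscale)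
 qed
 have ex: "\<exists>k z. ?a k z ~= 0"
 proof (rule ccontr)
  assume "\<not> ?thesis"
  hence "?a k b = 0" for k by blast
  hence "(deriv ^^ k) (%\<zeta>. p (rh + cscale \<zeta> b)) 0 = 0" for k by (simp add: line_coeff_def)
  moreover define e where "e = R0 / (norm b + 1)"
  ultimately have "p (rh + cscale \<zeta> b) = 0" if "\<zeta> : ball 0 e" for \<zeta>
   using holomorphic_fun_eq_0_on_ball[OF holz[of b], of \<zeta>] that by simp
  moreover have "e > 0" using R0 by (simp add: e_def add_nonneg_pos)
  ultimately show False using nz[of e] by auto
 qed
 define m where "m = (LEAST k. \<exists>z. ?a k z ~= 0)"
 have m: "\<exists>z. ?a m z ~= 0" unfolding m_def using ex by (rule LeastI_ex)
 have below: "?a k z = 0" if "k < m" for k z using not_less_Least[of k "%k. \<exists>z. ?a k z ~= 0"] that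
  unfolding m_def by (cases z) simp
 define P where "P = ?a m"
 define C where "C = fact (Suc m) * B * (4 / R0) ^ Suc m"
 define r where "r = R0 / 4"
 have r: "r > 0" using R0 by (simp add: r_def)
 have est: "cmod (p (rh + z) - P z) <= C * norm z ^ Suc m" if "norm z < r" for z
 proof -
  have "(\<Sum>k\<le>m. ?a k z) = P z"
   unfolding P_def using below by (subst sum.remove[of _ m]) (auto intro!: sum.neutral)
  moreover have "cmod (p (rh + z) - (\<Sum>k\<le>m. ?a k z)) <= C * norm z ^ Suc m"
   unfolding C_def using that B R0 by (intro holomorphic_cphase_taylor[OF p sub]) (auto simp: r_def)
  ultimately show ?thesis by simp
 qed
 have hom: "P (t *\<^sub>R z) = of_real t ^ m * P z" for t z
 proof -
  let ?f = "%\<zeta>. p (rh + cscale \<zeta> z)"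
  define de where "de = R0 / (norm z + 1)"
  have de: "de > 0" using R0 by (simp add: de_def add_nonneg_pos)
  define e where "e = de / (\<bar>t\<bar> + 1)"
  have e: "e > 0" using de by (simp add: e_def add_nonneg_pos)
  have "(deriv ^^ m) (%\<zeta>. p (rh + cscale \<zeta> (t *\<^sub>R z))) 0 = (deriv ^^ m) (%\<zeta>. ?f (of_real t * \<zeta>)) 0"
   unfolding cscale_scaleR ..
  also have "... = of_real t ^ m * (deriv ^^ m) ?f (of_real t * 0)"
  proof (rule higher_deriv_compose_linear[OF holz[of z]])
   fix w :: complex assume "w : ball 0 e"
   hence "cmod w * (\<bar>t\<bar> + 1) < de" by (simp add: e_def less_divide_eq add_nonneg_pos)
   moreover have "\<bar>t\<bar> * cmod w <= cmod w * (\<bar>t\<bar> + 1)" by (simp add: algebra_simps)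
   ultimately show "of_real t * w : ball 0 (R0 / (norm z + 1))" by (simp add: norm_mult de_def)
  qed (use e in auto)
  finally show ?thesis by (simp add: P_def line_coeff_def)
 qed
 \<comment> \<open>Scales tending to 0 that shrink the ball of radius N into the ball of radius r,
   where the estimate holds.\<close>
 define tt where "tt N n = r / (N * real (Suc n))" for N n
 define q where "q N n z = p (rh + tt N n *\<^sub>R z) / of_real (tt N n) ^ m" for N n z
 have tt: "tt N n > 0" "norm z < N ==> norm (tt N n *\<^sub>R z) < r" if "N > 0" for N n z
 proof -
  show *: "tt N n > 0" using that r by (simp add: tt_def)
  assume "norm z < N"
  hence "tt N n * norm z < tt N n * N" using * by simp
  also have "... = r / real (Suc n)" using that by (simp add: tt_def)
  also have "... <= r" using r by (simp add: divide_le_eq)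
  finally show "norm (tt N n *\<^sub>R z) < r" using * by simp
 qed
 have C0: "C \<ge> 0"
 proof -
  have "B \<ge> 0" using order_trans[OF norm_ge_zero B[of rh]] R0 by simp
  thus ?thesis using R0 by (simp add: C_def)
 qed
 have tt0: "(%n. tt N n) \<longlonglongrightarrow> 0" if "N > 0" for N
 proof -
  have "(%n. r / N * inverse (real (Suc n))) \<longlonglongrightarrow> r / N * 0"
   by (intro tendsto_mult tendsto_const LIMSEQ_inverse_real_of_nat)
  thus ?thesis
   by (simp only: tt_def[abs_def] divide_inverse inverse_mult_distrib mult.assoc mult_zero_right)
 qed
 have qest: "cmod (q N n z - P z) <= C * N ^ Suc m * tt N n" if "norm z < N" "N > 0" for N n z
 proof -
  let ?t = "tt N n"
  have t: "?t > 0" using tt that by auto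
  have "cmod (p (rh + ?t *\<^sub>R z) - of_real ?t ^ m * P z) <= C * norm (?t *\<^sub>R z) ^ Suc m"
   unfolding hom[symmetric] using tt that by (intro est) auto
  also have "... <= C * (?t * N) ^ Suc m" using t that C0 by (intro mult_left_mono power_mono) auto
  finally have "cmod (p (rh + ?t *\<^sub>R z) - of_real ?t ^ m * P z) <= (C * N ^ Suc m * ?t) * ?t ^ m"
   by (simp add: power_mult_distrib mult_ac)
  moreover have "q N n z - P z = (p (rh + ?t *\<^sub>R z) - of_real ?t ^ m * P z) / of_real (?t ^ m)"
   using t by (simp add: q_def field_simps)
  hence "cmod (q N n z - P z) = cmod (p (rh + ?t *\<^sub>R z) - of_real ?t ^ m * P z) / ?t ^ m"
   using t by (simp only: norm_divide norm_of_real) simp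
  ultimately show ?thesis using t by (simp add: divide_le_eq)
 qed
 have unif: "uniform_limit (ball 0 N) (q N) P sequentially" if N: "N > 0" for N
 proof (rule uniform_limitI)
  fix e :: real assume "e > 0"
  have "(%n. C * N ^ Suc m * tt N n) \<longlonglongrightarrow> C * N ^ Suc m * 0" by (intro tendsto_intros tt0 N)
  hence "\<forall>\<^sub>F n in sequentially. C * N ^ Suc m * tt N n < e" using \<open>e > 0\<close> by (intro order_tendstoD) auto
  thus "\<forall>\<^sub>F n in sequentially. \<forall>x\<in>ball 0 N. dist (q N n x) (P x) < e"
  proof eventually_elim
   case (elim n)
   show ?case
   proof
    fix x :: "'n cphase" assume "x : ball 0 N"
    hence "norm x < N" by (simp only: mem_ball_0)
    from le_less_trans[OF qest[OF this N] elim] show "dist (q N n x) (P x) < e" by (simp only: dist_norm)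
   qed
  qed
 qed
 have inS: "rh + z : S" if "norm z < r" for z
  using that sub R0 by (auto simp: r_def dist_norm)
 have contq: "continuous_on (ball 0 N) (q N n)" if N: "N > 0" for N n
 proof -
  have "(%z. rh + tt N n *\<^sub>R z) ` ball 0 N \<subseteq> S"
   by (rule image_subsetI, rule inS, rule tt(2)[OF N], simp only: mem_ball_0)
  hence "continuous_on (ball 0 N) (%z. p (rh + tt N n *\<^sub>R z))"
   by (intro continuous_on_compose2[OF holomorphic_cphase_continuous_on[OF p]] continuous_intros)
  thus ?thesis unfolding q_def[abs_def] using tt(1)[OF N, of n] by (intro continuous_intros) auto
 qed
 have cont: "continuous_on UNIV P"
 proof (rule continuous_at_imp_continuous_on, intro ballI)
  fix z :: "'n cphase"
  define N where "N = norm z + 1"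
  have N: "N > 0" "z : ball 0 N" unfolding mem_ball_0 N_def by (simp_all add: add_nonneg_pos del: split_paired_All)
  have "continuous_on (ball 0 N) P"
   by (rule uniform_limit_theorem[OF always_eventually[OF allI[OF contq[OF N(1)]]] unif[OF N(1)] sequentially_bot])
  thus "isCont P z" using N by (metis continuous_on_eq_continuous_at open_ball)
 qed
 have lin: "(%\<tau>. P (v + cscale \<tau> w)) holomorphic_on ball 0 2" for v w
 proof (rule holomorphic_uniform_sequence)
  define N where "N = norm v + 2 * norm w + 1"
  have N: "N > 0" by (simp add: N_def add_nonneg_pos)
  have inN: "norm (v + cscale \<tau> w) < N" if "\<tau> : ball 0 2" for \<tau>
  proof -
   have "norm (v + cscale \<tau> w) <= norm v + cmod \<tau> * norm w" using norm_triangle_ineq[of v "cscale \<tau> w"] by (simp add: norm_cscale)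
   moreover have "cmod \<tau> * norm w <= 2 * norm w" using that by (intro mult_right_mono) auto
   ultimately show ?thesis by (simp add: N_def)
  qed
  show "(%\<tau>. q N n (v + cscale \<tau> w)) holomorphic_on ball 0 2" for n
  proof -
   have "(%\<tau>. p ((rh + tt N n *\<^sub>R v) + cscale \<tau> (tt N n *\<^sub>R w))) holomorphic_on ball 0 2"
   proof (rule holomorphic_cphase_line_on[OF p])
    fix \<tau> :: complex assume \<tau>: "\<tau> : ball 0 2"
    have "rh + tt N n *\<^sub>R (v + cscale \<tau> w) : S" using tt(2)[OF N inN[OF \<tau>]] by (rule inS)
    thus "rh + tt N n *\<^sub>R v + cscale \<tau> (tt N n *\<^sub>R w) : S"
     by (simp add: scaleR_add_right add.assoc cscale_scaleR scaleR_cscale)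
   qed
   hence "(%\<tau>. p (rh + tt N n *\<^sub>R (v + cscale \<tau> w))) holomorphic_on ball 0 2"
    by (simp add: scaleR_add_right add.assoc cscale_scaleR scaleR_cscale)
   thus ?thesis unfolding q_def using tt(1)[OF N, of n]
    by (intro holomorphic_on_divide holomorphic_on_const) auto
  qed
  fix x :: complex assume x: "x : ball 0 2"
  then obtain d where d: "d > 0" "cball x d \<subseteq> ball 0 2"
   using open_contains_cball_eq[OF open_ball[of "0::complex" 2]] by metis
  have "uniform_limit (cball x d) (%n \<tau>. q N n (v + cscale \<tau> w)) (%\<tau>. P (v + cscale \<tau> w)) sequentially"
  proof (rule uniform_limitI)
   fix e :: real assume "e > 0"
   from uniform_limitD[OF unif[OF N] this]
   show "\<forall>\<^sub>F n in sequentially. \<forall>\<tau>\<in>cball x d. dist (q N n (v + cscale \<tau> w)) (P (v + cscale \<tau> w)) < e"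
   proof eventually_elim
    case (elim n)
    show ?case
    proof
     fix \<tau> assume "\<tau> : cball x d"
     hence "\<tau> : ball 0 2" using d(2) by (rule subsetD[rotated])
     hence "v + cscale \<tau> w : ball 0 N" using inN by (simp only: mem_ball_0)
     thus "dist (q N n (v + cscale \<tau> w)) (P (v + cscale \<tau> w)) < e" using elim by (rule bspec[rotated])
    qed
   qed
  qed
  thus "\<exists>d>0. cball x d \<subseteq> ball 0 2 & uniform_limit (cball x d) (%n \<tau>. q N n (v + cscale \<tau> w)) (%\<tau>. P (v + cscale \<tau> w)) sequentially"
   using d by (intro exI[of _ d] conjI)
 qed (rule open_ball)
 have nonzero: "\<exists>z. P z ~= 0" using m unfolding P_def .
 show thesis
  by (rule that[of r P C m]) (fact r est hom cont lin nonzero)+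
qed

lemma holomorphic_vanishing_on_real:
 assumes "f holomorphic_on ball 0 2" "!!t::real. \<bar>t\<bar> < 2 ==> f (of_real t) = 0" "z : ball 0 2"
 shows "f z = 0"
proof (rule analytic_continuation[OF assms(1), of "of_real ` {-1..1}" 0])
 have "(0::complex) islimpt (of_real ` {-1..1})"
 proof (rule islimpt_approachable[THEN iffD2], intro allI impI)
  fix e :: real assume "e > 0"
  define t where "t = min 1 (e / 2)"
  have "t > 0" "t <= 1" "t < e" using \<open>e > 0\<close> by (auto simp: t_def)
  hence "complex_of_real t : of_real ` {-1..1}" "complex_of_real t ~= 0" "dist (complex_of_real t) 0 < e"
   by (auto intro!: imageI)
  thus "\<exists>x'\<in>complex_of_real ` {-1..1}. x' ~= 0 & dist x' 0 < e" by blast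
 qed
 thus "(0::complex) islimpt (of_real ` {-1..1})" .
 show "of_real ` {-1..1} \<subseteq> ball (0::complex) 2" by auto
qed (use assms in auto)

text \<open>If P vanished on E, it would vanish at v + \<tau> w for all real \<tau>, by the identity
  theorem also at \<tau> = \<i>, and that point is z.\<close>

lemma leading_form_nonzero_on_totally_real:
 assumes "!!v w. (%\<tau>. P (v + cscale \<tau> w)) holomorphic_on ball 0 2" "P z ~= 0"
  and "!!v w t. v : E ==> w : E ==> v + t *\<^sub>R w : E"
  and "v : E" "w : E" "z = v + mult_i w"
 shows "\<exists>v\<in>E. P v ~= 0"
proof (rule ccontr)
 assume "\<not> ?thesis"
 hence van: "P (v + cscale (of_real t) w) = 0" for t
  using assms(3)[OF assms(4,5), of t] by (simp only: cscale_of_real) fast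
 have "P (v + cscale \<i> w) = 0"
  using holomorphic_vanishing_on_real[OF assms(1)[of v w] van, of \<i>] by simp
 thus False using assms(2,6) by (simp only: cscale_i)
qed

section \<open>The symplectic volume in coordinates\<close>

text \<open>The Leibniz determinant over an arbitrary index set, so that \<open>Basis\<close> itself
  can index rows and columns.\<close>

definition det_on :: "'i set => ('i => 'i => real) => real" where
 "det_on B M = (\<Sum>\<pi> | \<pi> permutes B. of_int (sign \<pi>) * (\<Prod>b\<in>B. M b (\<pi> b)))"

lemma det_on_compose_permutes:
 assumes "finite B" "G permutes B"
 shows "(\<Sum>\<pi> | \<pi> permutes B. of_int (sign \<pi>) * (\<Prod>b\<in>B. M (G b) (\<pi> b))) = of_int (sign G) * det_on B M"
proof -
 have "(\<Sum>\<pi> | \<pi> permutes B. of_int (sign \<pi>) * (\<Prod>b\<in>B. M (G b) (\<pi> b)))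
  = (\<Sum>\<pi> | \<pi> permutes B. of_int (sign (\<pi> \<circ> G)) * (\<Prod>b\<in>B. M (G b) ((\<pi> \<circ> G) b)))"
  by (rule sum_permutations_compose_right[OF assms(2)])
 also have "... = (\<Sum>\<pi> | \<pi> permutes B. of_int (sign G) * (of_int (sign \<pi>) * (\<Prod>b\<in>B. M b (\<pi> b))))"
 proof (rule sum.cong[OF refl], clarify)
  fix \<pi> assume p: "\<pi> permutes B"
  have "(\<Prod>b\<in>B. M (G b) ((\<pi> \<circ> G) b)) = (\<Prod>b\<in>B. M b (\<pi> b))"
   using prod.permute[OF assms(2), of "%b. M b (\<pi> b)"] by (simp add: o_def)
  moreover have "sign (\<pi> \<circ> G) = sign \<pi> * sign G"
   using p assms by (intro sign_compose) (auto intro: permutes_imp_permutation)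
  ultimately show "of_int (sign (\<pi> \<circ> G)) * (\<Prod>b\<in>B. M (G b) ((\<pi> \<circ> G) b)) = of_int (sign G) * (of_int (sign \<pi>) * (\<Prod>b\<in>B. M b (\<pi> b)))"
   by simp
 qed
 finally show ?thesis by (simp add: det_on_def sum_distrib_left)
qed

text \<open>Two equal rows: composing with the transposition of a and c permutes the terms and
  reverses their signs, so the sum is its own negative.\<close>

lemma det_on_compose_noninjective:
 assumes "finite B" "a : B" "c : B" "a ~= c" "G a = G c"
 shows "(\<Sum>\<pi> | \<pi> permutes B. of_int (sign \<pi>) * (\<Prod>b\<in>B. M (G b) (\<pi> b))) = (0::real)" (is "?S = 0")
proof -
 define \<tau> where "\<tau> = Transposition.transpose a c"
 have t: "\<tau> permutes B" unfolding \<tau>_def using assms by (intro permutes_swap_id)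
 have G: "G (\<tau> b) = G b" for b using assms(5) by (auto simp: \<tau>_def Transposition.transpose_def)
 have "?S = (\<Sum>\<pi> | \<pi> permutes B. of_int (sign (\<pi> \<circ> \<tau>)) * (\<Prod>b\<in>B. M (G b) ((\<pi> \<circ> \<tau>) b)))"
  by (rule sum_permutations_compose_right[OF t])
 also have "... = (\<Sum>\<pi> | \<pi> permutes B. - (of_int (sign \<pi>) * (\<Prod>b\<in>B. M (G b) (\<pi> b))))"
 proof (rule sum.cong[OF refl], clarify)
  fix \<pi> assume p: "\<pi> permutes B"
  have "(\<Prod>b\<in>B. M (G b) ((\<pi> \<circ> \<tau>) b)) = (\<Prod>b\<in>B. M (G (\<tau> b)) (\<pi> (\<tau> b)))" by (simp add: G)
  also have "... = (\<Prod>b\<in>B. M (G b) (\<pi> b))"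
   using prod.permute[OF t, of "%b. M (G b) (\<pi> b)"] by (simp add: o_def)
  finally have "(\<Prod>b\<in>B. M (G b) ((\<pi> \<circ> \<tau>) b)) = (\<Prod>b\<in>B. M (G b) (\<pi> b))" .
  moreover have "sign (\<pi> \<circ> \<tau>) = sign \<pi> * sign \<tau>"
   using p t assms(1) by (intro sign_compose) (auto intro: permutes_imp_permutation)
  moreover have "sign \<tau> = -1" unfolding \<tau>_def using assms(4) by (simp add: sign_swap_id)
  ultimately show "of_int (sign (\<pi> \<circ> \<tau>)) * (\<Prod>b\<in>B. M (G b) ((\<pi> \<circ> \<tau>) b)) = - (of_int (sign \<pi>) * (\<Prod>b\<in>B. M (G b) (\<pi> b)))"
   by simp
 qed
 also have "... = - ?S" by (simp add: sum_negf)
 finally show ?thesis by simp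
qed

lemma det_on_reindex:
 assumes "bij_betw e A B" "finite A"
 shows "det_on B M = det_on A (%i j. M (e i) (e j))"
proof -
 have inj: "inj_on e A" using assms(1) by (simp add: bij_betw_def)
 have bij: "bij_betw (map_permutation A e) {\<pi>. \<pi> permutes A} {\<pi>. \<pi> permutes B}"
 proof (rule bij_betw_byWitness[where f' = "map_permutation B (inv_into A e)"])
  show "\<forall>a\<in>{\<pi>. \<pi> permutes A}. map_permutation B (inv_into A e) (map_permutation A e a) = a"
   using assms(1) inj by (auto intro!: map_permutation_compose_inv)
  have b': "bij_betw (inv_into A e) B A" using assms(1) by (rule bij_betw_inv_into)
  show "\<forall>a'\<in>{\<pi>. \<pi> permutes B}. map_permutation A e (map_permutation B (inv_into A e) a') = a'"
   using b' assms(1) by (auto intro!: map_permutation_compose_inv simp: bij_betw_inv_into_right)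
  show "map_permutation A e ` {\<pi>. \<pi> permutes A} \<subseteq> {\<pi>. \<pi> permutes B}"
   using map_permutation_permutes[OF assms(1)] by auto
  show "map_permutation B (inv_into A e) ` {\<pi>. \<pi> permutes B} \<subseteq> {\<pi>. \<pi> permutes A}"
   using map_permutation_permutes[OF b'] by auto
 qed
 have "det_on B M = (\<Sum>\<pi> | \<pi> permutes A. of_int (sign (map_permutation A e \<pi>)) * (\<Prod>b\<in>B. M b (map_permutation A e \<pi> b)))"
  unfolding det_on_def using sum.reindex_bij_betw[OF bij, of "%\<pi>. of_int (sign \<pi>) * (\<Prod>b\<in>B. M b (\<pi> b))"] by simp
 also have "... = (\<Sum>\<pi> | \<pi> permutes A. of_int (sign \<pi>) * (\<Prod>i\<in>A. M (e i) (e (\<pi> i))))"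
 proof (rule sum.cong[OF refl], clarify)
  fix \<pi> assume p: "\<pi> permutes A"
  have "(\<Prod>b\<in>B. M b (map_permutation A e \<pi> b)) = (\<Prod>i\<in>A. M (e i) (map_permutation A e \<pi> (e i)))"
   using prod.reindex_bij_betw[OF assms(1), of "%b. M b (map_permutation A e \<pi> b)"] by simp
  also have "... = (\<Prod>i\<in>A. M (e i) (e (\<pi> i)))"
   using map_permutation_apply[OF inj] by (intro prod.cong) auto
  finally show "of_int (sign (map_permutation A e \<pi>)) * (\<Prod>b\<in>B. M b (map_permutation A e \<pi> b)) = of_int (sign \<pi>) * (\<Prod>i\<in>A. M (e i) (e (\<pi> i)))"
   using sign_map_permutation[OF inj p assms(2)] by simp
 qed
 finally show ?thesis by (simp add: det_on_def)
qed

lemma prod_Basis_cvec: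
 fixes f :: "complex ^ 'n::finite => 'b::comm_monoid_mult"
 shows "(\<Prod>b\<in>Basis. f b) = (\<Prod>j\<in>UNIV. f (axis j 1) * f (axis j \<i>))"
proof -
 let ?h = "%(j, u). axis j u :: complex ^ 'n"
 have B: "(Basis :: (complex ^ 'n) set) = ?h ` (UNIV \<times> {1, \<i>})"
  by (auto simp: Basis_vec_def Basis_complex_def)
 have inj: "inj_on ?h (UNIV \<times> {1, \<i>})"
  by (auto simp: inj_on_def axis_eq_axis)
 have "(\<Prod>b\<in>Basis. f b) = (\<Prod>x\<in>UNIV \<times> {1, \<i>}. f (?h x))"
  unfolding B using prod.reindex[OF inj, of f] by (simp add: o_def case_prod_unfold)
 also have "... = (\<Prod>j\<in>UNIV. \<Prod>u\<in>{1, \<i>}. f (axis j u))"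
  by (subst prod.Sigma) (auto simp: case_prod_unfold)
 also have "... = (\<Prod>j\<in>UNIV. f (axis j 1) * f (axis j \<i>))"
  by (simp add: complex_eq_iff)
 finally show ?thesis .
qed

lemma axis_in_Basis: "axis j 1 : (Basis :: (complex ^ 'n::finite) set)" "axis j \<i> : (Basis :: (complex ^ 'n) set)"
 by (auto simp: Basis_vec_def Basis_complex_def)

lemma Basis_cvec_cases:
 assumes "b : (Basis :: (complex ^ 'n::finite) set)"
 obtains j where "b = axis j 1" | j where "b = axis j \<i>"
 using assms by (auto simp: Basis_vec_def Basis_complex_def)

text \<open>Up to the factor 2^n n! this is the Pfaffian of the matrix of \<sigma> on the frame v.
  It is kept complex and signed because the transformation rule is algebraic.\<close>

definition pfaff :: "((complex ^ 'n) => 'n::finite cphase) => complex" where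
 "pfaff v = (\<Sum>\<pi> | \<pi> permutes (Basis :: (complex ^ 'n) set).
   of_int (sign \<pi>) * (\<Prod>j\<in>UNIV. csympl (v (\<pi> (axis j 1))) (v (\<pi> (axis j \<i>)))))"

lemma sympl_density_pfaff: "sympl_density D = cmod (pfaff D / 2 ^ CARD('n)) / fact CARD('n)"
 for D :: "(complex ^ 'n) => 'n::finite cphase"
 by (simp add: sympl_density_def pfaff_def)

lemma csympl_add_left: "csympl (u + v) w = csympl u w + csympl v w"
 by (simp add: csympl_def sum.distrib[symmetric] algebra_simps)
lemma csympl_add_right: "csympl w (u + v) = csympl w u + csympl w v"
 by (simp add: csympl_def sum.distrib[symmetric] algebra_simps)
lemma csympl_scaleR_left: "csympl (r *\<^sub>R u) w = of_real r * csympl u w"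
 unfolding csympl_def sum_distrib_left by (intro sum.cong) (auto simp: scaleR_conv_of_real[where 'a=complex] algebra_simps)
lemma csympl_scaleR_right: "csympl w (r *\<^sub>R u) = of_real r * csympl w u"
 unfolding csympl_def sum_distrib_left by (intro sum.cong) (auto simp: scaleR_conv_of_real[where 'a=complex] algebra_simps)
lemma csympl_zero [simp]: "csympl 0 w = 0" "csympl w 0 = 0"
 by (simp_all add: csympl_def)
lemma csympl_anti: "csympl u v = - csympl v u"
 unfolding csympl_def sum_negf[symmetric] by (intro sum.cong) (auto simp: algebra_simps)
lemma csympl_mult_i: "csympl (mult_i u) v = \<i> * csympl u v" "csympl u (mult_i v) = \<i> * csympl u v"
 unfolding csympl_def mult_i_def sum_distrib_left by (auto intro!: sum.cong simp: algebra_simps)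
lemma csympl_sum_left: "csympl (\<Sum>i\<in>I. u i) w = (\<Sum>i\<in>I. csympl (u i) w)"
 by (induction I rule: infinite_finite_induct) (auto simp: csympl_add_left)
lemma csympl_sum_right: "csympl w (\<Sum>i\<in>I. u i) = (\<Sum>i\<in>I. csympl w (u i))"
 by (induction I rule: infinite_finite_induct) (auto simp: csympl_add_right)

text \<open>The rule Pf (M^T A M) = det M Pf A. Bilinear expansion turns the product of sums into a
  sum over choices of basis vectors; choices with a repetition cancel by
  \<open>det_on_compose_noninjective\<close>, and the others are permutations, each contributing its
  sign times the determinant.\<close>

lemma pfaff_linear_combination:
 fixes v :: "(complex ^ 'n) => 'n::finite cphase"
 shows "pfaff (%b. \<Sum>c\<in>Basis. M c b *\<^sub>R v c) = of_real (det_on Basis M) * pfaff v"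
proof -
 let ?B = "Basis :: (complex ^ 'n) set"
 let ?e = "%g (b::complex^'n). \<Sum>c\<in>?B. M c b *\<^sub>R v c"
 \<comment> \<open>A choice g of two basis vectors for every j is read as a self-map of
   \<open>Basis\<close>, with the first one at \<open>axis j 1\<close> and the second at
   \<open>axis j \<i>\<close>. The inner product with the all-ones vector tells the two kinds apart,
   being 1 and 0. The identity outside \<open>Basis\<close> is what \<open>permutes\<close> asks
   for.\<close>
 define Gf where "Gf g b = (if b : ?B then if b \<bullet> (\<chi> i. 1) = 1 then fst (g (THE j. b = axis j 1)) else snd (g (THE j. b = axis j \<i>)) else b)"
  for g :: "'n => (complex ^ 'n) \<times> (complex ^ 'n)" and b
 have the: "(THE k. axis j x = (axis k x :: complex ^ 'n)) = j" if "x ~= 0" for j x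
  using that by (intro the_equality) (auto simp: axis_eq_axis)
 have G1: "Gf g (axis j 1) = fst (g j)" for g j
  using axis_in_Basis(1)[of j] by (simp add: Gf_def inner_axis' the)
 have G2: "Gf g (axis j \<i>) = snd (g j)" for g j
  using axis_in_Basis(2)[of j] by (simp add: Gf_def inner_axis' the)
 have Gout: "b \<notin> ?B ==> Gf g b = b" for g b by (simp add: Gf_def)
 let ?P = "%g. \<Prod>j\<in>UNIV. csympl (v (fst (g j))) (v (snd (g j)))"
 let ?X = "PiE (UNIV :: 'n set) (%_. ?B \<times> ?B)"
 have expand: "(\<Prod>j\<in>UNIV. csympl (\<Sum>c\<in>?B. M c (\<pi> (axis j 1)) *\<^sub>R v c) (\<Sum>c\<in>?B. M c (\<pi> (axis j \<i>)) *\<^sub>R v c))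
  = (\<Sum>g\<in>?X. of_real (\<Prod>b\<in>?B. M (Gf g b) (\<pi> b)) * ?P g)" for \<pi>
 proof -
  have "csympl (\<Sum>c\<in>?B. M c (\<pi> (axis j 1)) *\<^sub>R v c) (\<Sum>c\<in>?B. M c (\<pi> (axis j \<i>)) *\<^sub>R v c)
   = (\<Sum>x\<in>?B \<times> ?B. of_real (M (fst x) (\<pi> (axis j 1)) * M (snd x) (\<pi> (axis j \<i>))) * csympl (v (fst x)) (v (snd x)))" for j
   unfolding csympl_sum_left csympl_scaleR_left
   unfolding csympl_sum_right csympl_scaleR_right sum_distrib_left sum.cartesian_product
   by (intro sum.cong) auto
  hence "(\<Prod>j\<in>UNIV. csympl (\<Sum>c\<in>?B. M c (\<pi> (axis j 1)) *\<^sub>R v c) (\<Sum>c\<in>?B. M c (\<pi> (axis j \<i>)) *\<^sub>R v c))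
   = (\<Sum>g\<in>?X. \<Prod>j\<in>UNIV. of_real (M (fst (g j)) (\<pi> (axis j 1)) * M (snd (g j)) (\<pi> (axis j \<i>))) * csympl (v (fst (g j))) (v (snd (g j))))"
   by (simp only:) (rule prod_sum_PiE, auto)
  also have "... = (\<Sum>g\<in>?X. of_real (\<Prod>b\<in>?B. M (Gf g b) (\<pi> b)) * ?P g)"
  proof (rule sum.cong[OF refl])
   fix g
   have "(\<Prod>b\<in>?B. M (Gf g b) (\<pi> b)) = (\<Prod>j\<in>UNIV. M (fst (g j)) (\<pi> (axis j 1)) * M (snd (g j)) (\<pi> (axis j \<i>)))"
    unfolding prod_Basis_cvec G1 G2 ..
   thus "(\<Prod>j\<in>UNIV. of_real (M (fst (g j)) (\<pi> (axis j 1)) * M (snd (g j)) (\<pi> (axis j \<i>))) * csympl (v (fst (g j))) (v (snd (g j))))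
    = of_real (\<Prod>b\<in>?B. M (Gf g b) (\<pi> b)) * ?P g"
    by (simp add: prod.distrib)
  qed
  finally show ?thesis .
 qed
 have "pfaff (%b. \<Sum>c\<in>?B. M c b *\<^sub>R v c)
  = (\<Sum>\<pi> | \<pi> permutes ?B. \<Sum>g\<in>?X. of_int (sign \<pi>) * (of_real (\<Prod>b\<in>?B. M (Gf g b) (\<pi> b)) * ?P g))"
  unfolding pfaff_def expand sum_distrib_left ..
 also have "... = (\<Sum>g\<in>?X. \<Sum>\<pi> | \<pi> permutes ?B. of_int (sign \<pi>) * (of_real (\<Prod>b\<in>?B. M (Gf g b) (\<pi> b)) * ?P g))"
  by (rule sum.swap)
 also have "... = (\<Sum>g\<in>?X. of_real (\<Sum>\<pi> | \<pi> permutes ?B. of_int (sign \<pi>) * (\<Prod>b\<in>?B. M (Gf g b) (\<pi> b))) * ?P g)"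
  by (simp add: sum_distrib_right mult.assoc)
 also have "... = (\<Sum>g\<in>{g\<in>?X. inj_on (Gf g) ?B}. of_real (\<Sum>\<pi> | \<pi> permutes ?B. of_int (sign \<pi>) * (\<Prod>b\<in>?B. M (Gf g b) (\<pi> b))) * ?P g)"
 proof (rule sum.mono_neutral_right)
  show "finite ?X" by (intro finite_PiE) auto
  show "\<forall>g\<in>?X - {g\<in>?X. inj_on (Gf g) ?B}. of_real (\<Sum>\<pi> | \<pi> permutes ?B. of_int (sign \<pi>) * (\<Prod>b\<in>?B. M (Gf g b) (\<pi> b))) * ?P g = 0"
  proof
   fix g assume "g : ?X - {g\<in>?X. inj_on (Gf g) ?B}"
   then obtain a c where "a : ?B" "c : ?B" "a ~= c" "Gf g a = Gf g c" by (auto simp: inj_on_def)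
   from det_on_compose_noninjective[OF finite_Basis this, of M]
   show "of_real (\<Sum>\<pi> | \<pi> permutes ?B. of_int (sign \<pi>) * (\<Prod>b\<in>?B. M (Gf g b) (\<pi> b))) * ?P g = 0" by simp
  qed
 qed auto
 also have "... = (\<Sum>G | G permutes ?B. of_real (det_on ?B M) * (of_int (sign G) * (\<Prod>j\<in>UNIV. csympl (v (G (axis j 1))) (v (G (axis j \<i>))))))"
 proof (rule sum.reindex_bij_witness[where i = "%G j. (G (axis j 1), G (axis j \<i>))" and j = Gf])
  fix g assume "g : {g : ?X. inj_on (Gf g) ?B}"
  hence g: "!!j. fst (g j) : ?B & snd (g j) : ?B" "inj_on (Gf g) ?B"
   by (auto simp: PiE_def Pi_def mem_Times_iff)
  show "(%j. (Gf g (axis j 1), Gf g (axis j \<i>))) = g" by (simp add: G1 G2)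
  have "Gf g ` ?B \<subseteq> ?B"
  proof
   fix x assume "x : Gf g ` ?B"
   then obtain b where "b : ?B" "x = Gf g b" by auto
   thus "x : ?B" using g(1) by (auto elim!: Basis_cvec_cases simp: G1 G2)
  qed
  hence "bij_betw (Gf g) ?B ?B" using g(2) by (simp add: bij_betw_def endo_inj_surj)
  hence perm: "Gf g permutes ?B" using Gout by (intro bij_imp_permutes)
  thus "Gf g : {G. G permutes ?B}" by simp
  show "of_real (det_on ?B M) * (of_int (sign (Gf g)) * (\<Prod>j\<in>UNIV. csympl (v (Gf g (axis j 1))) (v (Gf g (axis j \<i>)))))
   = of_real (\<Sum>\<pi> | \<pi> permutes ?B. of_int (sign \<pi>) * (\<Prod>b\<in>?B. M (Gf g b) (\<pi> b))) * ?P g"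
   unfolding det_on_compose_permutes[OF finite_Basis perm] G1 G2 by simp
 next
  fix G assume "G : {G. G permutes ?B}"
  hence G: "G permutes ?B" by simp
  let ?g = "%j. (G (axis j 1), G (axis j \<i>))"
  have eq: "Gf ?g = G"
  proof
   fix b
   show "Gf ?g b = G b"
   proof (cases "b : ?B")
    case True
    thus ?thesis by (elim Basis_cvec_cases) (auto simp: G1 G2)
   next
    case False
    thus ?thesis using Gout permutes_not_in[OF G] by simp
   qed
  qed
  thus "Gf ?g = G" .
  show "?g : {g : ?X. inj_on (Gf g) ?B}"
   unfolding mem_Collect_eq eq using permutes_inj_on[OF G] permutes_in_image[OF G] axis_in_Basis
   by (auto simp: PiE_def Pi_def)
 qed
 finally show ?thesis by (simp add: pfaff_def sum_distrib_left)
qed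

definition abs_det :: "('a::euclidean_space => 'a) => real" where
 "abs_det A = \<bar>det_on Basis (%b c. A c \<bullet> b)\<bar>"

lemma sympl_density_compose:
 assumes "linear D"
 shows "sympl_density (%v. D (A v)) = abs_det A * sympl_density D"
proof -
 have "D (A b) = (\<Sum>c\<in>Basis. (A b \<bullet> c) *\<^sub>R D c)" for b
 proof -
  have "D (A b) = D (\<Sum>c\<in>Basis. (A b \<bullet> c) *\<^sub>R c)" by (simp add: euclidean_representation)
  thus ?thesis using assms by (simp add: linear_sum linear_scale)
 qed
 thus ?thesis
  using pfaff_linear_combination[of "%c b. A b \<bullet> c" D]
  by (simp add: sympl_density_pfaff norm_mult norm_divide abs_det_def)
qed

lemma sympl_density_nonneg: "0 <= sympl_density D"
 by (simp add: sympl_density_def)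

section \<open>Change of variables for nonnegative integrals\<close>

lemma set_nn_integral_has_integral_euclidean:
 fixes f :: "'a::euclidean_space => real"
 assumes "(f has_integral I) S" "(%x. indicator S x * f x) : borel_measurable borel"
  and "!!x. x : S ==> 0 <= f x"
 shows "(\<integral>\<^sup>+x\<in>S. ennreal (f x) \<partial>lborel) = ennreal I"
proof -
 have "((%x. indicator S x * f x) has_integral I) UNIV"
  using assms(1) by (simp add: indicator_def of_bool_def if_distrib[of "%c. c * _"] has_integral_restrict_UNIV cong: if_cong)
 hence "(\<integral>\<^sup>+x. ennreal (indicator S x * f x) \<partial>lborel) = ennreal I"
  using assms by (intro nn_integral_has_integral_lborel) (auto simp: indicator_def)
 moreover have "ennreal (indicator S x * f x) = ennreal (f x) * indicator S x" for x by (simp add: indicator_def)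
 ultimately show ?thesis by simp
qed

lemma set_nn_integral_finite_has_integral:
 fixes f :: "'a::euclidean_space => real"
 assumes m: "(%x. indicator S x * f x) : borel_measurable borel"
  and nn: "!!x. x : S ==> 0 <= f x" and fin: "(\<integral>\<^sup>+x\<in>S. ennreal (f x) \<partial>lborel) < \<infinity>"
 shows "f absolutely_integrable_on S"
proof -
 have eq: "ennreal (indicator S x * f x) = ennreal (f x) * indicator S x" for x by (simp add: indicator_def)
 have "integrable lborel (%x. indicator S x * f x)"
 proof (rule integrableI_nonneg)
  show "AE x in lborel. 0 <= indicator S x * f x" using nn by (intro AE_I2) (simp add: indicator_def)
  show "(\<integral>\<^sup>+ x. ennreal (indicator S x * f x) \<partial>lborel) < \<infinity>" using fin by (simp only: eq)
 qed (use m in simp)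
 hence "integrable lebesgue (%x. indicator S x *\<^sub>R f x)"
  using m by (simp add: integrable_completion)
 thus ?thesis by (simp add: set_integrable_def)
qed

text \<open>The change of variables for absolutely integrable functions transfers integrability in
  both directions. For a nonnegative function, finiteness of either integral is integrability, and
  otherwise both are infinite; so equality holds in \<open>ennreal\<close> without an integrability
  hypothesis.\<close>

lemma nn_integral_change_of_variables_cart:
 fixes g :: "real ^ 'm::{finite,wellorder} => real ^ 'm::_" and h :: "real ^ 'm::_ => real"
 assumes U: "open U" and der: "!!x. x : U ==> (g has_derivative g' x) (at x)" and inj: "inj_on g U"
  and mh: "(%x. indicator (g ` U) x * h x) : borel_measurable borel"
  and mg: "(%x. indicator U x * (\<bar>det (matrix (g' x))\<bar> * h (g x))) : borel_measurable borel"
  and nn: "!!x. 0 <= h x"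
 shows "(\<integral>\<^sup>+x\<in>g ` U. ennreal (h x) \<partial>lborel) = (\<integral>\<^sup>+x\<in>U. ennreal (\<bar>det (matrix (g' x))\<bar> * h (g x)) \<partial>lborel)"
  (is "?A = ?B")
proof -
 have cov: "(%x. \<bar>det (matrix (g' x))\<bar> * h (g x)) absolutely_integrable_on U &
      integral U (%x. \<bar>det (matrix (g' x))\<bar> * h (g x)) = b
   \<longleftrightarrow> h absolutely_integrable_on (g ` U) & integral (g ` U) h = b" for b
 proof -
  have "(%x. \<bar>det (matrix (g' x))\<bar> *\<^sub>R vec (h (g x)) :: real ^ 1) absolutely_integrable_on U &
      integral U (%x. \<bar>det (matrix (g' x))\<bar> *\<^sub>R vec (h (g x))) = (vec b :: real ^ 1)
     \<longleftrightarrow> (%x. vec (h x) :: real ^ 1) absolutely_integrable_on (g ` U) &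
      integral (g ` U) (%x. vec (h x)) = (vec b :: real ^ 1)"
   using U der inj by (intro has_absolute_integral_change_of_variables) (auto intro: has_derivative_at_withinI)
  thus ?thesis by (simp add: absolutely_integrable_on_1_iff integral_on_1_eq)
 qed
 have eqI: "?A = ?B" if "h absolutely_integrable_on (g ` U)"
 proof -
  define b where "b = integral (g ` U) h"
  have c: "(%x. \<bar>det (matrix (g' x))\<bar> * h (g x)) absolutely_integrable_on U"
    "integral U (%x. \<bar>det (matrix (g' x))\<bar> * h (g x)) = b"
   using cov[of b] that b_def by auto
  have "?A = ennreal b"
   using that mh nn unfolding b_def
   by (intro set_nn_integral_has_integral_euclidean integrable_integral) (auto dest: set_lebesgue_integral_eq_integral(1))
  moreover have "?B = ennreal b"
   using c(1) mg nn unfolding c(2)[symmetric]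
   by (intro set_nn_integral_has_integral_euclidean integrable_integral) (auto dest: set_lebesgue_integral_eq_integral(1))
  ultimately show ?thesis by simp
 qed
 show ?thesis
 proof (cases "?A < \<infinity>")
  case True
  thus ?thesis using mh nn by (intro eqI set_nn_integral_finite_has_integral) auto
 next
  case A: False
  show ?thesis
  proof (cases "?B < \<infinity>")
   case True
   hence "(%x. \<bar>det (matrix (g' x))\<bar> * h (g x)) absolutely_integrable_on U"
    using mg nn by (intro set_nn_integral_finite_has_integral) auto
   hence "h absolutely_integrable_on (g ` U)" using cov by blast
   thus ?thesis by (rule eqI)
  next
   case False
   thus ?thesis using A by (simp add: less_top[symmetric] infinity_ennreal_def)
  qed
 qed
qed

lemma ex_basis_enumeration: "\<exists>e :: 'n::finite bit0 => complex ^ 'n. bij_betw e UNIV Basis"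
 by (rule finite_same_card_bij) (simp_all add: mult.commute)

lemma prod_Basis_cart:
 fixes f :: "real ^ 'm::finite => 'b::comm_monoid_mult"
 shows "(\<Prod>b\<in>Basis. f b) = (\<Prod>i\<in>UNIV. f (axis i 1))"
proof -
 have B: "(Basis :: (real ^ 'm) set) = (%i. axis i 1) ` UNIV" by (auto simp: Basis_vec_def)
 have inj: "inj (%i. axis i 1 :: real ^ 'm)" by (auto simp: inj_on_def axis_eq_axis)
 show ?thesis unfolding B by (simp add: prod.reindex[OF inj])
qed

text \<open>Coordinates with respect to an enumeration of \<open>Basis\<close> carry everything to a
  real Cartesian space; they preserve Lebesgue measure, and the determinant taken there is
  \<open>det_on Basis\<close> after reindexing.\<close>

theorem nn_integral_change_of_variables:
 fixes th :: "complex ^ 'n::finite => complex ^ 'n" and h :: "complex ^ 'n => real"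
 assumes U: "open U" and der: "!!y. y : U ==> (th has_derivative th' y) (at y)" and inj: "inj_on th U"
  and mh: "(%x. indicator (th ` U) x * h x) : borel_measurable borel"
  and mg: "(%y. indicator U y * (abs_det (th' y) * h (th y))) : borel_measurable borel"
  and nn: "!!x. 0 <= h x"
 shows "(\<integral>\<^sup>+x\<in>th ` U. ennreal (h x) \<partial>lborel) = (\<integral>\<^sup>+y\<in>U. ennreal (abs_det (th' y) * h (th y)) \<partial>lborel)"
proof -
 \<comment> \<open>The index type \<open>'n bit0\<close> has 2n elements and carries the well-order
   that \<open>nn_integral_change_of_variables_cart\<close> asks of its index type.\<close>
 obtain e :: "'n bit0 => complex ^ 'n" where e: "bij_betw e UNIV Basis" using ex_basis_enumeration by blast
 have eB: "e i : Basis" for i using e by (auto simp: bij_betw_def)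
 have ee: "e i \<bullet> e j = (if i = j then 1 else 0)" for i j
  using e eB by (auto simp: inner_Basis bij_betw_def inj_on_def)
 define J :: "complex ^ 'n => real ^ 'n bit0" where "J x = (\<chi> i. x \<bullet> e i)" for x
 define K :: "real ^ 'n bit0 => complex ^ 'n" where "K z = (\<Sum>i\<in>UNIV. z $ i *\<^sub>R e i)" for z
 have KJ: "K (J x) = x" for x
 proof -
  have "K (J x) = (\<Sum>b\<in>Basis. (x \<bullet> b) *\<^sub>R b)"
   using sum.reindex_bij_betw[OF e, of "%b. (x \<bullet> b) *\<^sub>R b"] by (simp add: K_def J_def)
  thus ?thesis by (simp add: euclidean_representation)
 qed
 have Ke: "K z \<bullet> e i = z $ i" for z i
  by (simp add: K_def inner_sum_left ee if_distrib[of "%c. _ * c"] cong: if_cong)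
 have JK: "J (K z) = z" for z by (simp add: vec_eq_iff J_def Ke)
 have linJ: "bounded_linear J" unfolding J_def[abs_def]
  by (intro linear_conv_bounded_linear[THEN iffD1] linearI) (auto simp: vec_eq_iff inner_add_left)
 have linK: "bounded_linear K" unfolding K_def[abs_def]
  by (intro linear_conv_bounded_linear[THEN iffD1] linearI) (auto simp: algebra_simps sum.distrib scaleR_sum_right)
 have contK: "continuous_on S K" for S using linK by (rule linear_continuous_on)
 have contJ: "continuous_on S J" for S using linJ by (rule linear_continuous_on)
 have mK [measurable]: "K : borel_measurable borel" using contK by (intro borel_measurable_continuous_onI)
 have Kaxis: "K (axis j 1) = e j" for j
  by (simp add: K_def axis_def if_distrib[of "%c. c *\<^sub>R _"] cong: if_cong)
 have lb: "(lborel :: (complex ^ 'n) measure) = distr lborel borel K"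
 proof (rule lborel_eqI)
  fix l u :: "complex ^ 'n" assume lu: "!!b. b : Basis ==> l \<bullet> b <= u \<bullet> b"
  have all: "(\<forall>b\<in>Basis. P b) \<longleftrightarrow> (\<forall>i. P (e i))" for P
  proof -
   have B: "range e = Basis" using e by (simp add: bij_betw_def)
   show ?thesis unfolding B[symmetric] by simp
  qed
  have "K -` box l u = box (J l) (J u)"
  proof (rule set_eqI)
   fix z
   have "z : K -` box l u \<longleftrightarrow> (\<forall>i. l \<bullet> e i < z $ i & z $ i < u \<bullet> e i)"
    unfolding vimage_eq mem_box(1) all Ke ..
   thus "z : K -` box l u \<longleftrightarrow> z : box (J l) (J u)" by (simp add: mem_box_cart J_def)
  qed
  hence "emeasure (distr lborel borel K) (box l u) = emeasure lborel (box (J l) (J u))"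
   by (simp add: emeasure_distr)
  also have "... = (\<Prod>b\<in>Basis. (J u - J l) \<bullet> b)"
  proof (rule emeasure_lborel_box)
   fix b :: "real ^ 'n bit0" assume "b : Basis"
   then obtain i where "b = axis i 1" by (auto simp: Basis_vec_def)
   thus "J l \<bullet> b <= J u \<bullet> b" using lu[OF eB] by (simp add: inner_axis J_def)
  qed
  also have "(\<Prod>b\<in>Basis. (J u - J l) \<bullet> b) = (\<Prod>i\<in>UNIV. (u - l) \<bullet> e i)"
   unfolding prod_Basis_cart by (simp add: inner_axis J_def inner_diff_left)
  also have "... = (\<Prod>b\<in>Basis. (u - l) \<bullet> b)"
   using prod.reindex_bij_betw[OF e, of "%b. (u - l) \<bullet> b"] by simp
  finally show "emeasure (distr lborel borel K) (box l u) = (\<Prod>b\<in>Basis. (u - l) \<bullet> b)" .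
 qed simp
 define g where "g z = J (th (K z))" for z
 define g' where "g' z = (%v. J (th' (K z) (K v)))" for z
 define U' where "U' = K -` U"
 have oU': "open U'" unfolding U'_def using contK U by (intro open_vimage)
 have gU: "g ` U' = K -` (th ` U)"
 proof
  show "g ` U' \<subseteq> K -` (th ` U)" by (auto simp: g_def U'_def KJ)
  show "K -` (th ` U) \<subseteq> g ` U'"
  proof
   fix z assume "z : K -` (th ` U)"
   then obtain y where y: "y : U" "K z = th y" by auto
   hence "z = g (J y)" "J y : U'" by (auto simp: g_def U'_def KJ) (metis JK)
   thus "z : g ` U'" by blast
  qed
 qed
 have det: "\<bar>det (matrix (g' z))\<bar> = abs_det (th' (K z))" for z
 proof -
  have "det (matrix (g' z)) = det_on UNIV (%i j. th' (K z) (e j) \<bullet> e i)"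
   by (simp add: det_def det_on_def matrix_def g'_def Kaxis J_def)
  also have "... = det_on Basis (%b c. th' (K z) c \<bullet> b)"
   by (rule det_on_reindex[OF e, symmetric]) simp
  finally show ?thesis by (simp add: abs_det_def)
 qed
 have ind: "indicator (g ` U') z = (indicator (th ` U) (K z) :: 'z::zero_neq_one)" for z
  unfolding gU by (simp add: indicator_def)
 have ind': "indicator U' z = (indicator U (K z) :: 'z::zero_neq_one)" for z
  unfolding U'_def by (simp add: indicator_def)
 have "(\<integral>\<^sup>+x\<in>th ` U. ennreal (h x) \<partial>lborel) = (\<integral>\<^sup>+x. ennreal (indicator (th ` U) x * h x) \<partial>lborel)"
  by (intro nn_integral_cong) (simp add: indicator_def)
 also have "... = (\<integral>\<^sup>+z. ennreal (indicator (th ` U) (K z) * h (K z)) \<partial>lborel)"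
  using mh by (subst lb, subst nn_integral_distr) auto
 also have "... = (\<integral>\<^sup>+z\<in>g ` U'. ennreal (h (K z)) \<partial>lborel)"
  by (intro nn_integral_cong) (simp add: ind, simp add: indicator_def)
 also have "... = (\<integral>\<^sup>+z\<in>U'. ennreal (\<bar>det (matrix (g' z))\<bar> * h (K (g z))) \<partial>lborel)"
 proof (rule nn_integral_change_of_variables_cart[OF oU'])
  fix z assume "z : U'"
  hence y: "K z : U" by (simp add: U'_def)
  have "((%z. th (K z)) has_derivative (%v. th' (K z) (K v))) (at z)"
   by (rule has_derivative_compose[OF bounded_linear_imp_has_derivative[OF linK] der[OF y]])
  thus "(g has_derivative g' z) (at z)" unfolding g_def[abs_def] g'_def
   by (rule bounded_linear.has_derivative[OF linJ])
 next
  show "inj_on g U'"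
  proof (rule inj_onI)
   fix a b assume ab: "a : U'" "b : U'" "g a = g b"
   hence "th (K a) = th (K b)" unfolding g_def by (metis KJ)
   hence "K a = K b" using inj ab by (auto simp: inj_on_def U'_def)
   thus "a = b" by (metis JK)
  qed
  show "(%z. indicator (g ` U') z * h (K z)) : borel_measurable borel"
   unfolding ind using measurable_compose[OF mK mh] by simp
  show "(%z. indicator U' z * (\<bar>det (matrix (g' z))\<bar> * h (K (g z)))) : borel_measurable borel"
   unfolding ind' det g_def KJ using measurable_compose[OF mK mg] by simp
 qed (rule nn)
 also have "... = (\<integral>\<^sup>+z. ennreal (indicator U (K z) * (abs_det (th' (K z)) * h (th (K z)))) \<partial>lborel)"
  unfolding det g_def KJ by (intro nn_integral_cong) (simp add: ind', simp add: indicator_def)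
 also have "... = (\<integral>\<^sup>+y. ennreal (indicator U y * (abs_det (th' y) * h (th y))) \<partial>lborel)"
  using mg by (subst lb, subst nn_integral_distr) auto
 also have "... = (\<integral>\<^sup>+y\<in>U. ennreal (abs_det (th' y) * h (th y)) \<partial>lborel)"
  by (intro nn_integral_cong) (simp add: indicator_def)
 finally show ?thesis .
qed

section \<open>Independence of the symplectic volume from the parametrization\<close>

lemma continuous_on_csympl:
 assumes "continuous_on S f" "continuous_on S g"
 shows "continuous_on S (%y. csympl (f y) (g y))"
 unfolding csympl_def using assms by (intro continuous_intros)

lemma continuous_on_sympl_density:
 fixes \<phi> :: "complex ^ 'n => 'n::finite cphase"
 assumes "smooth_open U \<phi>"
 shows "continuous_on U (%y. sympl_density (frechet_derivative \<phi> (at y)))"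
proof -
 have "continuous_on U (%y. frechet_derivative \<phi> (at y) v)" for v
  using smooth_open_iter_continuous_on[OF assms, of "[v]"] by simp
 thus ?thesis unfolding sympl_density_def
  by (intro continuous_intros continuous_on_csympl) auto
qed

text \<open>By the chain rule and \<open>sympl_density_compose\<close> the density of g \<circ> th
  is that of g times the Jacobian of th, which is the factor in the change of variables. It serves
  both for a change of parametrization and for the projection of the ends to x.\<close>

lemma sympl_density_integral_transfer:
 fixes \<phi> g :: "complex ^ 'n => 'n::finite cphase" and h :: "complex ^ 'n => real"
 assumes \<phi>: "smooth_open U \<phi>" and g: "smooth_open (th ` U) g"
  and der: "!!y. y : U ==> (th has_derivative th' y) (at y)" and inj: "inj_on th U"
  and eq: "!!y. y : U ==> \<phi> y = g (th y)"
  and mh: "h : borel_measurable borel" and nn: "!!x. 0 <= h x"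
 shows "(\<integral>\<^sup>+x\<in>th ` U. ennreal (h x * sympl_density (frechet_derivative g (at x))) \<partial>lborel)
  = (\<integral>\<^sup>+y\<in>U. ennreal (h (th y) * sympl_density (frechet_derivative \<phi> (at y))) \<partial>lborel)"
proof -
 have U: "open U" using \<phi> by (rule smooth_open_open)
 have V: "open (th ` U)" using g by (rule smooth_open_open)
 have dens: "sympl_density (frechet_derivative \<phi> (at y)) = abs_det (th' y) * sympl_density (frechet_derivative g (at (th y)))"
  if y: "y : U" for y
 proof -
  have "((%y. g (th y)) has_derivative (%v. frechet_derivative g (at (th y)) (th' y v))) (at y)"
   by (rule has_derivative_compose[OF der[OF y] smooth_open_has_derivative[OF g imageI[OF y]]])
  hence "(\<phi> has_derivative (%v. frechet_derivative g (at (th y)) (th' y v))) (at y)"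
   by (rule has_derivative_transform_within_open[OF _ U y]) (simp add: eq)
  hence "frechet_derivative \<phi> (at y) = (%v. frechet_derivative g (at (th y)) (th' y v))"
   by (rule frechet_derivative_at[symmetric])
  moreover have "linear (frechet_derivative g (at (th y)))"
   using smooth_open_has_derivative[OF g imageI[OF y]] by (rule has_derivative_linear)
  ultimately show ?thesis by (simp add: sympl_density_compose)
 qed
 have cth: "continuous_on U th"
  using der by (intro continuous_at_imp_continuous_on) (auto intro: has_derivative_continuous)
 have "(%y. indicator U y *\<^sub>R th y) : borel_measurable borel"
  using U cth by (intro borel_measurable_continuous_on_indicator) auto
 from measurable_compose[OF this mh]
 have m1: "(%y. h (indicator U y *\<^sub>R th y)) : borel_measurable borel" .
 have m2: "(%y. indicator U y *\<^sub>R sympl_density (frechet_derivative \<phi> (at y))) : borel_measurable borel"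
  using U by (intro borel_measurable_continuous_on_indicator continuous_on_sympl_density \<phi>) auto
 have m3: "(%y. indicator (th ` U) y *\<^sub>R sympl_density (frechet_derivative g (at y))) : borel_measurable borel"
  using V by (intro borel_measurable_continuous_on_indicator continuous_on_sympl_density g) auto
 have "(\<integral>\<^sup>+x\<in>th ` U. ennreal (h x * sympl_density (frechet_derivative g (at x))) \<partial>lborel)
  = (\<integral>\<^sup>+y\<in>U. ennreal (abs_det (th' y) * (h (th y) * sympl_density (frechet_derivative g (at (th y))))) \<partial>lborel)"
 proof (rule nn_integral_change_of_variables[OF U der inj])
  show "(%x. indicator (th ` U) x * (h x * sympl_density (frechet_derivative g (at x)))) : borel_measurable borel"
   using borel_measurable_times[OF mh m3] by (simp add: mult_ac)
  have "(%y. indicator U y * (abs_det (th' y) * (h (th y) * sympl_density (frechet_derivative g (at (th y))))))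
   = (%y. h (indicator U y *\<^sub>R th y) * (indicator U y *\<^sub>R sympl_density (frechet_derivative \<phi> (at y))))"
   by (auto simp: fun_eq_iff indicator_def dens)
  thus "(%y. indicator U y * (abs_det (th' y) * (h (th y) * sympl_density (frechet_derivative g (at (th y)))))) : borel_measurable borel"
   using borel_measurable_times[OF m1 m2] by simp
 qed (auto intro!: mult_nonneg_nonneg nn sympl_density_nonneg)
 also have "... = (\<integral>\<^sup>+y\<in>U. ennreal (h (th y) * sympl_density (frechet_derivative \<phi> (at y))) \<partial>lborel)"
  by (intro nn_integral_cong) (simp add: indicator_def dens mult_ac)
 finally show ?thesis .
qed

lemma diffeomorphism_smooth:
 assumes "diffeomorphism UNIV M \<phi>"
 shows "smooth_open UNIV \<phi>" "bij_betw \<phi> UNIV M" "smooth_on M (inv_into UNIV \<phi>)"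
 using assms smooth_on_open[OF open_UNIV] unfolding diffeomorphism_def by auto

text \<open>\<open>sympl_vol\<close> selects some parametrization by choice. The transition map
  \<open>th\<close> to a given one is a smooth bijection of the parameter space, so both induce the
  same measure; hence the flow itself may serve as parametrization.\<close>

theorem sympl_vol_eq:
 fixes \<phi> :: "complex ^ 'n => 'n::finite cphase"
 assumes \<phi>: "diffeomorphism UNIV M \<phi>"
 shows "sympl_vol M = distr (density lborel (%y. ennreal (sympl_density (frechet_derivative \<phi> (at y))))) (restrict_space borel M) \<phi>"
proof -
 define \<psi> where "\<psi> = (SOME \<phi> :: complex ^ 'n => 'n cphase. diffeomorphism UNIV M \<phi>)"
 have \<psi>: "diffeomorphism UNIV M \<psi>" unfolding \<psi>_def
  by (rule someI[of "diffeomorphism UNIV M", OF \<phi>])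
 note D\<phi> = diffeomorphism_smooth[OF \<phi>] and D\<psi> = diffeomorphism_smooth[OF \<psi>]
 define th where "th y = inv_into UNIV \<phi> (\<psi> y)" for y
 have \<psi>M: "\<psi> y : M" "\<phi> y : M" for y using D\<psi>(2) D\<phi>(2) by (auto simp: bij_betw_def)
 have eq: "\<phi> (th y) = \<psi> y" for y
  unfolding th_def using D\<phi>(2) \<psi>M(1) by (simp add: bij_betw_inv_into_right)
 have "smooth_on UNIV th" unfolding th_def
  by (rule smooth_on_compose[OF smooth_open_imp_smooth_on[OF D\<psi>(1)] D\<phi>(3)]) (auto simp: \<psi>M)
 hence sth: "smooth_open UNIV th" by (intro smooth_on_open) auto
 have inj: "inj th" using D\<psi>(2) eq unfolding bij_betw_def inj_on_def by metis
 have surj: "range th = UNIV"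
 proof -
  have "x : range th" for x
  proof -
   obtain y where "\<psi> y = \<phi> x" using D\<psi>(2) \<psi>M(2)[of x] unfolding bij_betw_def by (metis imageE)
   hence "th y = x" unfolding th_def using D\<phi>(2) by (simp add: bij_betw_inv_into_left)
   thus ?thesis by blast
  qed
  thus ?thesis by blast
 qed
 have meas: "f : lborel \<rightarrow>\<^sub>M restrict_space borel M" "(%y. ennreal (sympl_density (frechet_derivative f (at y)))) : borel_measurable lborel"
  if "smooth_open UNIV f" "!!y. f y : M" for f :: "complex ^ 'n => 'n cphase"
 proof -
  have "f : borel_measurable borel"
   using smooth_open_continuous_on[OF that(1)] by (rule borel_measurable_continuous_onI)
  thus "f : lborel \<rightarrow>\<^sub>M restrict_space borel M" using that(2) by (intro measurable_restrict_space2) auto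
  have "(%y. sympl_density (frechet_derivative f (at y))) : borel_measurable borel"
   using continuous_on_sympl_density[OF that(1)] by (rule borel_measurable_continuous_onI)
  thus "(%y. ennreal (sympl_density (frechet_derivative f (at y)))) : borel_measurable lborel" by simp
 qed
 note m\<phi> = meas[OF D\<phi>(1) \<psi>M(2)] and m\<psi> = meas[OF D\<psi>(1) \<psi>M(1)]
 have "distr (density lborel (%y. ennreal (sympl_density (frechet_derivative \<psi> (at y))))) (restrict_space borel M) \<psi>
  = distr (density lborel (%y. ennreal (sympl_density (frechet_derivative \<phi> (at y))))) (restrict_space borel M) \<phi>" (is "?M1 = ?M2")
 proof (rule measure_eqI)
  fix A assume "A : sets ?M1"
  hence A: "A : sets (restrict_space borel M)" by simp
  have pre: "f -` A : sets borel" if "f : lborel \<rightarrow>\<^sub>M restrict_space borel M" for f :: "complex ^ 'n => 'n cphase"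
   using measurable_sets[OF that A] by simp
  have em: "emeasure (distr (density lborel (%y. ennreal (sympl_density (frechet_derivative f (at y))))) (restrict_space borel M) f) A
   = (\<integral>\<^sup>+y\<in>UNIV. ennreal (indicator (f -` A) y * sympl_density (frechet_derivative f (at y))) \<partial>lborel)"
   if m: "f : lborel \<rightarrow>\<^sub>M restrict_space borel M" "(%y. ennreal (sympl_density (frechet_derivative f (at y)))) : borel_measurable lborel" for f
  proof -
   have "emeasure (distr (density lborel (%y. ennreal (sympl_density (frechet_derivative f (at y))))) (restrict_space borel M) f) A
    = emeasure (density lborel (%y. ennreal (sympl_density (frechet_derivative f (at y))))) (f -` A)"
    using m(1) A by (subst emeasure_distr) auto
   also have "... = (\<integral>\<^sup>+y. ennreal (sympl_density (frechet_derivative f (at y))) * indicator (f -` A) y \<partial>lborel)"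
    using m pre[OF m(1)] by (intro emeasure_density) auto
   also have "... = (\<integral>\<^sup>+y\<in>UNIV. ennreal (indicator (f -` A) y * sympl_density (frechet_derivative f (at y))) \<partial>lborel)"
    by (intro nn_integral_cong) (simp add: indicator_def)
   finally show ?thesis .
  qed
  have "emeasure ?M2 A = (\<integral>\<^sup>+x\<in>range th. ennreal (indicator (\<phi> -` A) x * sympl_density (frechet_derivative \<phi> (at x))) \<partial>lborel)"
   unfolding surj by (rule em[OF m\<phi>])
  also have "... = (\<integral>\<^sup>+y\<in>UNIV. ennreal (indicator (\<phi> -` A) (th y) * sympl_density (frechet_derivative \<psi> (at y))) \<partial>lborel)"
  proof (rule sympl_density_integral_transfer[OF D\<psi>(1)])
   show "smooth_open (range th) \<phi>" unfolding surj by (rule D\<phi>(1))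
   show "(th has_derivative frechet_derivative th (at y)) (at y)" for y
    using smooth_open_has_derivative[OF sth] by simp
  qed (use inj eq pre[OF m\<phi>(1)] in auto)
  also have "... = (\<integral>\<^sup>+y\<in>UNIV. ennreal (indicator (\<psi> -` A) y * sympl_density (frechet_derivative \<psi> (at y))) \<partial>lborel)"
   by (intro nn_integral_cong) (simp add: indicator_def eq)
  also have "... = emeasure ?M1 A" by (rule em[OF m\<psi>, symmetric])
  finally show "emeasure ?M1 A = emeasure ?M2 A" ..
 qed simp
 thus ?thesis unfolding sympl_vol_def \<psi>_def[symmetric] Let_def .
qed

section \<open>Uniform bounds for logarithms of functions of finite type\<close>

lemma iter_deriv_line:
 assumes "smooth_open U F" "x + s *\<^sub>R v : U"
 shows "((%s. iter_deriv vs F (x + s *\<^sub>R v)) has_vector_derivative iter_deriv (v # vs) F (x + s *\<^sub>R v)) (at s)"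
proof -
 have "((%s. x + s *\<^sub>R v) has_derivative (%k. k *\<^sub>R v)) (at s)"
  by (auto intro!: derivative_eq_intros)
 from has_derivative_compose[OF this smooth_open_iter_has_derivative[OF assms]]
 have "((%s. iter_deriv vs F (x + s *\<^sub>R v)) has_derivative (%k. iter_deriv ((k *\<^sub>R v) # vs) F (x + s *\<^sub>R v))) (at s)" .
 moreover have "iter_deriv ((k *\<^sub>R v) # vs) F (x + s *\<^sub>R v) = k *\<^sub>R iter_deriv (v # vs) F (x + s *\<^sub>R v)" for k
  using linear_scale[OF has_derivative_linear[OF smooth_open_iter_has_derivative[OF assms, of vs]], of k v] .
 ultimately show ?thesis unfolding has_vector_derivative_def by simp
qed

lemma deriv_chain_line:
 assumes "smooth_open (T \<times> (UNIV :: 'a::real_normed_vector set)) F" "t : T"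
 shows "deriv_chain (%k s. iter_deriv (replicate k (0, v)) F (t, y + s *\<^sub>R v))"
 unfolding deriv_chain_def
proof (intro allI)
 fix k s
 have "(t, y) + s *\<^sub>R (0, v) : T \<times> UNIV" using assms(2) by simp
 from iter_deriv_line[OF assms(1) this, of "replicate k (0, v)"]
 show "((%s. iter_deriv (replicate k (0, v)) F (t, y + s *\<^sub>R v)) has_vector_derivative iter_deriv (replicate (Suc k) (0, v)) F (t, y + s *\<^sub>R v)) (at s)"
  by simp
qed

text \<open>If the derivatives up to order m vanished at 0, \<open>taylor_top_remainder\<close> with
  D = 0 would give |G 0 s| \<le> A |s|^(m+1), and the quotient by s^m would tend to 0.\<close>

lemma finite_order_along_curve:
 assumes "deriv_chain G" and "c ~= 0" and lim: "((%s. G 0 s / of_real s ^ m) \<longlongrightarrow> c) (at_right 0)"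
 shows "\<exists>k\<le>m. G k 0 ~= 0"
proof (rule ccontr)
 assume "\<not> ?thesis"
 hence z: "!!k. k <= m ==> G k 0 = 0" by blast
 have "continuous_on {-1..1} (G (Suc m))" using assms(1) by (rule deriv_chain_continuous)
 hence "bounded (G (Suc m) ` {-1..1})" by (intro compact_imp_bounded compact_continuous_image) auto
 then obtain A where "\<forall>z\<in>G (Suc m) ` {-1..1}. cmod z <= A" unfolding bounded_iff by blast
 hence A: "!!x. x : {-1..1} ==> cmod (G (Suc m) x) <= A" by blast
 have A0: "A \<ge> 0" using order_trans[OF norm_ge_zero A[of 0]] by simp
 have est: "cmod (G 0 s) <= A * \<bar>s\<bar> ^ Suc m" if "s : {-1..1}" for s
  using taylor_top_remainder[OF assms(1), of 0 "-1" 1 0 A m m s] A A0 z that by simp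
 have "((%s. G 0 s / of_real s ^ m) \<longlongrightarrow> 0) (at_right 0)"
 proof (rule Lim_null_comparison)
  have "\<forall>\<^sub>F s in at_right (0::real). s : {0<..<1}" by (rule eventually_at_right_real) simp
  thus "\<forall>\<^sub>F s in at_right 0. norm (G 0 s / of_real s ^ m) <= A * s"
  proof eventually_elim
   case (elim s)
   hence s: "s > 0" "s : {-1..1}" by auto
   have "norm (G 0 s / of_real s ^ m) = cmod (G 0 s) / s ^ m" using s by (simp add: norm_divide norm_power)
   also have "... <= (A * \<bar>s\<bar> ^ Suc m) / s ^ m" using est[OF s(2)] s by (intro divide_right_mono) auto
   also have "... = A * s" using s by simp
   finally show ?case .
  qed
  show "((%s. A * s) \<longlongrightarrow> 0) (at_right 0)" by (auto intro!: tendsto_eq_intros)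
 qed
 hence "c = 0" using tendsto_unique[OF trivial_limit_at_right_real lim] by blast
 thus False using assms(2) by simp
qed

lemma nn_integral_translate:
 fixes f :: "'a::euclidean_space => ennreal"
 assumes "f : borel_measurable borel"
 shows "(\<integral>\<^sup>+y. f (y + c) \<partial>lborel) = (\<integral>\<^sup>+y. f y \<partial>lborel)"
proof -
 have "(\<integral>\<^sup>+y. f y \<partial>lborel) = (\<integral>\<^sup>+y. f y \<partial>distr lborel borel ((+) c))" by (simp add: lborel_distr_plus)
 also have "... = (\<integral>\<^sup>+y. f (c + y) \<partial>lborel)" using assms by (subst nn_integral_distr) auto
 finally have "(\<integral>\<^sup>+y. f (c + y) \<partial>lborel) = (\<integral>\<^sup>+y. f y \<partial>lborel)" ..
 thus ?thesis by (simp only: add.commute[of _ c])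
qed

text \<open>If y + s v lies in the ball of radius r / 4 and |s| \<le> de, then y lies in the ball of
  radius r / 2. Integrating over s and exchanging the integrals turns bounds on segments parallel to
  v into a bound on a ball, without coordinates adapted to v.\<close>

lemma average_over_translates:
 fixes g :: "'a::euclidean_space => ennreal"
 assumes g [measurable]: "g : borel_measurable borel" and "de > 0" "de * norm v <= r / 4" "C \<ge> 0"
  and line: "!!y. y : ball y0 (r / 2) ==> (\<integral>\<^sup>+s\<in>{-de..de}. g (y + s *\<^sub>R v) \<partial>lborel) <= ennreal C"
 shows "ennreal (2 * de) * (\<integral>\<^sup>+y\<in>ball y0 (r / 4). g y \<partial>lborel) <= ennreal C * emeasure lborel (ball y0 (r / 2))"
proof -
 have "ennreal (2 * de) * (\<integral>\<^sup>+y\<in>ball y0 (r / 4). g y \<partial>lborel)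
  = (\<integral>\<^sup>+s. (\<integral>\<^sup>+y\<in>ball y0 (r / 4). g y \<partial>lborel) * indicator {-de..de} s \<partial>lborel)"
  using assms(2) by (subst nn_integral_cmult_indicator) (auto simp: mult.commute)
 also have "... <= (\<integral>\<^sup>+s. (\<integral>\<^sup>+y. g (y + s *\<^sub>R v) * indicator {-de..de} s * indicator (ball y0 (r / 2)) y \<partial>lborel) \<partial>lborel)"
 proof (intro nn_integral_mono)
  fix s :: real
  show "(\<integral>\<^sup>+y\<in>ball y0 (r / 4). g y \<partial>lborel) * indicator {-de..de} s
   <= (\<integral>\<^sup>+y. g (y + s *\<^sub>R v) * indicator {-de..de} s * indicator (ball y0 (r / 2)) y \<partial>lborel)"
  proof (cases "s : {-de..de}")
   case True
   have "(\<integral>\<^sup>+y\<in>ball y0 (r / 4). g y \<partial>lborel) = (\<integral>\<^sup>+y. g (y + s *\<^sub>R v) * indicator (ball y0 (r / 4)) (y + s *\<^sub>R v) \<partial>lborel)"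
    by (rule nn_integral_translate[of "%y. g y * indicator (ball y0 (r / 4)) y", symmetric])
     (intro borel_measurable_times_ennreal g borel_measurable_indicator, simp)
   also have "... <= (\<integral>\<^sup>+y. g (y + s *\<^sub>R v) * indicator (ball y0 (r / 2)) y \<partial>lborel)"
   proof (intro nn_integral_mono)
    fix y
    have "y : ball y0 (r / 2)" if "y + s *\<^sub>R v : ball y0 (r / 4)"
    proof -
     have "\<bar>s\<bar> * norm v <= de * norm v" using True by (intro mult_right_mono) auto
     hence "dist (y + s *\<^sub>R v) y <= r / 4" using assms(3) by (simp add: dist_norm)
     thus ?thesis using that dist_triangle[of y0 y "y + s *\<^sub>R v"] by simp
    qed
    thus "g (y + s *\<^sub>R v) * indicator (ball y0 (r / 4)) (y + s *\<^sub>R v) <= g (y + s *\<^sub>R v) * indicator (ball y0 (r / 2)) y"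
     by (auto simp: indicator_def)
   qed
   finally show ?thesis using True by simp
  qed simp
 qed
 also have "... = (\<integral>\<^sup>+y. (\<integral>\<^sup>+s. g (y + s *\<^sub>R v) * indicator {-de..de} s * indicator (ball y0 (r / 2)) y \<partial>lborel) \<partial>lborel)"
 proof (rule lborel_pair.Fubini')
  have "(%z::'a \<times> real. fst z + snd z *\<^sub>R v) : borel_measurable borel"
   by (intro borel_measurable_continuous_onI continuous_intros)
  from measurable_compose[OF this g]
  have "(%z::'a \<times> real. g (fst z + snd z *\<^sub>R v)) : borel_measurable (lborel \<Otimes>\<^sub>M lborel)"
   by (simp add: lborel_prod)
  thus "(%(y, s). g (y + s *\<^sub>R v) * indicator {-de..de} s * indicator (ball y0 (r / 2)) y) : borel_measurable (lborel \<Otimes>\<^sub>M lborel)"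
   unfolding case_prod_unfold
   by (intro borel_measurable_times_ennreal measurable_compose[OF measurable_fst] measurable_compose[OF measurable_snd]
    borel_measurable_indicator) simp_all
 qed
 also have "... <= (\<integral>\<^sup>+y. ennreal C * indicator (ball y0 (r / 2)) y \<partial>lborel)"
  using line by (intro nn_integral_mono) (auto simp: indicator_def)
 also have "... = ennreal C * emeasure lborel (ball y0 (r / 2))" by (rule nn_integral_cmult_indicator) simp
 finally show ?thesis .
qed

text \<open>Near (t0, y0) the m-th derivative along v stays away from 0 and the derivatives up to
  order m + 1 stay bounded, so one constant of \<open>finite_type_integral_bound\<close> serves all
  short segments parallel to v and all nearby t.\<close>

lemma local_bound_direction:
 fixes F :: "real \<times> 'a::euclidean_space => complex"
 assumes F: "smooth_open (T \<times> UNIV) F" and T: "open T" "t0 : T"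
  and nz: "iter_deriv (replicate m (0, v)) F (t0, y0) ~= 0"
 shows "\<exists>rh>0. \<exists>C\<ge>0. \<forall>t. \<bar>t - t0\<bar> < rh --> t : T &
  (\<integral>\<^sup>+y\<in>ball y0 rh. log_var (F (t, y)) (iter_deriv [(0, v)] F (t, y)) \<partial>lborel) <= ennreal C"
proof -
 define D where "D k = iter_deriv (replicate k (0, v)) F" for k
 have cD: "continuous_on (T \<times> UNIV) (D k)" for k unfolding D_def by (rule smooth_open_iter_continuous_on[OF F])
 have oT: "open (T \<times> (UNIV :: 'a set))" using T by (intro open_Times) auto
 define d0 where "d0 = cmod (D m (t0, y0)) / 2"
 have d0: "d0 > 0" using nz by (simp add: d0_def D_def)
 have "isCont (D m) (t0, y0)" using cD oT T by (simp add: continuous_on_eq_continuous_at)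
 then obtain e1 where e1: "e1 > 0" "!!z. dist z (t0, y0) < e1 ==> dist (D m z) (D m (t0, y0)) < d0"
  using d0 unfolding continuous_at_eps_delta by metis
 obtain e2 where e2: "e2 > 0" "cball t0 e2 \<subseteq> T" using T open_contains_cball by blast
 define r where "r = min (e1 / 3) (min e2 1)"
 have r: "r > 0" "r <= 1" "r <= e2" "r <= e1 / 3" using e1 e2 by (auto simp: r_def)
 let ?K = "cball t0 r \<times> cball y0 r"
 have KT: "?K \<subseteq> T \<times> UNIV" using e2 r by auto
 have low: "d0 <= cmod (D m z)" if "z : ?K" for z
 proof -
  obtain t y where z: "z = (t, y)" "dist t t0 <= r" "dist y y0 <= r" using \<open>z : ?K\<close> by (auto simp: dist_commute)
  have "dist z (t0, y0) <= dist t t0 + dist y y0"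
   unfolding z dist_Pair_Pair by (rule sqrt_sum_squares_le_sum) auto
  also have "... < e1" using z r e1 by linarith
  finally have "dist (D m z) (D m (t0, y0)) < d0" by (rule e1)
  thus ?thesis using norm_triangle_ineq2[of "D m (t0, y0)" "D m z"]
   by (simp add: d0_def dist_norm norm_minus_commute)
 qed
 have "\<exists>B. \<forall>z\<in>?K. cmod (D k z) <= B" for k
 proof -
  have "bounded (D k ` ?K)"
   by (intro compact_imp_bounded compact_continuous_image continuous_on_subset[OF cD KT] compact_Times compact_cball)
  thus ?thesis by (auto simp: bounded_iff)
 qed
 then obtain B where B: "!!k z. z : ?K ==> cmod (D k z) <= B k" by metis
 have B0: "B k \<ge> 0" for k using order_trans[OF norm_ge_zero B[of "(t0, y0)" k]] r by simp
 \<comment> \<open>Large enough for all three roles of the constant: the derivative bounds, 1 / A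
   \<le> d0, and the length 2 de of the segments.\<close>
 define A where "A = (\<Sum>k\<le>Suc m. B k) + 1 / d0 + 2"
 have A: "B k <= A" if "k <= Suc m" for k
  using member_le_sum[of k "{..Suc m}" B] that B0 d0 by (simp add: A_def add_increasing2)
 have "(\<Sum>k\<le>Suc m. B k) \<ge> 0" using B0 by (intro sum_nonneg) auto
 hence A2: "A \<ge> 2" "1 / d0 <= A" using d0 by (auto simp: A_def)
 have dA: "1 / A <= d0" using A2 d0 by (simp add: field_simps)
 obtain C where C: "C \<ge> 0" "!!G a b. deriv_chain G ==> a <= b ==> b - a <= A ==>
   (\<forall>k\<le>Suc m. \<forall>x\<in>{a..b}. cmod (G k x) <= A) ==> (\<forall>x\<in>{a..b}. 1 / A <= cmod (G m x)) ==>
   (\<integral>\<^sup>+x\<in>{a..b}. log_var (G 0 x) (G 1 x) \<partial>lborel) <= ennreal C"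
  using finite_type_integral_bound[of A m] by blast
 define de where "de = r / 4 / (norm v + 1)"
 have nv: "norm v + 1 > 0" by (simp add: add_nonneg_pos)
 have de: "de > 0" using r nv by (simp add: de_def)
 have dev: "de * (norm v + 1) = r / 4" using nv nonzero_divide_eq_eq[of "norm v + 1" "r / 4" de] unfolding de_def by (metis less_irrefl)
 hence "de * norm v + de = r / 4" by (simp only: distrib_left mult_1_right)
 moreover have "0 <= de * norm v" using de by simp
 ultimately have dev': "de * norm v <= r / 4" "de <= r / 4" using de by linarith+
 define X where "X = measure lborel (ball y0 (r / 2))"
 have X: "emeasure lborel (ball y0 (r / 2)) = ennreal X" "X \<ge> 0"
  unfolding X_def using emeasure_lborel_ball_finite[of y0 "r / 2"]
  by (intro emeasure_eq_ennreal_measure less_imp_neq) (simp_all add: top.not_eq_extremum)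
 have bound: "(\<integral>\<^sup>+y\<in>ball y0 (r / 4). log_var (F (t, y)) (iter_deriv [(0, v)] F (t, y)) \<partial>lborel) <= ennreal (C * X / (2 * de))"
  if t: "\<bar>t - t0\<bar> < r / 4" for t
 proof -
  have tr: "t : cball t0 r" using t r by (simp add: dist_real_def abs_minus_commute)
  have tT: "t : T" using tr e2 r by auto
  define g where "g y = log_var (D 0 (t, y)) (D 1 (t, y))" for y
  have mD: "(%y. D k (t, y)) : borel_measurable borel" for k
  proof (rule borel_measurable_continuous_onI)
   have "continuous_on UNIV (%y. (t, y))" by (intro continuous_intros)
   thus "continuous_on UNIV (%y. D k (t, y))"
    by (rule continuous_on_compose2[OF cD]) (use tT in auto)
  qed
  have gm: "g : borel_measurable borel" unfolding g_def by (intro log_var_measurable mD)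
  have "ennreal (2 * de) * (\<integral>\<^sup>+y\<in>ball y0 (r / 4). g y \<partial>lborel) <= ennreal C * emeasure lborel (ball y0 (r / 2))"
  proof (rule average_over_translates[OF gm de dev'(1) C(1)])
   fix y assume y: "y : ball y0 (r / 2)"
   have inK: "(t, y + s *\<^sub>R v) : ?K" if "s : {-de..de}" for s
   proof -
    have "\<bar>s\<bar> * norm v <= de * norm v" using that by (intro mult_right_mono) auto
    hence "dist (y + s *\<^sub>R v) y <= r / 4" using dev' by (simp add: dist_norm)
    hence "dist y0 (y + s *\<^sub>R v) <= r" using y r dist_triangle[of y0 "y + s *\<^sub>R v" y] by (simp add: dist_commute)
    thus ?thesis using tr by simp
   qed
   have "(\<integral>\<^sup>+s\<in>{-de..de}. log_var (D 0 (t, y + s *\<^sub>R v)) (D 1 (t, y + s *\<^sub>R v)) \<partial>lborel) <= ennreal C"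
   proof (rule C(2))
    show "deriv_chain (%k s. D k (t, y + s *\<^sub>R v))" unfolding D_def by (rule deriv_chain_line[OF F tT])
    show "- de <= de" "de - - de <= A" using de dev' r A2 by auto
    show "\<forall>k\<le>Suc m. \<forall>s\<in>{-de..de}. cmod (D k (t, y + s *\<^sub>R v)) <= A"
     using B[OF inK] A order_trans by blast
    show "\<forall>s\<in>{-de..de}. 1 / A <= cmod (D m (t, y + s *\<^sub>R v))"
     using low[OF inK] dA order_trans by blast
   qed
   thus "(\<integral>\<^sup>+s\<in>{-de..de}. g (y + s *\<^sub>R v) \<partial>lborel) <= ennreal C" by (simp add: g_def)
  qed
  also have "... = ennreal (C * X)" using C(1) X by (simp add: ennreal_mult)
  finally have "ennreal (1 / (2 * de)) * (ennreal (2 * de) * (\<integral>\<^sup>+y\<in>ball y0 (r / 4). g y \<partial>lborel)) <= ennreal (1 / (2 * de)) * ennreal (C * X)"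
   by (rule mult_left_mono) simp
  hence "(\<integral>\<^sup>+y\<in>ball y0 (r / 4). g y \<partial>lborel) <= ennreal (C * X / (2 * de))"
   using de C(1) X by (simp add: mult.assoc[symmetric] ennreal_mult[symmetric] del: ennreal_mult)
  thus ?thesis by (simp add: g_def D_def)
 qed
 have "t : T" if "\<bar>t - t0\<bar> < r / 4" for t using that e2 r by (auto simp: dist_real_def subset_iff abs_minus_commute)
 thus ?thesis using bound r de C(1) X
  by (intro exI[of _ "r / 4"] conjI exI[of _ "C * X / (2 * de)"]) auto
qed

lemma log_var_linear_combination:
 assumes "c > 0"
 shows "log_var z ((w1 - w2) / of_real c) <= ennreal (max 1 (1 / c)) * (log_var z w1 + log_var z w2)"
proof (cases "z = 0")
 case True
 have "0 < max 1 (1 / c)" by auto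
 hence "ennreal (max 1 (1 / c)) ~= 0" by (simp only: ennreal_eq_0_iff not_le)
 thus ?thesis using True by (simp add: log_var_def ennreal_mult_top)
next
 case False
 define l where "l = \<bar>ln (cmod z)\<bar>"
 have "(w1 - w2) / of_real c / z = of_real (1 / c) * (w1 / z - w2 / z)"
  using assms False by (simp add: field_simps)
 moreover have im: "Im (of_real r * u) = r * Im u" for r u by simp
 ultimately have "\<bar>Im ((w1 - w2) / of_real c / z)\<bar> = (1 / c) * \<bar>Im (w1 / z) - Im (w2 / z)\<bar>"
  using assms by (simp only: im minus_complex.sel abs_mult) simp
 also have "... <= (1 / c) * (\<bar>Im (w1 / z)\<bar> + \<bar>Im (w2 / z)\<bar>)" using assms by (intro mult_left_mono) auto
 also have "... <= max 1 (1 / c) * (\<bar>Im (w1 / z)\<bar> + \<bar>Im (w2 / z)\<bar>)" by (intro mult_right_mono) auto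
 finally have 1: "\<bar>Im ((w1 - w2) / of_real c / z)\<bar> <= max 1 (1 / c) * (\<bar>Im (w1 / z)\<bar> + \<bar>Im (w2 / z)\<bar>)" .
 have "1 * l <= max 1 (1 / c) * (l + l)" by (intro mult_mono) (auto simp: l_def)
 hence "\<bar>Im ((w1 - w2) / of_real c / z)\<bar> + l <= max 1 (1 / c) * (\<bar>Im (w1 / z)\<bar> + \<bar>Im (w2 / z)\<bar>) + max 1 (1 / c) * (l + l)"
  using 1 by linarith
 also have "... = max 1 (1 / c) * ((\<bar>Im (w1 / z)\<bar> + l) + (\<bar>Im (w2 / z)\<bar> + l))"
  by (simp only: distrib_left add_ac)
 finally have "\<bar>Im ((w1 - w2) / of_real c / z)\<bar> + l <= max 1 (1 / c) * ((\<bar>Im (w1 / z)\<bar> + l) + (\<bar>Im (w2 / z)\<bar> + l))" .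
 thus ?thesis using False unfolding l_def
  by (simp add: log_var_def ennreal_plus[symmetric] ennreal_mult'[symmetric] del: ennreal_plus)
qed

text \<open>Finite type along b itself may fail. But b is the difference of v + ep b and v divided
  by ep, both of finite type, and \<open>log_var_linear_combination\<close> bounds the derivative
  along b by those along the two.\<close>

lemma local_bound:
 fixes F :: "real \<times> 'a::euclidean_space => complex"
 assumes F: "smooth_open (T \<times> UNIV) F" and T: "open T" "t0 : T"
  and nz: "iter_deriv (replicate m (0, v)) F (t0, y0) ~= 0"
  and nzb: "!!b. b : Basis ==> \<exists>ep>0. \<exists>k. iter_deriv (replicate k (0, v + ep *\<^sub>R b)) F (t0, y0) ~= 0"
 shows "\<exists>rh>0. \<exists>C\<ge>0. \<forall>t. \<bar>t - t0\<bar> < rh --> (\<forall>b\<in>Basis.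
  (\<integral>\<^sup>+y\<in>ball y0 rh. log_var (F (t, y)) (iter_deriv [(0, b)] F (t, y)) \<partial>lborel) <= ennreal C)"
proof -
 define P where "P b rh C \<longleftrightarrow> rh > 0 & C \<ge> 0 & (\<forall>t. \<bar>t - t0\<bar> < rh -->
  (\<integral>\<^sup>+y\<in>ball y0 rh. log_var (F (t, y)) (iter_deriv [(0, b)] F (t, y)) \<partial>lborel) <= ennreal C)" for b :: 'a and rh C
 have "\<exists>rh C. P b rh C" if b: "b : Basis" for b
 proof -
  obtain ep k where eps: "ep > 0" "iter_deriv (replicate k (0, v + ep *\<^sub>R b)) F (t0, y0) ~= 0" using nzb[OF b] by blast
  obtain rh1 C1 where 1: "rh1 > 0" "C1 \<ge> 0" "!!t. \<bar>t - t0\<bar> < rh1 ==> t : T &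
   (\<integral>\<^sup>+y\<in>ball y0 rh1. log_var (F (t, y)) (iter_deriv [(0, v)] F (t, y)) \<partial>lborel) <= ennreal C1"
   using local_bound_direction[OF F T nz] by blast
  obtain rh2 C2 where 2: "rh2 > 0" "C2 \<ge> 0" "!!t. \<bar>t - t0\<bar> < rh2 ==> t : T &
   (\<integral>\<^sup>+y\<in>ball y0 rh2. log_var (F (t, y)) (iter_deriv [(0, v + ep *\<^sub>R b)] F (t, y)) \<partial>lborel) <= ennreal C2"
   using local_bound_direction[OF F T eps(2)] by blast
  define rh where "rh = min rh1 rh2"
  define c where "c = max 1 (1 / ep)"
  have c: "c \<ge> 0" by (simp add: c_def)
  have "(\<integral>\<^sup>+y\<in>ball y0 rh. log_var (F (t, y)) (iter_deriv [(0, b)] F (t, y)) \<partial>lborel) <= ennreal (c * (C2 + C1))"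
   if t: "\<bar>t - t0\<bar> < rh" for t
  proof -
   have tT: "t : T" using 1(3)[of t] t by (simp add: rh_def)
   have mD: "(%y. iter_deriv vs F (t, y)) : borel_measurable borel" for vs
   proof (rule borel_measurable_continuous_onI)
    have "continuous_on UNIV (%y. (t, y))" by (intro continuous_intros)
    thus "continuous_on UNIV (%y. iter_deriv vs F (t, y))"
     by (rule continuous_on_compose2[OF smooth_open_iter_continuous_on[OF F]]) (use tT in auto)
   qed
   let ?L = "%w y. log_var (F (t, y)) (iter_deriv [(0, w)] F (t, y))"
   have mL [measurable]: "?L w : borel_measurable borel" for w
    using mD[of "[]"] mD[of "[(0, w)]"] by (intro log_var_measurable) auto
   have pt: "?L b y <= ennreal c * (?L (v + ep *\<^sub>R b) y + ?L v y)" for y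
   proof -
    have lin: "linear (%w. iter_deriv [w] F (t, y))"
     using smooth_open_iter_has_derivative[OF F, of "(t, y)" "[]"] tT by (intro has_derivative_linear) auto
    have "(0, v + ep *\<^sub>R b) = (0::real, v) + ep *\<^sub>R (0, b)" by simp
    hence "iter_deriv [(0, v + ep *\<^sub>R b)] F (t, y) = iter_deriv [(0, v)] F (t, y) + ep *\<^sub>R iter_deriv [(0, b)] F (t, y)"
     using linear_add[OF lin] linear_scale[OF lin] by metis
    hence "iter_deriv [(0, b)] F (t, y) = (iter_deriv [(0, v + ep *\<^sub>R b)] F (t, y) - iter_deriv [(0, v)] F (t, y)) / of_real ep"
     using eps(1) by (simp add: scaleR_conv_of_real del: iter_deriv.simps)
    thus ?thesis unfolding c_def using log_var_linear_combination[OF eps(1)] by metis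
   qed
   have "(\<integral>\<^sup>+y\<in>ball y0 rh. ?L b y \<partial>lborel) <= (\<integral>\<^sup>+y. ennreal c * (?L (v + ep *\<^sub>R b) y * indicator (ball y0 rh2) y + ?L v y * indicator (ball y0 rh1) y) \<partial>lborel)"
   proof (intro nn_integral_mono)
    fix y
    show "?L b y * indicator (ball y0 rh) y <= ennreal c * (?L (v + ep *\<^sub>R b) y * indicator (ball y0 rh2) y + ?L v y * indicator (ball y0 rh1) y)"
    proof (cases "y : ball y0 rh")
     case True
     hence "y : ball y0 rh1" "y : ball y0 rh2" by (auto simp: rh_def)
     thus ?thesis using pt[of y] True by (simp del: iter_deriv.simps)
    qed simp
   qed
   also have "... = ennreal c * ((\<integral>\<^sup>+y\<in>ball y0 rh2. ?L (v + ep *\<^sub>R b) y \<partial>lborel) + (\<integral>\<^sup>+y\<in>ball y0 rh1. ?L v y \<partial>lborel))"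
   proof -
    have mm: "(%y. ?L w y * indicator (ball y0 q) y) : borel_measurable lborel" for w q
     unfolding measurable_lborel2 by (rule borel_measurable_times_ennreal[OF mL borel_measurable_indicator]) simp
    show ?thesis
     unfolding nn_integral_cmult[OF borel_measurable_add[OF mm mm]] nn_integral_add[OF mm mm] ..
   qed
   also have "... <= ennreal c * (ennreal C2 + ennreal C1)"
    using 1(3)[of t] 2(3)[of t] t by (intro mult_left_mono add_mono) (auto simp: rh_def simp del: iter_deriv.simps)
   also have "... = ennreal (c * (C2 + C1))" using c 1(2) 2(2) by (simp add: ennreal_mult ennreal_plus)
   finally show ?thesis .
  qed
  hence "P b rh (c * (C2 + C1))" unfolding P_def using 1 2 c by (auto simp: rh_def)
  thus ?thesis by blast
 qed
 then obtain rhf Cf where PF: "!!b. b : Basis ==> P b (rhf b) (Cf b)" by metis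
 define rh where "rh = Min (rhf ` (Basis :: 'a set))"
 define C where "C = sum Cf (Basis :: 'a set)"
 have rh: "rh > 0" unfolding rh_def using PF by (subst Min_gr_iff) (auto simp: P_def)
 have rhle: "rh <= rhf b" if "b : Basis" for b unfolding rh_def using that by (intro Min_le) auto
 have Cge: "Cf b <= C" if "b : Basis" for b unfolding C_def using that PF by (intro member_le_sum) (auto simp: P_def)
 have "C \<ge> 0" unfolding C_def using PF by (intro sum_nonneg) (auto simp: P_def)
 moreover have "(\<integral>\<^sup>+y\<in>ball y0 rh. log_var (F (t, y)) (iter_deriv [(0, b)] F (t, y)) \<partial>lborel) <= ennreal C"
  if "\<bar>t - t0\<bar> < rh" "b : Basis" for t b
 proof -
  have "(\<integral>\<^sup>+y\<in>ball y0 rh. log_var (F (t, y)) (iter_deriv [(0, b)] F (t, y)) \<partial>lborel)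
   <= (\<integral>\<^sup>+y\<in>ball y0 (rhf b). log_var (F (t, y)) (iter_deriv [(0, b)] F (t, y)) \<partial>lborel)"
   using rhle[OF that(2)] by (intro nn_integral_mono) (auto simp: indicator_def simp del: iter_deriv.simps)
  also have "... <= ennreal (Cf b)" using PF[OF that(2)] rhle[OF that(2)] that(1) unfolding P_def by auto
  also have "... <= ennreal C" using Cge[OF that(2)] by (rule ennreal_leI)
  finally show ?thesis .
 qed
 ultimately show ?thesis using rh by blast
qed

theorem compact_bound:
 fixes F :: "real \<times> 'a::euclidean_space => complex"
 assumes F: "smooth_open (T \<times> UNIV) F" and KT: "compact KT" "KT \<subseteq> T" and KY: "compact KY"
  and loc: "!!t0 y0. t0 : T ==> \<exists>rh>0. \<exists>C\<ge>0. \<forall>t. \<bar>t - t0\<bar> < rh --> (\<forall>b\<in>Basis.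
   (\<integral>\<^sup>+y\<in>ball y0 rh. log_var (F (t, y)) (iter_deriv [(0, b)] F (t, y)) \<partial>lborel) <= ennreal C)"
 shows "\<exists>C\<ge>0. \<forall>t\<in>KT. \<forall>b\<in>Basis. (\<integral>\<^sup>+y\<in>KY. log_var (F (t, y)) (iter_deriv [(0, b)] F (t, y)) \<partial>lborel) <= ennreal C"
proof -
 define P where "P z rh C \<longleftrightarrow> rh > 0 & C \<ge> 0 & (\<forall>t. \<bar>t - fst z\<bar> < rh --> (\<forall>b\<in>Basis.
   (\<integral>\<^sup>+y\<in>ball (snd z) rh. log_var (F (t, y)) (iter_deriv [(0, b)] F (t, y)) \<partial>lborel) <= ennreal C))" for z rh C
 have "\<exists>rh C. P z rh C" if "z : KT \<times> KY" for z
  using loc[of "fst z" "snd z"] that KT unfolding P_def by (auto simp: mem_Times_iff subset_iff simp del: iter_deriv.simps)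
 then obtain rh C where PC: "!!z. z : KT \<times> KY ==> P z (rh z) (C z)" by metis
 have cpt: "compact (KT \<times> KY)" using KT KY by (intro compact_Times)
 have opn: "open (ball (fst z) (rh z) \<times> ball (snd z) (rh z))" for z by (intro open_Times open_ball)
 have cov: "KT \<times> KY \<subseteq> (\<Union>z\<in>KT \<times> KY. ball (fst z) (rh z) \<times> ball (snd z) (rh z))"
  using PC by (force simp: P_def)
 obtain Z where Z: "Z \<subseteq> KT \<times> KY" "finite Z" "KT \<times> KY \<subseteq> (\<Union>z\<in>Z. ball (fst z) (rh z) \<times> ball (snd z) (rh z))"
  by (rule compactE_image[OF cpt opn cov])
 have C0: "C z \<ge> 0" if "z : Z" for z using PC Z that by (auto simp: P_def)
 have "(\<integral>\<^sup>+y\<in>KY. log_var (F (t, y)) (iter_deriv [(0, b)] F (t, y)) \<partial>lborel) <= ennreal (sum C Z)"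
  if t: "t : KT" and b: "b : Basis" for t b
 proof -
  let ?L = "%y. log_var (F (t, y)) (iter_deriv [(0, b)] F (t, y))"
  have mD: "(%y. iter_deriv vs F (t, y)) : borel_measurable borel" for vs
  proof (rule borel_measurable_continuous_onI)
   have "continuous_on UNIV (%y. (t, y))" by (intro continuous_intros)
   thus "continuous_on UNIV (%y. iter_deriv vs F (t, y))"
    by (rule continuous_on_compose2[OF smooth_open_iter_continuous_on[OF F]]) (use t KT in auto)
  qed
  have mL [measurable]: "?L : borel_measurable borel"
   using mD[of "[]"] mD[of "[(0, b)]"] by (intro log_var_measurable) auto
  \<comment> \<open>Only those boxes of the finite cover whose t-interval contains the given t have
    a usable bound, and they still cover KY.\<close>
  define Z' where "Z' = {z : Z. \<bar>t - fst z\<bar> < rh z}"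
  have "(\<integral>\<^sup>+y\<in>KY. ?L y \<partial>lborel) <= (\<integral>\<^sup>+y. (\<Sum>z\<in>Z'. ?L y * indicator (ball (snd z) (rh z)) y) \<partial>lborel)"
  proof (intro nn_integral_mono)
   fix y
   show "?L y * indicator KY y <= (\<Sum>z\<in>Z'. ?L y * indicator (ball (snd z) (rh z)) y)"
   proof (cases "y : KY")
    case True
    hence "(t, y) : KT \<times> KY" using t by simp
    then obtain z where z: "z : Z" "t : ball (fst z) (rh z)" "y : ball (snd z) (rh z)" using Z(3) by blast
    hence "z : Z'" by (simp add: Z'_def dist_real_def abs_minus_commute)
    hence "?L y * indicator (ball (snd z) (rh z)) y <= (\<Sum>z\<in>Z'. ?L y * indicator (ball (snd z) (rh z)) y)"
     using Z(2) by (intro member_le_sum) (auto simp: Z'_def)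
    thus ?thesis using True z by (simp del: iter_deriv.simps)
   qed simp
  qed
  also have "... = (\<Sum>z\<in>Z'. \<integral>\<^sup>+y\<in>ball (snd z) (rh z). ?L y \<partial>lborel)"
  proof (rule nn_integral_sum)
   show "(%y. ?L y * indicator (ball (snd z) (rh z)) y) : borel_measurable lborel" for z
    unfolding measurable_lborel2 by (rule borel_measurable_times_ennreal[OF mL borel_measurable_indicator]) simp
  qed
  also have "... <= (\<Sum>z\<in>Z'. ennreal (C z))"
  proof (rule sum_mono)
   fix z assume "z : Z'"
   hence "z : KT \<times> KY" "\<bar>t - fst z\<bar> < rh z" using Z(1) by (auto simp: Z'_def)
   thus "(\<integral>\<^sup>+y\<in>ball (snd z) (rh z). ?L y \<partial>lborel) <= ennreal (C z)"
    using PC b unfolding P_def by blast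
  qed
  also have "... <= (\<Sum>z\<in>Z. ennreal (C z))" using Z(2) by (intro sum_mono2) (auto simp: Z'_def)
  also have "... = ennreal (sum C Z)" using C0 by (intro sum_ennreal) auto
  finally show ?thesis .
 qed
 moreover have "sum C Z \<ge> 0" using C0 by (intro sum_nonneg) auto
 ultimately show ?thesis by blast
qed

section \<open>Almost everywhere differentiation of indefinite integrals\<close>

text \<open>Vitali's lemma selects disjoint intervals of radius r whose fivefold enlargements, of
  length 10 r, cover M. Each \<mu> r is at most the integral of k over the selected interval, and by
  disjointness these integrals add up to at most \<eta>.\<close>

lemma maximal_inequality:
 fixes k :: "real => real"
 assumes k [measurable]: "k : borel_measurable lebesgue" and "\<eta> \<ge> 0" "\<mu> > 0"
  and int: "(\<integral>\<^sup>+x. ennreal (k x) \<partial>lebesgue) <= ennreal \<eta>"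
  and M: "!!t. t : M ==> \<exists>r. 0 < r & r <= R & ennreal (\<mu> * r) <= (\<integral>\<^sup>+x\<in>cball t r. ennreal (k x) \<partial>lebesgue)"
 shows "\<exists>T. M \<subseteq> T & T : lmeasurable & measure lebesgue T <= 10 * \<eta> / \<mu>"
proof -
 have "\<exists>r. \<forall>t\<in>M. 0 < r t & r t <= R & ennreal (\<mu> * r t) <= (\<integral>\<^sup>+x\<in>cball t (r t). ennreal (k x) \<partial>lebesgue)"
  using M by (intro bchoice) blast
 then obtain r where r: "!!t. t : M ==> 0 < r t" "!!t. t : M ==> r t <= R"
  "!!t. t : M ==> ennreal (\<mu> * r t) <= (\<integral>\<^sup>+x\<in>cball t (r t). ennreal (k x) \<partial>lebesgue)" by blast
 have cov: "M \<subseteq> (\<Union>t\<in>M. cball t (r t))" using r(1) by force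
 obtain C where C: "countable C" "C \<subseteq> M"
  "pairwise (%i j. disjnt (cball i (r i)) (cball j (r j))) C" "M \<subseteq> (\<Union>i\<in>C. cball i (5 * r i))"
  by (rule Vitali_covering_lemma_cballs[OF cov, of R]) (use r in auto)
 define T where "T = (\<Union>i\<in>C. cball i (5 * r i))"
 have Tm [measurable]: "T : sets lebesgue" unfolding T_def using C(1) by (intro sets.countable_UN') auto
 define \<nu> where "\<nu> = density lebesgue (%x. ennreal (k x))"
 have nu: "emeasure \<nu> X = (\<integral>\<^sup>+x\<in>X. ennreal (k x) \<partial>lebesgue)" if "X : sets lebesgue" for X
  unfolding \<nu>_def using that by (intro emeasure_density) auto
 have "emeasure lebesgue T = (\<integral>\<^sup>+x. indicator T x \<partial>lebesgue)" by simp
 also have "... <= (\<integral>\<^sup>+x. (\<integral>\<^sup>+i. indicator (cball i (5 * r i)) x \<partial>count_space C) \<partial>lebesgue)"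
 proof (intro nn_integral_mono)
  fix x :: real
  show "indicator T x <= (\<integral>\<^sup>+i. indicator (cball i (5 * r i)) x \<partial>count_space C)"
  proof (cases "x : T")
   case True
   then obtain i where i: "i : C" "x : cball i (5 * r i)" by (auto simp: T_def)
   hence "(1::ennreal) = indicator (cball i (5 * r i)) x" by simp
   also have "... <= (\<integral>\<^sup>+i. indicator (cball i (5 * r i)) x \<partial>count_space C)"
    using i(1) by (rule nn_integral_ge_point)
   finally show ?thesis using True by simp
  qed simp
 qed
 also have "... = (\<integral>\<^sup>+i. (\<integral>\<^sup>+x. indicator (cball i (5 * r i)) x \<partial>lebesgue) \<partial>count_space C)"
  using C(1) by (intro nn_integral_count_space_nn_integral) (auto intro!: borel_measurable_indicator)
 also have "... = (\<integral>\<^sup>+i. ennreal (10 * r i) \<partial>count_space C)"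
 proof (intro nn_integral_cong)
  fix i assume "i : space (count_space C)"
  hence "r i > 0" using C(2) r(1) by auto
  thus "(\<integral>\<^sup>+x. indicator (cball i (5 * r i)) x \<partial>lebesgue) = ennreal (10 * r i)"
   by (simp add: cball_eq_atLeastAtMost)
 qed
 also have "... <= (\<integral>\<^sup>+i. ennreal (10 / \<mu>) * emeasure \<nu> (cball i (r i)) \<partial>count_space C)"
 proof (intro nn_integral_mono)
  fix i assume "i : space (count_space C)"
  hence i: "i : M" using C(2) by auto
  have "ennreal (10 * r i) = ennreal (10 / \<mu>) * ennreal (\<mu> * r i)"
   using assms(3) r(1)[OF i] by (subst ennreal_mult[symmetric]) auto
  also have "... <= ennreal (10 / \<mu>) * emeasure \<nu> (cball i (r i))"
   using r(3)[OF i] by (intro mult_left_mono) (auto simp: nu)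
  finally show "ennreal (10 * r i) <= ennreal (10 / \<mu>) * emeasure \<nu> (cball i (r i))" .
 qed
 also have "... = ennreal (10 / \<mu>) * (\<integral>\<^sup>+i. emeasure \<nu> (cball i (r i)) \<partial>count_space C)"
  by (rule nn_integral_cmult) simp
 also have "(\<integral>\<^sup>+i. emeasure \<nu> (cball i (r i)) \<partial>count_space C) = emeasure \<nu> (\<Union>i\<in>C. cball i (r i))"
  using C(1,3) by (intro emeasure_UN_countable[symmetric])
   (auto simp: \<nu>_def disjoint_family_on_def pairwise_def disjnt_def)
 also have "... <= (\<integral>\<^sup>+x. ennreal (k x) \<partial>lebesgue)"
  using C(1) by (subst nu) (auto intro!: nn_integral_mono simp: indicator_def intro!: sets.countable_UN')
 also have "... <= ennreal \<eta>" by (rule int)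
 also have "ennreal (10 / \<mu>) * ennreal \<eta> = ennreal (10 * \<eta> / \<mu>)"
  using assms(2,3) by (subst ennreal_mult[symmetric]) auto
 finally have em: "emeasure lebesgue T <= ennreal (10 * \<eta> / \<mu>)" by (simp add: mult_left_mono)
 have "T : lmeasurable" using em by (intro fmeasurableI) (auto intro: le_less_trans)
 moreover have "measure lebesgue T <= 10 * \<eta> / \<mu>"
  unfolding measure_def using em assms(2,3) by (intro enn2real_leI) auto
 ultimately show ?thesis using C(4) unfolding T_def by blast
qed

text \<open>A measurable function is almost everywhere a limit of continuous ones. Cutting these off
  at the bound B of Q changes nothing in the limit and provides the dominating constant 2 B.\<close>

lemma approximate_bounded_by_continuous:
 fixes Q :: "real => real"
 assumes "Q integrable_on {a..b}" "!!x. x : {a..b} ==> \<bar>Q x\<bar> <= B" "\<eta> > 0" "a <= b"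
 obtains g where "continuous_on UNIV g" "(%x. if x : {a..b} then \<bar>Q x - g x\<bar> else 0) : borel_measurable lebesgue"
  "(\<integral>\<^sup>+x. ennreal (if x : {a..b} then \<bar>Q x - g x\<bar> else 0) \<partial>lebesgue) <= ennreal \<eta>"
proof -
 have mQ0: "Q : borel_measurable (lebesgue_on {a..b})" using assms(1) by (rule integrable_imp_measurable)
 hence "Q measurable_on {a..b}" by (subst measurable_on_iff_borel_measurable) auto
 then obtain N g where N: "negligible N" and g: "!!n. continuous_on UNIV (g n)"
  "!!x. x \<notin> N ==> (%n. g n x) \<longlonglongrightarrow> (if x : {a..b} then Q x else 0)"
  unfolding measurable_on_def by blast
 have B0: "B \<ge> 0" using assms(2)[of a] assms(4) abs_ge_zero[of "Q a"] by simp
 define G where "G n x = max (- B) (min B (g n x))" for n x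
 have cG: "continuous_on UNIV (G n)" for n unfolding G_def using g(1) by (intro continuous_intros) auto
 have mQ [measurable]: "(%x. if x : {a..b} then Q x else 0) : borel_measurable lebesgue"
  using mQ0 by (rule borel_measurable_if_I) simp
 have mG [measurable]: "G n : borel_measurable lebesgue" for n
  by (rule measurable_completion) (simp add: borel_measurable_continuous_onI[OF cG])
 define k where "k n x = (if x : {a..b} then \<bar>Q x - G n x\<bar> else 0)" for n x
 have keq: "k n = (%x. indicator {a..b} x * \<bar>(if x : {a..b} then Q x else 0) - G n x\<bar>)" for n
  by (auto simp: k_def fun_eq_iff)
 have mk: "k n : borel_measurable lebesgue" for n unfolding keq
  by (intro borel_measurable_times borel_measurable_indicator borel_measurable_abs borel_measurable_diff mQ mG) simp
 have "(%n. \<integral>\<^sup>+x. ennreal (k n x) \<partial>lebesgue) \<longlonglongrightarrow> (\<integral>\<^sup>+(x::real). 0 \<partial>lebesgue)"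
 proof (rule nn_integral_dominated_convergence[where w="%x. ennreal (2 * B) * indicator {a..b} x"])
  show "AE x in lebesgue. ennreal (k j x) <= ennreal (2 * B) * indicator {a..b} x" for j
  proof (intro AE_I2)
   fix x
   have "\<bar>G j x\<bar> <= B" using B0 by (auto simp: G_def)
   thus "ennreal (k j x) <= ennreal (2 * B) * indicator {a..b} x"
    using assms(2)[of x] by (auto simp: k_def indicator_def intro!: ennreal_leI)
  qed
  have "(\<integral>\<^sup>+x. ennreal (2 * B) * indicator {a..b} x \<partial>lebesgue) = ennreal (2 * B) * ennreal (b - a)"
   using assms(4) by (subst nn_integral_cmult_indicator) auto
  thus "(\<integral>\<^sup>+x. ennreal (2 * B) * indicator {a..b} x \<partial>lebesgue) < \<infinity>"
   by (simp add: ennreal_mult_less_top)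
  have "AE x in lebesgue. x \<notin> N" using N by (intro AE_not_in) (simp add: negligible_iff_null_sets)
  thus "AE x in lebesgue. (%i. ennreal (k i x)) \<longlonglongrightarrow> 0"
  proof eventually_elim
   case (elim x)
   show ?case
   proof (cases "x : {a..b}")
    case True
    have "(%n. G n x) \<longlonglongrightarrow> max (- B) (min B (Q x))"
     unfolding G_def using g(2)[OF elim] True by (intro tendsto_intros) simp
    also have "max (- B) (min B (Q x)) = Q x" using assms(2)[OF True] by auto
    finally have "(%n. \<bar>Q x - G n x\<bar>) \<longlonglongrightarrow> \<bar>Q x - Q x\<bar>" by (intro tendsto_intros)
    hence "(%n. ennreal (k n x)) \<longlonglongrightarrow> ennreal 0" using True by (intro tendsto_ennrealI) (simp add: k_def)
    thus ?thesis by simp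
   next
    case False
    hence "k i x = 0" for i unfolding k_def by (simp only: if_False)
    thus ?thesis by simp
   qed
  qed
 qed (use mk in \<open>auto intro!: borel_measurable_times_ennreal borel_measurable_indicator\<close>)
 hence "(%n. \<integral>\<^sup>+x. ennreal (k n x) \<partial>lebesgue) \<longlonglongrightarrow> 0" by simp
 hence "\<forall>\<^sub>F n in sequentially. (\<integral>\<^sup>+x. ennreal (k n x) \<partial>lebesgue) < ennreal \<eta>"
  using assms(3) by (intro order_tendstoD) auto
 then obtain n where "(\<integral>\<^sup>+x. ennreal (k n x) \<partial>lebesgue) < ennreal \<eta>" by (auto simp: eventually_sequentially)
 thus thesis using cG[of n] mk[of n] unfolding k_def by (intro that[of "G n"]) (auto intro: less_imp_le)
qed

text \<open>Let g be continuous and close to Q in mean. Wherever |Q - g| is small at t and in mean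
  on all small intervals around t, the quotient is within 3 \<mu> of Q t: one \<mu> from the mean of
  |Q - g|, one from the continuity of g, one from |Q t - g t|. The exceptional t lie in the set of
  the maximal inequality or in a Markov set, both of small measure.\<close>

lemma negligible_bad_quotient:
 fixes Q I :: "real => real"
 assumes ab: "a < b" and int: "!!s t. a <= s ==> s <= t ==> t <= b ==> (Q has_integral (I t - I s)) {s..t}"
  and B: "!!x. x : {a..b} ==> \<bar>Q x\<bar> <= B" and lam: "\<mu> > 0"
 shows "negligible {t : {a<..<b}. \<not> (\<exists>de>0. \<forall>h. h ~= 0 & \<bar>h\<bar> < de --> \<bar>(I (t + h) - I t) / h - Q t\<bar> <= 3 * \<mu>)}"
  (is "negligible ?E")
 unfolding negligible_outer_le
proof (intro allI impI)
 fix e :: real assume "e > 0"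
 \<comment> \<open>The two exceptional sets have measure at most 10 \<eta> / \<mu> and \<eta> /
   \<mu>, which add up to e.\<close>
 define \<eta> where "\<eta> = \<mu> * e / 11"
 have eta: "\<eta> > 0" using \<open>e > 0\<close> lam by (simp add: \<eta>_def)
 have Qint: "Q integrable_on {a..b}" using int[of a b] ab by (auto simp: integrable_on_def)
 obtain g where g: "continuous_on UNIV g"
  "(%x. if x : {a..b} then \<bar>Q x - g x\<bar> else 0) : borel_measurable lebesgue"
  "(\<integral>\<^sup>+x. ennreal (if x : {a..b} then \<bar>Q x - g x\<bar> else 0) \<partial>lebesgue) <= ennreal \<eta>"
  by (rule approximate_bounded_by_continuous[OF Qint B eta]) (use ab in auto)
 define k where "k x = (if x : {a..b} then \<bar>Q x - g x\<bar> else 0)" for x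
 have km [measurable]: "k : borel_measurable lebesgue" using g(2) by (simp add: k_def[abs_def])
 have kint: "(\<integral>\<^sup>+x. ennreal (k x) \<partial>lebesgue) <= ennreal \<eta>" using g(3) by (simp add: k_def)
 have k0: "k x \<ge> 0" for x by (simp add: k_def)
 define M where "M = {t. \<exists>r. 0 < r & r <= b - a & ennreal (\<mu> * r) <= (\<integral>\<^sup>+x\<in>cball t r. ennreal (k x) \<partial>lebesgue)}"
 obtain T1 where T1: "M \<subseteq> T1" "T1 : lmeasurable" "measure lebesgue T1 <= 10 * \<eta> / \<mu>"
  using maximal_inequality[OF km _ lam kint, of M "b - a"] eta unfolding M_def by auto
 define T2 where "T2 = {x : space lebesgue. 1 <= ennreal (1 / \<mu>) * ennreal (k x)}"
 have "emeasure lebesgue T2 <= ennreal (1 / \<mu>) * (\<integral>\<^sup>+x\<in>space lebesgue. ennreal (k x) \<partial>lebesgue)"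
  unfolding T2_def by (rule nn_integral_Markov_inequality) auto
 also have "... <= ennreal (1 / \<mu>) * ennreal \<eta>" using kint by (intro mult_left_mono) auto
 also have "... = ennreal (\<eta> / \<mu>)" using lam eta by (subst ennreal_mult[symmetric]) auto
 finally have em2: "emeasure lebesgue T2 <= ennreal (\<eta> / \<mu>)" .
 have "T2 : sets lebesgue" unfolding T2_def by measurable
 hence T2: "T2 : lmeasurable" "measure lebesgue T2 <= \<eta> / \<mu>"
  using em2 eta lam by (auto intro!: fmeasurableI enn2real_leI simp: measure_def intro: le_less_trans)
 have "?E \<subseteq> T1 \<union> T2"
 proof
  fix t assume t: "t : ?E"
  show "t : T1 \<union> T2"
  proof (rule ccontr)
   assume "t \<notin> T1 \<union> T2"
   hence tM: "t \<notin> M" and tT2: "t \<notin> T2" using T1(1) by auto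
   have tab: "a < t" "t < b" using t by auto
   have "k t < \<mu>"
   proof (rule ccontr)
    assume "\<not> k t < \<mu>"
    hence "1 <= ennreal (1 / \<mu> * k t)" using lam by (simp add: field_simps)
    thus False using tT2 lam k0 by (simp add: T2_def ennreal_mult'[symmetric])
   qed
   hence kt: "\<bar>Q t - g t\<bar> <= \<mu>" using tab by (simp add: k_def)
   have "isCont g t" using g(1) by (simp add: continuous_on_eq_continuous_at)
   then obtain d where d: "d > 0" "!!x. \<bar>x - t\<bar> < d ==> \<bar>g x - g t\<bar> < \<mu>"
    using lam unfolding continuous_at_eps_delta by (auto simp: dist_real_def)
   define de where "de = min d (min (t - a) (b - t))"
   have de: "de > 0" using d tab by (simp add: de_def)
   have "\<bar>(I (t + h) - I t) / h - Q t\<bar> <= 3 * \<mu>" if h: "h ~= 0" "\<bar>h\<bar> < de" for h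
   proof -
    define u v where "u = min t (t + h)" and "v = max t (t + h)"
    have uv: "a <= u" "u <= v" "v <= b" "v - u = \<bar>h\<bar>" using h by (auto simp: u_def v_def de_def)
    have near: "x : {a..b}" "\<bar>x - t\<bar> < d" "x : cball t \<bar>h\<bar>" if "x : {u..v}" for x
    proof -
     have le: "\<bar>x - t\<bar> <= \<bar>h\<bar>"
      using that by (auto simp: u_def v_def min_def max_def split: if_splits)
     thus "x : {a..b}" "\<bar>x - t\<bar> < d" "x : cball t \<bar>h\<bar>"
      using that h uv by (auto simp: de_def dist_real_def abs_minus_commute)
    qed
    have hi: "(Q has_integral (I v - I u)) {u..v}" using int uv by blast
    have hi2: "((%x. Q x - Q t) has_integral (I v - I u) - (v - u) * Q t) {u..v}"
     using has_integral_diff[OF hi has_integral_const_real[of "Q t" u v]] uv by simp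
    have "ennreal (\<mu> * \<bar>h\<bar>) > (\<integral>\<^sup>+x\<in>cball t \<bar>h\<bar>. ennreal (k x) \<partial>lebesgue)"
    proof (rule ccontr)
     assume "\<not> ?thesis"
     hence "ennreal (\<mu> * \<bar>h\<bar>) <= (\<integral>\<^sup>+x\<in>cball t \<bar>h\<bar>. ennreal (k x) \<partial>lebesgue)" by (simp only: not_less)
     moreover have "0 < \<bar>h\<bar>" "\<bar>h\<bar> <= b - a" using h tab by (auto simp: de_def)
     ultimately have "t : M" unfolding M_def by blast
     thus False using tM by simp
    qed
    moreover have "(\<integral>\<^sup>+x\<in>{u..v}. ennreal (k x) \<partial>lebesgue) <= (\<integral>\<^sup>+x\<in>cball t \<bar>h\<bar>. ennreal (k x) \<partial>lebesgue)"
     using near(3) by (intro nn_integral_mono) (auto simp: indicator_def)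
    ultimately have kuv: "(\<integral>\<^sup>+x\<in>{u..v}. ennreal (k x) \<partial>lebesgue) < ennreal (\<mu> * \<bar>h\<bar>)" by (rule le_less_trans[rotated])
    have eqi: "ennreal (indicator {u..v} x *\<^sub>R k x) = ennreal (k x) * indicator {u..v} x" for x by (simp add: indicator_def)
    have si: "set_integrable lebesgue {u..v} k" unfolding set_integrable_def
    proof (rule integrableI_nonneg)
     show "AE x in lebesgue. 0 <= indicator {u..v} x *\<^sub>R k x" using k0 by (intro AE_I2) simp
     show "(\<integral>\<^sup>+ x. ennreal (indicator {u..v} x *\<^sub>R k x) \<partial>lebesgue) < \<infinity>"
      unfolding eqi using kuv by (rule less_trans) simp
    qed (intro borel_measurable_scaleR borel_measurable_indicator km, simp)
    hence kI: "k integrable_on {u..v}" "(LINT x:{u..v}|lebesgue. k x) = integral {u..v} k"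
     by (auto dest: set_lebesgue_integral_eq_integral)
    have "ennreal (integral {u..v} k) = (\<integral>\<^sup>+ x. ennreal (indicator {u..v} x *\<^sub>R k x) \<partial>lebesgue)"
     using si k0 unfolding kI(2)[symmetric] set_lebesgue_integral_def set_integrable_def
     by (intro nn_integral_eq_integral[symmetric]) auto
    hence "ennreal (integral {u..v} k) < ennreal (\<mu> * \<bar>h\<bar>)" unfolding eqi using kuv by simp
    hence ik: "integral {u..v} k <= \<mu> * \<bar>h\<bar>" using lam by (simp add: ennreal_less_iff integral_nonneg kI k0)
    have "norm (integral {u..v} (%x. Q x - Q t)) <= integral {u..v} (%x. k x + 2 * \<mu>)"
    proof (rule integral_norm_bound_integral)
     show "(%x. Q x - Q t) integrable_on {u..v}" using hi2 by (auto simp: integrable_on_def)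
     show "(%x. k x + 2 * \<mu>) integrable_on {u..v}" using kI(1) by (intro integrable_add integrable_const_ivl)
     fix x assume x: "x : {u..v}"
     have "\<bar>Q x - Q t\<bar> <= \<bar>Q x - g x\<bar> + \<bar>g x - g t\<bar> + \<bar>Q t - g t\<bar>" by linarith
     also have "... <= k x + \<mu> + \<mu>" using near[OF x] d(2)[of x] kt by (simp add: k_def)
     finally show "norm (Q x - Q t) <= k x + 2 * \<mu>" by simp
    qed
    also have "... = integral {u..v} k + (v - u) * (2 * \<mu>)"
     using kI(1) uv by (subst integral_add) auto
    also have "... <= 3 * \<mu> * \<bar>h\<bar>" using ik uv by (simp add: algebra_simps)
    finally have main: "\<bar>(I v - I u) - (v - u) * Q t\<bar> <= 3 * \<mu> * \<bar>h\<bar>"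
     using hi2 by (simp add: integral_unique)
    have "\<bar>(I (t + h) - I t) - h * Q t\<bar> = \<bar>(I v - I u) - (v - u) * Q t\<bar>"
     unfolding u_def v_def by (cases "h > 0") (auto simp: min_def max_def abs_if algebra_simps)
    hence "\<bar>(I (t + h) - I t) - h * Q t\<bar> <= 3 * \<mu> * \<bar>h\<bar>" using main by simp
    moreover have "(I (t + h) - I t) / h - Q t = ((I (t + h) - I t) - h * Q t) / h" using h by (simp add: field_simps)
    ultimately show ?thesis using h by (simp add: abs_divide divide_le_eq del: diff_divide_distrib)
   qed
   thus False using t de by blast
  qed
 qed
 moreover have "measure lebesgue (T1 \<union> T2) <= e"
 proof -
  have "measure lebesgue (T1 \<union> T2) <= measure lebesgue T1 + measure lebesgue T2"
   using T1 T2 by (intro measure_Un_le) auto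
  also have "... <= 10 * \<eta> / \<mu> + \<eta> / \<mu>" using T1 T2 by (intro add_mono)
  also have "... = e" using lam by (simp add: \<eta>_def field_simps)
  finally show ?thesis .
 qed
 moreover have "T1 \<union> T2 : lmeasurable" using T1 T2 by (intro fmeasurable.Un)
 ultimately show "\<exists>T. ?E \<subseteq> T & T : lmeasurable & measure lebesgue T <= e" by blast
qed

text \<open>Lebesgue's differentiation theorem for a bounded integrand: failure of differentiability
  with value Q t is failure for some tolerance 3 / (n + 1), and a countable union of negligible sets
  is negligible.\<close>

theorem negligible_not_differentiable_integral:
 fixes Q I :: "real => real"
 assumes ab: "a < b" and int: "!!s t. a <= s ==> s <= t ==> t <= b ==> (Q has_integral (I t - I s)) {s..t}"
  and B: "!!x. x : {a..b} ==> \<bar>Q x\<bar> <= B"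
 shows "negligible {t : {a<..<b}. \<not> (I has_real_derivative Q t) (at t)}"
proof -
 define E where "E n = {t : {a<..<b}. \<not> (\<exists>de>0. \<forall>h. h ~= 0 & \<bar>h\<bar> < de --> \<bar>(I (t + h) - I t) / h - Q t\<bar> <= 3 * (1 / real (Suc n)))}" for n
 have "negligible (E n)" for n
  unfolding E_def by (rule negligible_bad_quotient[OF ab int B]) (simp_all del: of_nat_Suc)
 hence "negligible (\<Union>n. E n)" by (rule negligible_Union_nat)
 moreover have "{t : {a<..<b}. \<not> (I has_real_derivative Q t) (at t)} \<subseteq> (\<Union>n. E n)"
 proof
  fix t assume t: "t : {t : {a<..<b}. \<not> (I has_real_derivative Q t) (at t)}"
  show "t : (\<Union>n. E n)"
  proof (rule ccontr)
   assume "t \<notin> (\<Union>n. E n)"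
   hence good: "\<exists>de>0. \<forall>h. h ~= 0 & \<bar>h\<bar> < de --> \<bar>(I (t + h) - I t) / h - Q t\<bar> <= 3 * (1 / real (Suc n))" for n
    using t unfolding E_def by blast
   have "(%h. (I (t + h) - I t) / h) \<midarrow>0\<rightarrow> Q t"
    unfolding LIM_eq
   proof (intro allI impI)
    fix r :: real assume "r > 0"
    then obtain n where n: "3 * (1 / real (Suc n)) < r"
     using reals_Archimedean[of "r / 3"] by (auto simp: inverse_eq_divide)
    obtain de where de: "de > 0" "!!h. h ~= 0 ==> \<bar>h\<bar> < de ==> \<bar>(I (t + h) - I t) / h - Q t\<bar> <= 3 * (1 / real (Suc n))"
     using good[of n] by blast
    show "\<exists>s>0. \<forall>h. h ~= 0 & norm (h - 0) < s --> norm ((I (t + h) - I t) / h - Q t) < r"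
     using de n by (intro exI[of _ de]) (auto intro: le_less_trans)
   qed
   hence "(I has_real_derivative Q t) (at t)" by (simp add: DERIV_def)
   thus False using t by simp
  qed
 qed
 ultimately show ?thesis by (rule negligible_subset)
qed

section \<open>Totally real submanifolds and the tube\<close>

lemma real_linear_cvec_expansion:
 fixes g :: "complex ^ 'n::finite => 'b::real_vector"
 assumes "linear g"
 shows "g v = (\<Sum>j\<in>UNIV. Re (v $ j) *\<^sub>R g (axis j 1) + Im (v $ j) *\<^sub>R g (axis j \<i>))"
proof -
 have "v = (\<Sum>j\<in>UNIV. Re (v $ j) *\<^sub>R axis j 1 + Im (v $ j) *\<^sub>R axis j \<i>)"
  unfolding vec_eq_iff
  by (simp add: axis_def scaleR_complex.ctr complex_eq_iff if_distrib[of "%c. _ *\<^sub>R c"] if_distrib[of Re] if_distrib[of Im] if_distrib[of "%c. _ * c"] sum.distrib cong: if_cong)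
 hence "g v = g (\<Sum>j\<in>UNIV. Re (v $ j) *\<^sub>R axis j 1 + Im (v $ j) *\<^sub>R axis j \<i>)" by (rule arg_cong)
 also have "... = (\<Sum>j\<in>UNIV. Re (v $ j) *\<^sub>R g (axis j 1) + Im (v $ j) *\<^sub>R g (axis j \<i>))"
  using assms by (simp add: linear_sum linear_add linear_scale)
 finally show ?thesis .
qed

text \<open>The right side is twice the antilinear part of g at v, and g (e_j) + \<i> g (\<i> e_j)
  is twice the derivative with respect to the conjugate of the j-th coordinate. This is the form in
  which the Levi matrix acts.\<close>

lemma antilinear_part:
 fixes g :: "complex ^ 'n::finite => complex"
 assumes "linear g"
 shows "(\<Sum>j\<in>UNIV. cnj (v $ j) * (g (axis j 1) + \<i> * g (axis j \<i>))) = g v + \<i> * g (\<i> *s v)"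
proof -
 have "g v + \<i> * g (\<i> *s v) = (\<Sum>j\<in>UNIV. Re (v $ j) *\<^sub>R g (axis j 1) + Im (v $ j) *\<^sub>R g (axis j \<i>))
  + \<i> * (\<Sum>j\<in>UNIV. Re ((\<i> *s v) $ j) *\<^sub>R g (axis j 1) + Im ((\<i> *s v) $ j) *\<^sub>R g (axis j \<i>))"
  using real_linear_cvec_expansion[OF assms, of v] real_linear_cvec_expansion[OF assms, of "\<i> *s v"] by simp
 also have "... = (\<Sum>j\<in>UNIV. cnj (v $ j) * (g (axis j 1) + \<i> * g (axis j \<i>)))"
  unfolding sum_distrib_left sum.distrib[symmetric]
  by (intro sum.cong) (auto simp: complex_eq_iff algebra_simps)
 finally show ?thesis ..
qed

lemma linear_mult_i: "linear (mult_i :: 'n::finite cphase => _)"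
 by (rule bounded_linear.linear[OF bounded_linear_mult_i])

lemmas mult_i_add = linear_add[OF linear_mult_i]
 and mult_i_scaleR = linear_scale[OF linear_mult_i]
 and mult_i_zero = linear_0[OF linear_mult_i]

lemma tubeI: "a : Lam \<Phi> ==> w : W ==> a + mult_i w : tube \<Phi> W"
 unfolding tube_def by blast

lemma tubeE:
 assumes "rh : tube \<Phi> W"
 obtains a w where "a : Lam \<Phi>" "w : W" "rh = a + mult_i w"
 using assms unfolding tube_def by blast

subsection \<open>The linear Lagrangian of a quadratic weight\<close>

lemma quadratic_form_derivative:
 fixes \<Phi> :: "complex ^ 'n::finite => real"
 assumes B: "bilinear B" "!!x. \<Phi> x = B x x"
 shows "((%y. complex_of_real (\<Phi> y)) has_derivative (%v. of_real (B x v + B v x))) (at x)"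
proof -
 have bb: "bounded_bilinear B" using B(1) by (rule bilinear_conv_bounded_bilinear[THEN iffD1])
 have "((%y. B y y) has_derivative (%v. B x v + B v x)) (at x)"
  using bounded_bilinear.FDERIV[OF bb has_derivative_ident has_derivative_ident, of x] by simp
 moreover have "\<Phi> = (%y. B y y)" using B(2) by (rule ext)
 ultimately have "(\<Phi> has_derivative (%v. B x v + B v x)) (at x)" by simp
 thus ?thesis by (rule bounded_linear.has_derivative[OF bounded_linear_of_real])
qed

text \<open>The second claim expresses that \<open>Lam \<Phi>\<close> is totally real. The first
  components give x = - \<i> y; inserted into the second ones, this says that the antilinear part of
  the gradient map vanishes at y, and pairing with y makes the Levi form vanish at y.\<close>

lemma quadratic_graph:
 fixes \<Phi> :: "complex ^ 'n::finite => real"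
 assumes "real_quadratic_form \<Phi>"
 shows "linear (graph_point \<Phi>)"
  and "strictly_psh \<Phi> ==> graph_point \<Phi> x + mult_i (graph_point \<Phi> y) = 0 ==> y = 0"
proof -
 obtain B where B: "bilinear B" "!!x. \<Phi> x = B x x" using assms unfolding real_quadratic_form_def by blast
 have fd: "frechet_derivative (%y. complex_of_real (\<Phi> y)) (at x) = (%v. of_real (B x v + B v x))" for x
  using frechet_derivative_at[OF quadratic_form_derivative[OF B]] by metis
 define g where "g j x = wirt j (%y. complex_of_real (\<Phi> y)) x" for j x
 have geq: "g j x = (of_real (B x (axis j 1) + B (axis j 1) x) - \<i> * of_real (B x (axis j \<i>) + B (axis j \<i>) x)) / 2" for j x
  by (simp add: g_def wirt_def fd)
 have ling: "linear (g j)" for j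
 proof (rule linearI)
  show "g j (x + y) = g j x + g j y" for x y
   unfolding geq using B(1) by (simp add: bilinear_ladd bilinear_radd algebra_simps add_divide_distrib[symmetric])
  show "g j (r *\<^sub>R x) = r *\<^sub>R g j x" for r x
   unfolding geq using B(1) by (simp add: bilinear_lmul bilinear_rmul scaleR_conv_of_real[where 'a=complex] algebra_simps)
 qed
 have gp: "graph_point \<Phi> x = (x, \<chi> j. (2 / \<i>) * g j x)" for x by (simp add: graph_point_def g_def)
 show lin: "linear (graph_point \<Phi>)"
 proof (rule linearI)
  show "graph_point \<Phi> (x + y) = graph_point \<Phi> x + graph_point \<Phi> y" for x y
   unfolding gp by (simp add: vec_eq_iff linear_add[OF ling] algebra_simps)
  show "graph_point \<Phi> (r *\<^sub>R x) = r *\<^sub>R graph_point \<Phi> x" for r x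
   unfolding gp by (simp add: vec_eq_iff linear_scale[OF ling] scaleR_conv_of_real[where 'a=complex])
 qed
 assume psh: "strictly_psh \<Phi>" and eq: "graph_point \<Phi> x + mult_i (graph_point \<Phi> y) = 0"
 show "y = 0"
 proof (rule ccontr)
  assume y: "y ~= 0"
  have x: "x + \<i> *s y = 0" using eq by (simp add: gp mult_i_def prod_eq_iff)
  have comp: "(2 / \<i>) * g k x + \<i> * ((2 / \<i>) * g k y) = 0" for k
   using eq by (simp add: gp mult_i_def prod_eq_iff vec_eq_iff)
  have xe: "x = (-1) *\<^sub>R (\<i> *s y)" using x by (simp add: eq_neg_iff_add_eq_0)
  have gx: "g k x = - g k (\<i> *s y)" for k using linear_scale[OF ling, of k "-1" "\<i> *s y"] unfolding xe by simp
  have anti: "g k y + \<i> * g k (\<i> *s y) = 0" for k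
  proof -
   have "(2 / \<i>) * (g k x + \<i> * g k y) = 0" using comp[of k] by (simp only: distrib_left mult.left_commute)
   hence "g k x + \<i> * g k y = 0" by simp
   hence "g k (\<i> *s y) = \<i> * g k y" unfolding gx by (metis add_eq_0_iff minus_minus)
   thus ?thesis by (simp only: mult.assoc[symmetric] i_squared) simp
  qed
  have lev: "levi \<Phi> x' $ j $ k = (g k (axis j 1) + \<i> * g k (axis j \<i>)) / 2" for x' j k
  proof -
   have "wirt k (%y. complex_of_real (\<Phi> y)) = g k" by (simp add: fun_eq_iff g_def)
   moreover have "frechet_derivative (g k) (at x') = g k"
    using ling[of k] by (intro frechet_derivative_at[symmetric] bounded_linear_imp_has_derivative) (simp add: linear_conv_bounded_linear)
   ultimately show ?thesis by (simp add: levi_def wirt_bar_def)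
  qed
  have "(\<Sum>j\<in>UNIV. \<Sum>k\<in>UNIV. levi \<Phi> 0 $ j $ k * cnj (y $ j) * y $ k)
   = (\<Sum>k\<in>UNIV. (\<Sum>j\<in>UNIV. cnj (y $ j) * (g k (axis j 1) + \<i> * g k (axis j \<i>))) * (y $ k / 2))"
   unfolding lev sum_distrib_right by (subst sum.swap) (auto intro!: sum.cong simp: field_simps)
  also have "... = 0" unfolding antilinear_part[OF ling] anti by simp
  finally have zero: "(\<Sum>j\<in>UNIV. \<Sum>k\<in>UNIV. levi \<Phi> 0 $ j $ k * cnj (y $ j) * y $ k) = 0" .
  from psh[unfolded strictly_psh_def, rule_format, OF y, of 0] show False
   unfolding zero by simp
 qed
qed

locale quadratic_weight =
 fixes \<Phi> :: "complex ^ 'n::finite => real"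
 assumes quadratic: "real_quadratic_form \<Phi>" and psh: "strictly_psh \<Phi>"
begin

text \<open>Coordinates adapted to the tube: \<open>Lam \<Phi>\<close> is totally real of half the
  dimension, so every point of phase space is a + \<i> w with unique a and w in
  \<open>Lam \<Phi>\<close>.\<close>

definition split_map :: "'n cphase => 'n cphase" where
 "split_map z = graph_point \<Phi> (fst z) + mult_i (graph_point \<Phi> (snd z))"

lemma linear_graph: "linear (graph_point \<Phi>)" by (rule quadratic_graph(1)[OF quadratic])

lemma fst_graph [simp]: "fst (graph_point \<Phi> x) = x" by (simp add: graph_point_def)

lemma linear_split: "linear split_map"
 unfolding split_map_def
 by (intro linearI)
  (simp_all add: linear_add[OF linear_graph] linear_scale[OF linear_graph] mult_i_add mult_i_scaleR algebra_simps)

lemma inj_split: "inj split_map"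
proof (rule linear_injective_0[OF linear_split, THEN iffD2], intro allI impI)
 fix z assume "split_map z = 0"
 hence e: "graph_point \<Phi> (fst z) + mult_i (graph_point \<Phi> (snd z)) = 0" by (simp add: split_map_def)
 hence "snd z = 0" by (rule quadratic_graph(2)[OF quadratic psh])
 moreover from this have "graph_point \<Phi> (fst z) = 0"
  using e linear_0[OF linear_graph] by (simp add: mult_i_zero)
 hence "fst z = 0" by (metis fst_graph fst_zero)
 ultimately show "z = 0" by (simp add: prod_eq_iff)
qed

lemma split_inverse: obtains R c where "linear R" "!!z. split_map (R z) = z" "c > 0" "!!z. norm (graph_point \<Phi> (snd (R z))) <= c * norm z"
proof -
 obtain R where R: "linear R" "\<forall>x. R (split_map x) = x" "\<forall>x. split_map (R x) = x"
  using linear_injective_isomorphism[OF linear_split inj_split] by blast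
 have "linear (%z. graph_point \<Phi> (snd (R z)))"
  using linear_compose[OF linear_compose[OF R(1) linear_snd] linear_graph] by (simp add: o_def)
 then obtain c where "c > 0" "!!z. norm (graph_point \<Phi> (snd (R z))) <= c * norm z"
  using linear_bounded_pos by metis
 thus thesis using that R by blast
qed

text \<open>In the splitting, a perturbation moves w by at most c times its size, while a may move
  freely in \<open>Lam \<Phi>\<close>. So the distance from the compact \<open>closure W'\<close> to
  the complement of W gives a uniform radius although the tube is unbounded.\<close>

lemma tube_margin:
 assumes "openin (top_of_set (Lam \<Phi>)) W" "bounded W'" "closure W' \<subseteq> W"
 shows "\<exists>r>0. \<forall>rh\<in>tube \<Phi> W'. ball rh r \<subseteq> tube \<Phi> W"
proof -
 obtain Q where Q: "open Q" "W = Lam \<Phi> \<inter> Q" using assms(1) by (auto simp: openin_open)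
 have "compact (closure W')" using assms(2) by simp
 moreover have "closure W' \<inter> (- Q) = {}" using assms(3) Q by auto
 ultimately obtain d where d: "d > 0" "!!x y. x : closure W' ==> y : - Q ==> d <= dist x y"
  using separate_compact_closed[of "closure W'" "- Q"] Q(1) by (auto simp: closed_def)
 obtain R c where R: "linear R" "!!z. split_map (R z) = z" "c > 0" "!!z. norm (graph_point \<Phi> (snd (R z))) <= c * norm z"
  using split_inverse by blast
 have "ball rh (d / c) \<subseteq> tube \<Phi> W" if "rh : tube \<Phi> W'" for rh
 proof
  fix z assume z: "z : ball rh (d / c)"
  obtain a w where a: "a : Lam \<Phi>" "w : W'" "rh = a + mult_i w" using \<open>rh : tube \<Phi> W'\<close> by (rule tubeE)
  define u where "u = R (z - rh)"
  have zr: "z - rh = graph_point \<Phi> (fst u) + mult_i (graph_point \<Phi> (snd u))"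
   using R(2)[of "z - rh"] by (simp only: u_def split_map_def)
  have "norm (graph_point \<Phi> (snd u)) <= c * norm (z - rh)" unfolding u_def by (rule R(4))
  also have "... < c * (d / c)" using z R(3) by (intro mult_strict_left_mono) (simp_all only: mem_ball dist_norm norm_minus_commute)
  finally have small: "norm (graph_point \<Phi> (snd u)) < d" using R(3) by simp
  have wc: "w : closure W'" using a closure_subset by blast
  obtain x y where xy: "a = graph_point \<Phi> x" "w = graph_point \<Phi> y"
   using a wc assms(3) Q(2) by (auto simp: Lam_def)
  have "w + graph_point \<Phi> (snd u) : Q"
  proof (rule ccontr)
   assume "w + graph_point \<Phi> (snd u) \<notin> Q"
   hence "d <= dist w (w + graph_point \<Phi> (snd u))" using d(2)[OF wc] by simp
   moreover have "dist w (w + graph_point \<Phi> (snd u)) = norm (graph_point \<Phi> (snd u))"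
    by (metis add_diff_cancel_left' dist_commute dist_norm)
   ultimately show False using small by simp
  qed
  moreover have "w + graph_point \<Phi> (snd u) : Lam \<Phi>"
   unfolding xy linear_add[OF linear_graph, symmetric] by (simp add: Lam_def)
  moreover have "a + graph_point \<Phi> (fst u) : Lam \<Phi>"
   unfolding xy linear_add[OF linear_graph, symmetric] by (simp add: Lam_def)
  moreover have "z = (a + graph_point \<Phi> (fst u)) + mult_i (w + graph_point \<Phi> (snd u))"
  proof -
   have "z = rh + (z - rh)" by (metis add.commute diff_add_cancel)
   also have "... = (a + graph_point \<Phi> (fst u)) + mult_i (w + graph_point \<Phi> (snd u))"
    unfolding zr unfolding a(3) by (simp only: mult_i_add add_ac)
   finally show ?thesis .
  qed
  ultimately show "z : tube \<Phi> W" unfolding tube_def Q(2) by blast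
 qed
 thus ?thesis using d(1) R(3) by (intro exI[of _ "d / c"]) simp
qed

lemma open_tube:
 assumes "openin (top_of_set (Lam \<Phi>)) W"
 shows "open (tube \<Phi> W)"
 unfolding open_contains_ball
proof
 fix rh assume "rh : tube \<Phi> W"
 then obtain a w where a: "a : Lam \<Phi>" "w : W" "rh = a + mult_i w" by (rule tubeE)
 then obtain r where "r > 0" "\<forall>rh\<in>tube \<Phi> {w}. ball rh r \<subseteq> tube \<Phi> W"
  using tube_margin[OF assms, of "{w}"] by auto
 moreover have "rh : tube \<Phi> {w}" unfolding a(3) using a(1) by (rule tubeI) simp
 ultimately show "\<exists>e>0. ball rh e \<subseteq> tube \<Phi> W" by blast
qed

lemma tube_mono: "W' \<subseteq> W ==> tube \<Phi> W' \<subseteq> tube \<Phi> W"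
 unfolding tube_def by blast

lemma norm_fst_le: "norm (fst z) <= norm z" for z :: "'a::real_normed_vector \<times> 'b::real_normed_vector"
 by (metis norm_fst_le prod.collapse)

lemma tube_norm_bound:
 assumes "bounded W'"
 shows "\<exists>C>0. \<forall>rh\<in>tube \<Phi> W'. norm rh <= C * (1 + norm (fst rh))"
proof -
 obtain B where B: "B > 0" "!!w. w : W' ==> norm w <= B" using assms by (meson bounded_pos)
 obtain c where c: "c > 0" "!!x. norm (graph_point \<Phi> x) <= c * norm x" using linear_bounded_pos[OF linear_graph] by metis
 have "norm rh <= (c * (1 + B) + B) * (1 + norm (fst rh))" if "rh : tube \<Phi> W'" for rh
 proof -
  obtain x w where x: "w : W'" "rh = graph_point \<Phi> x + mult_i w"
   using \<open>rh : tube \<Phi> W'\<close> unfolding tube_def Lam_def by blast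
  have nw: "norm (mult_i w) <= B" using B(2)[OF x(1)] by (simp only: norm_mult_i)
  have "x = fst rh - fst (mult_i w)" by (simp only: x(2) fst_add fst_graph add_diff_cancel_right')
  hence "norm x <= norm (fst rh) + norm (fst (mult_i w))" using norm_triangle_ineq4 by metis
  hence "norm x <= norm (fst rh) + B" using norm_fst_le[of "mult_i w"] nw by linarith
  hence "c * norm x <= c * (norm (fst rh) + B)" using c by (intro mult_left_mono) auto
  moreover have "norm rh <= c * norm x + B"
   using norm_triangle_ineq[of "graph_point \<Phi> x" "mult_i w"] c(2)[of x] nw unfolding x(2) by linarith
  moreover have "c * (norm (fst rh) + B) + B <= (c * (1 + B) + B) * (1 + norm (fst rh))"
  proof -
   have "0 <= c * B * norm (fst rh)" "0 <= B * norm (fst rh)" using c B by auto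
   thus ?thesis using c by (simp add: algebra_simps)
  qed
  ultimately show ?thesis by linarith
 qed
 thus ?thesis using B c by (intro exI[of _ "c * (1 + B) + B"]) (auto intro!: add_pos_pos)
qed

text \<open>The direction b belongs to \<open>Lam \<Phi>\<close>, so the strip |Im \<zeta>| < r /
  |b| of the line through \<open>rh\<close> stays in the tube. If p vanished near \<zeta> = 0, it
  would vanish on the whole strip, contrary to p \<rightarrow> 1 along the real axis.\<close>

lemma nonzero_on_real_line:
 assumes W: "openin (top_of_set (Lam \<Phi>)) W" and p: "holomorphic_cphase p (tube \<Phi> W)"
  and decay: "m < 0" "!!rh. rh : tube \<Phi> W ==> cmod (p rh - 1) <= C * (sqrt (1 + (norm rh)\<^sup>2)) powr m"
  and rh: "rh : tube \<Phi> W" and b: "b = graph_point \<Phi> x" "x ~= 0" and e: "e > 0"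
 shows "\<exists>\<zeta>. cmod \<zeta> < e & p (rh + cscale \<zeta> b) ~= 0"
proof (rule ccontr)
 assume neg: "\<not> ?thesis"
 obtain a w where a: "a : Lam \<Phi>" "w : W" "rh = a + mult_i w" using rh by (rule tubeE)
 obtain r where r: "r > 0" "\<forall>rh\<in>tube \<Phi> {w}. ball rh r \<subseteq> tube \<Phi> W" using tube_margin[OF W, of "{w}"] a by auto
 have bn: "norm b > 0"
 proof -
  have "b ~= 0" using b by (metis fst_graph fst_zero)
  thus ?thesis by simp
 qed
 define D where "D = {\<zeta>::complex. \<bar>Im \<zeta>\<bar> < r / norm b}"
 have Deq: "D = {\<zeta>. Im \<zeta> < r / norm b} \<inter> {\<zeta>. - (r / norm b) < Im \<zeta>}" by (auto simp: D_def)
 have oD: "open D" unfolding Deq by (intro open_Int open_halfspace_Im_lt open_halfspace_Im_gt)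
 have cD: "connected D" unfolding Deq
  by (intro convex_connected convex_Int) (auto simp: convex_halfspace_Im_lt convex_halfspace_Im_gt)
 have inT: "rh + cscale \<zeta> b : tube \<Phi> W" if "\<zeta> : D" for \<zeta>
 proof -
  obtain y where y: "a = graph_point \<Phi> y" using a by (auto simp: Lam_def)
  have "a + Re \<zeta> *\<^sub>R b = graph_point \<Phi> (y + Re \<zeta> *\<^sub>R x)"
   unfolding y b by (simp only: linear_add[OF linear_graph] linear_scale[OF linear_graph])
  hence "a + Re \<zeta> *\<^sub>R b : Lam \<Phi>" by (simp add: Lam_def)
  from tubeI[OF this, of w "{w}"] have "rh + Re \<zeta> *\<^sub>R b : tube \<Phi> {w}"
   unfolding a(3) by (simp add: add_ac)
  moreover have "rh + cscale \<zeta> b : ball (rh + Re \<zeta> *\<^sub>R b) r"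
  proof -
   have "dist (rh + cscale \<zeta> b) (rh + Re \<zeta> *\<^sub>R b) = norm (Im \<zeta> *\<^sub>R mult_i b)"
    unfolding cscale_eq dist_norm by (simp only: add_diff_cancel_left add_diff_cancel_left' add.assoc[symmetric])
   also have "... = \<bar>Im \<zeta>\<bar> * norm b" by (simp only: norm_scaleR norm_mult_i)
   also have "... < r" using that bn by (simp add: D_def pos_less_divide_eq)
   finally show ?thesis by (simp only: mem_ball dist_commute)
  qed
  ultimately show ?thesis using r(2) by blast
 qed
 have hol: "(%\<zeta>. p (rh + cscale \<zeta> b)) holomorphic_on D" using inT by (rule holomorphic_cphase_line_on[OF p])
 have z0: "p (rh + cscale \<zeta> b) = 0" if "\<zeta> : ball 0 e" for \<zeta> using neg that by auto
 have all0: "p (rh + cscale \<zeta> b) = 0" if "\<zeta> : D" for \<zeta>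
 proof -
  have 0: "0 : D" using r bn by (simp add: D_def)
  have "\<exists>d>0. ball 0 d \<subseteq> D" using oD 0 open_contains_ball by blast
  then obtain d where d: "d > 0" "ball 0 d \<subseteq> D" by blast
  define B where "B = ball (0::complex) (min d e)"
  have "B \<subseteq> D" "0 : B" "open B" "!!z. z : B ==> p (rh + cscale z b) = 0"
   using d e z0 by (auto simp: B_def)
  moreover from this have "0 islimpt B" using interior_limit_point[of 0 B] by (simp add: interior_open)
  ultimately show ?thesis using analytic_continuation[OF hol oD cD, of B 0 \<zeta>] 0 that by blast
 qed
 have "C * (sqrt (1 + (norm (rh + t *\<^sub>R b))\<^sup>2)) powr m \<ge> 1" for t
 proof -
  have t: "complex_of_real t : D" using r bn by (simp add: D_def)
  have "rh + t *\<^sub>R b : tube \<Phi> W" "p (rh + t *\<^sub>R b) = 0" using inT[OF t] all0[OF t] by (simp_all only: cscale_of_real)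
  thus ?thesis using decay(2)[of "rh + t *\<^sub>R b"] by simp
 qed
 moreover have "((%t. C * (sqrt (1 + (norm (rh + t *\<^sub>R b))\<^sup>2)) powr m) \<longlongrightarrow> C * 0) at_top"
 proof (intro tendsto_mult tendsto_const)
  have "filterlim (%t. t * norm b - norm rh) at_top at_top"
   using bn by real_asymp
  hence lim: "filterlim (%t. sqrt (1 + (norm (rh + t *\<^sub>R b))\<^sup>2)) at_top at_top"
  proof (rule filterlim_at_top_mono)
   show "\<forall>\<^sub>F t in at_top. t * norm b - norm rh <= sqrt (1 + (norm (rh + t *\<^sub>R b))\<^sup>2)"
    using eventually_ge_at_top[of 0]
   proof eventually_elim
    case (elim t)
    have "t * norm b - norm rh <= norm (rh + t *\<^sub>R b)"
     using norm_triangle_ineq2[of "t *\<^sub>R b" "- rh"] elim by (simp add: add.commute)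
    also have "... <= sqrt (1 + (norm (rh + t *\<^sub>R b))\<^sup>2)" by (intro real_le_rsqrt) simp
    finally show ?case .
   qed
  qed
  show "((%t. (sqrt (1 + (norm (rh + t *\<^sub>R b))\<^sup>2)) powr m) \<longlongrightarrow> 0) at_top"
   using tendsto_neg_powr[OF decay(1) lim] .
 qed
 ultimately have "1 <= C * 0" by (intro tendsto_lowerbound[where F="at_top :: real filter"]) (auto intro: always_eventually)
 thus False by simp
qed

end

subsection \<open>Tangent spaces and Hamilton vectors\<close>

text \<open>Let G be a smooth local extension of the inverse. Then G \<circ> K is the identity near
  y, so G' is a left inverse of K'; and a curve \<gamma> in M is K \<circ> G \<circ> \<gamma> near
  time 0, so its velocity lies in the range of K'.\<close>

lemma tangent_space_parametrization:
 fixes K :: "complex ^ 'n => 'n::finite cphase"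
 assumes K: "diffeomorphism UNIV M K"
 shows "tangent_space M (K y) = range (frechet_derivative K (at y))"
  and "inj (frechet_derivative K (at y))" and "linear (frechet_derivative K (at y))"
proof -
 note D = diffeomorphism_smooth[OF K]
 define J where "J = inv_into UNIV K"
 have KM: "K x : M" for x using D(2) by (auto simp: bij_betw_def)
 have JK: "J (K x) = x" for x unfolding J_def using D(2) by (simp add: bij_betw_inv_into_left)
 have KJ: "K (J z) = z" if "z : M" for z unfolding J_def using D(2) that by (simp add: bij_betw_inv_into_right)
 let ?A = "frechet_derivative K (at y)"
 have dK: "(K has_derivative frechet_derivative K (at x)) (at x)" for x
  by (rule smooth_open_has_derivative[OF D(1)]) simp
 show lin: "linear ?A" using dK by (rule has_derivative_linear)
 obtain U G where U: "K y : U" "smooth_open U G" "\<forall>z\<in>M \<inter> U. G z = J z"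
  using D(3) KM unfolding smooth_on_def J_def by blast
 have oU: "open U" by (rule smooth_open_open[OF U(2)])
 have dG: "(G has_derivative frechet_derivative G (at (K y))) (at (K y))" by (rule smooth_open_has_derivative[OF U(2,1)])
 have comp: "((%x. G (K x)) has_derivative (%v. frechet_derivative G (at (K y)) (?A v))) (at y)"
  by (rule has_derivative_compose[OF dK dG])
 have oV: "open (K -` U)" using oU smooth_open_continuous_on[OF D(1)] by (intro open_vimage)
 have "((%x. x) has_derivative (%v. frechet_derivative G (at (K y)) (?A v))) (at y)"
  by (rule has_derivative_transform_within_open[OF comp oV]) (use U KM JK in auto)
 hence GA: "frechet_derivative G (at (K y)) (?A v) = v" for v
  using has_derivative_unique[OF _ has_derivative_ident] by metis
 show "inj ?A" by (rule injI) (metis GA)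
 show "tangent_space M (K y) = range ?A"
 proof
  show "range ?A \<subseteq> tangent_space M (K y)"
  proof
   fix u assume "u : range ?A"
   then obtain h where h: "u = ?A h" by blast
   define \<gamma> where "\<gamma> s = K (y + s *\<^sub>R h)" for s :: real
   have "smooth_open UNIV (%s::real. s *\<^sub>R h)" by (intro smooth_open_bounded_linear bounded_linear_scaleR_left) auto
   hence "smooth_open UNIV (%s::real. y + s *\<^sub>R h)" by (intro smooth_open_add smooth_open_const) auto
   hence "smooth_open UNIV \<gamma>" unfolding \<gamma>_def by (rule smooth_open_compose[OF _ D(1)]) auto
   hence "smooth_open {-1<..<1} \<gamma>" by (rule smooth_open_subset) auto
   moreover have "(\<gamma> has_vector_derivative u) (at 0)"
   proof -
    have "((%s::real. y + s *\<^sub>R h) has_derivative (%s. s *\<^sub>R h)) (at 0)" by (auto intro!: derivative_eq_intros)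
    moreover have "(K has_derivative ?A) (at (y + 0 *\<^sub>R h))" using dK[of y] by simp
    ultimately have "(\<gamma> has_derivative (%s. ?A (s *\<^sub>R h))) (at 0)" unfolding \<gamma>_def by (rule has_derivative_compose)
    thus ?thesis unfolding has_vector_derivative_def h by (simp add: linear_scale[OF lin])
   qed
   moreover have "\<gamma> ` {-1<..<1} \<subseteq> M" "\<gamma> 0 = K y" using KM by (auto simp: \<gamma>_def)
   ultimately show "u : tangent_space M (K y)" unfolding tangent_space_def
    by (intro CollectI exI[of _ \<gamma>] exI[of _ 1]) simp
  qed
  show "tangent_space M (K y) \<subseteq> range ?A"
  proof
   fix u assume "u : tangent_space M (K y)"
   then obtain \<gamma> e where g: "e > 0" "smooth_open {-e<..<e} \<gamma>" "\<gamma> ` {-e<..<e} \<subseteq> M" "\<gamma> 0 = K y" "(\<gamma> has_vector_derivative u) (at (0::real))"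
    unfolding tangent_space_def by blast
   have gd: "(\<gamma> has_derivative (%s. s *\<^sub>R u)) (at 0)" using g(5) by (simp add: has_vector_derivative_def)
   define \<beta> where "\<beta> s = G (\<gamma> s)" for s
   have bd: "(\<beta> has_derivative (%s. frechet_derivative G (at (K y)) (s *\<^sub>R u))) (at 0)"
    unfolding \<beta>_def using has_derivative_compose[OF gd] dG g(4) by metis
   have b0: "\<beta> 0 = y" using U(1,3) KM JK by (simp add: \<beta>_def g(4))
   have "((%s. K (\<beta> s)) has_derivative (%s. ?A (frechet_derivative G (at (K y)) (s *\<^sub>R u)))) (at 0)"
    using has_derivative_compose[OF bd] dK[of y] b0 by metis
   moreover have "open ({-e<..<e} \<inter> \<gamma> -` U)"
    using smooth_open_continuous_on[OF g(2)] oU by (intro continuous_open_preimage) auto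
   moreover have "0 : {-e<..<e} \<inter> \<gamma> -` U" using g U by simp
   moreover have "K (\<beta> s) = \<gamma> s" if "s : {-e<..<e} \<inter> \<gamma> -` U" for s
   proof -
    have "\<gamma> s : M \<inter> U" using that g(3) by auto
    thus ?thesis using U(3) KJ by (simp add: \<beta>_def)
   qed
   ultimately have "(\<gamma> has_derivative (%s. ?A (frechet_derivative G (at (K y)) (s *\<^sub>R u)))) (at 0)"
    by (rule has_derivative_transform_within_open)
   hence "(%s. s *\<^sub>R u) = (%s. ?A (frechet_derivative G (at (K y)) (s *\<^sub>R u)))" by (rule has_derivative_unique[OF gd])
   from fun_cong[OF this, of 1] show "u : range ?A" by (metis rangeI scaleR_one)
  qed
 qed
qed

text \<open>Two derivatives within M may differ as linear maps, but along a curve in M both compute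
  the derivative of the same function of one variable.\<close>

lemma mdiff_tangent:
 assumes D: "(f has_derivative D) (at rh within M)" and v: "v : tangent_space M rh"
 shows "mdiff M f rh v = D v"
proof -
 have F: "(f has_derivative frechet_derivative f (at rh within M)) (at rh within M)"
  using D frechet_derivative_works differentiable_def by blast
 obtain \<gamma> e where g: "e > 0" "\<gamma> ` {-e<..<e} \<subseteq> M" "\<gamma> 0 = rh" "(\<gamma> has_vector_derivative v) (at (0::real))"
  using v unfolding tangent_space_def by blast
 have gd: "(\<gamma> has_derivative (%s. s *\<^sub>R v)) (at 0 within {-e<..<e})"
  using g(4) by (simp add: has_vector_derivative_def has_derivative_at_withinI)
 have at0: "at (0::real) within {-e<..<e} = at 0" using g(1) by (intro at_within_open) auto
 have c: "((%s. f (\<gamma> s)) has_derivative (%s. E (s *\<^sub>R v))) (at 0)" if "(f has_derivative E) (at rh within M)" for E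
 proof -
  have "(f has_derivative E) (at (\<gamma> 0) within \<gamma> ` {-e<..<e})" using that g(2,3) has_derivative_subset by blast
  from has_derivative_in_compose[OF gd this] show ?thesis by (simp only: at0)
 qed
 have "(%s. frechet_derivative f (at rh within M) (s *\<^sub>R v)) = (%s. D (s *\<^sub>R v))"
  by (rule has_derivative_unique[OF c[OF F] c[OF D]])
 from fun_cong[OF this, of 1] show ?thesis by (simp add: mdiff_def)
qed

lemma linear_mdiff:
 assumes "(f has_derivative D) (at rh within M)"
 shows "linear (mdiff M f rh)"
proof -
 have "(f has_derivative frechet_derivative f (at rh within M)) (at rh within M)"
  using assms frechet_derivative_works differentiable_def by blast
 thus ?thesis unfolding mdiff_def by (rule has_derivative_linear)
qed

text \<open>If u + \<i> v = 0 with tangent u and v, then \<sigma>(u, \<cdot>) + \<i> \<sigma>(v,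
  \<cdot>) = 0 on the tangent space, where both terms are real; so both vanish and u = v = 0 by
  nondegeneracy. The map S is thus injective between spaces of equal dimension, hence onto.\<close>

lemma IR_totally_real:
 fixes K :: "complex ^ 'n => 'n::finite cphase"
 assumes IR: "IR_manifold M" and K: "diffeomorphism UNIV M K"
 shows "\<exists>v\<in>tangent_space M (K y). \<exists>w\<in>tangent_space M (K y). z = v + mult_i w"
proof -
 let ?A = "frechet_derivative K (at y)" and ?E = "tangent_space M (K y)"
 note T = tangent_space_parametrization[OF K, of y]
 have KM: "K y : M" using diffeomorphism_smooth(2)[OF K] by (auto simp: bij_betw_def)
 have E: "?A h : ?E" for h unfolding T(1) by simp
 have re: "csympl u v : \<real>" if "u : ?E" "v : ?E" for u v using IR KM that unfolding IR_manifold_def by blast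
 have nd: "u = 0" if "u : ?E" "!!v. v : ?E ==> csympl u v = 0" for u
  using IR KM that unfolding IR_manifold_def by blast
 define S where "S z = ?A (fst z) + mult_i (?A (snd z))" for z :: "'n cphase"
 have lm: "linear (mult_i :: 'n cphase => _)" by (rule bounded_linear.linear[OF bounded_linear_mult_i])
 have linS: "linear S" unfolding S_def
  by (intro linearI) (simp_all add: linear_add[OF T(3)] linear_scale[OF T(3)] linear_add[OF lm] linear_scale[OF lm] algebra_simps)
 have "inj S"
 proof (rule linear_injective_0[OF linS, THEN iffD2], intro allI impI)
  fix z assume "S z = 0"
  hence s: "?A (fst z) + mult_i (?A (snd z)) = 0" by (simp only: S_def)
  have zero: "csympl (?A (fst z)) v = 0 & csympl (?A (snd z)) v = 0" if v: "v : ?E" for v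
  proof -
   have "csympl (?A (fst z)) v + \<i> * csympl (?A (snd z)) v = 0"
    using arg_cong[OF s, of "%u. csympl u v"] by (simp only: csympl_add_left csympl_mult_i csympl_zero)
   moreover obtain a b where "csympl (?A (fst z)) v = of_real a" "csympl (?A (snd z)) v = of_real b"
    using re[OF E v] by (metis Reals_cases)
   ultimately show ?thesis by (simp add: complex_eq_iff)
  qed
  have "?A (fst z) = 0" "?A (snd z) = 0" using zero by (auto intro!: nd E)
  hence "fst z = 0" "snd z = 0" using linear_injective_0[OF T(3)] T(2) by blast+
  thus "z = 0" by (simp add: prod_eq_iff)
 qed
 hence "surj S" by (rule linear_inj_imp_surj[OF linS])
 then obtain x where "S x = z" by (metis surjD)
 thus ?thesis using E unfolding S_def by blast
qed

text \<open>Nondegeneracy makes h \<mapsto> \<sigma>(K' h, K' \<cdot>) injective, hence onto the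
  covectors by dimension. This gives existence and uniqueness for the definite description in
  \<open>ham_vec\<close>.\<close>

lemma ham_vec_spec:
 fixes K :: "complex ^ 'n => 'n::finite cphase"
 assumes IR: "IR_manifold M" and K: "diffeomorphism UNIV M K" and al: "linear al"
 shows "ham_vec M (K y) al : tangent_space M (K y)"
  and "v : tangent_space M (K y) ==> csympl (ham_vec M (K y) al) v = - complex_of_real (al v)"
proof -
 let ?A = "frechet_derivative K (at y)" and ?E = "tangent_space M (K y)"
 note T = tangent_space_parametrization[OF K, of y]
 have KM: "K y : M" using diffeomorphism_smooth(2)[OF K] by (auto simp: bij_betw_def)
 have E: "?A h : ?E" for h unfolding T(1) by simp
 have re: "csympl u v : \<real>" if "u : ?E" "v : ?E" for u v using IR KM that unfolding IR_manifold_def by blast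
 have nd: "u = 0" if "u : ?E" "!!v. v : ?E ==> csympl u v = 0" for u
  using IR KM that unfolding IR_manifold_def by blast
 \<comment> \<open>The covector \<sigma>(K' h, K' \<cdot>) in coordinates; \<open>Re\<close> loses
   nothing because \<sigma> is real on the tangent space.\<close>
 define S where "S h = (\<Sum>b\<in>Basis. Re (csympl (?A h) (?A b)) *\<^sub>R b)" for h :: "complex ^ 'n"
 have Sb: "S h \<bullet> b = Re (csympl (?A h) (?A b))" if "b : Basis" for h b
  unfolding S_def using that by simp
 have linS: "linear S"
  by (rule linearI; rule euclidean_eqI)
   (simp_all add: Sb inner_add_left linear_add[OF T(3)] linear_scale[OF T(3)] csympl_add_left csympl_scaleR_left)
 have ext: "csympl u (?A k) = - complex_of_real (\<beta> (?A k))"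
  if "u : ?E" "!!b. b : Basis ==> Re (csympl u (?A b)) = - \<beta> (?A b)" "linear \<beta>" for u k \<beta>
 proof -
  have "csympl u (?A b) = - of_real (\<beta> (?A b))" if "b : Basis" for b
   using re[OF \<open>u : ?E\<close> E[of b]] that \<open>!!b. b : Basis ==> Re (csympl u (?A b)) = - \<beta> (?A b)\<close>
   by (simp add: complex_eq_iff complex_is_Real_iff)
  moreover have "?A k = (\<Sum>b\<in>Basis. (k \<bullet> b) *\<^sub>R ?A b)"
  proof -
   have "?A k = ?A (\<Sum>b\<in>Basis. (k \<bullet> b) *\<^sub>R b)" by (simp add: euclidean_representation)
   thus ?thesis by (simp add: linear_sum[OF T(3)] linear_scale[OF T(3)])
  qed
  ultimately show ?thesis
   by (simp add: csympl_sum_right csympl_scaleR_right linear_sum[OF \<open>linear \<beta>\<close>] linear_scale[OF \<open>linear \<beta>\<close>] sum_negf)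
 qed
 have "inj S"
 proof (rule linear_injective_0[OF linS, THEN iffD2], intro allI impI)
  fix h assume "S h = 0"
  hence "Re (csympl (?A h) (?A b)) = 0" if "b : Basis" for b using Sb[OF that, of h] by simp
  hence "csympl (?A h) (?A k) = 0" for k using ext[OF E, of h "%_. 0" k] by (simp add: linear_zero)
  hence "?A h = 0" by (intro nd E) (auto simp: T(1))
  thus "h = 0" using linear_injective_0[OF T(3)] T(2) by blast
 qed
 hence "surj S" by (rule linear_inj_imp_surj[OF linS])
 from surjD[OF this, of "\<Sum>b\<in>Basis. (- al (?A b)) *\<^sub>R b"]
 obtain h where "(\<Sum>b\<in>Basis. (- al (?A b)) *\<^sub>R b) = S h" by (rule exE)
 hence h: "S h = (\<Sum>b\<in>Basis. (- al (?A b)) *\<^sub>R b)" by (rule sym)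
 have "Re (csympl (?A h) (?A b)) = - al (?A b)" if "b : Basis" for b
  unfolding Sb[OF that, of h, symmetric] h by (rule inner_sum_left_Basis[OF that])
 hence hk: "csympl (?A h) (?A k) = - complex_of_real (al (?A k))" for k by (intro ext E al)
 have "ham_vec M (K y) al = ?A h"
  unfolding ham_vec_def
 proof (rule the_equality)
  show "?A h : ?E & (\<forall>v\<in>?E. csympl (?A h) v = - complex_of_real (al v))" using hk E by (auto simp: T(1))
  fix u assume u: "u : ?E & (\<forall>v\<in>?E. csympl u v = - complex_of_real (al v))"
  obtain k where k: "u = ?A k" using u T(1) by auto
  have "?A (k - h) = 0"
  proof (rule nd[OF E])
   fix v assume v: "v : ?E"
   have "csympl (?A (k - h) + ?A h) v = csympl (?A h) v"
    using u v hk k by (auto simp: T(1) linear_diff[OF T(3)])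
   thus "csympl (?A (k - h)) v = 0" by (simp add: csympl_add_left)
  qed
  thus "u = ?A h" unfolding k by (simp add: linear_diff[OF T(3)])
 qed
 thus "ham_vec M (K y) al : ?E" "v : ?E ==> csympl (ham_vec M (K y) al) v = - complex_of_real (al v)"
  using hk E by (auto simp: T(1))
qed

section \<open>The flow in coordinates\<close>

lemma bounded_bilinear_csympl: "bounded_bilinear (csympl :: 'n::finite cphase => _)"
 unfolding bilinear_conv_bounded_bilinear[symmetric] bilinear_def
 by (intro conjI allI linearI) (simp_all only: csympl_add_left csympl_add_right csympl_scaleR_left csympl_scaleR_right scaleR_conv_of_real)

lemma partial_snd_has_derivative:
 assumes "smooth_open (T \<times> UNIV) F" "t : T"
 shows "((%y. F (t, y)) has_derivative (%v. iter_deriv [(0, v)] F (t, y))) (at y)"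
proof -
 have "((%y. (t, y)) has_derivative (%v. (0, v))) (at y)"
  by (intro has_derivative_Pair has_derivative_const has_derivative_ident)
 from has_derivative_compose[OF this] smooth_open_iter_has_derivative[OF assms(1), of "(t, y)" "[]"] assms(2)
 show ?thesis by simp
qed

lemma partial_fst_has_vector_derivative:
 fixes F :: "real \<times> 'a::real_normed_vector => 'b::real_normed_vector"
 assumes "smooth_open (T \<times> UNIV) F" "t : T"
 shows "((%s. iter_deriv vs F (s, y)) has_vector_derivative iter_deriv ((1, 0) # vs) F (t, y)) (at t)"
proof -
 have tT: "(t, y) : T \<times> UNIV" using assms(2) by simp
 have "((%s. (s, y)) has_derivative (%s. (s, 0))) (at t)"
  by (intro has_derivative_Pair has_derivative_const has_derivative_ident)
 from has_derivative_compose[OF this smooth_open_iter_has_derivative[OF assms(1) tT, of vs]]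
 have "((%s. iter_deriv vs F (s, y)) has_derivative (%s. iter_deriv ((s, 0) # vs) F (t, y))) (at t)" .
 moreover have "iter_deriv ((s, 0) # vs) F (t, y) = s *\<^sub>R iter_deriv ((1, 0) # vs) F (t, y)" for s
  using linear_scale[OF has_derivative_linear[OF smooth_open_iter_has_derivative[OF assms(1) tT, of vs]], of s "(1, 0)"]
  by (simp only: scaleR_Pair scaleR_zero_right real_scaleR_def mult_1_right)
 ultimately show ?thesis unfolding has_vector_derivative_def by (rule has_derivative_eq_rhs[OF _ ext])
qed

lemma smooth_open_partial_vector_derivative:
 fixes F :: "real \<times> 'a::real_normed_vector => 'b::real_normed_vector"
 assumes "smooth_open (T \<times> UNIV) F" "t : T"
 shows "((%s. iter_deriv vs F (t, y + s *\<^sub>R u)) has_vector_derivative iter_deriv ((0, u) # vs) F (t, y)) (at 0)"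
proof -
 have tT: "(t, y) : T \<times> UNIV" using assms(2) by simp
 have "((%s::real. (t, y + s *\<^sub>R u)) has_derivative (%s. (0, s *\<^sub>R u))) (at 0)"
  by (intro has_derivative_Pair has_derivative_const) (auto intro!: derivative_eq_intros)
 from has_derivative_compose[OF this, of "iter_deriv vs F" "%v. iter_deriv (v # vs) F (t, y)"]
 have "((%s. iter_deriv vs F (t, y + s *\<^sub>R u)) has_derivative (%s. iter_deriv ((0, s *\<^sub>R u) # vs) F (t, y))) (at 0)"
  using smooth_open_iter_has_derivative[OF assms(1) tT, of vs] by simp
 moreover have "iter_deriv ((0, s *\<^sub>R u) # vs) F (t, y) = s *\<^sub>R iter_deriv ((0, u) # vs) F (t, y)" for s
  using linear_scale[OF has_derivative_linear[OF smooth_open_iter_has_derivative[OF assms(1) tT, of vs]], of s "(0, u)"]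
  by (simp only: scaleR_Pair scaleR_zero_right)
 ultimately show ?thesis unfolding has_vector_derivative_def by (rule has_derivative_eq_rhs[OF _ ext])
qed

text \<open>\<open>generating_functions\<close> asserts the flow only existentially. The locale
  fixes one flow and one parametrization \<phi> of \<open>\<Lambda> 0\<close>, so that y \<mapsto>
  \<kappa> t (\<phi> y) parametrizes every \<open>\<Lambda> t\<close> by the same space.\<close>

locale deformation = quadratic_weight \<Phi> for \<Phi> :: "complex ^ 'n::finite => real" +
 fixes W W' :: "'n cphase set" and p :: "'n cphase => complex" and T :: "real set"
  and \<Lambda> :: "real => 'n cphase set" and f :: "real => 'n cphase => real"
  and \<kappa> :: "real => 'n cphase => 'n cphase" and \<phi> :: "complex ^ 'n => 'n cphase"
 assumes W: "bounded_open_nbhd_0 \<Phi> W" and W': "bounded_open_nbhd_0 \<Phi> W'" and clW: "closure W' \<subseteq> W"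
  and p: "admissible_symbol \<Phi> W p"
  and oT: "open T" and iT: "is_interval T" and T0: "0 : T"
  and fam: "admissible_family \<Phi> W' T \<Lambda>"
  and fC: "smooth_Cb_family T \<Lambda> f"
  and \<kappa>s: "smooth_on (T \<times> \<Lambda> 0) (%(t, rh). \<kappa> t rh)"
  and \<kappa>0: "!!rh. rh : \<Lambda> 0 ==> \<kappa> 0 rh = rh"
  and \<kappa>d: "!!t. t : T ==> diffeomorphism (\<Lambda> 0) (\<Lambda> t) (\<kappa> t)"
  and \<kappa>t: "!!t rh. t : T ==> rh : \<Lambda> 0 ==>
   ((%s. \<kappa> s rh) has_vector_derivative mult_i (ham_fun (\<Lambda> t) (f t) (\<kappa> t rh))) (at t)"
  and \<phi>: "diffeomorphism UNIV (\<Lambda> 0) \<phi>"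
begin

definition K :: "real \<times> (complex ^ 'n) => 'n cphase" where "K z = \<kappa> (fst z) (\<phi> (snd z))"
definition F :: "real \<times> (complex ^ 'n) => complex" where "F z = p (K z)"
definition g :: "real \<times> (complex ^ 'n) => real" where "g z = f (fst z) (K z)"
definition w :: "complex ^ 'n => real" where "w y = sympl_density (frechet_derivative \<phi> (at y))"
definition ham :: "real => complex ^ 'n => 'n cphase" where "ham t y = ham_fun (\<Lambda> t) (f t) (K (t, y))"

lemma IR: "t : T ==> IR_manifold (\<Lambda> t)" and \<Lambda>W': "t : T ==> \<Lambda> t \<subseteq> tube \<Phi> W'" and \<Lambda>closed: "t : T ==> closed (\<Lambda> t)"
 using fam unfolding admissible_family_def admissible_IR_def by auto

lemma openW: "openin (top_of_set (Lam \<Phi>)) W" and bW': "bounded W'" and WW: "W' \<subseteq> W"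
 using W W' clW closure_subset[of W'] unfolding bounded_open_nbhd_0_def by auto

lemma \<phi>\<Lambda>: "\<phi> y : \<Lambda> 0"
 using diffeomorphism_smooth(2)[OF \<phi>] by (auto simp: bij_betw_def)

lemma K0: "K (0, y) = \<phi> y"
 using \<kappa>0[OF \<phi>\<Lambda>] by (simp add: K_def)

lemma K\<Lambda>: "t : T ==> K (t, y) : \<Lambda> t"
 using \<kappa>d[of t] \<phi>\<Lambda>[of y] unfolding diffeomorphism_def bij_betw_def K_def by auto

lemma openTU: "open (T \<times> (UNIV :: (complex ^ 'n) set))"
 using oT by (intro open_Times) auto

lemma K_smooth: "smooth_open (T \<times> UNIV) K"
proof (rule smooth_on_open[OF openTU])
 have 1: "smooth_on (T \<times> UNIV) (%z. (fst z, \<phi> (snd z)))"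
 proof (rule smooth_on_Pair)
  show "smooth_on (T \<times> UNIV) (fst :: real \<times> (complex ^ 'n) => real)"
   by (rule smooth_on_bounded_linear[OF bounded_linear_fst])
  show "smooth_on (T \<times> UNIV) (%z. \<phi> (snd z))"
   by (rule smooth_on_compose[OF smooth_on_bounded_linear[OF bounded_linear_snd]
    smooth_open_imp_smooth_on[OF diffeomorphism_smooth(1)[OF \<phi>] order_refl]]) auto
 qed
 have "smooth_on (T \<times> UNIV) (%z. (%(t, rh). \<kappa> t rh) (fst z, \<phi> (snd z)))"
  by (rule smooth_on_compose[OF 1 \<kappa>s]) (auto simp: \<phi>\<Lambda>)
 thus "smooth_on (T \<times> UNIV) K" by (simp add: K_def[abs_def])
qed

lemma K_diffeo:
 assumes t: "t : T"
 shows "diffeomorphism UNIV (\<Lambda> t) (%y. K (t, y))"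
proof -
 note D = diffeomorphism_smooth[OF \<phi>]
 have b: "bij_betw (\<kappa> t) (\<Lambda> 0) (\<Lambda> t)" and si: "smooth_on (\<Lambda> t) (inv_into (\<Lambda> 0) (\<kappa> t))" and s: "smooth_on (\<Lambda> 0) (\<kappa> t)"
  using \<kappa>d[OF t] unfolding diffeomorphism_def by auto
 have bij: "bij_betw (%y. K (t, y)) UNIV (\<Lambda> t)"
  using bij_betw_trans[OF D(2) b] by (simp add: K_def o_def)
 moreover have "smooth_on UNIV (%y. K (t, y))"
  unfolding K_def fst_conv snd_conv
  by (rule smooth_on_compose[OF smooth_open_imp_smooth_on[OF D(1) order_refl] s]) (auto simp: \<phi>\<Lambda>)
 moreover have "smooth_on (\<Lambda> t) (%rh. inv_into UNIV \<phi> (inv_into (\<Lambda> 0) (\<kappa> t) rh))"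
 proof (rule smooth_on_compose[OF si D(3)])
  show "inv_into (\<Lambda> 0) (\<kappa> t) ` \<Lambda> t \<subseteq> \<Lambda> 0" using bij_betw_inv_into[OF b] by (simp add: bij_betw_def)
 qed
 hence "smooth_on (\<Lambda> t) (inv_into UNIV (%y. K (t, y)))"
 proof (rule smooth_on_cong)
  fix rh assume "rh : \<Lambda> t"
  then obtain y where y: "rh = K (t, y)" using bij by (auto simp: bij_betw_def)
  have "inv_into UNIV (%y. K (t, y)) rh = y" unfolding y by (rule bij_betw_inv_into_left[OF bij]) simp
  moreover have "inv_into (\<Lambda> 0) (\<kappa> t) rh = \<phi> y" unfolding y K_def fst_conv snd_conv by (rule bij_betw_inv_into_left[OF b \<phi>\<Lambda>])
  moreover have "inv_into UNIV \<phi> (\<phi> y) = y" by (rule bij_betw_inv_into_left[OF D(2)]) simp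
  ultimately show "inv_into UNIV \<phi> (inv_into (\<Lambda> 0) (\<kappa> t) rh) = inv_into UNIV (%y. K (t, y)) rh" by simp
 qed
 ultimately show ?thesis unfolding diffeomorphism_def by simp
qed

lemma K_partial: "t : T ==> frechet_derivative (%y. K (t, y)) (at y) = (%v. iter_deriv [(0, v)] K (t, y))"
 by (rule frechet_derivative_at[symmetric]) (rule partial_snd_has_derivative[OF K_smooth])

lemma tangent_eq: "t : T ==> tangent_space (\<Lambda> t) (K (t, y)) = range (%v. iter_deriv [(0, v)] K (t, y))"
 using tangent_space_parametrization(1)[OF K_diffeo] by (simp only: K_partial)

lemma inj_partial: "t : T ==> inj (%v. iter_deriv [(0, v)] K (t, y))"
 and linear_partial: "t : T ==> linear (%v. iter_deriv [(0, v)] K (t, y))"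
 using tangent_space_parametrization(2,3)[OF K_diffeo, of t y] by (simp_all only: K_partial)

lemma K_time: "t : T ==> iter_deriv [(1, 0)] K (t, y) = mult_i (ham t y)"
proof -
 assume t: "t : T"
 have "((%s. K (s, y)) has_vector_derivative mult_i (ham t y)) (at t)"
  using \<kappa>t[OF t \<phi>\<Lambda>[of y]] by (simp add: K_def ham_def)
 moreover have "((%s. K (s, y)) has_vector_derivative iter_deriv [(1, 0)] K (t, y)) (at t)"
  using partial_fst_has_vector_derivative[OF K_smooth t, of "[]" y] by simp
 ultimately show ?thesis using vector_derivative_unique_at by blast
qed

lemma g_smooth: "smooth_open (T \<times> UNIV) g"
proof (rule smooth_on_open[OF openTU])
 have fs: "smooth_on (SIGMA t:T. \<Lambda> t) (%(t, rh). f t rh)" using fC unfolding smooth_Cb_family_def by blast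
 have 1: "smooth_on (T \<times> UNIV) (%z. (fst z, K z))"
  by (rule smooth_on_Pair[OF smooth_on_bounded_linear[OF bounded_linear_fst] smooth_open_imp_smooth_on[OF K_smooth order_refl]])
 have "smooth_on (T \<times> UNIV) (%z. (%(t, rh). f t rh) (fst z, K z))"
  by (rule smooth_on_compose[OF 1 fs]) (auto simp: K\<Lambda>)
 thus "smooth_on (T \<times> UNIV) g" by (simp add: g_def[abs_def])
qed

lemma f_smooth: "t : T ==> smooth_on (\<Lambda> t) (f t)"
proof -
 assume t: "t : T"
 have fs: "smooth_on (SIGMA t:T. \<Lambda> t) (%(t, rh). f t rh)" using fC unfolding smooth_Cb_family_def by blast
 have "smooth_open UNIV (%rh::'n cphase. (t, rh))"
  by (intro smooth_open_Pair smooth_open_const smooth_open_bounded_linear bounded_linear_ident) auto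
 hence 1: "smooth_on (\<Lambda> t) (%rh::'n cphase. (t, rh))" by (rule smooth_open_imp_smooth_on) simp
 have "smooth_on (\<Lambda> t) (%rh. (%(t, rh). f t rh) (t, rh))"
  by (rule smooth_on_compose[OF 1 fs]) (use t in auto)
 thus ?thesis by simp
qed

lemma mdiff_pullback:
 assumes t: "t : T" and q: "(q has_derivative D) (at (K (t, y)) within \<Lambda> t)"
  and qK: "((%y. q (K (t, y))) has_derivative E) (at y)"
 shows "mdiff (\<Lambda> t) q (K (t, y)) (iter_deriv [(0, v)] K (t, y)) = E v"
proof -
 have dK: "((%y. K (t, y)) has_derivative (%v. iter_deriv [(0, v)] K (t, y))) (at y)"
  by (rule partial_snd_has_derivative[OF K_smooth t])
 have "range (%y. K (t, y)) \<subseteq> \<Lambda> t" using K\<Lambda>[OF t] by auto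
 hence "(q has_derivative D) (at (K (t, y)) within range (%y. K (t, y)))" by (rule has_derivative_subset[OF q])
 from has_derivative_in_compose[OF dK this]
 have "((%y. q (K (t, y))) has_derivative (%v. D (iter_deriv [(0, v)] K (t, y)))) (at y)" .
 hence "(%v. D (iter_deriv [(0, v)] K (t, y))) = E" by (rule has_derivative_unique[OF _ qK])
 moreover have "iter_deriv [(0, v)] K (t, y) : tangent_space (\<Lambda> t) (K (t, y))" unfolding tangent_eq[OF t] by (rule rangeI)
 ultimately show ?thesis using mdiff_tangent[OF q] by metis
qed

lemma mdiff_f: "t : T ==> mdiff (\<Lambda> t) (f t) (K (t, y)) (iter_deriv [(0, v)] K (t, y)) = iter_deriv [(0, v)] g (t, y)"
proof -
 assume t: "t : T"
 obtain D where "(f t has_derivative D) (at (K (t, y)) within \<Lambda> t)"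
  using smooth_on_differentiable[OF f_smooth[OF t] K\<Lambda>[OF t]] by (rule exE)
 moreover have "((%y. f t (K (t, y))) has_derivative (%v. iter_deriv [(0, v)] g (t, y))) (at y)"
  using partial_snd_has_derivative[OF g_smooth t, of y] by (simp add: g_def)
 ultimately show ?thesis by (rule mdiff_pullback[OF t])
qed

lemma linear_mdiff_f: "t : T ==> linear (mdiff (\<Lambda> t) (f t) (K (t, y)))"
proof -
 assume t: "t : T"
 obtain D where "(f t has_derivative D) (at (K (t, y)) within \<Lambda> t)"
  using smooth_on_differentiable[OF f_smooth[OF t] K\<Lambda>[OF t]] by (rule exE)
 thus ?thesis by (rule linear_mdiff)
qed

lemma ham_tangent: "t : T ==> ham t y : tangent_space (\<Lambda> t) (K (t, y))"
 unfolding ham_def ham_fun_def by (rule ham_vec_spec(1)[OF IR K_diffeo linear_mdiff_f])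

lemma csympl_ham:
 assumes t: "t : T"
 shows "csympl (ham t y) (iter_deriv [(0, v)] K (t, y)) = - complex_of_real (iter_deriv [(0, v)] g (t, y))"
proof -
 have "iter_deriv [(0, v)] K (t, y) : tangent_space (\<Lambda> t) (K (t, y))" unfolding tangent_eq[OF t] by (rule rangeI)
 from ham_vec_spec(2)[OF IR[OF t] K_diffeo[OF t] linear_mdiff_f[OF t] this]
 show ?thesis unfolding ham_def ham_fun_def by (simp only: mdiff_f[OF t])
qed

text \<open>With K_t = \<i> H one has \<sigma>(K_t, K_v) = - \<i> g_v. Differentiating this in
  direction u and antisymmetrizing in u and v removes the mixed second derivatives of g and the
  spatial ones of K by symmetry; what is left is the time derivative of \<sigma>(K_u, K_v).\<close>

lemma symplectic_flow_derivative:
 assumes t: "t : T"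
 shows "((%s. csympl (iter_deriv [(0, u)] K (s, y)) (iter_deriv [(0, v)] K (s, y))) has_vector_derivative 0) (at t)"
proof -
 have tT: "(t, y) : T \<times> UNIV" using t by simp
 let ?I = "%vs. iter_deriv vs K (t, y)"
 have key: "csympl (?I [(0, u), (1, 0)]) (?I [(0, v)]) + csympl (?I [(1, 0)]) (?I [(0, u), (0, v)])
  = - \<i> * of_real (iter_deriv [(0, u), (0, v)] g (t, y))" for u v
 proof -
  have "((%s. csympl (iter_deriv [(1, 0)] K (t, y + s *\<^sub>R u)) (iter_deriv [(0, v)] K (t, y + s *\<^sub>R u)))
   has_vector_derivative csympl (iter_deriv [(1, 0)] K (t, y + 0 *\<^sub>R u)) (?I [(0, u), (0, v)]) + csympl (?I [(0, u), (1, 0)]) (iter_deriv [(0, v)] K (t, y + 0 *\<^sub>R u))) (at 0)"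
   by (rule bounded_bilinear.has_vector_derivative[OF bounded_bilinear_csympl
     smooth_open_partial_vector_derivative[OF K_smooth t] smooth_open_partial_vector_derivative[OF K_smooth t]])
  moreover have "csympl (iter_deriv [(1, 0)] K (t, y')) (iter_deriv [(0, v)] K (t, y')) = (- \<i>) * of_real (iter_deriv [(0, v)] g (t, y'))" for y'
   unfolding K_time[OF t] csympl_mult_i csympl_ham[OF t] by simp
  ultimately have 1: "((%s. (- \<i>) * of_real (iter_deriv [(0, v)] g (t, y + s *\<^sub>R u)))
   has_vector_derivative csympl (?I [(1, 0)]) (?I [(0, u), (0, v)]) + csympl (?I [(0, u), (1, 0)]) (?I [(0, v)])) (at 0)"
   by (simp only: scaleR_zero_left add_0_right)
  have "((%s. complex_of_real (iter_deriv [(0, v)] g (t, y + s *\<^sub>R u))) has_vector_derivative of_real (iter_deriv [(0, u), (0, v)] g (t, y))) (at 0)"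
   by (rule bounded_linear.has_vector_derivative[OF bounded_linear_of_real smooth_open_partial_vector_derivative[OF g_smooth t]])
  hence 2: "((%s. (- \<i>) * of_real (iter_deriv [(0, v)] g (t, y + s *\<^sub>R u)))
   has_vector_derivative (- \<i>) * of_real (iter_deriv [(0, u), (0, v)] g (t, y))) (at 0)"
   by (rule has_vector_derivative_mult_right)
  show ?thesis using vector_derivative_unique_at[OF 1 2] by (simp only: add.commute)
 qed
 have symK: "?I [(0, u), (0, v)] = ?I [(0, v), (0, u)]" by (rule mixed_partials[OF K_smooth tT])
 have symg: "iter_deriv [(0, u), (0, v)] g (t, y) = iter_deriv [(0, v), (0, u)] g (t, y)" by (rule mixed_partials[OF g_smooth tT])
 have symt: "?I [(1, 0), (0, x)] = ?I [(0, x), (1, 0)]" for x by (rule mixed_partials[OF K_smooth tT])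
 have anti: "csympl (?I [(0, u), (1, 0)]) (?I [(0, v)]) - csympl (?I [(0, v), (1, 0)]) (?I [(0, u)]) = 0"
  using key[of u v] key[of v u] unfolding symK symg by (metis add_diff_cancel_right diff_self)
 have "((%s. csympl (iter_deriv [(0, u)] K (s, y)) (iter_deriv [(0, v)] K (s, y))) has_vector_derivative
  csympl (?I [(0, u)]) (?I [(1, 0), (0, v)]) + csympl (?I [(1, 0), (0, u)]) (?I [(0, v)])) (at t)"
  by (rule bounded_bilinear.has_vector_derivative[OF bounded_bilinear_csympl
   partial_fst_has_vector_derivative[OF K_smooth t] partial_fst_has_vector_derivative[OF K_smooth t]])
 moreover have "csympl (?I [(0, u)]) (?I [(1, 0), (0, v)]) + csympl (?I [(1, 0), (0, u)]) (?I [(0, v)]) = 0"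
  unfolding symt csympl_anti[of "?I [(0, u)]"] using anti by (simp only: uminus_add_conv_diff)
 ultimately show ?thesis by (simp only:)
qed

lemma symplectic_flow:
 assumes t: "t : T"
 shows "csympl (iter_deriv [(0, u)] K (t, y)) (iter_deriv [(0, v)] K (t, y)) = csympl (iter_deriv [(0, u)] K (0, y)) (iter_deriv [(0, v)] K (0, y))"
proof (rule has_derivative_zero_unique[of T "%t. csympl (iter_deriv [(0, u)] K (t, y)) (iter_deriv [(0, v)] K (t, y))"])
 show "convex T" using iT by (simp add: is_interval_convex)
 fix s assume "s : T"
 from symplectic_flow_derivative[OF this, of u y v]
 show "((%t. csympl (iter_deriv [(0, u)] K (t, y)) (iter_deriv [(0, v)] K (t, y))) has_derivative (%h. 0)) (at s within T)"
  unfolding has_vector_derivative_def by (simp only: scaleR_zero_right) (rule has_derivative_at_withinI)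
qed (use t T0 in auto)

lemma density_K:
 assumes t: "t : T"
 shows "sympl_density (frechet_derivative (%y. K (t, y)) (at y)) = w y"
proof -
 have "frechet_derivative \<phi> (at y) = (%v. iter_deriv [(0, v)] K (0, y))"
  using K_partial[OF T0, of y] by (simp only: K0)
 thus ?thesis
  unfolding w_def sympl_density_def K_partial[OF t] by (simp only: symplectic_flow[OF t])
qed

lemma sympl_vol_K:
 assumes t: "t : T"
 shows "sympl_vol (\<Lambda> t) = distr (density lborel (%y. ennreal (w y))) (restrict_space borel (\<Lambda> t)) (%y. K (t, y))"
 using sympl_vol_eq[OF K_diffeo[OF t]] by (simp only: density_K[OF t])

lemma w_nonneg: "0 <= w y" by (simp add: w_def sympl_density_nonneg)

lemma w_continuous: "continuous_on UNIV w"
 unfolding w_def[abs_def] by (rule continuous_on_sympl_density[OF diffeomorphism_smooth(1)[OF \<phi>]])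

lemma p_holomorphic: "holomorphic_cphase p (tube \<Phi> W)"
 using p unfolding admissible_symbol_def by blast

lemma K_tube': "t : T ==> K (t, y) : tube \<Phi> W'" using K\<Lambda> \<Lambda>W' by blast
lemma K_tube: "t : T ==> K (t, y) : tube \<Phi> W" using K_tube' tube_mono[OF WW] by blast

lemma p_smooth: "smooth_open (tube \<Phi> W) p"
 by (rule holomorphic_cphase_smooth[OF p_holomorphic open_tube[OF openW]])

lemma F_smooth: "smooth_open (T \<times> UNIV) F"
 unfolding F_def[abs_def] by (rule smooth_open_compose[OF K_smooth p_smooth]) (auto intro: K_tube)

lemma F_derivative:
 assumes t: "t : T"
 shows "iter_deriv [v] F (t, y) = frechet_derivative p (at (K (t, y))) (iter_deriv [v] K (t, y))"
proof -
 have tT: "(t, y) : T \<times> UNIV" using t by simp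
 have "(F has_derivative (%v. frechet_derivative p (at (K (t, y))) (frechet_derivative K (at (t, y)) v))) (at (t, y))"
  unfolding F_def[abs_def]
  by (rule has_derivative_compose[OF smooth_open_has_derivative[OF K_smooth tT] smooth_open_has_derivative[OF p_smooth K_tube[OF t]]])
 hence "frechet_derivative F (at (t, y)) = (%v. frechet_derivative p (at (K (t, y))) (frechet_derivative K (at (t, y)) v))"
  by (rule frechet_derivative_at[symmetric])
 thus ?thesis by simp
qed

lemma p_decay:
 obtains m C where "m < - 2 * real CARD('n)" "C \<ge> 0"
  "!!rh. rh : tube \<Phi> W ==> cmod (p rh - 1) <= C * (sqrt (1 + (norm rh)\<^sup>2)) powr m"
proof -
 obtain m C where mC: "m < - 2 * real CARD('n)"
  "!!rh. rh : tube \<Phi> W ==> cmod (p rh - 1) <= C * (sqrt (1 + (norm rh)\<^sup>2)) powr m"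
  using p unfolding admissible_symbol_def by blast
 have "cmod (p rh - 1) <= max C 0 * (sqrt (1 + (norm rh)\<^sup>2)) powr m" if "rh : tube \<Phi> W" for rh
  using mC(2)[OF that] by (rule order_trans) (intro mult_right_mono, auto)
 thus thesis using mC(1) by (intro that[of m "max C 0"]) auto
qed

text \<open>The curve s \<mapsto> K (t, y + s h) is not a line, but its rescaled displacement
  \<open>z s\<close> tends to the velocity A. By homogeneity and continuity of P the quotient F /
  s^m tends to P A, and \<open>finite_order_along_curve\<close> applies.\<close>

lemma finite_type_in_direction:
 assumes t: "t : T" and r: "r > 0"
  and est: "!!z. norm z < r ==> cmod (p (K (t, y) + z) - P z) <= C * norm z ^ Suc m"
  and hom: "!!s z. P (s *\<^sub>R z) = of_real s ^ m * P z" and cont: "continuous_on UNIV P"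
  and nz: "P (iter_deriv [(0, h)] K (t, y)) ~= 0"
 shows "\<exists>k. iter_deriv (replicate k (0, h)) F (t, y) ~= 0"
proof -
 define A where "A = iter_deriv [(0, h)] K (t, y)"
 define G where "G k s = iter_deriv (replicate k (0, h)) F (t, y + s *\<^sub>R h)" for k s
 have chain: "deriv_chain G" unfolding G_def by (rule deriv_chain_line[OF F_smooth t])
 define c where "c s = K (t, y + s *\<^sub>R h)" for s
 define z where "z s = (1 / s) *\<^sub>R (c s - c 0)" for s
 have cd: "(c has_derivative (%s. s *\<^sub>R A)) (at 0)"
  using smooth_open_partial_vector_derivative[OF K_smooth t, of "[]" y h]
  by (simp only: iter_deriv.simps(1) c_def[abs_def] A_def has_vector_derivative_def)
 hence "((%s. (1 / norm (s - 0)) *\<^sub>R (c s - (c 0 + (s - 0) *\<^sub>R A))) \<longlongrightarrow> 0) (at 0)"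
  unfolding has_derivative_within by (rule conjunct2)
 hence "((%s. (1 / norm (s - 0)) *\<^sub>R (c s - (c 0 + (s - 0) *\<^sub>R A))) \<longlongrightarrow> 0) (at_right 0)"
  by (rule filterlim_mono) (auto simp: at_within_le_at)
 hence "((%s. z s - A) \<longlongrightarrow> 0) (at_right 0)"
 proof (rule Lim_transform_eventually)
  show "\<forall>\<^sub>F s in at_right 0. (1 / norm (s - 0)) *\<^sub>R (c s - (c 0 + (s - 0) *\<^sub>R A)) = z s - A"
   using eventually_at_right_less[of "0::real"]
   by eventually_elim (simp add: z_def scaleR_diff_right scaleR_add_right)
 qed
 hence zlim: "(z \<longlongrightarrow> A) (at_right 0)" by (rule LIM_zero_cancel)
 have "isCont P A" using cont by (rule continuous_on_interior) simp
 hence Plim: "((%s. P (z s)) \<longlongrightarrow> P A) (at_right 0)" using zlim by (rule isCont_tendsto_compose)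
 have s0: "((%s::real. s) \<longlongrightarrow> 0) (at_right 0)" by (rule tendsto_ident_at)
 have nlim: "((%s. norm (s *\<^sub>R z s)) \<longlongrightarrow> 0) (at_right 0)"
  using tendsto_norm[OF tendsto_scaleR[OF s0 zlim]] by simp
 have ev: "\<forall>\<^sub>F s in at_right 0. norm (G 0 s / of_real s ^ m - P (z s)) <= C * norm (z s) ^ Suc m * s"
  using order_tendstoD(2)[OF nlim r] eventually_at_right_less[of 0]
 proof eventually_elim
  case (elim s)
  have cs: "c s = K (t, y) + s *\<^sub>R z s" using elim by (simp add: z_def c_def)
  have "G 0 s = p (K (t, y) + s *\<^sub>R z s)" unfolding cs[symmetric] by (simp add: G_def F_def c_def)
  hence "cmod (G 0 s - of_real s ^ m * P (z s)) <= C * norm (s *\<^sub>R z s) ^ Suc m"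
   using est[OF elim(1)] unfolding hom by simp
  also have "... = (C * norm (z s) ^ Suc m * s) * s ^ m" using elim(2) by (simp add: power_mult_distrib)
  finally have le: "cmod (G 0 s - of_real s ^ m * P (z s)) <= (C * norm (z s) ^ Suc m * s) * s ^ m" .
  have "G 0 s / of_real s ^ m - P (z s) = (G 0 s - of_real s ^ m * P (z s)) / of_real (s ^ m)"
   using elim(2) by (simp add: field_simps)
  hence "norm (G 0 s / of_real s ^ m - P (z s)) = cmod (G 0 s - of_real s ^ m * P (z s)) / s ^ m"
   using elim(2) by (simp only: norm_divide norm_of_real) simp
  thus ?case using le elim(2) by (simp add: divide_le_eq)
 qed
 have "((%s. C * norm (z s) ^ Suc m * s) \<longlongrightarrow> C * norm A ^ Suc m * 0) (at_right 0)"
  by (intro tendsto_intros zlim s0)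
 hence "((%s. G 0 s / of_real s ^ m - P (z s)) \<longlongrightarrow> 0) (at_right 0)"
  by (intro Lim_null_comparison[OF ev]) simp
 from tendsto_add[OF this Plim] have "((%s. G 0 s / of_real s ^ m) \<longlongrightarrow> P A) (at_right 0)" by simp
 from finite_order_along_curve[OF chain _ this] nz
 obtain k where "G k 0 ~= 0" unfolding A_def by blast
 thus ?thesis unfolding G_def by (intro exI[of _ k]) simp
qed

text \<open>The leading form of p does not vanish on the totally real tangent space, so P (K' h)
  \<noteq> 0 for some h. This is an open condition on h and persists for h + ep b with small ep > 0;
  these are the two kinds of directions that \<open>local_bound\<close> requires.\<close>

lemma finite_type:
 assumes t: "t : T"
 shows "\<exists>v. (\<exists>m. iter_deriv (replicate m (0, v)) F (t, y) ~= 0) &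
  (\<forall>b\<in>Basis. \<exists>ep>0. \<exists>k. iter_deriv (replicate k (0, v + ep *\<^sub>R b)) F (t, y) ~= 0)"
proof -
 obtain m0 C0 where dec: "m0 < - 2 * real CARD('n)"
  "!!rh. rh : tube \<Phi> W ==> cmod (p rh - 1) <= C0 * (sqrt (1 + (norm rh)\<^sup>2)) powr m0"
  using p_decay by blast
 have m0: "m0 < 0" using dec(1) by (rule less_trans) simp
 \<comment> \<open>Any nonzero x serves, as it only has to span a line in
   \<open>Lam \<Phi>\<close>.\<close>
 define x :: "complex ^ 'n" where "x = axis undefined 1"
 have x: "x ~= 0" unfolding x_def by (simp add: axis_eq_0_iff)
 have nz: "\<exists>\<zeta>. cmod \<zeta> < e & p (K (t, y) + cscale \<zeta> (graph_point \<Phi> x)) ~= 0" if "e > 0" for e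
  by (rule nonzero_on_real_line[OF openW p_holomorphic m0 dec(2) K_tube[OF t, of y] refl x that])
 obtain r m P C where P: "r > 0" "!!z. norm z < r ==> cmod (p (K (t, y) + z) - P z) <= C * norm z ^ Suc m"
  "!!s z. P (s *\<^sub>R z) = of_real s ^ m * P z" "continuous_on UNIV P"
  "!!v w. (%\<tau>. P (v + cscale \<tau> w)) holomorphic_on ball 0 2" "\<exists>z. P z ~= 0"
  by (rule leading_form[OF p_holomorphic open_tube[OF openW] K_tube[OF t, of y] nz]) (assumption, rule that)
 let ?A = "%h. iter_deriv [(0, h)] K (t, y)"
 obtain z where z: "P z ~= 0" using P(6) by blast
 obtain u v where uv: "u : range ?A" "v : range ?A" "z = u + mult_i v"
  using IR_totally_real[OF IR[OF t] K_diffeo[OF t], of y z] unfolding tangent_eq[OF t] by blast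
 note lin = linear_partial[OF t, of y]
 have "\<exists>v\<in>range ?A. P v ~= 0"
 proof (rule leading_form_nonzero_on_totally_real[OF P(5) z _ uv])
  fix a b and s :: real assume "a : range ?A" "b : range ?A"
  then obtain h k where "a = ?A h" "b = ?A k" by blast
  hence "a + s *\<^sub>R b = ?A (h + s *\<^sub>R k)" by (simp only: linear_add[OF lin] linear_scale[OF lin])
  thus "a + s *\<^sub>R b : range ?A" by (rule range_eqI)
 qed
 then obtain h where h: "P (?A h) ~= 0" by blast
 have dir: "\<exists>k. iter_deriv (replicate k (0, h')) F (t, y) ~= 0" if "P (?A h') ~= 0" for h'
  by (rule finite_type_in_direction[OF t P(1-4) that])
 have pos: "\<exists>ep>0. P (?A (h + ep *\<^sub>R b)) ~= 0" for b
 proof -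
  have bl: "bounded_linear ?A" using lin by (simp only: linear_conv_bounded_linear)
  have "((%ep::real. h + ep *\<^sub>R b) \<longlongrightarrow> h + 0 *\<^sub>R b) (at_right 0)" by (intro tendsto_intros)
  hence "((%ep::real. h + ep *\<^sub>R b) \<longlongrightarrow> h) (at_right 0)" by (simp only: scaleR_zero_left add_0_right)
  from bounded_linear.tendsto[OF bl this] have "((%ep::real. ?A (h + ep *\<^sub>R b)) \<longlongrightarrow> ?A h) (at_right 0)" .
  moreover have "isCont P (?A h)" using P(4) by (rule continuous_on_interior) simp
  ultimately have "((%ep::real. P (?A (h + ep *\<^sub>R b))) \<longlongrightarrow> P (?A h)) (at_right 0)" by (rule isCont_tendsto_compose[rotated])
  hence "\<forall>\<^sub>F ep in at_right (0::real). P (?A (h + ep *\<^sub>R b)) ~= 0" using h by (rule tendsto_imp_eventually_ne)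
  hence "\<forall>\<^sub>F ep in at_right (0::real). P (?A (h + ep *\<^sub>R b)) ~= 0 & 0 < ep"
   using eventually_at_right_less[of "0::real"] by (rule eventually_conj)
  hence "\<exists>ep::real. P (?A (h + ep *\<^sub>R b)) ~= 0 & 0 < ep"
   by (rule eventually_happens'[OF trivial_limit_at_right_real])
  thus ?thesis by (elim exE conjE) (intro exI conjI)
 qed
 have "\<exists>ep>0. \<exists>k. iter_deriv (replicate k (0, h + ep *\<^sub>R b)) F (t, y) ~= 0" for b
  using pos[of b] by (elim exE conjE) (rule exI, rule conjI, assumption, rule dir)
 with dir[OF h] show ?thesis by (intro exI[of _ h] conjI ballI)
qed

lemma compact_log_var_bound:
 assumes "compact KT" "KT \<subseteq> T" "compact KY"
 shows "\<exists>C\<ge>0. \<forall>t\<in>KT. \<forall>b\<in>Basis. (\<integral>\<^sup>+y\<in>KY. log_var (F (t, y)) (iter_deriv [(0, b)] F (t, y)) \<partial>lborel) <= ennreal C"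
proof (rule compact_bound[OF F_smooth assms])
 fix t0 y0 assume t0: "t0 : T"
 obtain v m where v: "iter_deriv (replicate m (0, v)) F (t0, y0) ~= 0"
  "!!b. b : Basis ==> \<exists>ep>0. \<exists>k. iter_deriv (replicate k (0, v + ep *\<^sub>R b)) F (t0, y0) ~= 0"
  using finite_type[OF t0, of y0]
  by (elim exE conjE) (rule that, assumption, erule bspec)
 show "\<exists>rh>0. \<exists>C\<ge>0. \<forall>t. \<bar>t - t0\<bar> < rh --> (\<forall>b\<in>Basis.
   (\<integral>\<^sup>+y\<in>ball y0 rh. log_var (F (t, y)) (iter_deriv [(0, b)] F (t, y)) \<partial>lborel) <= ennreal C)"
  by (rule local_bound[OF F_smooth oT t0 v])
qed

end

section \<open>Graphs near infinity\<close>

text \<open>The derivative of the \<xi> component of \<open>graph_point\<close> in direction u: as 2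
  / \<i> times (a - \<i> b) / 2 equals - \<i> a - b, the two real partial derivatives carry the
  coefficients - \<i> and - 1.\<close>

definition graph_slope :: "(complex ^ 'n => real) => complex ^ 'n => complex ^ 'n => complex ^ 'n::finite" where
 "graph_slope Ps x u = (\<Sum>j\<in>UNIV. iter_deriv [u, axis j 1] Ps x *\<^sub>R axis j (- \<i>) + iter_deriv [u, axis j \<i>] Ps x *\<^sub>R axis j (- 1))"

lemma scaleR_axis_nth: "(r *\<^sub>R axis j c) $ k = (if j = k then of_real r * c else (0::complex))"
 by (simp add: axis_def scaleR_conv_of_real[where 'a=complex])

lemma wirt_of_real:
 assumes "smooth_open U Ps" "x : U"
 shows "wirt j (%y. complex_of_real (Ps y)) x = (of_real (iter_deriv [axis j 1] Ps x) - \<i> * of_real (iter_deriv [axis j \<i>] Ps x)) / 2"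
proof -
 have "((%y. complex_of_real (Ps y)) has_derivative (%v. of_real (iter_deriv [v] Ps x))) (at x)"
  using bounded_linear.has_derivative[OF bounded_linear_of_real smooth_open_iter_has_derivative[OF assms, of "[]"]] by simp
 hence "frechet_derivative (%y. complex_of_real (Ps y)) (at x) = (%v. of_real (iter_deriv [v] Ps x))"
  by (rule frechet_derivative_at[symmetric])
 thus ?thesis unfolding wirt_def by simp
qed

lemma graph_point_smooth_eq:
 assumes "smooth_open U Ps" "x : U"
 shows "graph_point Ps x = (x, \<Sum>j\<in>UNIV. iter_deriv [axis j 1] Ps x *\<^sub>R axis j (- \<i>) + iter_deriv [axis j \<i>] Ps x *\<^sub>R axis j (- 1))"
proof -
 have nth: "(\<Sum>j\<in>UNIV. iter_deriv [axis j 1] Ps x *\<^sub>R axis j (- \<i>) + iter_deriv [axis j \<i>] Ps x *\<^sub>R axis j (- 1)) $ k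
  = - \<i> * of_real (iter_deriv [axis k 1] Ps x) - of_real (iter_deriv [axis k \<i>] Ps x)" for k
 proof -
  have "(\<Sum>j\<in>UNIV. iter_deriv [axis j 1] Ps x *\<^sub>R axis j (- \<i>) + iter_deriv [axis j \<i>] Ps x *\<^sub>R axis j (- 1)) $ k
   = (\<Sum>j\<in>UNIV. if j = k then - \<i> * of_real (iter_deriv [axis k 1] Ps x) - of_real (iter_deriv [axis k \<i>] Ps x) else 0)"
   unfolding sum_component vector_add_component scaleR_axis_nth by (intro sum.cong refl) simp
  thus ?thesis by (simp del: iter_deriv.simps)
 qed
 have "2 / \<i> * ((a - \<i> * b) / 2) = - \<i> * a - b" for a b :: complex by (simp add: field_simps)
 thus ?thesis unfolding graph_point_def
  by (simp only: prod.inject vec_eq_iff vec_lambda_beta nth wirt_of_real[OF assms] simp_thms)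
qed

lemma graph_point_smooth:
 assumes "smooth_open U Ps"
 shows "smooth_open U (graph_point Ps)"
  and "x : U ==> (graph_point Ps has_derivative (%u. (u, graph_slope Ps x u))) (at x)"
proof -
 let ?G = "%x. (x, \<Sum>j\<in>UNIV. iter_deriv [axis j 1] Ps x *\<^sub>R axis j (- \<i>) + iter_deriv [axis j \<i>] Ps x *\<^sub>R axis j (- 1))"
 have oU: "open U" using assms by (rule smooth_open_open)
 have "smooth_open U ?G"
  by (intro smooth_open_Pair smooth_open_bounded_linear[OF bounded_linear_ident oU] smooth_open_sum oU smooth_open_add
   smooth_open_bounded_linear_compose[OF bounded_linear_scaleR_left] smooth_open_iter assms)
 thus "smooth_open U (graph_point Ps)"
  by (rule smooth_open_cong) (rule graph_point_smooth_eq[OF assms, symmetric])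
 assume x: "x : U"
 have d: "(iter_deriv vs Ps has_derivative (%u. iter_deriv (u # vs) Ps x)) (at x)" for vs
  by (rule smooth_open_iter_has_derivative[OF assms x])
 have "(?G has_derivative (%u. (u, graph_slope Ps x u))) (at x)"
  unfolding graph_slope_def
  by (intro has_derivative_Pair has_derivative_ident has_derivative_sum has_derivative_add
   bounded_linear.has_derivative[OF bounded_linear_scaleR_left] d)
 thus "(graph_point Ps has_derivative (%u. (u, graph_slope Ps x u))) (at x)"
  by (rule has_derivative_transform_within_open[OF _ oU x]) (rule graph_point_smooth_eq[OF assms, symmetric])
qed

lemma holomorphic_part:
 fixes h :: "complex ^ 'n::finite => real"
 assumes "linear h"
 shows "(\<Sum>j\<in>UNIV. v $ j * (of_real (h (axis j 1)) - \<i> * of_real (h (axis j \<i>)))) = of_real (h v) - \<i> * of_real (h (\<i> *s v))"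
proof -
 have l: "linear (%v. complex_of_real (h v))"
  using linear_compose[OF assms, of complex_of_real] bounded_linear.linear[OF bounded_linear_of_real] by (simp add: o_def)
 show ?thesis using arg_cong[OF antilinear_part[OF l, of v], of cnj] by simp
qed

text \<open>In terms of the real Hessian h both sides are h (\<i> u) v - h u (\<i> v): the
  holomorphic second derivatives drop out by symmetry and the Levi matrix remains. Through this
  identity a bound on the inverse Levi matrix controls a tangent vector by its symplectic
  products.\<close>

lemma csympl_graph_tangent:
 fixes Ps :: "complex ^ 'n => real"
 assumes Ps: "smooth_open U Ps" and x: "x : U"
 shows "csympl (u, graph_slope Ps x u) (v, graph_slope Ps x v)
  = of_real (4 * Im (\<Sum>j\<in>UNIV. cnj (u $ j) * (levi Ps x *v v) $ j))"
proof -
 define h where "h u v = iter_deriv [u, v] Ps x" for u v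
 have sym: "h u v = h v u" for u v unfolding h_def by (rule mixed_partials[OF Ps x])
 have linl: "linear (%u. h u v)" for v
  unfolding h_def by (rule has_derivative_linear[OF smooth_open_iter_has_derivative[OF Ps x]])
 have linr: "linear (%v. h u v)" for u using linl[of u] by (simp only: sym[of u])
 have ii: "h (\<i> *s u) (\<i> *s (\<i> *s v)) = - h (\<i> *s u) v" for u v
 proof -
  have "\<i> *s (\<i> *s v) = (-1) *\<^sub>R v" by (simp add: vec_eq_iff)
  thus ?thesis using linear_scale[OF linr, of "\<i> *s u" "-1" v] by simp
 qed
 have slope: "graph_slope Ps x u $ k = - \<i> * (of_real (h u (axis k 1)) - \<i> * of_real (h u (axis k \<i>)))" for u k
 proof -
  have "graph_slope Ps x u $ k = (\<Sum>j\<in>UNIV. if j = k then - \<i> * (of_real (h u (axis k 1)) - \<i> * of_real (h u (axis k \<i>))) else 0)"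
   unfolding graph_slope_def sum_component h_def[symmetric] vector_add_component scaleR_axis_nth
   by (intro sum.cong refl) (simp add: algebra_simps)
  thus ?thesis by simp
 qed
 have s1: "(\<Sum>j\<in>UNIV. graph_slope Ps x u $ j * v $ j) = - \<i> * (of_real (h u v) - \<i> * of_real (h u (\<i> *s v)))" for u v
 proof -
  have "(\<Sum>j\<in>UNIV. graph_slope Ps x u $ j * v $ j) = - \<i> * (\<Sum>j\<in>UNIV. v $ j * (of_real (h u (axis j 1)) - \<i> * of_real (h u (axis j \<i>))))"
   unfolding sum_distrib_left by (intro sum.cong refl) (simp add: slope algebra_simps)
  thus ?thesis by (simp only: holomorphic_part[OF linr])
 qed
 have "csympl (u, graph_slope Ps x u) (v, graph_slope Ps x v)
  = (\<Sum>j\<in>UNIV. graph_slope Ps x u $ j * v $ j) - (\<Sum>j\<in>UNIV. graph_slope Ps x v $ j * u $ j)"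
  unfolding csympl_def by (simp add: sum_subtractf mult.commute)
 also have "... = of_real (h (\<i> *s u) v - h u (\<i> *s v))"
  unfolding s1 sym[of v u] sym[of v "\<i> *s u"] by (simp add: complex_eq_iff)
 finally have L: "csympl (u, graph_slope Ps x u) (v, graph_slope Ps x v) = of_real (h (\<i> *s u) v - h u (\<i> *s v))" .
 have oU: "open U" using Ps by (rule smooth_open_open)
 have dw: "frechet_derivative (wirt k (%y. complex_of_real (Ps y))) (at x) = (%u. (of_real (h u (axis k 1)) - \<i> * of_real (h u (axis k \<i>))) / 2)" for k
 proof -
  have "((%y. complex_of_real (iter_deriv [e] Ps y)) has_derivative (%u. of_real (h u e))) (at x)" for e
   unfolding h_def by (rule bounded_linear.has_derivative[OF bounded_linear_of_real smooth_open_iter_has_derivative[OF Ps x]])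
  hence "((%y. (of_real (iter_deriv [axis k 1] Ps y) - \<i> * of_real (iter_deriv [axis k \<i>] Ps y)) / 2) has_derivative (%u. (of_real (h u (axis k 1)) - \<i> * of_real (h u (axis k \<i>))) / 2)) (at x)"
   by (intro bounded_linear.has_derivative[OF bounded_linear_divide] has_derivative_diff bounded_linear.has_derivative[OF bounded_linear_mult_right])
  hence "(wirt k (%y. complex_of_real (Ps y)) has_derivative (%u. (of_real (h u (axis k 1)) - \<i> * of_real (h u (axis k \<i>))) / 2)) (at x)"
   by (rule has_derivative_transform_within_open[OF _ oU x]) (rule wirt_of_real[OF Ps, symmetric])
  thus ?thesis by (rule frechet_derivative_at[symmetric])
 qed
 have lv: "(levi Ps x *v v) $ j = ((of_real (h (axis j 1) v) - \<i> * of_real (h (axis j 1) (\<i> *s v))) + \<i> * (of_real (h (axis j \<i>) v) - \<i> * of_real (h (axis j \<i>) (\<i> *s v)))) / 4" for j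
 proof -
  have "(levi Ps x *v v) $ j = (\<Sum>k\<in>UNIV. v $ k * (of_real (h (axis j 1) (axis k 1)) - \<i> * of_real (h (axis j 1) (axis k \<i>)))) / 4
   + \<i> * (\<Sum>k\<in>UNIV. v $ k * (of_real (h (axis j \<i>) (axis k 1)) - \<i> * of_real (h (axis j \<i>) (axis k \<i>)))) / 4"
   unfolding matrix_vector_mult_def levi_def wirt_bar_def dw
   by (simp add: sum_distrib_left sum_divide_distrib sum.distrib[symmetric]) (intro sum.cong refl, simp add: field_simps)
  thus ?thesis unfolding holomorphic_part[OF linr] by (simp only: add_divide_distrib)
 qed
 define g where "g u = complex_of_real (h u v) - \<i> * of_real (h u (\<i> *s v))" for u
 have "linear g" unfolding g_def
  by (intro linearI) (simp_all add: linear_add[OF linl] linear_scale[OF linl] scaleR_conv_of_real[where 'a=complex] algebra_simps)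
 from antilinear_part[OF this, of u]
 have "(\<Sum>j\<in>UNIV. cnj (u $ j) * (levi Ps x *v v) $ j) = (g u + \<i> * g (\<i> *s u)) / 4"
  unfolding lv g_def[symmetric] times_divide_eq_right sum_divide_distrib[symmetric] by (simp only:)
 hence "4 * Im (\<Sum>j\<in>UNIV. cnj (u $ j) * (levi Ps x *v v) $ j) = h (\<i> *s u) v - h u (\<i> *s v)"
  by (simp only:) (simp add: g_def)
 thus ?thesis unfolding L by (simp only:)
qed

lemma norm_le_sum_components: "norm (x :: 'a::real_normed_vector ^ 'n::finite) <= (\<Sum>j\<in>UNIV. norm (x $ j))"
 unfolding norm_vec_def by (rule L2_set_le_sum) simp

lemma norm_matrix_vector_mult_le:
 fixes A :: "'a::real_normed_algebra_1 ^ 'n::finite ^ 'm::finite"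
 shows "norm (A *v x) <= real (CARD('m) * CARD('n)) * norm A * norm x"
proof -
 have "norm ((A *v x) $ j) <= real CARD('n) * (norm A * norm x)" for j
 proof -
  have "norm ((A *v x) $ j) <= (\<Sum>k\<in>UNIV. norm (A $ j $ k * x $ k))"
   unfolding matrix_vector_mult_def by (simp add: norm_sum)
  also have "... <= (\<Sum>k\<in>(UNIV::'n set). norm A * norm x)"
  proof (rule sum_mono)
   fix k
   have "norm (A $ j $ k * x $ k) <= norm (A $ j $ k) * norm (x $ k)" by (rule norm_mult_ineq)
   also have "... <= norm A * norm x"
    by (intro mult_mono order_trans[OF Finite_Cartesian_Product.norm_nth_le Finite_Cartesian_Product.norm_nth_le]
     Finite_Cartesian_Product.norm_nth_le) auto
   finally show "norm (A $ j $ k * x $ k) <= norm A * norm x" .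
  qed
  finally show ?thesis by simp
 qed
 hence "(\<Sum>j\<in>UNIV. norm ((A *v x) $ j)) <= (\<Sum>j\<in>(UNIV::'m set). real CARD('n) * (norm A * norm x))" by (rule sum_mono)
 with norm_le_sum_components[of "A *v x"] show ?thesis by (simp add: algebra_simps)
qed

text \<open>Testing against \<open>v = L\<^sup>-\<^sup>1(\<i>u)\<close> turns \<open>Im \<langle>Lv, u\<rangle>\<close> into \<open>|u|\<^sup>2\<close>.\<close>

lemma invertible_form_bound:
 fixes L :: "complex ^ 'n ^ 'n::finite"
 assumes L: "invertible L" "norm (matrix_inv L) <= C"
  and est: "!!v. \<bar>4 * Im (\<Sum>j\<in>UNIV. cnj (u $ j) * (L *v v) $ j)\<bar> <= B * norm v" and B: "B \<ge> 0"
 shows "norm u <= B * (real (CARD('n) * CARD('n)) * C)"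
proof (cases "u = 0")
 case True
 have "0 <= C" using L(2) norm_ge_zero order_trans by blast
 thus ?thesis using True B by simp
next
 case False
 define v where "v = matrix_inv L *v (\<i> *s u)"
 have Lv: "L *v v = \<i> *s u" unfolding v_def matrix_vector_mul_assoc
  using someI_ex[OF L(1)[unfolded invertible_def]] by (simp add: matrix_inv_def)
 have "(\<Sum>j\<in>UNIV. cnj (u $ j) * (L *v v) $ j) = \<i> * of_real (\<Sum>j\<in>UNIV. (cmod (u $ j))\<^sup>2)"
  unfolding Lv of_real_sum sum_distrib_left
  by (intro sum.cong refl) (simp del: of_real_power add: complex_norm_square algebra_simps)
 hence "\<bar>4 * Im (\<Sum>j\<in>UNIV. cnj (u $ j) * (L *v v) $ j)\<bar> = 4 * (norm u)\<^sup>2"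
  by (simp add: norm_vec_def L2_set_def sum_nonneg)
 hence "4 * (norm u)\<^sup>2 <= B * norm v" using est[of v] by simp
 also have "norm v <= real (CARD('n) * CARD('n)) * norm (matrix_inv L) * norm (\<i> *s u)"
  unfolding v_def by (rule norm_matrix_vector_mult_le)
 also have "norm (\<i> *s u) = norm u" by (simp add: norm_vec_def norm_mult)
 also have "real (CARD('n) * CARD('n)) * norm (matrix_inv L) * norm u <= real (CARD('n) * CARD('n)) * C * norm u"
  using L(2) by (intro mult_right_mono mult_left_mono) auto
 finally have "4 * (norm u)\<^sup>2 <= B * (real (CARD('n) * CARD('n)) * C * norm u)"
  using B by (simp add: mult_left_mono)
 hence "(norm u)\<^sup>2 <= B * (real (CARD('n) * CARD('n)) * C * norm u)" by (smt (verit) zero_le_power2)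
 thus ?thesis using False by (simp add: power2_eq_square mult.assoc)
qed

lemma linear_bound_on_basis:
 fixes D :: "'a::euclidean_space => 'b::real_normed_vector"
 assumes D: "linear D" and B: "!!b. b : Basis ==> norm (D b) <= B"
 shows "norm (D v) <= real DIM('a) * B * norm v"
proof -
 have "D v = D (\<Sum>b\<in>Basis. (v \<bullet> b) *\<^sub>R b)" by (simp add: euclidean_representation)
 also have "... = (\<Sum>b\<in>Basis. (v \<bullet> b) *\<^sub>R D b)" by (simp add: linear_sum[OF D] linear_scale[OF D])
 also have "norm ... <= (\<Sum>b\<in>(Basis::'a set). norm v * B)"
  using B by (intro order_trans[OF norm_sum] sum_mono) (auto simp: intro!: mult_mono Basis_le_norm)
 finally show ?thesis by (simp add: algebra_simps)
qed

lemma sympl_density_bounded: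
 fixes D :: "complex ^ 'n => 'n::finite cphase"
 assumes "!!u v. u : Basis ==> v : Basis ==> cmod (csympl (D u) (D v)) <= B"
 shows "sympl_density D <= real (card {\<pi>. \<pi> permutes (Basis :: (complex ^ 'n) set)}) * B ^ CARD('n)"
proof -
 let ?P = "{\<pi>. \<pi> permutes (Basis :: (complex ^ 'n) set)}"
 let ?S = "\<Sum>\<pi>\<in>?P. of_int (sign \<pi>) * (\<Prod>j\<in>UNIV. csympl (D (\<pi> (axis j 1))) (D (\<pi> (axis j \<i>))))"
 have "cmod ?S <= (\<Sum>\<pi>\<in>?P. B ^ CARD('n))"
 proof (intro order_trans[OF norm_sum] sum_mono)
  fix \<pi> assume "\<pi> : ?P"
  hence \<pi>: "\<pi> b : Basis" if "b : Basis" for b using that by (simp add: permutes_in_image)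
  have "cmod (\<Prod>j\<in>UNIV. csympl (D (\<pi> (axis j 1))) (D (\<pi> (axis j \<i>)))) <= (\<Prod>j\<in>(UNIV::'n set). B)"
   unfolding prod_norm[symmetric] by (intro prod_mono conjI assms \<pi>) (auto simp: Basis_vec_def Basis_complex_def)
  thus "cmod (of_int (sign \<pi>) * (\<Prod>j\<in>UNIV. csympl (D (\<pi> (axis j 1))) (D (\<pi> (axis j \<i>))))) <= B ^ CARD('n)"
   by (simp add: norm_mult sign_def)
 qed
 hence "cmod ?S <= real (card ?P) * B ^ CARD('n)" by simp
 moreover have "sympl_density D <= cmod ?S"
 proof -
  have "cmod ?S <= cmod ?S * (2 ^ CARD('n) * fact CARD('n))"
  proof -
   have "1 * 1 <= (2::real) ^ CARD('n) * fact CARD('n)" by (intro mult_mono one_le_power fact_ge_1) auto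
   hence "cmod ?S * 1 <= cmod ?S * (2 ^ CARD('n) * fact CARD('n))" by (intro mult_left_mono) auto
   thus ?thesis by simp
  qed
  thus ?thesis unfolding sympl_density_def by (simp add: norm_divide norm_power divide_le_eq mult.assoc)
 qed
 ultimately show ?thesis by linarith
qed

text \<open>Where 2^k \<le> 1 + |x| < 2^(k+1) the integrand is at most 2^(m k), and the ball of
  radius 2^(k+1) has volume of order 2^(k d). The resulting series is geometric with ratio 2^(m + d)
  < 1.\<close>

lemma powr_weight_integrable:
 assumes m: "m < - real DIM('a)"
 shows "(\<integral>\<^sup>+x. ennreal ((1 + norm (x::'a::euclidean_space)) powr m) \<partial>lborel) < \<infinity>"
proof -
 let ?d = "DIM('a)"
 define r where "r k = (2::real) ^ Suc k" for k
 have bound: "ennreal ((1 + norm x) powr m) <= (\<Sum>k. ennreal ((2 powr m) ^ k) * indicator (ball 0 (r k)) x)" for x :: 'a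
 proof -
  define N where "N = 1 + norm x"
  have N1: "N \<ge> 1" by (simp add: N_def)
  obtain k where k: "2 ^ k <= N" "N < 2 ^ Suc k"
  proof -
   have "\<exists>k. N < 2 ^ k" by (rule real_arch_pow) simp
   then obtain k0 where k0: "N < 2 ^ k0" "!!j. j < k0 ==> \<not> N < 2 ^ j"
    using exists_least_iff[of "%k. N < 2 ^ k"] by blast
   have "k0 ~= 0" using k0(1) N1 by (cases k0) auto
   then obtain j where "k0 = Suc j" using not0_implies_Suc by blast
   thus thesis using k0 by (intro that[of j]) (auto simp: not_less)
  qed
  have "N powr m <= (2 ^ k) powr m" using k(1) m by (intro powr_mono2') auto
  also have "... = (2 powr m) ^ k" by (simp add: powr_realpow[symmetric] powr_powr mult.commute flip: powr_power)
  finally have "ennreal (N powr m) <= ennreal ((2 powr m) ^ k) * indicator (ball 0 (r k)) x"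
   using k(2) by (simp add: r_def N_def ennreal_leI)
  also have "... <= (\<Sum>k. ennreal ((2 powr m) ^ k) * indicator (ball 0 (r k)) x)"
  proof -
   define g where "g k = ennreal ((2 powr m) ^ k) * indicator (ball 0 (r k)) x" for k
   have "sum g {k} <= suminf g" by (rule sum_le_suminf) auto
   hence "g k <= suminf g" by simp
   thus ?thesis unfolding g_def .
  qed
  finally show ?thesis by (simp add: N_def)
 qed
 have "(\<integral>\<^sup>+x. ennreal ((1 + norm (x::'a)) powr m) \<partial>lborel)
  <= (\<integral>\<^sup>+x. (\<Sum>k. ennreal ((2 powr m) ^ k) * indicator (ball (0::'a) (r k)) x) \<partial>lborel)"
  by (intro nn_integral_mono bound)
 also have "... = (\<Sum>k. \<integral>\<^sup>+x. ennreal ((2 powr m) ^ k) * indicator (ball (0::'a) (r k)) x \<partial>lborel)"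
  by (intro nn_integral_suminf borel_measurable_times_ennreal borel_measurable_const borel_measurable_indicator) simp
 also have "... = (\<Sum>k. ennreal (unit_ball_vol ?d * 2 ^ ?d * (2 powr (m + ?d)) ^ k))"
 proof (intro suminf_cong)
  fix k
  have "(\<integral>\<^sup>+x. ennreal ((2 powr m) ^ k) * indicator (ball (0::'a) (r k)) x \<partial>lborel) = ennreal ((2 powr m) ^ k) * emeasure lborel (ball (0::'a) (r k))"
   by (rule nn_integral_cmult_indicator) simp
  also have "... = ennreal ((2 powr m) ^ k * (unit_ball_vol ?d * r k ^ ?d))"
  proof -
   have "emeasure lborel (ball (0::'a) (r k)) = ennreal (unit_ball_vol ?d * r k ^ ?d)"
    by (rule emeasure_ball) (simp add: r_def)
   moreover have "0 <= unit_ball_vol ?d * r k ^ ?d" by (intro mult_nonneg_nonneg zero_le_power) (auto simp: r_def unit_ball_vol_nonneg)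
   ultimately show ?thesis by (simp only: ennreal_mult[OF zero_le_power[OF powr_ge_zero]])
  qed
  also have "(2 powr m) ^ k * (unit_ball_vol ?d * r k ^ ?d) = unit_ball_vol ?d * 2 ^ ?d * (2 powr (m + ?d)) ^ k"
  proof -
   have "r k ^ ?d = 2 ^ ?d * (2 ^ ?d) ^ k" unfolding r_def by (simp add: power_mult_distrib power_mult[symmetric] mult.commute)
   moreover have "(2::real) powr (m + ?d) = 2 powr m * 2 ^ ?d" by (simp add: powr_add powr_realpow)
   ultimately show ?thesis by (simp add: power_mult_distrib)
  qed
  finally show "(\<integral>\<^sup>+x. ennreal ((2 powr m) ^ k) * indicator (ball (0::'a) (r k)) x \<partial>lborel) = ennreal (unit_ball_vol ?d * 2 ^ ?d * (2 powr (m + ?d)) ^ k)" .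
 qed
 also have "... < \<infinity>"
 proof -
  have "(2::real) powr (m + ?d) < 2 powr 0" using m by (intro powr_less_mono) auto
  hence "summable (%k. unit_ball_vol ?d * 2 ^ ?d * (2 powr (m + ?d)) ^ k)"
   by (intro summable_mult summable_geometric) simp
  thus ?thesis by (subst suminf_ennreal2) (auto simp: unit_ball_vol_nonneg)
 qed
 finally show ?thesis .
qed

text \<open>A curve starting far out cannot come close before it has used up its speed: look at the first time
 at which it would leave the far region.\<close>

lemma far_flow_bound:
 fixes c :: "real => 'a::real_normed_vector \<times> 'b::real_normed_vector"
 assumes cont: "continuous_on {0..\<tau>} c" and \<tau>: "\<tau> \<ge> 0" and C: "C \<ge> 0"
  and der: "!!s. s : {0..\<tau>} ==> R < norm (fst (c s)) ==> (c has_vector_derivative c' s) (at s) & norm (c' s) <= C"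
  and start: "R + C * \<tau> < norm (fst (c 0))"
 shows "norm (c \<tau> - c 0) <= C * \<tau>" "R < norm (fst (c \<tau>))"
proof -
 have move: "norm (c s - c 0) <= C * s" if s: "0 <= s" "s <= \<tau>" "!!r. 0 <= r ==> r < s ==> R < norm (fst (c r))" for s
 proof (cases "s = 0")
  case False
  have "norm (c s - c 0) <= C * s - C * 0"
  proof (rule differentiable_bound_general[where f' = c' and \<phi>' = "%_. C"])
   show "0 < s" using s False by simp
   show "continuous_on {0..s} c" by (rule continuous_on_subset[OF cont]) (use s in auto)
   show "continuous_on {0..s} ((*) C)" by (intro continuous_intros)
   fix r assume "0 < r" "r < s"
   thus "(c has_vector_derivative c' r) (at r)" "norm (c' r) <= C" using der[of r] s by auto
   show "((*) C has_vector_derivative C) (at r)" by (auto intro!: derivative_eq_intros simp: has_vector_derivative_def)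
  qed
  thus ?thesis by simp
 qed simp
 have stay: "R < norm (fst (c s))" if "0 <= s" "s <= \<tau>" "norm (c s - c 0) <= C * s" for s
 proof -
  have "norm (fst (c 0)) - norm (fst (c s)) <= norm (fst (c s - c 0))"
   using norm_triangle_ineq3[of "fst (c 0)" "fst (c s)"] by (simp add: norm_minus_commute)
  also have "... <= norm (c s - c 0)" by (metis norm_fst_le prod.collapse)
  also have "... <= C * \<tau>" using that mult_left_mono[OF that(2) C] by linarith
  finally show ?thesis using start by linarith
 qed
 have far: "R < norm (fst (c s))" if s: "0 <= s" "s <= \<tau>" for s
 proof (rule ccontr)
  define S where "S = {s : {0..\<tau>}. norm (fst (c s)) <= R}"
  assume "\<not> R < norm (fst (c s))"
  hence ne: "S ~= {}" using s by (auto simp: S_def)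
  have "continuous_on {0..\<tau>} (%s. norm (fst (c s)))" by (intro continuous_intros cont)
  hence "closed S" unfolding S_def by (intro continuous_on_closed_Collect_le continuous_on_const closed_atLeastAtMost)
  moreover have bdd: "bdd_below S" by (auto simp: S_def bdd_below_def)
  ultimately have inS: "Inf S : S" using ne closed_contains_Inf by blast
  define th where "th = Inf S"
  have low: "th <= r" if "r : S" for r unfolding th_def using that bdd by (rule cInf_lower)
  have "th : S" using inS by (simp only: th_def)
  hence th: "0 <= th" "th <= \<tau>" "norm (fst (c th)) <= R" by (simp_all add: S_def)
  have "R < norm (fst (c r))" if "0 <= r" "r < th" for r
  proof (rule ccontr)
   assume "\<not> R < norm (fst (c r))"
   hence "r : S" using that th by (simp add: S_def)
   from low[OF this] show False using that by simp
  qed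
  from stay[OF th(1,2) move[OF th(1,2) this]] show False using th(3) by simp
 qed
 show "norm (c \<tau> - c 0) <= C * \<tau>" by (rule move[OF \<tau> order_refl far]) auto
 show "R < norm (fst (c \<tau>))" by (rule far[OF \<tau> order_refl])
qed

lemma abs_ln_norm_le: "cmod (z - 1) <= 1/2 ==> \<bar>ln (cmod z)\<bar> <= 2 * cmod (z - 1)"
proof -
 assume z: "cmod (z - 1) <= 1/2"
 define x where "x = cmod z - 1"
 have x: "\<bar>x\<bar> <= cmod (z - 1)" unfolding x_def using norm_triangle_ineq3[of z 1] by simp
 have "\<bar>ln (1 + x) - x\<bar> <= 2 * x\<^sup>2" using x z by (intro abs_ln_one_plus_x_minus_x_bound) auto
 moreover have "2 * x\<^sup>2 <= \<bar>x\<bar>"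
 proof -
  have "2 * x\<^sup>2 = (2 * \<bar>x\<bar>) * \<bar>x\<bar>" by (simp add: power2_eq_square abs_mult_self_eq mult.assoc)
  also have "... <= 1 * \<bar>x\<bar>" using x z by (intro mult_right_mono) auto
  finally show ?thesis by simp
 qed
 ultimately have "\<bar>ln (1 + x)\<bar> <= 2 * \<bar>x\<bar>" by linarith
 thus ?thesis using x by (simp add: x_def)
qed

lemma finite_uniform_bound:
 assumes "finite A" "!!a. a : A ==> \<exists>B. \<forall>x\<in>X. q a x <= (B::real)"
 shows "\<exists>B\<ge>0. \<forall>a\<in>A. \<forall>x\<in>X. q a x <= B"
 using assms
proof (induction A rule: finite_induct)
 case empty
 thus ?case by (intro exI[of _ 0]) simp
next
 case (insert a A)
 obtain B1 where "\<forall>x\<in>X. q a x <= B1" using insert.prems[of a] by auto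
 moreover obtain B2 where "B2 \<ge> 0" "\<forall>a\<in>A. \<forall>x\<in>X. q a x <= B2" using insert.IH insert.prems by auto
 ultimately show ?case by (intro exI[of _ "max B1 B2"]) fastforce
qed

lemma norm_axis_complex: "norm (axis j c :: complex ^ 'n::finite) = cmod c"
proof -
 have "(\<Sum>i\<in>UNIV. (norm ((axis j c :: complex ^ 'n) $ i))\<^sup>2) = (\<Sum>i\<in>UNIV. if i = j then (cmod c)\<^sup>2 else 0)"
  by (intro sum.cong refl) (simp add: axis_def)
 thus ?thesis by (simp add: norm_vec_def L2_set_def)
qed

lemma graph_outside_mono:
 assumes "graph_outside R Ps M" "R <= R'"
 shows "graph_outside R' Ps M"
 unfolding graph_outside_def
proof (intro equalityI subsetI)
 fix rh assume r: "rh : {rh : M. fst rh : far R'}"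
 hence "rh : graph_point Ps ` far R" using assms unfolding graph_outside_def by auto
 then obtain x where "rh = graph_point Ps x" by blast
 thus "rh : graph_point Ps ` far R'" using r by (auto simp: graph_point_def)
next
 fix rh assume "rh : graph_point Ps ` far R'"
 then obtain x where x: "rh = graph_point Ps x" "x : far R'" by blast
 hence "rh : graph_point Ps ` far R" using assms(2) by auto
 hence "rh : M" using assms(1) unfolding graph_outside_def by blast
 thus "rh : {rh : M. fst rh : far R'}" using x by (simp add: graph_point_def)
qed

lemma graph_outside_point:
 assumes "graph_outside R Ps M"
 shows "rh : M ==> R < norm (fst rh) ==> graph_point Ps (fst rh) = rh"
  and "R < norm x ==> graph_point Ps x : M"
proof -
 assume "rh : M" "R < norm (fst rh)"
 hence "rh : graph_point Ps ` far R" using assms unfolding graph_outside_def by blast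
 then obtain x where "rh = graph_point Ps x" by blast
 thus "graph_point Ps (fst rh) = rh" by (simp add: graph_point_def)
next
 assume "R < norm x"
 hence "graph_point Ps x : graph_point Ps ` far R" by simp
 thus "graph_point Ps x : M" using assms unfolding graph_outside_def by blast
qed

text \<open>A weight is not determined by M, but its graph points over large x are. This allows
  weights coming from different hypotheses to be exchanged.\<close>

lemma graph_outside_unique:
 assumes "graph_outside R Ps M" "graph_outside R' Ps' M" "R < norm x" "R' < norm x"
 shows "graph_point Ps x = graph_point Ps' x"
proof -
 have "fst (graph_point Ps x) = x" by (simp add: graph_point_def)
 thus ?thesis
  using graph_outside_point(1)[OF assms(2), of "graph_point Ps x"] graph_outside_point(2)[OF assms(1,3)] assms(4) by simp
qed

lemma open_far: "open (far R)"
 by (intro open_Collect_less continuous_intros)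

lemma tangent_space_graph:
 fixes Ps :: "complex ^ 'n::finite => real"
 assumes M: "graph_outside R Ps M" and Ps: "smooth_open (far R) Ps" and rh: "rh : M" "R < norm (fst rh)"
 shows "v : tangent_space M rh ==> v = (fst v, graph_slope Ps (fst rh) (fst v))"
  and "(u, graph_slope Ps (fst rh) u) : tangent_space M rh"
proof -
 define x where "x = fst rh"
 have x: "x : far R" using rh by (simp add: x_def)
 have G: "graph_point Ps x = rh" unfolding x_def by (rule graph_outside_point(1)[OF M rh])
 note dG = graph_point_smooth(2)[OF Ps x]
 {
  assume "v : tangent_space M rh"
  then obtain \<gamma> e where \<gamma>: "e > 0" "smooth_open {-e<..<e} \<gamma>" "\<gamma> ` {-e<..<e} \<subseteq> M" "\<gamma> 0 = rh" "(\<gamma> has_vector_derivative v) (at (0::real))"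
   unfolding tangent_space_def by (elim CollectE exE conjE) (rule that)
  have d: "(\<gamma> has_derivative (%s. s *\<^sub>R v)) (at 0)" using \<gamma>(5) by (simp only: has_vector_derivative_def)
  have df: "((%s. fst (\<gamma> s)) has_derivative (%s. fst (s *\<^sub>R v))) (at 0)"
   by (rule bounded_linear.has_derivative[OF bounded_linear_fst d])
  have "(graph_point Ps has_derivative (%u. (u, graph_slope Ps x u))) (at (fst (\<gamma> 0)))" using dG by (simp only: \<gamma>(4) x_def)
  from has_derivative_compose[OF df this]
  have "((%s. graph_point Ps (fst (\<gamma> s))) has_derivative (%s. (fst (s *\<^sub>R v), graph_slope Ps x (fst (s *\<^sub>R v))))) (at 0)" .
  moreover have "continuous_on {-e<..<e} (%s. fst (\<gamma> s))"
   by (intro continuous_on_fst smooth_open_continuous_on[OF \<gamma>(2)])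
  hence "open ({-e<..<e} \<inter> (%s. fst (\<gamma> s)) -` far R)" by (rule continuous_open_preimage[OF _ open_greaterThanLessThan open_far])
  moreover have "0 : {-e<..<e} \<inter> (%s. fst (\<gamma> s)) -` far R" using \<gamma>(1,4) rh by simp
  moreover have "graph_point Ps (fst (\<gamma> s)) = \<gamma> s" if "s : {-e<..<e} \<inter> (%s. fst (\<gamma> s)) -` far R" for s
   using that \<gamma>(3) by (intro graph_outside_point(1)[OF M]) auto
  ultimately have "(\<gamma> has_derivative (%s. (fst (s *\<^sub>R v), graph_slope Ps x (fst (s *\<^sub>R v))))) (at 0)"
   by (rule has_derivative_transform_within_open)
  from fun_cong[OF has_derivative_unique[OF d this], of 1]
  show "v = (fst v, graph_slope Ps (fst rh) (fst v))" by (simp only: scaleR_one x_def)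
 }
 obtain d where d: "d > 0" "ball x d \<subseteq> far R" using open_far x open_contains_ball by metis
 define e where "e = d / (norm u + 1)"
 have e: "e > 0" using d(1) by (simp add: e_def add_nonneg_pos)
 have in_far: "x + s *\<^sub>R u : far R" if "s : {-e<..<e}" for s
 proof -
  have "\<bar>s\<bar> * norm u <= \<bar>s\<bar> * (norm u + 1)" by (intro mult_left_mono) auto
  also have "... < e * (norm u + 1)" using that by (intro mult_strict_right_mono) (auto simp: add_nonneg_pos)
  also have "... = d" unfolding e_def by (simp add: add_nonneg_eq_0_iff)
  finally have "x + s *\<^sub>R u : ball x d" by (simp add: dist_norm)
  thus ?thesis using d(2) by blast
 qed
 define \<gamma> where "\<gamma> s = graph_point Ps (x + s *\<^sub>R u)" for s :: real
 have "smooth_open {-e<..<e} (%s::real. s *\<^sub>R u)" by (intro smooth_open_bounded_linear bounded_linear_scaleR_left) auto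
 hence "smooth_open {-e<..<e} (%s::real. x + s *\<^sub>R u)" by (intro smooth_open_add smooth_open_const) auto
 hence "smooth_open {-e<..<e} \<gamma>" unfolding \<gamma>_def
  by (rule smooth_open_compose[OF _ graph_point_smooth(1)[OF Ps]]) (intro image_subsetI in_far)
 moreover have "\<gamma> ` {-e<..<e} \<subseteq> M"
  unfolding \<gamma>_def using in_far by (intro image_subsetI graph_outside_point(2)[OF M]) blast
 moreover have "\<gamma> 0 = rh" by (simp add: \<gamma>_def G)
 moreover have "(\<gamma> has_vector_derivative (u, graph_slope Ps (fst rh) u)) (at 0)"
 proof -
  have "((%s::real. x + s *\<^sub>R u) has_derivative (%s. s *\<^sub>R u)) (at 0)" by (auto intro!: derivative_eq_intros)
  moreover have "(graph_point Ps has_derivative (%u. (u, graph_slope Ps x u))) (at (x + 0 *\<^sub>R u))" using dG by simp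
  ultimately have "(\<gamma> has_derivative (%s. (s *\<^sub>R u, graph_slope Ps x (s *\<^sub>R u)))) (at 0)" unfolding \<gamma>_def by (rule has_derivative_compose)
  moreover have "(s *\<^sub>R u, graph_slope Ps x (s *\<^sub>R u)) = s *\<^sub>R (u, graph_slope Ps (fst rh) u)" for s
   using linear_scale[OF has_derivative_linear[OF dG], of s u] by (simp only: x_def)
  ultimately show ?thesis unfolding has_vector_derivative_def by (simp only:)
 qed
 ultimately show "(u, graph_slope Ps (fst rh) u) : tangent_space M rh" unfolding tangent_space_def
  using e by (intro CollectI exI[of _ \<gamma>] exI[of _ e] conjI)
qed

lemma graph_slope_bound:
 fixes Ps :: "complex ^ 'n::finite => real"
 assumes Ps: "smooth_open U Ps" "x : U"
  and B: "!!u v. u : Basis ==> v : Basis ==> \<bar>iter_deriv [u, v] Ps x\<bar> <= B"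
 shows "norm (graph_slope Ps x u) <= real DIM(complex ^ 'n) * (real CARD('n) * (2 * B)) * norm u"
proof (rule linear_bound_on_basis)
 have "linear (%u. snd (u, graph_slope Ps x u))"
  using has_derivative_linear[OF bounded_linear.has_derivative[OF bounded_linear_snd graph_point_smooth(2)[OF Ps]]] .
 thus "linear (graph_slope Ps x)" by simp
 fix b :: "complex ^ 'n" assume b: "b : Basis"
 have ax: "axis j 1 : (Basis :: (complex ^ 'n) set)" "axis j \<i> : (Basis :: (complex ^ 'n) set)" for j
  by (auto simp: Basis_vec_def Basis_complex_def)
 have "norm (iter_deriv [b, axis j 1] Ps x *\<^sub>R axis j (- \<i>) + iter_deriv [b, axis j \<i>] Ps x *\<^sub>R (axis j (- 1) :: complex ^ 'n)) <= 2 * B" for j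
  using norm_triangle_ineq[of "iter_deriv [b, axis j 1] Ps x *\<^sub>R axis j (- \<i>)" "iter_deriv [b, axis j \<i>] Ps x *\<^sub>R (axis j (- 1) :: complex ^ 'n)"]
   B[OF b ax(1)[of j]] B[OF b ax(2)[of j]]
  by (simp add: norm_axis_complex del: iter_deriv.simps)
 hence "(\<Sum>j\<in>UNIV. norm (iter_deriv [b, axis j 1] Ps x *\<^sub>R axis j (- \<i>) + iter_deriv [b, axis j \<i>] Ps x *\<^sub>R (axis j (- 1) :: complex ^ 'n))) <= (\<Sum>j\<in>(UNIV::'n set). 2 * B)"
  by (rule sum_mono)
 also have "... = real CARD('n) * (2 * B)" by simp
 finally show "norm (graph_slope Ps x b) <= real CARD('n) * (2 * B)"
  unfolding graph_slope_def by (rule order_trans[OF norm_sum])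
qed

lemma iter_deriv_slice:
 fixes F :: "real \<times> 'a::real_normed_vector => 'b::real_normed_vector"
 assumes F: "smooth_open (T \<times> U) F" and t: "t : T" and U: "open U" and x: "x : U"
 shows "((%x. F (t, x)) has_derivative (%v. iter_deriv [(0, v)] F (t, x))) (at x)"
  and "iter_deriv [v] (%x. F (t, x)) x = iter_deriv [(0, v)] F (t, x)"
proof -
 have d: "((%x. (t, x)) has_derivative (%v. (0, v))) (at x)"
  by (intro has_derivative_Pair has_derivative_const has_derivative_ident)
 have tx: "(t, x) : T \<times> U" using t x by (rule SigmaI)
 have "(F has_derivative (%v. iter_deriv [v] F (t, x))) (at (t, x))"
  using smooth_open_iter_has_derivative[OF F tx, of "[]"] by (simp only: iter_deriv.simps(1))
 from has_derivative_compose[OF d this]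
 show *: "((%x. F (t, x)) has_derivative (%v. iter_deriv [(0, v)] F (t, x))) (at x)" .
 show "iter_deriv [v] (%x. F (t, x)) x = iter_deriv [(0, v)] F (t, x)"
  using fun_cong[OF frechet_derivative_at[OF *], of v] by simp
qed

lemma smooth_open_slice:
 fixes F :: "real \<times> 'a::euclidean_space => 'b::real_normed_vector"
 assumes F: "smooth_open (T \<times> U) F" and t: "t : T" and U: "open U"
 shows "smooth_open U (%x. F (t, x))"
 by (rule smooth_open_compose[OF smooth_open_Pair[OF smooth_open_const[OF U] smooth_open_bounded_linear[OF bounded_linear_ident U]] F])
  (use t in auto)

section \<open>The Hamilton field near infinity\<close>

context deformation
begin

text \<open>The bound on the Hessian of the weights is the case N = 0, with no further x-derivative,
  of the condition on the second derivatives in \<open>admissible_family\<close>; finitely many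
  pairs of basis vectors share one constant.\<close>

lemma ends:
 obtains R Ps C B where
  "!!t. t : T ==> graph_outside R (Ps t) (\<Lambda> t)" "smooth_open (T \<times> far R) (%(t, x). Ps t x)"
  "!!t x. t : T ==> R < norm x ==> invertible (levi (Ps t) x) & norm (matrix_inv (levi (Ps t) x)) <= C"
  "!!t x u v. t : T ==> R < norm x ==> u : Basis ==> v : Basis ==> \<bar>iter_deriv [u, v] (Ps t) x\<bar> <= B"
proof -
 obtain R Ps C where *:
  "!!t. t : T ==> graph_outside R (Ps t) (\<Lambda> t)" "smooth_open (T \<times> far R) (%(t, x). Ps t x)"
  "!!t x. t : T ==> x : far R ==> invertible (levi (Ps t) x) & norm (matrix_inv (levi (Ps t) x)) <= C"
  and b: "\<forall>N u v. Cb_inf_unif T (far R) (%t x. (deriv ^^ N) (%s. iter_deriv [u, v] (Ps s) x) t)"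
  using fam unfolding admissible_family_def by (elim conjE exE) (rule that, auto)
 have "\<exists>B. \<forall>z\<in>T \<times> far R. \<bar>iter_deriv [u, v] (Ps (fst z)) (snd z)\<bar> <= B" for u v
 proof -
  have "bounded ((%(t, x). iter_deriv [] ((%t x. (deriv ^^ 0) (%s. iter_deriv [u, v] (Ps s) x) t) t) x) ` (T \<times> far R))"
   using b[rule_format, of 0 u v] unfolding Cb_inf_unif_def by (elim conjE) (erule spec)
  hence "bounded ((%(t, x). iter_deriv [u, v] (Ps t) x) ` (T \<times> far R))"
   by (simp only: iter_deriv.simps(1) funpow_0)
  then obtain B where "!!z. z : (%(t, x). iter_deriv [u, v] (Ps t) x) ` (T \<times> far R) ==> norm z <= B"
   unfolding bounded_iff by blast
  thus ?thesis by (intro exI[of _ B] ballI) (force simp del: iter_deriv.simps simp: case_prod_beta)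
 qed
 hence "\<exists>B\<ge>0. \<forall>a\<in>Basis \<times> Basis. \<forall>z\<in>T \<times> far R. \<bar>iter_deriv [fst a, snd a] (Ps (fst z)) (snd z)\<bar> <= B"
  by (intro finite_uniform_bound) auto
 then obtain B where "\<forall>a\<in>Basis \<times> Basis. \<forall>z\<in>T \<times> far R. \<bar>iter_deriv [fst a, snd a] (Ps (fst z)) (snd z)\<bar> <= B" by blast
 hence "\<bar>iter_deriv [u, v] (Ps t) x\<bar> <= B" if "t : T" "R < norm x" "u : Basis" "v : Basis" for t x u v
  using that by (auto simp del: iter_deriv.simps dest!: bspec[of _ _ "(u, v)"] bspec[of _ _ "(t, x)"])
 thus thesis using * by (intro that[of R Ps C B]) (auto simp del: iter_deriv.simps)
qed

text \<open>By \<open>csympl_graph_tangent\<close>, the defining identity of H becomes 4 Im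
  \<langle>L v, H_x\<rangle> = - df(v) with the Levi matrix L. So the bounds on df and on the
  inverse of L bound the x component of H, and the Hessian of the weight then bounds the \<xi>
  component.\<close>

lemma ham_far_bound:
 assumes ab: "{a..b} \<subseteq> T"
 shows "\<exists>R C. 0 <= C & (\<forall>t\<in>{a..b}. \<forall>y. R < norm (fst (K (t, y))) --> norm (ham t y) <= C)"
proof -
 obtain R1 Ps C1 B1 where E: "!!t. t : T ==> graph_outside R1 (Ps t) (\<Lambda> t)" "smooth_open (T \<times> far R1) (%(t, x). Ps t x)"
  "!!t x. t : T ==> R1 < norm x ==> invertible (levi (Ps t) x) & norm (matrix_inv (levi (Ps t) x)) <= C1"
  "!!t x u v. t : T ==> R1 < norm x ==> u : Basis ==> v : Basis ==> \<bar>iter_deriv [u, v] (Ps t) x\<bar> <= B1"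
  by (rule ends) (rule that)
 obtain R2 Ps' where f2: "\<forall>t\<in>T. graph_outside R2 (Ps' t) (\<Lambda> t)"
  "\<forall>K vs. compact K & K \<subseteq> T --> bounded (iter_deriv vs (%(t, x). f t (graph_point (Ps' t) x)) ` (K \<times> far R2))"
  using fC unfolding smooth_Cb_family_def by (elim conjE exE) (rule that)
 define J where "J = (%(t, x). f t (graph_point (Ps' t) x))"
 define R where "R = max R1 R2"
 have R: "R1 <= R" "R2 <= R" by (auto simp: R_def)
 note go = graph_outside_mono[OF E(1) R(1)]
 have oF: "open (T \<times> far R)" using oT open_far by (rule open_Times)
 have sP: "smooth_open (T \<times> far R) (%z. Ps (fst z) (snd z))"
 proof -
  have "T \<times> far R \<subseteq> T \<times> far R1" using R(1) by auto
  from smooth_open_subset[OF E(2) oF this] show ?thesis by (rule smooth_open_cong) (rule case_prod_beta)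
 qed
 have sl: "smooth_open (far R) (Ps t)" if "t : T" for t
  using smooth_open_slice[OF sP that open_far] by (simp only: fst_conv snd_conv)
 \<comment> \<open>The derivatives of f are bounded in a chart given by \<open>Ps'\<close>, which
   comes without any smoothness; far out its graph points are those of the smooth family
   \<open>Ps\<close>.\<close>
 have gp: "graph_point (Ps' t) x = graph_point (Ps t) x" if "t : T" "x : far R" for t x
  by (rule graph_outside_unique[OF f2(1)[rule_format, OF that(1)] E(1)[OF that(1)]]) (use that R in auto)
 let ?P = "%z. Ps (fst z) (snd z)"
 let ?G = "%z::real \<times> (complex ^ 'n). (snd z, \<Sum>j\<in>UNIV. iter_deriv [(0, axis j 1)] ?P z *\<^sub>R axis j (- \<i>) + iter_deriv [(0, axis j \<i>)] ?P z *\<^sub>R axis j (- 1))"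
 have sG0: "smooth_open (T \<times> far R) ?G"
  by (intro smooth_open_Pair smooth_open_bounded_linear[OF bounded_linear_snd oF] smooth_open_sum oF smooth_open_add
   smooth_open_bounded_linear_compose[OF bounded_linear_scaleR_left] smooth_open_iter sP)
 have sG: "smooth_open (T \<times> far R) (%z. graph_point (Ps (fst z)) (snd z))"
 proof (rule smooth_open_cong[OF sG0])
  fix z :: "real \<times> (complex ^ 'n)" assume z: "z : T \<times> far R"
  obtain t x where tx: "z = (t, x)" by (rule prod.exhaust)
  have t: "t : T" "x : far R" using z by (auto simp: tx)
  have "iter_deriv [v] (Ps t) x = iter_deriv [(0, v)] ?P (t, x)" for v
   using iter_deriv_slice(2)[OF sP t(1) open_far t(2), of v] by (simp only: fst_conv snd_conv)
  thus "?G z = graph_point (Ps (fst z)) (snd z)"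
   unfolding tx fst_conv snd_conv graph_point_smooth_eq[OF sl[OF t(1)] t(2)] by (simp only:)
 qed
 have sJ: "smooth_open (T \<times> far R) J"
 proof (rule smooth_on_open[OF oF])
  have fs: "smooth_on (SIGMA t:T. \<Lambda> t) (%(t, rh). f t rh)" using fC unfolding smooth_Cb_family_def by blast
  have 1: "smooth_on (T \<times> far R) (%z. (fst z, graph_point (Ps (fst z)) (snd z)))"
   by (rule smooth_on_Pair[OF smooth_on_bounded_linear[OF bounded_linear_fst] smooth_open_imp_smooth_on[OF sG order_refl]])
  have "smooth_on (T \<times> far R) (%z. (%(t, rh). f t rh) (fst z, graph_point (Ps (fst z)) (snd z)))"
   by (rule smooth_on_compose[OF 1 fs]) (use graph_outside_point(2)[OF go] in auto)
  thus "smooth_on (T \<times> far R) J"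
   by (rule smooth_on_cong) (auto simp: J_def gp)
 qed
 have "\<exists>B. \<forall>z\<in>{a..b} \<times> far R. \<bar>iter_deriv [(0, e)] J z\<bar> <= B" for e
 proof -
  have "bounded (iter_deriv [(0, e)] J ` ({a..b} \<times> far R2))" using f2(2) ab compact_Icc unfolding J_def by blast
  then obtain B where "!!z. z : {a..b} \<times> far R2 ==> norm (iter_deriv [(0, e)] J z) <= B"
   unfolding bounded_iff by blast
  thus ?thesis using R(2) by (intro exI[of _ B]) (auto simp del: iter_deriv.simps)
 qed
 then obtain B2 where B2: "B2 \<ge> 0" "!!e z. e : Basis ==> z : {a..b} \<times> far R ==> \<bar>iter_deriv [(0, e)] J z\<bar> <= B2"
  using finite_uniform_bound[OF finite_Basis, of "{a..b} \<times> far R" "%e z. \<bar>iter_deriv [(0, e)] J z\<bar>"] by blast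
 define B3 where "B3 = real DIM(complex ^ 'n) * B2"
 define B4 where "B4 = real DIM(complex ^ 'n) * (real CARD('n) * (2 * \<bar>B1\<bar>))"
 define C where "C = B3 * (real (CARD('n) * CARD('n)) * \<bar>C1\<bar>)"
 have B34: "B3 \<ge> 0" "B4 \<ge> 0" "C \<ge> 0" using B2(1) by (auto simp: B3_def B4_def C_def)
 have "norm (ham t y) <= C + B4 * C" if t: "t : {a..b}" and y: "R < norm (fst (K (t, y)))" for t y
 proof -
  have tT: "t : T" using t ab by blast
  define x where "x = fst (K (t, y))"
  define H where "H = ham t y"
  have x: "x : far R" using y by (simp add: x_def)
  have Gx: "graph_point (Ps t) x = K (t, y)" unfolding x_def by (rule graph_outside_point(1)[OF go[OF tT] K\<Lambda>[OF tT] y])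
  note ts = tangent_space_graph[OF go[OF tT] sl[OF tT] K\<Lambda>[OF tT] y, folded x_def]
  have H: "H = (fst H, graph_slope (Ps t) x (fst H))" unfolding H_def by (rule ts(1)[OF ham_tangent[OF tT]])
  have df: "\<bar>mdiff (\<Lambda> t) (f t) (K (t, y)) (v, graph_slope (Ps t) x v)\<bar> <= B3 * norm v" for v
  proof -
   obtain D where D: "(f t has_derivative D) (at (K (t, y)) within \<Lambda> t)"
    using smooth_on_differentiable[OF f_smooth[OF tT] K\<Lambda>[OF tT]] by (rule exE)
   have "(f t has_derivative D) (at (graph_point (Ps t) x) within graph_point (Ps t) ` far R)"
    unfolding Gx by (rule has_derivative_subset[OF D]) (use graph_outside_point(2)[OF go[OF tT]] in auto)
   from has_derivative_in_compose[OF has_derivative_at_withinI[OF graph_point_smooth(2)[OF sl[OF tT] x]] this]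
   have "((%x. f t (graph_point (Ps t) x)) has_derivative (%u. D (u, graph_slope (Ps t) x u))) (at x)"
    by (simp only: at_within_open[OF x open_far])
   hence "((%x. J (t, x)) has_derivative (%u. D (u, graph_slope (Ps t) x u))) (at x)"
    by (rule has_derivative_transform_within_open[OF _ open_far x]) (simp add: J_def gp[OF tT])
   from has_derivative_unique[OF this iter_deriv_slice(1)[OF sJ tT open_far x]]
   have DJ: "D (u, graph_slope (Ps t) x u) = iter_deriv [(0, u)] J (t, x)" for u by (rule fun_cong)
   have lin: "linear (%u. iter_deriv [(0, u)] J (t, x))"
    by (rule has_derivative_linear[OF iter_deriv_slice(1)[OF sJ tT open_far x]])
   have "(t, x) : {a..b} \<times> far R" using t x by (rule SigmaI)
   hence "norm (iter_deriv [(0, v)] J (t, x)) <= B3 * norm v" unfolding B3_def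
    using B2(2) by (intro linear_bound_on_basis[OF lin]) (simp only: real_norm_def)
   thus ?thesis unfolding mdiff_tangent[OF D ts(2)] DJ by (simp only: real_norm_def)
  qed
  have "\<bar>4 * Im (\<Sum>j\<in>UNIV. cnj (fst H $ j) * (levi (Ps t) x *v v) $ j)\<bar> <= B3 * norm v" for v
  proof -
   have "csympl H (v, graph_slope (Ps t) x v) = - complex_of_real (mdiff (\<Lambda> t) (f t) (K (t, y)) (v, graph_slope (Ps t) x v))"
    unfolding H_def ham_def ham_fun_def
    by (rule ham_vec_spec(2)[OF IR[OF tT] K_diffeo[OF tT] linear_mdiff_f[OF tT] ts(2)])
   moreover have "csympl H (v, graph_slope (Ps t) x v) = of_real (4 * Im (\<Sum>j\<in>UNIV. cnj (fst H $ j) * (levi (Ps t) x *v v) $ j))"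
    using csympl_graph_tangent[OF sl[OF tT] x, of "fst H" v] H by simp
   ultimately have "complex_of_real (4 * Im (\<Sum>j\<in>UNIV. cnj (fst H $ j) * (levi (Ps t) x *v v) $ j)) = complex_of_real (- mdiff (\<Lambda> t) (f t) (K (t, y)) (v, graph_slope (Ps t) x v))"
    by (simp only: of_real_minus)
   hence "4 * Im (\<Sum>j\<in>UNIV. cnj (fst H $ j) * (levi (Ps t) x *v v) $ j) = - mdiff (\<Lambda> t) (f t) (K (t, y)) (v, graph_slope (Ps t) x v)"
    by (simp only: of_real_eq_iff)
   thus ?thesis using df[of v] by simp
  qed
  hence "norm (fst H) <= C" unfolding C_def
   using E(3)[OF tT, of x] x R(1) B34 by (intro invertible_form_bound[of "levi (Ps t) x"]) auto
  moreover have "norm (graph_slope (Ps t) x (fst H)) <= B4 * norm (fst H)" unfolding B4_def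
  proof (rule graph_slope_bound[OF sl[OF tT] x])
   fix u v :: "complex ^ 'n" assume "u : Basis" "v : Basis"
   thus "\<bar>iter_deriv [u, v] (Ps t) x\<bar> <= \<bar>B1\<bar>" using E(4)[OF tT, of x u v] x R(1) by (simp del: iter_deriv.simps)
  qed
  moreover have "norm H <= norm (fst H) + norm (graph_slope (Ps t) x (fst H))"
   by (subst H) (rule norm_Pair_le)
  ultimately show ?thesis unfolding H_def[symmetric] using mult_left_mono[of "norm (fst H)" C B4] B34 by linarith
 qed
 thus ?thesis using B34 by (intro exI[of _ R] exI[of _ "C + B4 * C"]) auto
qed

end

lemma compact_continuous_bound:
 fixes f :: "'a::topological_space => 'b::real_normed_vector"
 assumes "compact S" "continuous_on S f"
 shows "\<exists>B\<ge>0. \<forall>x\<in>S. norm (f x) <= B"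
proof -
 obtain B where "!!z. z : f ` S ==> norm z <= B"
  using compact_imp_bounded[OF compact_continuous_image[OF assms(2,1)]] unfolding bounded_iff by blast
 thus ?thesis by (intro exI[of _ "max B 0"]) (auto simp: le_max_iff_disj)
qed

section \<open>A weight at infinity on the parameter space\<close>

context deformation
begin

text \<open>Formed with the initial point \<phi> y instead of K (t, y), so that one integrable
  function serves all t; far out the two points differ by a bounded amount, by
  \<open>flow_far\<close>.\<close>

definition weight :: "real => complex ^ 'n => real" where "weight m y = (1 + norm (fst (\<phi> y))) powr m"

lemma \<phi>_smooth: "smooth_open UNIV \<phi>" by (rule diffeomorphism_smooth(1)[OF \<phi>])

lemma weight_pos: "0 < weight m y"
 unfolding weight_def by (simp add: powr_gt_zero add_nonneg_eq_0_iff)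

lemma \<phi>_continuous: "continuous_on A \<phi>"
 using smooth_open_continuous_on[OF \<phi>_smooth] continuous_on_subset by blast

lemma weight_continuous: "continuous_on A (weight m)"
proof -
 have "1 + norm (fst (\<phi> y)) ~= 0" for y using norm_ge_zero[of "fst (\<phi> y)"] by linarith
 thus ?thesis unfolding weight_def by (intro continuous_intros \<phi>_continuous ballI)
qed

text \<open>In the tube the x component controls the norm, so the part of the closed set
  \<open>\<Lambda> 0\<close> with bounded x is compact; the continuous inverse of \<phi> carries it
  to the parameter space.\<close>

lemma compact_core: "compact {y. norm (fst (\<phi> y)) <= r}"
proof -
 define C where "C = {rh : \<Lambda> 0. norm (fst rh) <= r}"
 obtain c where c: "c > 0" "\<forall>rh\<in>tube \<Phi> W'. norm rh <= c * (1 + norm (fst rh))" using tube_norm_bound[OF bW'] by blast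
 have "norm rh <= c * (1 + r)" if "rh : C" for rh
 proof -
  have "norm rh <= c * (1 + norm (fst rh))" using c(2) that \<Lambda>W'[OF T0] unfolding C_def by blast
  also have "... <= c * (1 + r)" using c(1) that by (intro mult_left_mono) (auto simp: C_def)
  finally show ?thesis .
 qed
 hence "bounded C" unfolding bounded_iff by blast
 moreover have "closed C"
 proof -
  have "C = \<Lambda> 0 \<inter> {rh. norm (fst rh) <= r}" by (auto simp: C_def)
  moreover have "closed {rh::'n cphase. norm (fst rh) <= r}" by (intro closed_Collect_le continuous_intros)
  ultimately show ?thesis using \<Lambda>closed[OF T0] by auto
 qed
 ultimately have "compact C" by (simp add: compact_eq_bounded_closed)
 moreover have "continuous_on C (inv_into UNIV \<phi>)"
  by (rule continuous_on_subset[OF smooth_on_continuous_on[OF diffeomorphism_smooth(3)[OF \<phi>]]]) (auto simp: C_def)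
 ultimately have "compact (inv_into UNIV \<phi> ` C)" by (rule compact_continuous_image[rotated])
 moreover have "inv_into UNIV \<phi> ` C = {y. norm (fst (\<phi> y)) <= r}"
 proof -
  have bij: "bij_betw \<phi> UNIV (\<Lambda> 0)" by (rule diffeomorphism_smooth(2)[OF \<phi>])
  have "C = \<phi> ` {y. norm (fst (\<phi> y)) <= r}"
  proof (intro equalityI subsetI)
   fix rh assume "rh : C"
   moreover from this have "rh : range \<phi>" using bij unfolding C_def bij_betw_def by blast
   then obtain y where "rh = \<phi> y" by blast
   ultimately show "rh : \<phi> ` {y. norm (fst (\<phi> y)) <= r}" by (intro image_eqI[of _ _ y]) (auto simp: C_def)
  next
   fix rh assume "rh : \<phi> ` {y. norm (fst (\<phi> y)) <= r}"
   then obtain y where "rh = \<phi> y" "norm (fst (\<phi> y)) <= r" by blast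
   thus "rh : C" using \<phi>\<Lambda> by (simp add: C_def)
  qed
  moreover have "inv_into UNIV \<phi> (\<phi> y) = y" for y by (rule bij_betw_inv_into_left[OF bij]) simp
  ultimately show ?thesis by (simp add: image_image)
 qed
 ultimately show ?thesis by simp
qed

text \<open>Over the end, y \<mapsto> x is injective and turns w into the density of the graph,
  which is bounded because the Hessian of \<open>Ps 0\<close> is; this leaves (1 + |x|)^m in real
  dimension 2n. The rest of the parameter space is compact.\<close>

lemma weight_integrable:
 assumes m: "m < - 2 * real CARD('n)"
 shows "(\<integral>\<^sup>+y. ennreal (weight m y * w y) \<partial>lborel) < \<infinity>"
proof -
 obtain R Ps C B where E: "!!t. t : T ==> graph_outside R (Ps t) (\<Lambda> t)" "smooth_open (T \<times> far R) (%(t, x). Ps t x)"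
  "!!t x. t : T ==> R < norm x ==> invertible (levi (Ps t) x) & norm (matrix_inv (levi (Ps t) x)) <= C"
  "!!t x u v. t : T ==> R < norm x ==> u : Basis ==> v : Basis ==> \<bar>iter_deriv [u, v] (Ps t) x\<bar> <= B"
  by (rule ends) (rule that)
 have sl: "smooth_open (far R) (Ps 0)"
  using smooth_open_slice[OF E(2) T0 open_far] by simp
 define G where "G = graph_point (Ps 0)"
 define Y where "Y = {y. norm (fst (\<phi> y)) <= R}"
 define U where "U = {y. R < norm (fst (\<phi> y))}"
 define th where "th y = fst (\<phi> y)" for y
 have cY: "compact Y" unfolding Y_def by (rule compact_core)
 have oU: "open U" unfolding U_def by (intro open_Collect_less continuous_intros \<phi>_continuous)
 have m0: "m < 0" by (rule less_le_trans[OF m]) simp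
 have eqG: "\<phi> y = G (th y)" if "y : U" for y
  unfolding G_def th_def using that by (intro graph_outside_point(1)[OF E(1)[OF T0] \<phi>\<Lambda>, symmetric]) (simp add: U_def)
 have bij: "bij_betw \<phi> UNIV (\<Lambda> 0)" by (rule diffeomorphism_smooth(2)[OF \<phi>])
 have img: "th ` U = far R"
 proof
  show "th ` U \<subseteq> far R" by (auto simp: th_def U_def)
  show "far R \<subseteq> th ` U"
  proof
   fix x :: "complex ^ 'n" assume x: "x : far R"
   hence "G x : \<Lambda> 0" unfolding G_def by (intro graph_outside_point(2)[OF E(1)[OF T0]]) simp
   hence "G x : range \<phi>" using bij by (simp add: bij_betw_def)
   then obtain y where "G x = \<phi> y" by (rule rangeE)
   hence "\<phi> y = G x" by (rule sym)
   hence "th y = x" by (simp add: th_def G_def graph_point_def)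
   thus "x : th ` U" using x by (intro image_eqI[of _ _ y]) (auto simp: U_def th_def)
  qed
 qed
 have sG: "smooth_open (far R) G" unfolding G_def by (rule graph_point_smooth(1)[OF sl])
 define M where "M = real DIM(complex ^ 'n) * (real CARD('n) * (2 * \<bar>B\<bar>))"
 have M0: "M \<ge> 0" by (simp add: M_def)
 have dG: "frechet_derivative G (at x) u = (u, graph_slope (Ps 0) x u)" if "x : far R" for x u
  using frechet_derivative_at[OF graph_point_smooth(2)[OF sl that]] unfolding G_def by metis
 obtain Cb where Cb: "Cb \<ge> 0" "!!u v :: 'n cphase. cmod (csympl u v) <= norm u * norm v * Cb"
  using bounded_bilinear.nonneg_bounded[OF bounded_bilinear_csympl] by blast
 define D where "D = real (card {\<pi>. \<pi> permutes (Basis :: (complex ^ 'n) set)}) * ((1 + M) * (1 + M) * Cb) ^ CARD('n)"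
 have dens: "sympl_density (frechet_derivative G (at x)) <= D" if x: "x : far R" for x
  unfolding D_def
 proof (rule sympl_density_bounded)
  have nb: "norm (frechet_derivative G (at x) u) <= 1 + M" if u: "u : Basis" for u
  proof -
   have "norm (graph_slope (Ps 0) x u) <= M * norm u" unfolding M_def
   proof (rule graph_slope_bound[OF sl x])
    fix u v :: "complex ^ 'n" assume "u : Basis" "v : Basis"
    thus "\<bar>iter_deriv [u, v] (Ps 0) x\<bar> <= \<bar>B\<bar>" using E(4)[OF T0, of x u v] x by (simp del: iter_deriv.simps)
   qed
   thus ?thesis unfolding dG[OF x] using norm_Pair_le[of u "graph_slope (Ps 0) x u"] u by simp
  qed
  fix u v :: "complex ^ 'n" assume "u : Basis" "v : Basis"
  hence "norm (frechet_derivative G (at x) u) * norm (frechet_derivative G (at x) v) <= (1 + M) * (1 + M)"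
   using M0 by (intro mult_mono nb) auto
  thus "cmod (csympl (frechet_derivative G (at x) u) (frechet_derivative G (at x) v)) <= (1 + M) * (1 + M) * Cb"
   using Cb(2)[of "frechet_derivative G (at x) u" "frechet_derivative G (at x) v"] mult_right_mono[OF _ Cb(1)] order_trans by blast
 qed
 have mh: "(%x::complex ^ 'n. (1 + norm x) powr m) : borel_measurable borel" by measurable
 have "(\<integral>\<^sup>+y\<in>U. ennreal (weight m y * w y) \<partial>lborel)
  = (\<integral>\<^sup>+y\<in>U. ennreal ((1 + norm (th y)) powr m * sympl_density (frechet_derivative \<phi> (at y))) \<partial>lborel)"
  unfolding weight_def w_def th_def ..
 also have "... = (\<integral>\<^sup>+x\<in>th ` U. ennreal ((1 + norm x) powr m * sympl_density (frechet_derivative G (at x))) \<partial>lborel)"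
 proof (rule sympl_density_integral_transfer[symmetric, where h="%x. (1 + norm x) powr m" and th'="%y v. fst (frechet_derivative \<phi> (at y) v)"])
  show "smooth_open U \<phi>" by (rule smooth_open_subset[OF \<phi>_smooth oU subset_UNIV])
  show "\<phi> y = G (th y)" if "y : U" for y by (rule eqG[OF that])
  show "(%x::complex ^ 'n. (1 + norm x) powr m) : borel_measurable borel" by (rule mh)
  show "smooth_open (th ` U) G" unfolding img by (rule sG)
  show "inj_on th U"
  proof (rule inj_onI)
   fix y z assume "y : U" "z : U" "th y = th z"
   hence "\<phi> y = \<phi> z" using eqG by metis
   thus "y = z" using bij by (simp add: bij_betw_def inj_eq)
  qed
  show "(th has_derivative (%v. fst (frechet_derivative \<phi> (at y) v))) (at y)" for y
   unfolding th_def by (rule bounded_linear.has_derivative[OF bounded_linear_fst smooth_open_has_derivative[OF \<phi>_smooth]]) simp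
 qed auto
 also have "... <= (\<integral>\<^sup>+x. ennreal D * ennreal ((1 + norm (x :: complex ^ 'n)) powr m) \<partial>lborel)"
 proof (rule nn_integral_mono)
  fix x :: "complex ^ 'n"
  show "ennreal ((1 + norm x) powr m * sympl_density (frechet_derivative G (at x))) * indicator (th ` U) x <= ennreal D * ennreal ((1 + norm x) powr m)"
  proof (cases "x : far R")
   case True
   have "(1 + norm x) powr m * sympl_density (frechet_derivative G (at x)) <= D * (1 + norm x) powr m"
    using mult_right_mono[OF dens[OF True] powr_ge_zero[of "1 + norm x" m]] by (simp add: mult.commute)
   hence "ennreal ((1 + norm x) powr m * sympl_density (frechet_derivative G (at x))) <= ennreal (D * (1 + norm x) powr m)"
    by (rule ennreal_leI)
   also have "... = ennreal D * ennreal ((1 + norm x) powr m)" by (rule ennreal_mult'') simp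
   finally show ?thesis using True by (simp add: img)
  qed (simp add: img)
 qed
 also have "... = ennreal D * (\<integral>\<^sup>+x. ennreal ((1 + norm (x :: complex ^ 'n)) powr m) \<partial>lborel)"
  by (rule nn_integral_cmult) measurable
 also have "... < \<infinity>"
 proof -
  have "m < - real DIM(complex ^ 'n)" using m by simp
  from powr_weight_integrable[OF this] show ?thesis by (simp add: ennreal_mult_less_top)
 qed
 finally have fU: "(\<integral>\<^sup>+y\<in>U. ennreal (weight m y * w y) \<partial>lborel) < \<infinity>" .
 have "continuous_on Y (%y. weight m y * w y)"
  by (intro continuous_on_mult weight_continuous continuous_on_subset[OF w_continuous subset_UNIV])
 from compact_continuous_bound[OF cY this]
 obtain Bw where Bw: "Bw \<ge> 0" "\<forall>y\<in>Y. norm (weight m y * w y) <= Bw" by (elim exE conjE) (rule that)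
 have Bw': "weight m y * w y <= Bw" if "y : Y" for y
  using bspec[OF Bw(2) that] unfolding real_norm_def by linarith
 have "(\<integral>\<^sup>+y\<in>Y. ennreal (weight m y * w y) \<partial>lborel) <= (\<integral>\<^sup>+y. ennreal Bw * indicator Y y \<partial>lborel)"
 proof (rule nn_integral_mono)
  fix y show "ennreal (weight m y * w y) * indicator Y y <= ennreal Bw * indicator Y y"
   by (cases "y : Y") (simp_all add: ennreal_leI[OF Bw'])
 qed
 also have "... = ennreal Bw * emeasure lborel Y" using cY by (intro nn_integral_cmult_indicator) (simp add: borel_compact)
 also have "... < \<infinity>" using emeasure_bounded_finite[OF compact_imp_bounded[OF cY]] by (simp add: ennreal_mult_less_top)
 finally have fY: "(\<integral>\<^sup>+y\<in>Y. ennreal (weight m y * w y) \<partial>lborel) < \<infinity>" .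
 have meas: "(%y. ennreal (weight m y * w y)) : borel_measurable borel"
  by (intro measurable_compose[OF _ measurable_ennreal] borel_measurable_continuous_onI continuous_on_mult weight_continuous w_continuous)
 have "(\<integral>\<^sup>+y. ennreal (weight m y * w y) \<partial>lborel) = (\<integral>\<^sup>+y. ennreal (weight m y * w y) * indicator U y + ennreal (weight m y * w y) * indicator Y y \<partial>lborel)"
  by (intro nn_integral_cong) (auto simp: indicator_def U_def Y_def)
 also have "... = (\<integral>\<^sup>+y\<in>U. ennreal (weight m y * w y) \<partial>lborel) + (\<integral>\<^sup>+y\<in>Y. ennreal (weight m y * w y) \<partial>lborel)"
  using meas oU cY by (intro nn_integral_add borel_measurable_times_ennreal[OF _ borel_measurable_indicator]) (auto simp: borel_compact)
 finally show ?thesis using fU fY by simp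
qed

text \<open>The speed bound holds only while the trajectory is far out. A starting point with the
  additional margin C (b - a) cannot use it up within the time interval, by
  \<open>far_flow_bound\<close>. Negative times are treated by reversing the flow.\<close>

lemma flow_far:
 assumes ab: "{a..b} \<subseteq> T" "a <= 0" "0 <= b"
 shows "\<exists>R c. 0 <= c & (\<forall>t\<in>{a..b}. \<forall>y. R < norm (fst (\<phi> y)) --> norm (K (t, y) - \<phi> y) <= c & norm (ham t y) <= c)"
proof -
 obtain R C where C: "0 <= C" "!!t y. t : {a..b} ==> R < norm (fst (K (t, y))) ==> norm (ham t y) <= C"
  using ham_far_bound[OF ab(1)] by blast
 have dK: "((%s. K (s, y)) has_vector_derivative mult_i (ham t y)) (at t)" if "t : {a..b}" for t y
 proof -
  have t: "t : T" using that ab(1) by blast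
  show ?thesis using partial_fst_has_vector_derivative[OF K_smooth t, of "[]" y] K_time[OF t] by (simp only: iter_deriv.simps(1))
 qed
 have "norm (K (t, y) - \<phi> y) <= C * (b - a) & R < norm (fst (K (t, y)))"
  if t: "t : {a..b}" and y: "R + C * (b - a) < norm (fst (\<phi> y))" for t y
 proof (cases "t \<ge> 0")
  case True
  have tl: "C * t <= C * (b - a)" using t ab by (intro mult_left_mono C(1)) auto
  have d: "((%s. K (s, y)) has_vector_derivative mult_i (ham s y)) (at s)" if "s : {0..t}" for s
   using that t ab by (intro dK) auto
  note fl = far_flow_bound[of t "%s. K (s, y)" C R "%s. mult_i (ham s y)"]
  have "continuous_on {0..t} (%s. K (s, y))"
   using d by (intro continuous_at_imp_continuous_on ballI has_vector_derivative_continuous)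
  moreover have "((%s. K (s, y)) has_vector_derivative mult_i (ham s y)) (at s) & norm (mult_i (ham s y)) <= C"
   if "s : {0..t}" "R < norm (fst (K (s, y)))" for s
   using d[OF that(1)] C(2)[OF _ that(2)] that(1) t ab by (auto simp: norm_mult_i)
  moreover have "R + C * t < norm (fst (K (0, y)))" using y tl by (simp add: K0)
  ultimately have "norm (K (t, y) - K (0, y)) <= C * t" "R < norm (fst (K (t, y)))" using fl[OF _ True C(1)] by blast+
  thus ?thesis using tl by (simp add: K0)
 next
  case False
  have tl: "C * (- t) <= C * (b - a)" using t ab by (intro mult_left_mono C(1)) auto
  have d: "((%s. K (- s, y)) has_vector_derivative - mult_i (ham (- s) y)) (at s)" if "s : {0..- t}" for s
  proof -
   have "(uminus has_vector_derivative (- 1 :: real)) (at s)"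
    by (auto intro!: derivative_eq_intros simp: has_vector_derivative_def)
   moreover have "- s : {a..b}" using that t ab by auto
   ultimately have "((%s. K (s, y)) \<circ> uminus has_vector_derivative (-1) *\<^sub>R mult_i (ham (- s) y)) (at s)"
    using dK by (intro vector_diff_chain_at)
   thus ?thesis by (simp add: o_def)
  qed
  note fl = far_flow_bound[of "- t" "%s. K (- s, y)" C R "%s. - mult_i (ham (- s) y)"]
  have "continuous_on {0..- t} (%s. K (- s, y))"
   using d by (intro continuous_at_imp_continuous_on ballI has_vector_derivative_continuous)
  moreover have "((%s. K (- s, y)) has_vector_derivative - mult_i (ham (- s) y)) (at s) & norm (- mult_i (ham (- s) y)) <= C"
   if "s : {0..- t}" "R < norm (fst (K (- s, y)))" for s
   using d[OF that(1)] C(2)[OF _ that(2)] that(1) t ab by (auto simp: norm_mult_i)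
  moreover have "R + C * (- t) < norm (fst (K (- 0, y)))" using y tl by (simp add: K0)
  ultimately have "norm (K (- (- t), y) - K (- 0, y)) <= C * (- t)" "R < norm (fst (K (- (- t), y)))" using fl[OF _ _ C(1)] False by force+
  thus ?thesis using tl by (simp add: K0)
 qed
 note far = this
 show ?thesis
 proof (intro exI conjI ballI allI impI)
  show "0 <= max C (C * (b - a))" using C(1) by simp
  fix t y assume "t : {a..b}" "R + C * (b - a) < norm (fst (\<phi> y))"
  from far[OF this] C(2)[OF \<open>t : {a..b}\<close>]
  show "norm (K (t, y) - \<phi> y) <= max C (C * (b - a))" "norm (ham t y) <= max C (C * (b - a))" by (auto simp: le_max_iff_disj)
 qed
qed

end

section \<open>Bounds for the pulled-back symbol and its time derivative\<close>

context deformation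
begin

definition dF :: "real => complex ^ 'n => complex" where "dF t y = iter_deriv [(1, 0)] F (t, y)"

abbreviation lv where "lv t y \<equiv> \<bar>Re (dF t y / F (t, y))\<bar> + \<bar>ln (cmod (F (t, y)))\<bar>"

lemma dF_ham: "t : T ==> dF t y = \<i> * frechet_derivative p (at (K (t, y))) (ham t y)"
 unfolding dF_def F_derivative[of t] K_time[of t] cscale_i[symmetric]
 by (rule holomorphic_cphase_derivative(2)[OF p_holomorphic K_tube])

text \<open>\<open>tube_margin\<close> provides balls of a fixed radius inside the tube around all
  points of \<open>\<Lambda> t\<close>. Cauchy's inequality for p - 1 on them gives the derivative
  of p the decay of p - 1, and the Hamilton field is bounded there.\<close>

lemma far_decay:
 assumes ab: "{a..b} \<subseteq> T" "a <= 0" "0 <= b"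
 obtains m C R where "m < - 2 * real CARD('n)" "0 <= C"
  "!!t y. t : {a..b} ==> R < norm (fst (\<phi> y)) ==>
   cmod (F (t, y) - 1) <= C * weight m y & cmod (dF t y) <= C * weight m y & cmod (F (t, y) - 1) <= 1 / 2"
proof -
 obtain m A where m: "m < - 2 * real CARD('n)" and A: "A \<ge> 0"
  "!!rh. rh : tube \<Phi> W ==> cmod (p rh - 1) <= A * (sqrt (1 + (norm rh)\<^sup>2)) powr m"
  by (rule p_decay) (rule that)
 have m1: "m <= - 1"
 proof -
  have "1 <= real CARD('n)" by (simp add: Suc_leI)
  thus ?thesis using m by linarith
 qed
 obtain R0 c where c: "0 <= c" "!!t y. t : {a..b} ==> R0 < norm (fst (\<phi> y)) ==> norm (K (t, y) - \<phi> y) <= c & norm (ham t y) <= c"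
  using flow_far[OF ab] by blast
 obtain r0 where r0: "r0 > 0" "\<forall>rh\<in>tube \<Phi> W'. ball rh r0 \<subseteq> tube \<Phi> W" using tube_margin[OF openW bW' clW] by blast
 define r where "r = min r0 1"
 have sub: "ball rh r \<subseteq> tube \<Phi> W" if "rh : tube \<Phi> W'" for rh
  by (rule order_trans[OF subset_ball bspec[OF r0(2) that]]) (simp add: r_def)
 have r: "0 < r" "r <= 1" using r0(1) by (simp_all add: r_def)
 define A1 where "A1 = A * (1 / 2) powr m"
 have A1: "A1 \<ge> 0" using A(1) by (simp add: A1_def)
 \<comment> \<open>Let N be the norm of the x component of \<phi> y. For N > 2 c + 3, every z within
   distance 1 of K (t, y) has |z| \<ge> (1 + N) / 2; for N > 2 A1, the bound A1 / (1 + N) is at most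
   1/2.\<close>
 define R where "R = max R0 (max (2 * c + 3) (2 * A1))"
 define C where "C = A1 + 2 * A1 / r * c"
 have "2 * A1 / r * c \<ge> 0" using A1 r(1) c(1) by simp
 hence C: "A1 <= C" "2 * A1 / r * c <= C" "0 <= C" using A1 by (auto simp: C_def)
 have est: "cmod (p z - 1) <= A1 * weight m y"
  if t: "t : {a..b}" and y: "R < norm (fst (\<phi> y))" and z: "z : ball (K (t, y)) r" for t y z
 proof -
  have tT: "t : T" using t ab by blast
  have zW: "z : tube \<Phi> W" by (rule subsetD[OF sub[OF K_tube'[OF tT]] z])
  define N where "N = norm (fst (\<phi> y))"
  have N: "R0 < N" "2 * c + 3 < N" using y by (auto simp: N_def R_def)
  have "norm (\<phi> y - z) <= norm (K (t, y) - \<phi> y) + norm (K (t, y) - z)"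
   using norm_triangle_ineq4[of "K (t, y) - z" "K (t, y) - \<phi> y"] by (simp add: algebra_simps)
  also have "... <= c + 1" using c(2)[OF t, of y] N(1) z r(2) by (auto simp: N_def dist_norm)
  finally have d: "norm (fst (\<phi> y - z)) <= c + 1" by (rule order_trans[OF norm_fst_le])
  have "N - norm (fst z) <= norm (fst (\<phi> y - z))" unfolding N_def fst_diff by (rule norm_triangle_ineq2)
  from order_trans[OF this d] have "(1 + N) / 2 <= norm (fst z)" using N(2) by (simp add: field_simps)
  also have "... <= norm z" by (rule norm_fst_le)
  also have "... <= sqrt (1 + (norm z)\<^sup>2)" by (intro real_le_rsqrt) simp
  finally have "(1 + N) / 2 <= sqrt (1 + (norm z)\<^sup>2)" .
  hence "(sqrt (1 + (norm z)\<^sup>2)) powr m <= ((1 + N) / 2) powr m"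
   using m1 N c(1) by (intro powr_mono2') auto
  also have "... = (1 / 2) powr m * weight m y"
   using powr_mult[of "1 + N" "1 / 2" m] by (simp add: weight_def N_def mult.commute)
  finally have "A * (sqrt (1 + (norm z)\<^sup>2)) powr m <= A * ((1 / 2) powr m * weight m y)" using A(1) by (rule mult_left_mono)
  thus ?thesis using A(2)[OF zW] by (simp add: A1_def mult.assoc)
 qed
 have concl: "cmod (F (t, y) - 1) <= C * weight m y & cmod (dF t y) <= C * weight m y & cmod (F (t, y) - 1) <= 1 / 2"
  if t: "t : {a..b}" and y: "R < norm (fst (\<phi> y))" for t y
 proof (intro conjI)
  have tT: "t : T" using t ab by blast
  have w0: "0 <= weight m y" by (rule less_imp_le[OF weight_pos])
  have F1: "cmod (F (t, y) - 1) <= A1 * weight m y" using est[OF t y, of "K (t, y)"] r(1) by (simp add: F_def)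
  show "cmod (F (t, y) - 1) <= C * weight m y" using F1 mult_right_mono[OF C(1) w0] by linarith
  show "cmod (F (t, y) - 1) <= 1 / 2"
  proof -
   have N: "2 * A1 < 1 + norm (fst (\<phi> y))" using y by (simp add: R_def)
   have "weight m y <= (1 + norm (fst (\<phi> y))) powr (- 1)" unfolding weight_def using m1 by (intro powr_mono) auto
   hence "A1 * weight m y <= A1 * (1 + norm (fst (\<phi> y))) powr (- 1)" using A1 by (rule mult_left_mono)
   also have "... = A1 / (1 + norm (fst (\<phi> y)))" by (simp add: powr_minus_divide add_nonneg_nonneg)
   also have "... <= 1 / 2" using N A1 by (simp add: divide_le_eq add_pos_nonneg)
   finally show ?thesis using F1 by linarith
  qed
  have hol: "holomorphic_cphase (%z. p z - 1) (tube \<Phi> W)"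
   unfolding holomorphic_cphase_def
  proof
   fix z assume "z : tube \<Phi> W"
   then obtain D where D: "(p has_derivative D) (at z)" "\<forall>v. D (mult_i v) = \<i> * D v"
    using p_holomorphic unfolding holomorphic_cphase_def by blast
   have "((%z. p z - 1) has_derivative D) (at z)" using has_derivative_diff[OF D(1) has_derivative_const[of 1]] by simp
   thus "\<exists>D. ((%z. p z - 1) has_derivative D) (at z) & (\<forall>v. D (mult_i v) = \<i> * D v)"
    using D(2) by (intro exI[of _ D] conjI)
  qed
  have fd: "frechet_derivative (%z. p z - 1) (at (K (t, y))) = frechet_derivative p (at (K (t, y)))"
  proof (rule frechet_derivative_at[symmetric])
   show "((%z. p z - 1) has_derivative frechet_derivative p (at (K (t, y)))) (at (K (t, y)))"
    using has_derivative_diff[OF holomorphic_cphase_derivative(1)[OF p_holomorphic K_tube[OF tT]] has_derivative_const[of 1]] by simp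
  qed
  have est': "cmod (p z - 1) <= A1 * weight m y" if "z : ball (K (t, y)) r" for z by (rule est[OF t y that])
  have "cmod (dF t y) = cmod (frechet_derivative p (at (K (t, y))) (ham t y))"
   unfolding dF_ham[OF tT] by (simp add: norm_mult)
  also have "... <= 2 * (A1 * weight m y) / r * norm (ham t y)"
   using holomorphic_cphase_derivative_bound[OF hol sub[OF K_tube'[OF tT, of y]] est' r(1), of "ham t y"] unfolding fd .
  also have "... <= 2 * (A1 * weight m y) / r * c"
   using c(2)[OF t, of y] y A1 w0 r(1) by (intro mult_left_mono) (auto simp: R_def)
  also have "... = (2 * A1 / r * c) * weight m y" by simp
  also have "... <= C * weight m y" by (rule mult_right_mono[OF C(2) w0])
  finally show "cmod (dF t y) <= C * weight m y" .
 qed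
 show thesis by (rule that[OF m C(3) concl])
qed

lemma F_continuous: "S \<subseteq> T \<times> UNIV ==> continuous_on S (iter_deriv vs F)"
 using smooth_open_iter_continuous_on[OF F_smooth] continuous_on_subset by blast

text \<open>Over the compact core the quotients by the positive weight are continuous, hence
  bounded; so the far bounds extend to all y. They dominate the difference quotients of the
  regularized functional.\<close>

lemma majorant:
 assumes ab: "{a..b} \<subseteq> T" "a <= 0" "0 <= b"
 obtains m C where "m < - 2 * real CARD('n)" "0 <= C"
  "!!t y. t : {a..b} ==> cmod (F (t, y) - 1) <= C * weight m y"
  "!!t y. t : {a..b} ==> cmod (dF t y) <= C * weight m y"
proof -
 obtain m C R where m: "m < - 2 * real CARD('n)" and C: "0 <= C"
  "!!t y. t : {a..b} ==> R < norm (fst (\<phi> y)) ==>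
   cmod (F (t, y) - 1) <= C * weight m y & cmod (dF t y) <= C * weight m y & cmod (F (t, y) - 1) <= 1 / 2"
  by (rule far_decay[OF ab]) (rule that)
 define Y where "Y = {y. norm (fst (\<phi> y)) <= R}"
 have cY: "compact ({a..b} \<times> Y)" unfolding Y_def by (intro compact_Times compact_Icc compact_core)
 have sub: "{a..b} \<times> Y \<subseteq> T \<times> UNIV" using ab(1) by auto
 have c0: "continuous_on ({a..b} \<times> Y) (%z. inverse (weight m (snd z)))"
  using weight_pos by (intro continuous_on_inverse continuous_on_compose2[OF weight_continuous[of UNIV] continuous_on_snd[OF continuous_on_id]]) (auto simp: less_imp_neq[THEN not_sym])
 have c1: "continuous_on ({a..b} \<times> Y) (%z. of_real (inverse (weight m (snd z))) * (F z - 1))"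
  using F_continuous[OF sub, of "[]"] by (intro continuous_on_mult continuous_on_diff continuous_on_const continuous_on_of_real c0) simp
 have c2: "continuous_on ({a..b} \<times> Y) (%z. of_real (inverse (weight m (snd z))) * iter_deriv [(1, 0)] F z)"
  by (intro continuous_on_mult continuous_on_of_real c0 F_continuous[OF sub])
 obtain B1 where B1: "B1 \<ge> 0" "\<forall>z\<in>{a..b} \<times> Y. cmod (of_real (inverse (weight m (snd z))) * (F z - 1)) <= B1"
  using compact_continuous_bound[OF cY c1] by blast
 obtain B2 where B2: "B2 \<ge> 0" "\<forall>z\<in>{a..b} \<times> Y. cmod (of_real (inverse (weight m (snd z))) * iter_deriv [(1, 0)] F z) <= B2"
  using compact_continuous_bound[OF cY c2] by blast
 have near: "cmod z <= B * weight m y" if "cmod (of_real (inverse (weight m y)) * z) <= B" for z y B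
  using that weight_pos[of m y] by (simp add: norm_mult norm_divide norm_inverse field_simps)
 define C' where "C' = C + B1 + B2"
 have C': "C <= C'" "B1 <= C'" "B2 <= C'" using C(1) B1(1) B2(1) by (auto simp: C'_def)
 have up: "x <= C' * weight m y" if "x <= B * weight m y" "B <= C'" for x B y
  using that(1) mult_right_mono[OF that(2) less_imp_le[OF weight_pos[of m y]]] by linarith
 have "cmod (F (t, y) - 1) <= C' * weight m y & cmod (dF t y) <= C' * weight m y" if t: "t : {a..b}" for t y
 proof (cases "R < norm (fst (\<phi> y))")
  case True
  thus ?thesis using C(2)[OF t True] up[OF _ C'(1)] by blast
 next
  case False
  hence "(t, y) : {a..b} \<times> Y" using t by (simp add: Y_def)
  note z = bspec[OF B1(2) this] bspec[OF B2(2) this]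
  have z1: "cmod (of_real (inverse (weight m y)) * (F (t, y) - 1)) <= B1" using z(1) unfolding snd_conv .
  have z2: "cmod (of_real (inverse (weight m y)) * dF t y) <= B2" using z(2) unfolding dF_def snd_conv .
  from up[OF near[OF z1] C'(2)] up[OF near[OF z2] C'(3)] show ?thesis by (rule conjI)
 qed
 thus thesis using m C(1) C'(1) by (intro that[of m C']) auto
qed

text \<open>On the compact set of (t, y, h) with |h| = 1 the vector K' h never vanishes, so its norm
  has a positive lower bound and the coordinates of a tangent vector are controlled by its norm.
  That of H is the norm of the time derivative of K, continuous on a compact set.\<close>

lemma ham_coordinates:
 assumes ab: "{a..b} \<subseteq> T" and Y: "compact Y"
 shows "\<exists>C\<ge>0. \<forall>t\<in>{a..b}. \<forall>y\<in>Y. \<exists>h. norm h <= C & ham t y = iter_deriv [(0, h)] K (t, y)"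
proof -
 define A where "A z h = (\<Sum>b\<in>Basis. (h \<bullet> b) *\<^sub>R iter_deriv [(0, b)] K z)" for z and h :: "complex ^ 'n"
 have AK: "A (t, y) h = iter_deriv [(0, h)] K (t, y)" if t: "t : T" for t y h
 proof -
  note lin = linear_partial[OF t, of y]
  have "iter_deriv [(0, h)] K (t, y) = iter_deriv [(0, \<Sum>b\<in>Basis. (h \<bullet> b) *\<^sub>R b)] K (t, y)" by (simp only: euclidean_representation)
  thus ?thesis unfolding A_def by (simp only: linear_sum[OF lin] linear_scale[OF lin])
 qed
 define X where "X = ({a..b} \<times> Y) \<times> sphere (0 :: complex ^ 'n) 1"
 have cX: "compact X" unfolding X_def by (intro compact_Times compact_Icc Y compact_sphere)
 have Kc: "continuous_on (T \<times> UNIV) (iter_deriv vs K)" for vs by (rule smooth_open_iter_continuous_on[OF K_smooth])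
 have contA: "continuous_on X (%x. A (fst x) (snd x))" unfolding A_def
  by (intro continuous_intros continuous_on_compose2[OF Kc continuous_on_fst[OF continuous_on_id]]) (use ab in \<open>auto simp: X_def\<close>)
 have nz: "A (fst x) (snd x) ~= 0" if x: "x : X" for x
 proof
  assume A0: "A (fst x) (snd x) = 0"
  obtain t y h where xe: "x = ((t, y), h)" by (metis prod.exhaust)
  have t: "t : T" "norm h = 1" using x ab by (auto simp: xe X_def)
  have "iter_deriv [(0, h)] K (t, y) = iter_deriv [(0, 0)] K (t, y)"
   using A0 linear_0[OF linear_partial[OF t(1), of y]] by (simp only: xe fst_conv snd_conv AK[OF t(1)])
  hence "h = 0" using inj_partial[OF t(1), of y] by (rule injD[rotated])
  thus False using t(2) by simp
 qed
 have "continuous_on X (%x. inverse (norm (A (fst x) (snd x))))"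
  using nz by (intro continuous_on_inverse continuous_on_norm contA) auto
 from compact_continuous_bound[OF cX this]
 obtain B where B: "B \<ge> 0" "\<forall>x\<in>X. norm (inverse (norm (A (fst x) (snd x)))) <= B" by blast
 have cY: "compact ({a..b} \<times> Y)" by (intro compact_Times compact_Icc Y)
 have "continuous_on ({a..b} \<times> Y) (iter_deriv [(1, 0)] K)" by (rule continuous_on_subset[OF Kc]) (use ab in auto)
 from compact_continuous_bound[OF cY this]
 obtain B2 where B2: "B2 \<ge> 0" "\<forall>z\<in>{a..b} \<times> Y. norm (iter_deriv [(1, 0)] K z) <= B2" by blast
 have "\<exists>h. norm h <= B * B2 & ham t y = iter_deriv [(0, h)] K (t, y)" if t: "t : {a..b}" and y: "y : Y" for t y
 proof -
  have tT: "t : T" using t ab by blast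
  obtain h where h: "ham t y = iter_deriv [(0, h)] K (t, y)" using ham_tangent[OF tT, of y] unfolding tangent_eq[OF tT] by (rule rangeE)
  have "norm h <= B * B2"
  proof (cases "h = 0")
   case False
   have nh: "norm h > 0" using False by simp
   define u where "u = (1 / norm h) *\<^sub>R h"
   have inX: "((t, y), u) : X" using t y nh by (simp add: X_def u_def)
   have "inverse (norm (A (t, y) u)) <= B" using bspec[OF B(2) inX] unfolding fst_conv snd_conv real_norm_def by linarith
   moreover have "A (t, y) u ~= 0" using nz[OF inX] unfolding fst_conv snd_conv .
   ultimately have "1 <= B * norm (A (t, y) u)" by (simp add: field_simps)
   also have "A (t, y) u = (1 / norm h) *\<^sub>R ham t y"
    unfolding AK[OF tT] h u_def using linear_scale[OF linear_partial[OF tT, of y], of "1 / norm h" h] .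
   finally have "norm h <= B * norm (ham t y)" using nh by (simp add: field_simps)
   also have "norm (ham t y) = norm (iter_deriv [(1, 0)] K (t, y))" by (simp only: K_time[OF tT] norm_mult_i)
   also have "B * ... <= B * B2" using B2(2) t y B(1) by (intro mult_left_mono) (auto simp del: iter_deriv.simps)
   finally show ?thesis .
  qed (use B(1) B2(1) in simp)
  thus ?thesis using h by (intro exI conjI)
 qed
 thus ?thesis using B(1) B2(1) by (intro exI[of _ "B * B2"]) simp
qed

text \<open>By holomorphy dF = \<i> F'(h), hence Re (dF / F) = - \<Sum> h_b Im (F_b / F):
  multiplication by \<i> turns the time derivative of ln |F| into the imaginary parts that
  \<open>log_var\<close> bounds. At zeros of F the right side is infinite.\<close>

lemma dF_log_var:
 assumes t: "t : T" and h: "ham t y = iter_deriv [(0, h)] K (t, y)"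
 shows "ennreal (lv t y)
  <= ennreal (1 + norm h) * (\<Sum>b\<in>Basis. log_var (F (t, y)) (iter_deriv [(0, b)] F (t, y)))"
proof -
 define D where "D v = iter_deriv [(0, v)] F (t, y)" for v
 define z where "z = F (t, y)"
 define L where "L = \<bar>ln (cmod z)\<bar>"
 have L0: "0 <= L" by (simp add: L_def)
 have "ennreal (\<bar>Re (dF t y / z)\<bar> + L) <= ennreal (1 + norm h) * (\<Sum>b\<in>Basis. log_var z (D b))"
 proof (cases "z = 0")
  case True
  obtain e :: "complex ^ 'n" where e: "e : Basis" using nonempty_Basis by blast
  have "log_var z (D e) <= (\<Sum>b\<in>Basis. log_var z (D b))"
   using sum_nonneg_leq_bound[OF finite_Basis _ refl e, of "%b. log_var z (D b)"] by simp
  hence "(\<Sum>b\<in>Basis. log_var z (D b)) = top" using True by (simp add: log_var_def top_unique)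
  moreover have "ennreal (1 + norm h) * top = top"
   using norm_ge_zero[of h] by (simp add: ennreal_mult_top ennreal_eq_0_iff not_le add_pos_nonneg del: ennreal_plus)
  ultimately show ?thesis by (simp only: top_greatest)
 next
  case False
  have lin: "linear D" unfolding D_def by (rule has_derivative_linear[OF partial_snd_has_derivative[OF F_smooth t]])
  have "dF t y = \<i> * D h" unfolding dF_ham[OF t] F_derivative[OF t] h D_def ..
  hence "Re (dF t y / z) = Re (\<i> * (D h / z))" by (simp only: times_divide_eq_right)
  also have "... = - Im (D h / z)" by (rule Re_i_times)
  also have "D h = (\<Sum>b\<in>Basis. (h \<bullet> b) *\<^sub>R D b)"
  proof -
   have "D h = D (\<Sum>b\<in>Basis. (h \<bullet> b) *\<^sub>R b)" by (simp only: euclidean_representation)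
   thus ?thesis by (simp only: linear_sum[OF lin] linear_scale[OF lin])
  qed
  also have "(\<Sum>b\<in>Basis. (h \<bullet> b) *\<^sub>R D b) / z = (\<Sum>b\<in>Basis. (h \<bullet> b) *\<^sub>R (D b / z))"
   by (simp only: sum_divide_distrib scaleR_conv_of_real[where 'a=complex] times_divide_eq_right)
  also have "Im ... = (\<Sum>b\<in>Basis. (h \<bullet> b) * Im (D b / z))" by simp
  finally have "\<bar>Re (dF t y / z)\<bar> = \<bar>\<Sum>b\<in>Basis. (h \<bullet> b) * Im (D b / z)\<bar>" by (simp only: abs_minus_cancel)
  also have "... <= (\<Sum>b\<in>Basis. \<bar>(h \<bullet> b) * Im (D b / z)\<bar>)" by (rule sum_abs)
  also have "... <= (\<Sum>b\<in>Basis. norm h * \<bar>Im (D b / z)\<bar>)"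
  proof (rule sum_mono)
   fix b :: "complex ^ 'n" assume "b : Basis"
   from mult_right_mono[OF Basis_le_norm[OF this, of h] abs_ge_zero]
   show "\<bar>(h \<bullet> b) * Im (D b / z)\<bar> <= norm h * \<bar>Im (D b / z)\<bar>" by (simp only: abs_mult)
  qed
  finally have q: "\<bar>Re (dF t y / z)\<bar> <= norm h * (\<Sum>b\<in>Basis. \<bar>Im (D b / z)\<bar>)"
   by (simp only: sum_distrib_left)
  define S where "S = (\<Sum>b\<in>(Basis :: (complex ^ 'n) set). \<bar>Im (D b / z)\<bar>)"
  define S' where "S' = real DIM(complex ^ 'n) * L"
  have "real 1 <= real DIM(complex ^ 'n)" by (rule of_nat_mono, unfold One_nat_def, rule Suc_leI, rule DIM_positive)
  hence "1 * L <= real DIM(complex ^ 'n) * L" by (intro mult_right_mono L0) (simp only: of_nat_1)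
  hence LS: "L <= S'" by (simp only: S'_def mult_1_left)
  have S0: "0 <= S" unfolding S_def by (intro sum_nonneg) simp
  have sum: "(\<Sum>b\<in>(Basis :: (complex ^ 'n) set). \<bar>Im (D b / z)\<bar> + L) = S + S'"
   unfolding sum.distrib S_def S'_def by simp
  have "norm h * S' \<ge> 0" using LS L0 by simp
  hence "\<bar>Re (dF t y / z)\<bar> + L <= (1 + norm h) * (S + S')"
   using q LS S0 unfolding S_def[symmetric] by (simp add: algebra_simps)
  hence "ennreal (\<bar>Re (dF t y / z)\<bar> + L) <= ennreal ((1 + norm h) * (S + S'))" by (rule ennreal_leI)
  also have "... = ennreal (1 + norm h) * ennreal (S + S')" using S0 LS L0 by (intro ennreal_mult) auto
  also have "ennreal (S + S') = (\<Sum>b\<in>Basis. ennreal (\<bar>Im (D b / z)\<bar> + L))"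
   unfolding sum[symmetric] using L0 by (intro sum_ennreal[symmetric]) simp
  also have "... = (\<Sum>b\<in>Basis. log_var z (D b))"
   using False by (simp only: log_var_def L_def if_False)
  finally show ?thesis .
 qed
 thus ?thesis unfolding L_def z_def D_def .
qed

lemma F_measurable: "t : T ==> (%y. iter_deriv vs F (t, y)) : borel_measurable borel"
 by (intro borel_measurable_continuous_onI continuous_on_compose2[OF F_continuous[OF order_refl]] continuous_intros) auto

text \<open>Over the compact core the bound is that of \<open>log_var\<close> in the basis
  directions, with w and the coordinates of H bounded. Outside, |F - 1| \<le> 1/2 bounds the
  quotient and the logarithm by 2 C times the weight each. Zeros of F lie in the core and are null
  because \<open>log_var\<close> is infinite there.\<close>

lemma log_bounds:
 assumes ab: "{a..b} \<subseteq> T" "a <= 0" "0 <= b"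
 obtains M where "0 <= M"
  "!!t. t : {a..b} ==> (\<integral>\<^sup>+y. ennreal ((lv t y) * w y) \<partial>lborel) <= ennreal M"
  "!!t. t : {a..b} ==> AE y in lborel. F (t, y) ~= 0"
proof -
 obtain m C R where m: "m < - 2 * real CARD('n)" and C: "0 <= C"
  "!!t y. t : {a..b} ==> R < norm (fst (\<phi> y)) ==>
   cmod (F (t, y) - 1) <= C * weight m y & cmod (dF t y) <= C * weight m y & cmod (F (t, y) - 1) <= 1 / 2"
  by (rule far_decay[OF ab]) (rule that)
 define Y where "Y = {y. norm (fst (\<phi> y)) <= R}"
 have cY: "compact Y" unfolding Y_def by (rule compact_core)
 have mY: "Y : sets borel" by (rule borel_compact[OF cY])
 obtain c where c: "c \<ge> 0" "!!t y. t : {a..b} ==> y : Y ==> \<exists>h. norm h <= c & ham t y = iter_deriv [(0, h)] K (t, y)"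
  using ham_coordinates[OF ab(1) cY] by (elim exE conjE) (rule that, assumption, drule bspec, assumption, erule bspec)
 obtain B where B: "B \<ge> 0" "!!t e. t : {a..b} ==> e : Basis ==>
   (\<integral>\<^sup>+y\<in>Y. log_var (F (t, y)) (iter_deriv [(0, e)] F (t, y)) \<partial>lborel) <= ennreal B"
  using compact_log_var_bound[OF compact_Icc ab(1) cY] by blast
 obtain bw where bw: "bw \<ge> 0" "\<forall>y\<in>Y. norm (w y) <= bw"
  using compact_continuous_bound[OF cY continuous_on_subset[OF w_continuous subset_UNIV]] by blast
 define I where "I = (\<integral>\<^sup>+y. ennreal (weight m y * w y) \<partial>lborel)"
 have I: "I < \<infinity>" unfolding I_def by (rule weight_integrable[OF m])
 define N where "N = ennreal (4 * C) * I + ennreal ((1 + c) * bw) * (of_nat DIM(complex ^ 'n) * ennreal B)"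
 have N: "N < \<infinity>" unfolding N_def using I by (simp add: ennreal_mult_less_top of_nat_less_top)
 have meas_w: "(%y. ennreal (weight m y * w y)) : borel_measurable borel"
  by (intro measurable_compose[OF _ measurable_ennreal] borel_measurable_continuous_onI continuous_on_mult weight_continuous w_continuous)
 have lvm: "(%y. log_var (F (t, y)) (iter_deriv [(0, e)] F (t, y))) : borel_measurable borel" if "t : T" for t e
  using F_measurable[OF that, of "[]"] F_measurable[OF that, of "[(0, e)]"] by (intro log_var_measurable) simp_all
 have main: "(\<integral>\<^sup>+y. ennreal ((lv t y) * w y) \<partial>lborel) <= N" if t: "t : {a..b}" for t
 proof -
  have tT: "t : T" using t ab by blast
  let ?l = "%e y. log_var (F (t, y)) (iter_deriv [(0, e)] F (t, y))"
  have pt: "ennreal ((lv t y) * w y)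
   <= ennreal (4 * C) * ennreal (weight m y * w y) + ennreal ((1 + c) * bw) * (\<Sum>e\<in>Basis. ?l e y * indicator Y y)" for y
  proof (cases "y : Y")
   case True
   obtain h where h: "norm h <= c" "ham t y = iter_deriv [(0, h)] K (t, y)" using c(2)[OF t True] by blast
   have "ennreal ((lv t y) * w y)
    = ennreal (lv t y) * ennreal (w y)"
    by (rule ennreal_mult'') (rule w_nonneg)
   also have "... <= (ennreal (1 + norm h) * (\<Sum>e\<in>Basis. ?l e y)) * ennreal bw"
   proof (intro mult_mono dF_log_var[OF tT h(2)] ennreal_leI)
    show "w y <= bw" using bspec[OF bw(2) True] unfolding real_norm_def by linarith
   qed (rule zero_le)+
   also have "... <= (ennreal (1 + c) * (\<Sum>e\<in>Basis. ?l e y)) * ennreal bw"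
    using h(1) by (intro mult_right_mono ennreal_leI) (simp_all only: add_le_cancel_left zero_le)
   also have "... = ennreal ((1 + c) * bw) * (\<Sum>e\<in>Basis. ?l e y * indicator Y y)"
   proof -
    have e: "ennreal ((1 + c) * bw) = ennreal (1 + c) * ennreal bw" using c(1) bw(1) by (intro ennreal_mult) auto
    have "(\<Sum>e\<in>Basis. ?l e y * indicator Y y) = (\<Sum>e\<in>Basis. ?l e y)" using True by (simp only: indicator_simps mult_1_right)
    thus ?thesis unfolding e by (simp only: ac_simps)
   qed
   finally show ?thesis by (rule order_trans) simp
  next
   case False
   hence y: "R < norm (fst (\<phi> y))" by (simp add: Y_def)
   note d = C(2)[OF t y]
   have F2: "1 / 2 <= cmod (F (t, y))" using d norm_triangle_ineq2[of 1 "1 - F (t, y)"] by (simp add: norm_minus_commute)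
   have "\<bar>Re (dF t y / F (t, y))\<bar> <= cmod (dF t y) / cmod (F (t, y))"
    using abs_Re_le_cmod[of "dF t y / F (t, y)"] by (simp add: norm_divide)
   also have "... <= cmod (dF t y) / (1 / 2)" using F2 by (intro divide_left_mono) auto
   also have "... <= 2 * (C * weight m y)" using d by simp
   finally have "lv t y <= 4 * C * weight m y"
    using abs_ln_norm_le[of "F (t, y)"] d by linarith
   from mult_right_mono[OF this w_nonneg[of y]]
   have "ennreal ((lv t y) * w y) <= ennreal (4 * C * (weight m y * w y))"
    by (simp add: ennreal_leI mult.assoc)
   also have "... = ennreal (4 * C) * ennreal (weight m y * w y)" using C(1) by (simp add: ennreal_mult')
   finally show ?thesis by (rule order_trans) simp
  qed
  have ms: "(%y. ?l e y * indicator Y y) : borel_measurable lborel" for e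
   using lvm[OF tT, of e] mY by (intro borel_measurable_times_ennreal borel_measurable_indicator) auto
  have "(\<integral>\<^sup>+y. ennreal ((lv t y) * w y) \<partial>lborel)
   <= (\<integral>\<^sup>+y. ennreal (4 * C) * ennreal (weight m y * w y) + ennreal ((1 + c) * bw) * (\<Sum>e\<in>Basis. ?l e y * indicator Y y) \<partial>lborel)"
   by (rule nn_integral_mono) (rule pt)
  also have "... = ennreal (4 * C) * I + ennreal ((1 + c) * bw) * (\<Sum>e\<in>Basis. \<integral>\<^sup>+y\<in>Y. ?l e y \<partial>lborel)"
  proof -
   have m1: "(%y. \<Sum>e\<in>Basis. ?l e y * indicator Y y) : borel_measurable lborel" by (intro borel_measurable_sum ms)
   have m2: "(%y. ennreal (weight m y * w y)) : borel_measurable lborel" using meas_w by simp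
   have e1: "(\<integral>\<^sup>+y. ennreal (4 * C) * ennreal (weight m y * w y) \<partial>lborel) = ennreal (4 * C) * I"
    unfolding I_def by (rule nn_integral_cmult[OF m2])
   have e2: "(\<integral>\<^sup>+y. ennreal ((1 + c) * bw) * (\<Sum>e\<in>Basis. ?l e y * indicator Y y) \<partial>lborel) = ennreal ((1 + c) * bw) * (\<integral>\<^sup>+y. (\<Sum>e\<in>Basis. ?l e y * indicator Y y) \<partial>lborel)"
    by (rule nn_integral_cmult[OF m1])
   have e3: "(\<integral>\<^sup>+y. (\<Sum>e\<in>Basis. ?l e y * indicator Y y) \<partial>lborel) = (\<Sum>e\<in>Basis. \<integral>\<^sup>+y\<in>Y. ?l e y \<partial>lborel)"
    by (rule nn_integral_sum[OF ms])
   show ?thesis unfolding e1[symmetric] e3[symmetric] e2[symmetric]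
    by (rule nn_integral_add[OF borel_measurable_times_ennreal[OF borel_measurable_const m2] borel_measurable_times_ennreal[OF borel_measurable_const m1]])
  qed
  also have "... <= ennreal (4 * C) * I + ennreal ((1 + c) * bw) * (\<Sum>e\<in>(Basis :: (complex ^ 'n) set). ennreal B)"
   by (intro add_left_mono mult_left_mono sum_mono B(2)[OF t]) auto
  also have "... = N" unfolding N_def by simp
  finally show ?thesis .
 qed
 have null: "AE y in lborel. F (t, y) ~= 0" if t: "t : {a..b}" for t
 proof -
  have tT: "t : T" using t ab by blast
  obtain e :: "complex ^ 'n" where e: "e : Basis" using nonempty_Basis by blast
  let ?l = "%y. log_var (F (t, y)) (iter_deriv [(0, e)] F (t, y)) * indicator Y y"
  have "?l : borel_measurable lborel"
   using lvm[OF tT, of e] mY by (intro borel_measurable_times_ennreal borel_measurable_indicator) auto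
  moreover have "(\<integral>\<^sup>+y. ?l y \<partial>lborel) ~= \<infinity>" using B(2)[OF t e] le_less_trans[OF _ ennreal_less_top] unfolding infinity_ennreal_def by (intro less_imp_neq)
  ultimately have "AE y in lborel. ?l y ~= \<infinity>" by (rule nn_integral_noteq_infinite)
  thus ?thesis
  proof (rule AE_mp, intro AE_I2 impI)
   fix y assume ly: "?l y ~= \<infinity>"
   show "F (t, y) ~= 0"
   proof (cases "y : Y")
    case True
    thus ?thesis using ly by (auto simp: log_var_def)
   next
    case False
    hence "cmod (F (t, y) - 1) <= 1 / 2" using C(2)[OF t, of y] by (simp add: Y_def)
    thus ?thesis by auto
   qed
  qed
 qed
 show thesis
 proof (rule that[of "enn2real N"])
  show "0 <= enn2real N" by simp
  have "ennreal (enn2real N) = N" using N by (simp add: less_top)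
  thus "(\<integral>\<^sup>+y. ennreal ((lv t y) * w y) \<partial>lborel) <= ennreal (enn2real N)" if "t : {a..b}" for t
   using main[OF that] by simp
 qed (rule null)
qed

end

section \<open>Differentiating the functionals\<close>

text \<open>The normalization by 1 + ep^2 makes it vanish at |z| = 1, the modulus to which p tends
  at infinity.\<close>

definition reg_log :: "real => complex => real" where
 "reg_log ep z = 1 / 2 * ln (((cmod z)\<^sup>2 + ep\<^sup>2) / (1 + ep\<^sup>2))"

text \<open>With r = |z|^2 and e = ep^2, the quotient (r + e) / (1 + e) is a convex combination of r
  and 1, so its logarithm lies between ln r and 0. Hence ln |p| dominates all
  regularizations.\<close>

lemma abs_reg_log_le:
 assumes "z ~= 0"
 shows "\<bar>reg_log ep z\<bar> <= \<bar>ln (cmod z)\<bar>"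
proof -
 define r where "r = (cmod z)\<^sup>2"
 define e where "e = ep\<^sup>2"
 have r: "0 < r" and e: "0 <= e" using assms by (auto simp: r_def e_def)
 define Q where "Q = (r + e) / (1 + e)"
 have Q0: "0 < Q" using r e by (auto simp: Q_def intro!: divide_pos_pos)
 have lr: "ln r = 2 * ln (cmod z)" using assms by (simp add: r_def ln_realpow)
 have "\<bar>ln Q\<bar> <= \<bar>ln r\<bar>"
 proof (cases "r <= 1")
  case True
  have "r * e <= 1 * e" using True e by (intro mult_right_mono) auto
  hence "r <= Q" unfolding Q_def using e by (simp add: le_divide_eq algebra_simps)
  moreover have "Q <= 1" unfolding Q_def using True e by (simp add: divide_le_eq)
  ultimately have "ln r <= ln Q" "ln Q <= 0" using r Q0 by auto
  thus ?thesis by linarith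
 next
  case False
  have "1 * e <= r * e" using False e by (intro mult_right_mono) auto
  hence "Q <= r" unfolding Q_def using e by (simp add: divide_le_eq algebra_simps)
  moreover have "1 <= Q" unfolding Q_def using False e by (simp add: le_divide_eq)
  ultimately have "ln Q <= ln r" "0 <= ln Q" using r Q0 by auto
  thus ?thesis by linarith
 qed
 thus ?thesis unfolding lr by (simp add: reg_log_def Q_def r_def e_def abs_mult)
qed

lemma reg_log_derivative:
 assumes c: "(c has_vector_derivative c') (at t)" and ep: "ep > 0"
 shows "((%s. reg_log ep (c s)) has_vector_derivative ((c t \<bullet> c') / ((cmod (c t))\<^sup>2 + ep\<^sup>2))) (at t)"
proof -
 have "((%s. c s \<bullet> c s) has_vector_derivative (c t \<bullet> c' + c' \<bullet> c t)) (at t)"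
  by (rule bounded_bilinear.has_vector_derivative[OF bounded_bilinear_inner c c])
 hence d: "((%s. (cmod (c s))\<^sup>2) has_real_derivative (2 * (c t \<bullet> c'))) (at t)"
  by (simp add: has_real_derivative_iff_has_vector_derivative power2_norm_eq_inner inner_commute)
 have pos: "0 < (cmod (c t))\<^sup>2 + ep\<^sup>2" "0 < 1 + ep\<^sup>2" using ep by (auto intro: add_nonneg_pos add_pos_nonneg)
 have "((%s. ((cmod (c s))\<^sup>2 + ep\<^sup>2) / (1 + ep\<^sup>2)) has_real_derivative (2 * (c t \<bullet> c')) / (1 + ep\<^sup>2)) (at t)"
  by (rule DERIV_cdivide) (rule DERIV_add[OF d DERIV_const, simplified])
 from DERIV_chain2[OF DERIV_ln this] pos
 have "((%s. ln (((cmod (c s))\<^sup>2 + ep\<^sup>2) / (1 + ep\<^sup>2))) has_real_derivative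
  inverse (((cmod (c t))\<^sup>2 + ep\<^sup>2) / (1 + ep\<^sup>2)) * ((2 * (c t \<bullet> c')) / (1 + ep\<^sup>2))) (at t)" by simp
 from DERIV_cmult[OF this, of "1 / 2"]
 have "((%s. reg_log ep (c s)) has_real_derivative
  1 / 2 * (inverse (((cmod (c t))\<^sup>2 + ep\<^sup>2) / (1 + ep\<^sup>2)) * ((2 * (c t \<bullet> c')) / (1 + ep\<^sup>2)))) (at t)"
  unfolding reg_log_def .
 moreover have "1 / 2 * (inverse (A / B) * ((2 * X) / B)) = X / A" if "A > 0" "B > 0" for A B X :: real
  using that by (simp add: field_simps)
 ultimately show ?thesis using pos by (simp add: has_real_derivative_iff_has_vector_derivative)
qed

section \<open>The functionals in coordinates and the limit of vanishing regularization\<close>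

context deformation
begin

definition q :: "real => complex ^ 'n => real" where "q t y = Re (dF t y / F (t, y))"

definition qe :: "real => real => complex ^ 'n => real" where
 "qe ep t y = (F (t, y) \<bullet> dF t y) / ((cmod (F (t, y)))\<^sup>2 + ep\<^sup>2)"

text \<open>The factor lies between 0 and 1 and tends to 1 wherever F \<noteq> 0, so q both
  dominates the regularized derivatives and is their limit. At a zero of F both sides are 0, the
  right one by division by 0.\<close>

lemma qe_q: "qe ep t y = q t y * ((cmod (F (t, y)))\<^sup>2 / ((cmod (F (t, y)))\<^sup>2 + ep\<^sup>2))"
proof (cases "F (t, y) = 0")
 case False
 have "q t y = (dF t y \<bullet> F (t, y)) / (cmod (F (t, y)))\<^sup>2"
  unfolding q_def by (simp add: Re_divide' inner_complex_def cmod_power2 Re_divide add_divide_distrib)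
 hence "q t y * (cmod (F (t, y)))\<^sup>2 = F (t, y) \<bullet> dF t y" using False by (simp add: inner_commute)
 thus ?thesis unfolding qe_def by simp
qed (simp add: qe_def)

lemma abs_qe_le: "\<bar>qe ep t y\<bar> <= \<bar>q t y\<bar>"
proof -
 have "(cmod (F (t, y)))\<^sup>2 / ((cmod (F (t, y)))\<^sup>2 + ep\<^sup>2) <= 1" by (intro divide_le_eq_1[THEN iffD2]) (auto simp: add_nonneg_eq_0_iff less_le)
 thus ?thesis unfolding qe_q abs_mult by (intro mult_left_le) auto
qed

lemma mdiff_p:
 assumes t: "t : T" and v: "v : tangent_space (\<Lambda> t) (K (t, y))"
 shows "darg (\<Lambda> t) p (K (t, y)) v = Im (frechet_derivative p (at (K (t, y))) v / F (t, y))"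
proof (cases "F (t, y) = 0")
 case True
 thus ?thesis by (simp add: darg_def F_def)
next
 case False
 have d: "(p has_derivative frechet_derivative p (at (K (t, y)))) (at (K (t, y)) within \<Lambda> t)"
  by (rule has_derivative_at_withinI[OF holomorphic_cphase_derivative(1)[OF p_holomorphic K_tube[OF t]]])
 have m1: "mdiff (\<Lambda> t) p (K (t, y)) v = frechet_derivative p (at (K (t, y))) v" by (rule mdiff_tangent[OF d v])
 have m2: "mdiff (\<Lambda> t) (%z. cnj (p z)) (K (t, y)) v = cnj (frechet_derivative p (at (K (t, y))) v)"
  by (rule mdiff_tangent[OF bounded_linear.has_derivative[OF bounded_linear_cnj d] v])
 have "Re (1 / (2 * \<i>) * (X - cnj X)) = Im X" for X by (simp add: complex_diff_cnj)
 from this[of "frechet_derivative p (at (K (t, y))) v / F (t, y)"] False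
 show ?thesis by (simp add: darg_def m1 m2 F_def)
qed

lemma linear_darg: "t : T ==> linear (darg (\<Lambda> t) p (K (t, y)))"
proof -
 assume t: "t : T"
 have d: "(p has_derivative frechet_derivative p (at (K (t, y)))) (at (K (t, y)) within \<Lambda> t)"
  by (rule has_derivative_at_withinI[OF holomorphic_cphase_derivative(1)[OF p_holomorphic K_tube[OF t]]])
 note l1 = linear_mdiff[OF d] and l2 = linear_mdiff[OF bounded_linear.has_derivative[OF bounded_linear_cnj d]]
 show ?thesis
 proof (cases "p (K (t, y)) = 0")
  case True
  thus ?thesis by (simp add: darg_def[abs_def] linear_zero)
 next
  case False
  note d1 = linear_compose[OF l1 bounded_linear.linear[OF bounded_linear_divide[of "p (K (t, y))"]], unfolded o_def]
   and d2 = linear_compose[OF l2 bounded_linear.linear[OF bounded_linear_divide[of "cnj (p (K (t, y)))"]], unfolded o_def]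
  note d3 = linear_compose[OF linear_compose_sub[OF d1 d2] bounded_linear.linear[OF bounded_linear_mult_right[of "1 / (2 * \<i>)"]], unfolded o_def]
  have "linear (%v. Re (1 / (2 * \<i>) * (mdiff (\<Lambda> t) p (K (t, y)) v / p (K (t, y)) - mdiff (\<Lambda> t) (%z. cnj (p z)) (K (t, y)) v / cnj (p (K (t, y))))))"
   by (rule linear_compose[OF d3 bounded_linear.linear[OF bounded_linear_Re], unfolded o_def])
  thus ?thesis using False by (simp only: darg_def[abs_def] if_False)
 qed
qed

lemma darg_ham:
 assumes t: "t : T"
 shows "darg (\<Lambda> t) p (K (t, y)) (ham_fun (\<Lambda> t) (f t) (K (t, y))) = - q t y"
proof -
 have "q t y = Re (\<i> * (frechet_derivative p (at (K (t, y))) (ham t y) / F (t, y)))"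
  unfolding q_def dF_ham[OF t] by (simp only: times_divide_eq_right)
 also have "... = - Im (frechet_derivative p (at (K (t, y))) (ham t y) / F (t, y))" by (rule Re_i_times)
 also have "... = - darg (\<Lambda> t) p (K (t, y)) (ham t y)" by (simp only: mdiff_p[OF t ham_tangent[OF t]])
 finally show ?thesis by (simp only: ham_def minus_minus)
qed

text \<open>The two formulas for the formal derivative agree pointwise: df (H_arg) = - \<sigma>(H_f,
  H_arg) = \<sigma>(H_arg, H_f) = - d arg (H_f).\<close>

lemma mdiff_ham_arg:
 assumes t: "t : T"
 shows "mdiff (\<Lambda> t) (f t) (K (t, y)) (ham_arg (\<Lambda> t) p (K (t, y))) = q t y"
proof -
 let ?a = "ham_arg (\<Lambda> t) p (K (t, y))"
 note h = ham_vec_spec[OF IR[OF t] K_diffeo[OF t]]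
 have a: "?a : tangent_space (\<Lambda> t) (K (t, y))" unfolding ham_arg_def by (rule h(1)[OF linear_darg[OF t]])
 have 1: "csympl (ham t y) ?a = - complex_of_real (mdiff (\<Lambda> t) (f t) (K (t, y)) ?a)"
  unfolding ham_def ham_fun_def by (rule h(2)[OF linear_mdiff_f[OF t] a])
 have 2: "csympl ?a (ham t y) = - complex_of_real (darg (\<Lambda> t) p (K (t, y)) (ham t y))"
  unfolding ham_arg_def by (rule h(2)[OF linear_darg[OF t] ham_tangent[OF t]])
 have 3: "darg (\<Lambda> t) p (K (t, y)) (ham t y) = - q t y" unfolding ham_def by (rule darg_ham[OF t])
 have "complex_of_real (mdiff (\<Lambda> t) (f t) (K (t, y)) ?a) = - csympl (ham t y) ?a" unfolding 1 by (rule minus_minus[symmetric])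
 also have "... = csympl ?a (ham t y)" by (rule csympl_anti[symmetric])
 also have "... = complex_of_real (q t y)" unfolding 2 3 by (simp only: of_real_minus minus_minus)
 finally show ?thesis by (simp only: of_real_eq_iff)
qed

text \<open>Measurability of u on \<open>\<Lambda> t\<close> follows from that of y \<mapsto> u (K
  (t, y)) through the continuous inverse of K, so integrands need to be examined in coordinates
  only.\<close>

lemma transport:
 assumes t: "t : T" and u: "(%y. u (K (t, y))) : borel_measurable borel"
 shows "integrable (sympl_vol (\<Lambda> t)) u \<longleftrightarrow> integrable lborel (%y. w y * (u (K (t, y)) :: real))"
  and "integral\<^sup>L (sympl_vol (\<Lambda> t)) u = (LINT y|lborel. w y * u (K (t, y)))"
proof -
 note D = diffeomorphism_smooth[OF K_diffeo[OF t]]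
 let ?N = "restrict_space borel (\<Lambda> t)" and ?M = "density lborel (%y. ennreal (w y))"
 have mw: "w : borel_measurable lborel" using borel_measurable_continuous_onI[OF w_continuous] by simp
 have mK: "(%y. K (t, y)) : measurable ?M ?N"
 proof (rule measurable_restrict_space2)
  show "(%y. K (t, y)) : space ?M \<rightarrow> \<Lambda> t" using K\<Lambda>[OF t] by simp
  have "(%y. K (t, y)) : borel_measurable borel" by (rule borel_measurable_continuous_onI[OF smooth_open_continuous_on[OF D(1)]])
  thus "(%y. K (t, y)) : measurable ?M borel" by simp
 qed
 have mu: "u : borel_measurable ?N"
 proof -
  have "inv_into UNIV (%y. K (t, y)) : measurable ?N borel"
   by (rule borel_measurable_continuous_on_restrict[OF smooth_on_continuous_on[OF D(3)]])
  from measurable_compose[OF this u]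
  have "(%rh. u (K (t, inv_into UNIV (%y. K (t, y)) rh))) : borel_measurable ?N" .
  moreover have "u (K (t, inv_into UNIV (%y. K (t, y)) rh)) = u rh" if "rh : space ?N" for rh
  proof -
   have "rh : \<Lambda> t" using that by (simp add: space_restrict_space)
   thus ?thesis using bij_betw_inv_into_right[OF D(2)] by metis
  qed
  ultimately show ?thesis by (subst measurable_cong[where g = "%rh. u (K (t, inv_into UNIV (%y. K (t, y)) rh))"]) auto
 qed
 have u': "(%y. u (K (t, y))) : borel_measurable lborel" using u by simp
 have nn: "AE y in lborel. 0 <= w y" using w_nonneg by simp
 show "integrable (sympl_vol (\<Lambda> t)) u \<longleftrightarrow> integrable lborel (%y. w y * u (K (t, y)))"
  unfolding sympl_vol_K[OF t] integrable_distr_eq[OF mK mu] integrable_density[OF u' mw nn] real_scaleR_def ..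
 show "integral\<^sup>L (sympl_vol (\<Lambda> t)) u = (LINT y|lborel. w y * u (K (t, y)))"
  unfolding sympl_vol_K[OF t] integral_distr[OF mK mu] integral_density[OF u' mw nn] real_scaleR_def ..
qed

lemma F_meas: "t : T ==> (%y. F (t, y)) : borel_measurable borel" and dF_meas: "t : T ==> dF t : borel_measurable borel"
 using F_measurable[of t "[]"] F_measurable[of t "[(1, 0)]"] unfolding dF_def[abs_def] by simp_all

lemma ln_meas: "t : T ==> (%y. ln (cmod (F (t, y)))) : borel_measurable borel"
 and reg_meas: "t : T ==> (%y. reg_log ep (F (t, y))) : borel_measurable borel"
 and q_meas: "t : T ==> q t : borel_measurable borel"
 and qe_meas: "t : T ==> qe ep t : borel_measurable borel"
proof -
 assume t: "t : T"
 note [measurable] = F_meas[OF t] dF_meas[OF t]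
 show "(%y. ln (cmod (F (t, y)))) : borel_measurable borel" by measurable
 show "(%y. reg_log ep (F (t, y))) : borel_measurable borel" unfolding reg_log_def by measurable
 show "q t : borel_measurable borel" unfolding q_def[abs_def] by measurable
 show "qe ep t : borel_measurable borel" unfolding qe_def[abs_def] by measurable
qed

lemma w_meas: "w : borel_measurable borel" by (rule borel_measurable_continuous_onI[OF w_continuous])

text \<open>The interval has to contain 0 besides t, because the estimates near infinity compare K
  (t, y) with its position at time 0.\<close>

lemma surrounding:
 assumes t: "t : T"
 obtains a b where "{a..b} \<subseteq> T" "a <= 0" "0 <= b" "a < t" "t < b"
proof -
 obtain e where e: "e > 0" "cball t e \<subseteq> T" using oT t open_contains_cball by blast
 have te: "t - e : T" "t + e : T" using e by (auto simp: dist_norm subset_iff)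
 have "min 0 (t - e) : T" "max 0 (t + e) : T" using te T0 by (auto simp: min_def max_def)
 hence "{min 0 (t - e)..max 0 (t + e)} \<subseteq> T" using mem_is_interval_1_I[OF iT] by (meson atLeastAtMost_iff subsetI)
 thus thesis using e(1) by (intro that[of "min 0 (t - e)" "max 0 (t + e)"]) auto
qed

lemma integrable_log:
 assumes t: "t : T"
 shows "integrable lborel (%y. w y * ln (cmod (F (t, y))))" "integrable lborel (%y. w y * q t y)"
  "AE y in lborel. F (t, y) ~= 0"
proof -
 obtain a b where ab: "{a..b} \<subseteq> T" "a <= 0" "0 <= b" "a < t" "t < b" by (rule surrounding[OF t])
 obtain M where M: "!!t. t : {a..b} ==> (\<integral>\<^sup>+y. ennreal ((lv t y) * w y) \<partial>lborel) <= ennreal M"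
  "!!t. t : {a..b} ==> AE y in lborel. F (t, y) ~= 0"
  by (rule log_bounds[OF ab(1-3)]) (rule that)
 have tab: "t : {a..b}" using ab by simp
 have fin: "(\<integral>\<^sup>+y. ennreal ((\<bar>q t y\<bar> + \<bar>ln (cmod (F (t, y)))\<bar>) * w y) \<partial>lborel) < \<infinity>"
  using le_less_trans[OF M(1)[OF tab] ennreal_less_top] unfolding q_def infinity_ennreal_def .
 have int: "integrable lborel (%y. w y * v y)"
  if v: "v : borel_measurable borel" "!!y. \<bar>v y\<bar> <= \<bar>q t y\<bar> + \<bar>ln (cmod (F (t, y)))\<bar>" for v
 proof (rule integrableI_bounded)
  show "(%y. w y * v y) : borel_measurable lborel" using w_meas v(1) by simp
  have "(\<integral>\<^sup>+y. ennreal (norm (w y * v y)) \<partial>lborel) <= (\<integral>\<^sup>+y. ennreal ((\<bar>q t y\<bar> + \<bar>ln (cmod (F (t, y)))\<bar>) * w y) \<partial>lborel)"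
  proof (intro nn_integral_mono ennreal_leI)
   fix y show "norm (w y * v y) <= (\<bar>q t y\<bar> + \<bar>ln (cmod (F (t, y)))\<bar>) * w y"
    using mult_right_mono[OF v(2)[of y] w_nonneg[of y]] w_nonneg[of y] by (simp add: abs_mult mult.commute)
  qed
  thus "(\<integral>\<^sup>+y. ennreal (norm (w y * v y)) \<partial>lborel) < \<infinity>" using fin by (rule le_less_trans)
 qed
 show "integrable lborel (%y. w y * ln (cmod (F (t, y))))" by (rule int[OF ln_meas[OF t]]) simp
 show "integrable lborel (%y. w y * q t y)" by (rule int[OF q_meas[OF t]]) simp
 show "AE y in lborel. F (t, y) ~= 0" by (rule M(2)[OF tab])
qed

lemma integrable_reg:
 assumes t: "t : T"
 shows "integrable lborel (%y. w y * reg_log ep (F (t, y)))"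
proof (rule Bochner_Integration.integrable_bound[OF integrable_log(1)[OF t]])
 show "(%y. w y * reg_log ep (F (t, y))) : borel_measurable lborel" using w_meas reg_meas[OF t] by simp
 show "AE y in lborel. norm (w y * reg_log ep (F (t, y))) <= norm (w y * ln (cmod (F (t, y))))"
  using integrable_log(3)[OF t]
 proof eventually_elim
  case (elim y)
  show ?case unfolding real_norm_def abs_mult by (rule mult_left_mono[OF abs_reg_log_le[OF elim] abs_ge_zero])
 qed
qed

lemma I_fun_eq: "t : T ==> I_fun (\<Lambda> t) p = (LINT y|lborel. w y * ln (cmod (F (t, y))))"
 unfolding I_fun_def F_def by (rule transport(2)) (use ln_meas in \<open>simp_all add: F_def\<close>)

lemma I_eps_eq: "t : T ==> I_eps ep (\<Lambda> t) p = (LINT y|lborel. w y * reg_log ep (F (t, y)))"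
proof -
 assume t: "t : T"
 have "I_eps ep (\<Lambda> t) p = (LINT rh|sympl_vol (\<Lambda> t). reg_log ep (p rh))"
  unfolding I_eps_def reg_log_def by (rule integral_mult_right_zero[symmetric])
 also have "... = (LINT y|lborel. w y * reg_log ep (p (K (t, y))))"
  by (rule transport(2)[OF t]) (use reg_meas[OF t] in \<open>simp add: F_def\<close>)
 finally show ?thesis by (simp only: F_def)
qed

definition Q :: "real => real" where "Q t = (LINT y|lborel. w y * q t y)"

lemma formal_dI_eq: "t : T ==> formal_dI (\<Lambda> t) p (f t) = Q t"
proof -
 assume t: "t : T"
 have "(LINT rh|sympl_vol (\<Lambda> t). darg (\<Lambda> t) p rh (ham_fun (\<Lambda> t) (f t) rh)) = (LINT y|lborel. w y * (- q t y))"
  using transport(2)[OF t, of "%rh. darg (\<Lambda> t) p rh (ham_fun (\<Lambda> t) (f t) rh)"] q_meas[OF t]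
  unfolding darg_ham[OF t] by simp
 thus ?thesis unfolding formal_dI_def Q_def by simp
qed

text \<open>The difference quotients are dominated by an integrable weight, the derivative in \<open>t\<close> of the
 regularized logarithm being at most \<open>|F| |\<partial>\<^sub>tF| / ep\<^sup>2\<close>.\<close>

lemma I_eps_derivative:
 assumes t: "t : T" and ep: "ep > 0"
 shows "((%s. I_eps ep (\<Lambda> s) p) has_real_derivative (LINT y|lborel. w y * qe ep t y)) (at t)"
proof -
 obtain a b where ab: "{a..b} \<subseteq> T" "a <= 0" "0 <= b" "a < t" "t < b" by (rule surrounding[OF t])
 obtain m C where m: "m < - 2 * real CARD('n)" and C: "0 <= C"
  "!!t y. t : {a..b} ==> cmod (F (t, y) - 1) <= C * weight m y"
  "!!t y. t : {a..b} ==> cmod (dF t y) <= C * weight m y"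
  by (rule majorant[OF ab(1-3)]) (rule that)
 have m0: "m <= 0" by (rule order_trans[OF less_imp_le[OF m]]) simp
 have w1: "weight m y <= 1" for y
 proof -
  have "(1 + norm (fst (\<phi> y))) powr m <= 1 powr m" using m0 by (intro powr_mono2') auto
  thus ?thesis by (simp add: weight_def)
 qed
 define B where "B = (1 + C) * C / ep\<^sup>2"
 have qb: "\<bar>qe ep s y\<bar> <= B * weight m y" if s: "s : {a..b}" for s y
 proof -
  have "cmod (F (s, y)) <= 1 + C"
   using norm_triangle_ineq[of "F (s, y) - 1" 1] C(2)[OF s, of y] mult_left_mono[OF w1[of y] C(1)] by simp
  hence "\<bar>F (s, y) \<bullet> dF s y\<bar> <= (1 + C) * (C * weight m y)"
   using Cauchy_Schwarz_ineq2[of "F (s, y)" "dF s y"] mult_mono[OF _ C(3)[OF s, of y]] C(1) by (smt (verit) norm_ge_zero)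
  moreover have "\<bar>qe ep s y\<bar> = \<bar>F (s, y) \<bullet> dF s y\<bar> / ((cmod (F (s, y)))\<^sup>2 + ep\<^sup>2)"
   unfolding qe_def by (simp add: abs_divide)
  moreover have "... <= \<bar>F (s, y) \<bullet> dF s y\<bar> / ep\<^sup>2" using ep by (intro divide_left_mono mult_pos_pos add_nonneg_pos) auto
  ultimately have "\<bar>qe ep s y\<bar> <= (1 + C) * (C * weight m y) / ep\<^sup>2"
   using divide_right_mono[of "\<bar>F (s, y) \<bullet> dF s y\<bar>" "(1 + C) * (C * weight m y)" "ep\<^sup>2"] by simp
  thus ?thesis by (simp add: B_def mult.assoc)
 qed
 have dl: "((%s. reg_log ep (F (s, y))) has_vector_derivative qe ep s y) (at s)" if s: "s : {a..b}" for s y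
 proof -
  have sT: "s : T" using s ab(1) by blast
  have "((%s. F (s, y)) has_vector_derivative dF s y) (at s)"
   using partial_fst_has_vector_derivative[OF F_smooth sT, of "[]" y] unfolding dF_def by (simp only: iter_deriv.simps(1))
  from reg_log_derivative[OF this ep] show ?thesis unfolding qe_def .
 qed
 have lip: "\<bar>reg_log ep (F (s, y)) - reg_log ep (F (t, y))\<bar> <= B * weight m y * \<bar>s - t\<bar>" if s: "s : {a..b}" for s y
 proof -
  have "norm (reg_log ep (F (s, y)) - reg_log ep (F (t, y))) <= B * weight m y * \<bar>s - t\<bar>"
  proof (rule vector_derivative_bound[where f' = "%s. qe ep s y"])
   fix x assume "x : closed_segment t s"
   hence x: "x : {a..b}" using s ab(4,5) by (auto simp: closed_segment_eq_real_ivl split: if_splits)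
   show "((%s. reg_log ep (F (s, y))) has_vector_derivative qe ep x y) (at x)" by (rule dl[OF x])
   show "norm (qe ep x y) <= B * weight m y" unfolding real_norm_def by (rule qb[OF x])
  qed
  thus ?thesis by (simp only: real_norm_def)
 qed
 have iw: "integrable lborel (%y. B * (weight m y * w y))"
 proof (intro integrable_mult_right impI integrableI_bounded)
  show "(%y. weight m y * w y) : borel_measurable lborel"
   using borel_measurable_continuous_onI[OF continuous_on_mult[OF weight_continuous w_continuous]] by simp
  have "ennreal (norm (weight m y * w y)) = ennreal (weight m y * w y)" for y
   using weight_pos[of m y] w_nonneg[of y] by (simp add: abs_mult)
  thus "(\<integral>\<^sup>+y. ennreal (norm (weight m y * w y)) \<partial>lborel) < \<infinity>" using weight_integrable[OF m] by simp
 qed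
 define J where "J s = (LINT y|lborel. w y * reg_log ep (F (s, y)))" for s
 have "((%s. (J s - J t) / (s - t)) \<longlongrightarrow> (LINT y|lborel. w y * qe ep t y)) (at t within {a<..<b})"
  unfolding tendsto_at_iff_sequentially
 proof (intro allI impI)
  fix X assume X: "\<forall>i. X i : {a<..<b} - {t}" "X \<longlonglongrightarrow> t"
  have XT: "X i : T" "X i : {a..b}" "X i ~= t" for i using X(1)[rule_format, of i] ab(1) by auto
  have eq: "(J (X i) - J t) / (X i - t) = (LINT y|lborel. w y * ((reg_log ep (F (X i, y)) - reg_log ep (F (t, y))) / (X i - t)))" for i
  proof -
   have "J (X i) - J t = (LINT y|lborel. w y * reg_log ep (F (X i, y)) - w y * reg_log ep (F (t, y)))"
    unfolding J_def by (rule Bochner_Integration.integral_diff[symmetric, OF integrable_reg[OF XT(1)] integrable_reg[OF t]])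
   hence "(J (X i) - J t) / (X i - t) = (LINT y|lborel. (w y * reg_log ep (F (X i, y)) - w y * reg_log ep (F (t, y))) / (X i - t))"
    by (simp only: integral_divide_zero)
   thus ?thesis by (simp only: right_diff_distrib times_divide_eq_right)
  qed
  have "(%i. LINT y|lborel. w y * ((reg_log ep (F (X i, y)) - reg_log ep (F (t, y))) / (X i - t))) \<longlonglongrightarrow> (LINT y|lborel. w y * qe ep t y)"
  proof (rule integral_dominated_convergence[OF _ _ iw])
   show "(%y. w y * qe ep t y) : borel_measurable lborel" using w_meas qe_meas[OF t] by simp
   show "(%y. w y * ((reg_log ep (F (X i, y)) - reg_log ep (F (t, y))) / (X i - t))) : borel_measurable lborel" for i
    using w_meas reg_meas[OF XT(1)] reg_meas[OF t] by simp
   show "AE y in lborel. (%i. w y * ((reg_log ep (F (X i, y)) - reg_log ep (F (t, y))) / (X i - t))) \<longlonglongrightarrow> w y * qe ep t y"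
   proof (rule AE_I2, rule tendsto_mult_left)
    fix y
    have "t : {a..b}" using ab by simp
    from dl[OF this, of y]
    have "((%s. (reg_log ep (F (s, y)) - reg_log ep (F (t, y))) / (s - t)) \<longlongrightarrow> qe ep t y) (at t)"
     unfolding has_real_derivative_iff_has_vector_derivative[symmetric] has_field_derivative_iff .
    hence "((%s. (reg_log ep (F (s, y)) - reg_log ep (F (t, y))) / (s - t)) \<circ> X) \<longlonglongrightarrow> qe ep t y"
     unfolding tendsto_at_iff_sequentially using X(2) XT(3) by (elim allE[of _ X] impE) auto
    thus "(%i. (reg_log ep (F (X i, y)) - reg_log ep (F (t, y))) / (X i - t)) \<longlonglongrightarrow> qe ep t y" by (simp only: o_def)
   qed
   show "AE y in lborel. norm (w y * ((reg_log ep (F (X i, y)) - reg_log ep (F (t, y))) / (X i - t))) <= B * (weight m y * w y)" for i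
   proof (rule AE_I2)
    fix y
    have "\<bar>(reg_log ep (F (X i, y)) - reg_log ep (F (t, y))) / (X i - t)\<bar> <= B * weight m y"
     using lip[OF XT(2)[of i], of y] XT(3)[of i] by (simp add: abs_divide divide_le_eq)
    from mult_left_mono[OF this w_nonneg[of y]]
    show "norm (w y * ((reg_log ep (F (X i, y)) - reg_log ep (F (t, y))) / (X i - t))) <= B * (weight m y * w y)"
     using w_nonneg[of y] by (simp add: abs_mult mult.commute mult.left_commute)
   qed
  qed
  thus "((%s. (J s - J t) / (s - t)) \<circ> X) \<longlonglongrightarrow> (LINT y|lborel. w y * qe ep t y)"
   unfolding o_def eq .
 qed
 hence "(J has_real_derivative (LINT y|lborel. w y * qe ep t y)) (at t)"
  unfolding has_field_derivative_iff using at_within_open[of t "{a<..<b}"] ab(4,5) by simp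
 thus ?thesis
  by (rule has_field_derivative_transform_within_open[OF _ oT t]) (simp only: J_def I_eps_eq)
qed

lemma qe_tendsto:
 assumes t: "t : T" and X: "X \<longlonglongrightarrow> 0" "!!i. X i ~= 0"
 shows "(%i. LINT y|lborel. w y * qe (X i) t y) \<longlonglongrightarrow> Q t"
 unfolding Q_def
proof (rule integral_dominated_convergence[where w = "%y. \<bar>w y * q t y\<bar>"])
 show "(%y. w y * q t y) : borel_measurable lborel" using w_meas q_meas[OF t] by simp
 show "(%y. w y * qe (X i) t y) : borel_measurable lborel" for i using w_meas qe_meas[OF t] by simp
 show "integrable lborel (%y. \<bar>w y * q t y\<bar>)" by (intro integrable_abs integrable_log(2)[OF t])
 show "AE y in lborel. norm (w y * qe (X i) t y) <= \<bar>w y * q t y\<bar>" for i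
  unfolding real_norm_def abs_mult by (intro AE_I2 mult_left_mono abs_qe_le abs_ge_zero)
 show "AE y in lborel. (%i. w y * qe (X i) t y) \<longlonglongrightarrow> w y * q t y"
  using integrable_log(3)[OF t]
 proof eventually_elim
  case (elim y)
  have "(%i. q t y * ((cmod (F (t, y)))\<^sup>2 / ((cmod (F (t, y)))\<^sup>2 + (X i)\<^sup>2))) \<longlonglongrightarrow> q t y * ((cmod (F (t, y)))\<^sup>2 / ((cmod (F (t, y)))\<^sup>2 + 0\<^sup>2))"
   using elim by (intro tendsto_intros X(1)) auto
  hence "(%i. qe (X i) t y) \<longlonglongrightarrow> q t y" using elim by (simp add: qe_q)
  thus ?case by (rule tendsto_mult_left)
 qed
qed

lemma reg_tendsto:
 assumes t: "t : T" and X: "X \<longlonglongrightarrow> 0"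
 shows "(%i. LINT y|lborel. w y * reg_log (X i) (F (t, y))) \<longlonglongrightarrow> (LINT y|lborel. w y * ln (cmod (F (t, y))))"
proof (rule integral_dominated_convergence[where w = "%y. \<bar>w y * ln (cmod (F (t, y)))\<bar>"])
 show "(%y. w y * ln (cmod (F (t, y)))) : borel_measurable lborel" using w_meas ln_meas[OF t] by simp
 show "(%y. w y * reg_log (X i) (F (t, y))) : borel_measurable lborel" for i using w_meas reg_meas[OF t] by simp
 show "integrable lborel (%y. \<bar>w y * ln (cmod (F (t, y)))\<bar>)" by (intro integrable_abs integrable_log(1)[OF t])
 show "AE y in lborel. norm (w y * reg_log (X i) (F (t, y))) <= \<bar>w y * ln (cmod (F (t, y)))\<bar>" for i
  using integrable_log(3)[OF t]
 proof eventually_elim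
  case (elim y)
  show ?case unfolding real_norm_def abs_mult by (rule mult_left_mono[OF abs_reg_log_le[OF elim] abs_ge_zero])
 qed
 show "AE y in lborel. (%i. w y * reg_log (X i) (F (t, y))) \<longlonglongrightarrow> w y * ln (cmod (F (t, y)))"
  using integrable_log(3)[OF t]
 proof eventually_elim
  case (elim y)
  have "(%i. 1 / 2 * ln (((cmod (F (t, y)))\<^sup>2 + (X i)\<^sup>2) / (1 + (X i)\<^sup>2))) \<longlonglongrightarrow> 1 / 2 * ln (((cmod (F (t, y)))\<^sup>2 + 0\<^sup>2) / (1 + 0\<^sup>2))"
   using elim by (intro tendsto_intros X) auto
  moreover have "1 / 2 * ln (((cmod (F (t, y)))\<^sup>2 + 0\<^sup>2) / (1 + 0\<^sup>2)) = ln (cmod (F (t, y)))" using elim by (simp add: ln_realpow)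
  ultimately show ?case unfolding reg_log_def by (intro tendsto_mult_left) simp
 qed
qed

text \<open>The fundamental theorem of calculus applies to the regularized functionals. Along X
  their derivatives converge to Q at every time and are bounded by M uniformly, so dominated
  convergence in t yields the integrability of Q and the integral formula for I together.\<close>

lemma Q_integral:
 assumes ab: "{a..b} \<subseteq> T" "a <= 0" "0 <= b"
 obtains M where "0 <= M" "!!t. t : {a..b} ==> \<bar>Q t\<bar> <= M"
  "!!s t. a <= s ==> s <= t ==> t <= b ==> (Q has_integral (I_fun (\<Lambda> t) p - I_fun (\<Lambda> s) p)) {s..t}"
proof -
 obtain M where M: "0 <= M" "!!t. t : {a..b} ==> (\<integral>\<^sup>+y. ennreal ((lv t y) * w y) \<partial>lborel) <= ennreal M"
  by (rule log_bounds[OF ab]) (rule that)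
 have int: "\<bar>LINT y|lborel. w y * v y\<bar> <= M" if t: "t : {a..b}" and v: "!!y. \<bar>v y\<bar> <= \<bar>q t y\<bar>" for t v
 proof -
  have "(\<integral>\<^sup>+y. ennreal (norm (w y * v y)) \<partial>lborel) <= (\<integral>\<^sup>+y. ennreal ((lv t y) * w y) \<partial>lborel)"
  proof (intro nn_integral_mono ennreal_leI)
   fix y
   have "\<bar>v y\<bar> <= lv t y" using v[of y] unfolding q_def by linarith
   from mult_right_mono[OF this w_nonneg[of y]]
   show "norm (w y * v y) <= (lv t y) * w y"
    using w_nonneg[of y] by (simp only: real_norm_def abs_mult abs_of_nonneg mult.commute)
  qed
  hence "(\<integral>\<^sup>+y. ennreal (norm (w y * v y)) \<partial>lborel) <= ennreal M" using M(2)[OF t] by (rule order_trans)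
  moreover have "ennreal (norm (LINT y|lborel. w y * v y)) <= (\<integral>\<^sup>+y. ennreal (norm (w y * v y)) \<partial>lborel)"
  \<comment> \<open>A nonintegrable function has integral 0, so the bound holds in that case as
    well.\<close>
  proof (cases "integrable lborel (%y. w y * v y)")
   case True
   thus ?thesis by (rule integral_norm_bound_ennreal)
  next
   case False
   hence "(LINT y|lborel. w y * v y) = 0" by (rule not_integrable_integral_eq)
   thus ?thesis by (simp only: norm_zero ennreal_0 zero_le)
  qed
  ultimately have "ennreal (norm (LINT y|lborel. w y * v y)) <= ennreal M" by (rule order_trans[rotated])
  thus ?thesis using M(1) by simp
 qed
 have QM: "\<bar>Q t\<bar> <= M" if "t : {a..b}" for t unfolding Q_def by (rule int[OF that]) simp
 define X where "X i = 1 / real (Suc i)" for i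
 have X: "X \<longlonglongrightarrow> 0" "X i > 0" for i
 proof -
  show "X \<longlonglongrightarrow> 0" unfolding X_def[abs_def] by (rule LIMSEQ_Suc[OF lim_1_over_n])
 qed (simp add: X_def)
 define D where "D i t = (LINT y|lborel. w y * qe (X i) t y)" for i t
 have hi: "(Q has_integral (I_fun (\<Lambda> t) p - I_fun (\<Lambda> s) p)) {s..t}" if st: "a <= s" "s <= t" "t <= b" for s t
 proof -
  have sub: "{s..t} \<subseteq> {a..b}" using st by auto
  have inT: "x : T" if "x : {s..t}" for x using that sub ab(1) by blast
  have sT: "s : T" "t : T" using inT st(2) by auto
  have ftc: "(D i has_integral (I_eps (X i) (\<Lambda> t) p - I_eps (X i) (\<Lambda> s) p)) {s..t}" for i
  proof (rule fundamental_theorem_of_calculus[OF st(2)])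
   fix x assume "x : {s..t}"
   from has_vector_derivative_at_within[OF I_eps_derivative[OF inT[OF this] X(2), unfolded has_real_derivative_iff_has_vector_derivative]]
   show "((%t. I_eps (X i) (\<Lambda> t) p) has_vector_derivative D i x) (at x within {s..t})" unfolding D_def .
  qed
  have dc: "Q integrable_on {s..t}" "(%i. integral {s..t} (D i)) \<longlonglongrightarrow> integral {s..t} Q"
  proof -
   have 1: "D i integrable_on {s..t}" for i using ftc by (rule has_integral_integrable)
   have 2: "(%_. M) integrable_on {s..t}" by (rule integrable_const_ivl)
   have 3: "norm (D i x) <= M" if "x : {s..t}" for i x
    unfolding D_def real_norm_def by (rule int[OF subsetD[OF sub that] abs_qe_le])
   have 4: "(%i. D i x) \<longlonglongrightarrow> Q x" if "x : {s..t}" for x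
    unfolding D_def by (rule qe_tendsto[OF inT[OF that] X(1)]) (use X(2) in \<open>simp add: less_imp_neq[THEN not_sym]\<close>)
   show "Q integrable_on {s..t}" by (rule dominated_convergence(1)[OF 1 2 3 4])
   show "(%i. integral {s..t} (D i)) \<longlonglongrightarrow> integral {s..t} Q" by (rule dominated_convergence(2)[OF 1 2 3 4])
  qed
  have "(%i. I_eps (X i) (\<Lambda> t) p - I_eps (X i) (\<Lambda> s) p) \<longlonglongrightarrow> I_fun (\<Lambda> t) p - I_fun (\<Lambda> s) p"
   unfolding I_eps_eq[OF sT(1)] I_eps_eq[OF sT(2)] I_fun_eq[OF sT(1)] I_fun_eq[OF sT(2)]
   by (intro tendsto_diff reg_tendsto sT X(1))
  moreover have "integral {s..t} (D i) = I_eps (X i) (\<Lambda> t) p - I_eps (X i) (\<Lambda> s) p" for i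
   using ftc by (rule integral_unique)
  ultimately have "integral {s..t} Q = I_fun (\<Lambda> t) p - I_fun (\<Lambda> s) p"
   using LIMSEQ_unique[OF dc(2)] by simp
  thus ?thesis using dc(1) by (simp only: has_integral_integral)
 qed
 show thesis by (rule that[OF M(1) QM hi])
qed

lemma lipschitz:
 assumes "compact A" "A \<subseteq> T"
 shows "\<exists>L. L-lipschitz_on A (%t. I_fun (\<Lambda> t) p)"
proof -
 \<comment> \<open>Adjoining 0 makes the interval spanned by the set contain 0, as the bounds for Q
   require.\<close>
 have c: "compact (insert 0 A)" using assms(1) by simp
 obtain a where a: "a : insert 0 A" "!!x. x : insert 0 A ==> a <= x" using compact_attains_inf[OF c] by auto
 obtain b where b: "b : insert 0 A" "!!x. x : insert 0 A ==> x <= b" using compact_attains_sup[OF c] by auto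
 have "a : T" "b : T" using a(1) b(1) assms(2) T0 by auto
 hence ab: "{a..b} \<subseteq> T" using mem_is_interval_1_I[OF iT] by (meson atLeastAtMost_iff subsetI)
 obtain M where M: "0 <= M" "!!t. t : {a..b} ==> \<bar>Q t\<bar> <= M"
  "!!s t. a <= s ==> s <= t ==> t <= b ==> (Q has_integral (I_fun (\<Lambda> t) p - I_fun (\<Lambda> s) p)) {s..t}"
  by (rule Q_integral[OF ab a(2)[OF insertI1] b(2)[OF insertI1]]) (rule that)
 have le: "\<bar>I_fun (\<Lambda> t) p - I_fun (\<Lambda> s) p\<bar> <= M * (t - s)" if st: "a <= s" "s <= t" "t <= b" for s t
 proof -
  have "norm (I_fun (\<Lambda> t) p - I_fun (\<Lambda> s) p) <= M * measure lborel {s..t}"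
   by (rule has_integral_bound_real[OF M(1) finite.emptyI M(3)[OF st]]) (use M(2) st in auto)
  thus ?thesis using st(2) by simp
 qed
 have "M-lipschitz_on A (%t. I_fun (\<Lambda> t) p)"
 proof (rule lipschitz_onI[OF _ M(1)])
  fix x y assume "x : A" "y : A"
  hence xy: "a <= x" "x <= b" "a <= y" "y <= b" using a(2) b(2) by auto
  show "dist (I_fun (\<Lambda> x) p) (I_fun (\<Lambda> y) p) <= M * dist x y"
  proof (cases "x <= y")
   case True
   thus ?thesis using le[OF xy(1) True xy(4)] by (simp add: dist_real_def abs_minus_commute)
  next
   case False
   thus ?thesis using le[OF xy(3) _ xy(2)] by (simp add: dist_real_def)
  qed
 qed
 thus ?thesis ..
qed

text \<open>Every point of the open set T lies inside an interval with rational end points in T;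
  there are countably many of these, and each contributes a negligible set.\<close>

lemma ae_derivative:
 "AE t in lborel. t : T --> ((%s. I_fun (\<Lambda> s) p) has_real_derivative Q t) (at t)"
proof -
 define E where "E a b = {t : {a<..<b}. \<not> ((%s. I_fun (\<Lambda> s) p) has_real_derivative Q t) (at t)}" for a b :: real
 define P where "P = {(a, b). a : \<rat> & b : \<rat> & a : T & b : T & a < b}"
 have neg: "negligible (E a b)" if ab: "a : T" "b : T" "a < b" for a b
 proof -
  define a' b' where "a' = min 0 a" and "b' = max 0 b"
  have "a' : T" "b' : T" using ab T0 by (auto simp: a'_def b'_def min_def max_def)
  hence sub: "{a'..b'} \<subseteq> T" using mem_is_interval_1_I[OF iT] by (meson atLeastAtMost_iff subsetI)
  obtain M where M: "0 <= M" "!!t. t : {a'..b'} ==> \<bar>Q t\<bar> <= M"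
   "!!s t. a' <= s ==> s <= t ==> t <= b' ==> (Q has_integral (I_fun (\<Lambda> t) p - I_fun (\<Lambda> s) p)) {s..t}"
   by (rule Q_integral[OF sub]) (auto simp: a'_def b'_def)
  have l: "a' <= a" "b <= b'" by (auto simp: a'_def b'_def)
  show ?thesis unfolding E_def
  proof (rule negligible_not_differentiable_integral[OF ab(3)])
   fix s t assume "a <= s" "s <= t" "t <= b"
   thus "(Q has_integral (I_fun (\<Lambda> t) p - I_fun (\<Lambda> s) p)) {s..t}" using l by (intro M(3)) auto
  next
   fix x assume "x : {a..b}"
   thus "\<bar>Q x\<bar> <= M" using l by (intro M(2)) auto
  qed
 qed
 have "countable P" by (rule countable_subset[of _ "\<rat> \<times> \<rat>"]) (auto simp: P_def countable_rat)
 hence "countable ((%(a, b). E a b) ` P)" by (rule countable_image)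
 moreover have "!!S. S : (%(a, b). E a b) ` P ==> negligible S" using neg by (auto simp: P_def)
 ultimately have "negligible (\<Union>((%(a, b). E a b) ` P))" by (rule negligible_countable_Union)
 hence "\<Union>((%(a, b). E a b) ` P) : null_sets lebesgue" by (simp only: negligible_iff_null_sets)
 hence "AE t in lebesgue. t \<notin> \<Union>((%(a, b). E a b) ` P)" by (rule AE_not_in)
 hence "AE t in lborel. t \<notin> \<Union>((%(a, b). E a b) ` P)" by (simp only: AE_completion_iff)
 thus ?thesis
 proof eventually_elim
  case (elim t)
  show ?case
  proof
   assume t: "t : T"
   obtain e where e: "e > 0" "cball t e \<subseteq> T" using oT t open_contains_cball by blast
   obtain a where a: "a : \<rat>" "t - e < a" "a < t" using Rats_dense_in_real[of "t - e" t] e(1) by auto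
   obtain b where b: "b : \<rat>" "t < b" "b < t + e" using Rats_dense_in_real[of t "t + e"] e(1) by auto
   have "a : cball t e" "b : cball t e" using a b by (auto simp: dist_real_def)
   hence "(a, b) : P" using a b e(2) by (auto simp: P_def)
   hence "t \<notin> E a b" using elim by blast
   thus "((%s. I_fun (\<Lambda> s) p) has_real_derivative Q t) (at t)" using a b by (simp add: E_def)
  qed
 qed
qed

end

text \<open>The integrability claims come first because a Bochner integral is 0 for a nonintegrable
  integrand; they give the functionals and both formulas for the formal derivative their intended
  meaning. Lipschitz continuity is claimed on compact subsets of T, since the bounds in
  \<open>smooth_Cb_family\<close> are only locally uniform in t.\<close>

theorem proposition4p4:
  fixes \<Phi>\<^sub>0 :: "complex ^ 'n::finite \<Rightarrow> real"
    and W W' :: "'n cphase set"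
    and p :: "'n cphase \<Rightarrow> complex"
    and T :: "real set"
    and \<Lambda> :: "real \<Rightarrow> 'n cphase set"
    and f :: "real \<Rightarrow> 'n cphase \<Rightarrow> real"
  assumes "real_quadratic_form \<Phi>\<^sub>0" and "strictly_psh \<Phi>\<^sub>0"
    and "bounded_open_nbhd_0 \<Phi>\<^sub>0 W" and "bounded_open_nbhd_0 \<Phi>\<^sub>0 W'" and "closure W' \<subseteq> W"
    and "admissible_symbol \<Phi>\<^sub>0 W p"
    and "open T" and "is_interval T" and "0 \<in> T"
    and "admissible_family \<Phi>\<^sub>0 W' T \<Lambda>"
    and "generating_functions T \<Lambda> f"
  shows
    "(\<forall>t\<in>T.
        integrable (sympl_vol (\<Lambda> t)) (\<lambda>\<rho>. ln (cmod (p \<rho>))) \<and>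
        (\<forall>\<epsilon>\<in>{0<..1}. integrable (sympl_vol (\<Lambda> t))
                         (\<lambda>\<rho>. ln (((cmod (p \<rho>))\<^sup>2 + \<epsilon>\<^sup>2) / (1 + \<epsilon>\<^sup>2)))) \<and>
        integrable (sympl_vol (\<Lambda> t)) (\<lambda>\<rho>. darg (\<Lambda> t) p \<rho> (ham_fun (\<Lambda> t) (f t) \<rho>)) \<and>
        integrable (sympl_vol (\<Lambda> t)) (\<lambda>\<rho>. mdiff (\<Lambda> t) (f t) \<rho> (ham_arg (\<Lambda> t) p \<rho>)))
     \<and> (\<forall>t\<in>T.
        (\<forall>\<epsilon>\<in>{0<..1}. (\<lambda>s. I_eps \<epsilon> (\<Lambda> s) p) differentiable (at t)) \<and>
        ((\<lambda>\<epsilon>. deriv (\<lambda>s. I_eps \<epsilon> (\<Lambda> s) p) t) \<longlongrightarrow> formal_dI (\<Lambda> t) p (f t)) (at_right 0))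
     \<and> (\<forall>t\<in>T. formal_dI (\<Lambda> t) p (f t) =
          (LINT \<rho>|sympl_vol (\<Lambda> t). mdiff (\<Lambda> t) (f t) \<rho> (ham_arg (\<Lambda> t) p \<rho>)))
     \<and> (\<forall>K. compact K \<and> K \<subseteq> T \<longrightarrow> (\<exists>L. L-lipschitz_on K (\<lambda>t. I_fun (\<Lambda> t) p)))
     \<and> (AE t in lborel. t \<in> T \<longrightarrow>
          ((\<lambda>s. I_fun (\<Lambda> s) p) has_real_derivative formal_dI (\<Lambda> t) p (f t)) (at t))"
proof -
 obtain \<kappa> where \<kappa>: "smooth_on (T \<times> \<Lambda> 0) (%(t, rh). \<kappa> t rh)" "\<forall>rh\<in>\<Lambda> 0. \<kappa> 0 rh = rh"
  "\<forall>t\<in>T. diffeomorphism (\<Lambda> 0) (\<Lambda> t) (\<kappa> t)"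
  "\<forall>t\<in>T. \<forall>rh\<in>\<Lambda> 0. ((%s. \<kappa> s rh) has_vector_derivative mult_i (ham_fun (\<Lambda> t) (f t) (\<kappa> t rh))) (at t)"
  using assms(11) unfolding generating_functions_def by (elim conjE exE) (rule that)
 have "admissible_IR \<Phi>\<^sub>0 W' (\<Lambda> 0)" using assms(9,10) unfolding admissible_family_def by blast
 hence "\<exists>\<phi> :: (complex ^ 'n) => 'n cphase. diffeomorphism UNIV (\<Lambda> 0) \<phi>" unfolding admissible_IR_def by (elim conjE)
 then obtain \<phi> :: "(complex ^ 'n) => 'n cphase" where \<phi>: "diffeomorphism UNIV (\<Lambda> 0) \<phi>" by (rule exE)
 have "smooth_Cb_family T \<Lambda> f" using assms(11) unfolding generating_functions_def by (rule conjunct1)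
 then interpret deformation \<Phi>\<^sub>0 W W' p T \<Lambda> f \<kappa> \<phi>
  using assms(1-10) \<kappa>(2-4) by (unfold_locales) (simp_all only: \<kappa>(1) \<phi>)
 show ?thesis
 proof (intro conjI ballI allI impI)
  fix t assume t: "t : T"
  show "integrable (sympl_vol (\<Lambda> t)) (%rh. ln (cmod (p rh)))"
   using transport(1)[OF t, of "%rh. ln (cmod (p rh))"] ln_meas[OF t] integrable_log(1)[OF t] by (simp add: F_def)
  show "integrable (sympl_vol (\<Lambda> t)) (%rh. darg (\<Lambda> t) p rh (ham_fun (\<Lambda> t) (f t) rh))"
   using transport(1)[OF t, of "%rh. darg (\<Lambda> t) p rh (ham_fun (\<Lambda> t) (f t) rh)"] q_meas[OF t] integrable_log(2)[OF t]
   unfolding darg_ham[OF t] by simp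
  note m = transport[OF t, of "%rh. mdiff (\<Lambda> t) (f t) rh (ham_arg (\<Lambda> t) p rh)", unfolded mdiff_ham_arg[OF t], OF q_meas[OF t]]
  show "integrable (sympl_vol (\<Lambda> t)) (%rh. mdiff (\<Lambda> t) (f t) rh (ham_arg (\<Lambda> t) p rh))"
   unfolding m(1) by (rule integrable_log(2)[OF t])
  show "formal_dI (\<Lambda> t) p (f t) = (LINT rh|sympl_vol (\<Lambda> t). mdiff (\<Lambda> t) (f t) rh (ham_arg (\<Lambda> t) p rh))"
   unfolding m(2) formal_dI_eq[OF t] Q_def ..
  show "((%ep. deriv (%s. I_eps ep (\<Lambda> s) p) t) \<longlongrightarrow> formal_dI (\<Lambda> t) p (f t)) (at_right 0)"
   unfolding tendsto_at_iff_sequentially formal_dI_eq[OF t]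
  proof (intro allI impI)
   fix X :: "nat => real" assume X: "\<forall>i. X i : {0<..} - {0}" "X \<longlonglongrightarrow> 0"
   have pos: "X i > 0" for i using X(1) by simp
   have "((%ep. deriv (%s. I_eps ep (\<Lambda> s) p) t) \<circ> X) = (%i. LINT y|lborel. w y * qe (X i) t y)"
    unfolding o_def by (rule ext) (rule DERIV_imp_deriv[OF I_eps_derivative[OF t pos]])
   thus "((%ep. deriv (%s. I_eps ep (\<Lambda> s) p) t) \<circ> X) \<longlonglongrightarrow> Q t"
    using qe_tendsto[OF t X(2) less_imp_neq[OF pos, THEN not_sym]] by simp
  qed
  fix ep :: real assume ep: "ep : {0<..1}"
  have "integrable lborel (%y. 2 * (w y * reg_log ep (F (t, y))))" by (intro integrable_mult_right integrable_reg[OF t])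
  hence "integrable lborel (%y. w y * ln (((cmod (F (t, y)))\<^sup>2 + ep\<^sup>2) / (1 + ep\<^sup>2)))" by (simp add: reg_log_def)
  moreover have "(%y. ln (((cmod (F (t, y)))\<^sup>2 + ep\<^sup>2) / (1 + ep\<^sup>2))) : borel_measurable borel"
   using F_meas[OF t] by measurable
  ultimately show "integrable (sympl_vol (\<Lambda> t)) (%rh. ln (((cmod (p rh))\<^sup>2 + ep\<^sup>2) / (1 + ep\<^sup>2)))"
   using transport(1)[OF t, of "%rh. ln (((cmod (p rh))\<^sup>2 + ep\<^sup>2) / (1 + ep\<^sup>2))"] unfolding F_def by blast
  show "(%s. I_eps ep (\<Lambda> s) p) differentiable (at t)"
   using I_eps_derivative[OF t, of ep] ep by (auto simp: real_differentiable_def)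
 next
  fix A assume "compact A & A \<subseteq> T"
  thus "\<exists>L. L-lipschitz_on A (%t. I_fun (\<Lambda> t) p)" using lipschitz by blast
 next
  show "AE t in lborel. t : T --> ((%s. I_fun (\<Lambda> s) p) has_real_derivative formal_dI (\<Lambda> t) p (f t)) (at t)"
   using ae_derivative
  proof eventually_elim
   case (elim t)
   show ?case
   proof
    assume t: "t : T"
    from elim t show "((%s. I_fun (\<Lambda> s) p) has_real_derivative formal_dI (\<Lambda> t) p (f t)) (at t)"
     unfolding formal_dI_eq[OF t] by (rule mp)
   qed
  qed
 qed
qed

end
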